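(* Let $(V,g)$ be an oriented Euclidean vector space of dimension $2n$, let $J_0,J_1\in\mathcal J_g$, and let $\gamma=\{J_t\}_{0\le t\le1}$ be a geodesic in $\mathcal J_g$ from $J_0$ to $J_1$, with $t$ proportional to the arc-length parameter. Assume that $\gamma$ lies completely in the complement of the cut locus of $J_0$. Then: 1. The parallel transport in $\mathcal H$ along $\gamma$ is $\mathcal U^{\mathcal H}_{J_1J_0}=\left(\det\frac{J_0+J_1}{2}\right)^{-1/4}\mathcal P_{J_1J_0}$, where $\mathcal P_{J_1J_0}\colon\mathcal H_{J_0}\to\mathcal H_{J_1}$ is the orthogonal projection in $\mathcal H_0$. 2. The parallel transport in $\sqrt{\mathcal K^{-1}}$ along $\gamma$ is $\mathcal U^{\sqrt{\mathcal K^{-1}}}_{J_1J_0}=\sqrt{\det\big(J_{1/2}/\sqrt{-1}\,\big|_{V_{J_0}^{1,0}}\big)}$, and for any $\mu_0,\mu_0'\in\bigwedge^nV_{J_0}^{1,0}$, $$\big\langle\,\mathcal U^{\sqrt{\mathcal K^{-1}}}_{J_1J_0}\sqrt{\mu_0'},\sqrt{\mu_0}\,\big\rangle=\left(\det\tfrac{J_0+J_1}{2}\right)^{1/4}\big\langle\sqrt{\mu_0'},\sqrt{\mu_0}\,\big\rangle .$$ 3. The parallel transport in $\hat{\mathcal H}=\mathcal H\otimes\sqrt{\mathcal K^{-1}}$ along $\gamma$, which is $\mathcal U^{\hat{\mathcal H}}_{J_1J_0}=\mathcal U^{\mathcal H}_{J_1J_0}\otimes\mathcal U^{\sqrt{\mathcal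 K^{-1}}}_{J_1J_0}$, corresponds to the pairing between $\hat{\mathcal H}_{J_0}$ and $\hat{\mathcal H}_{J_1}$ given by $$\langle\psi_1\otimes\sqrt{\mu_1},\psi_0\otimes\sqrt{\mu_0}\rangle=\langle\psi_1,\psi_0\rangle\,\langle\sqrt{\mu_1},\sqrt{\mu_0}\rangle,\qquad \psi_l\in\mathcal H_{J_l},\ \mu_l\in\textstyle\bigwedge^nV_{J_l}^{1,0}\ (l=0,1).$$
   Context: Complex structures: $\mathcal J_g$ is the manifold of all $J\in\mathrm{End}(V)$ with $J^2=-1$, $g(J\cdot,J\cdot)=g$, and inducing the given orientation; it is given the Riemannian metric $\eta_g(X,X)=-\frac14\mathrm{tr}(X^2)$ for $X\in T_J\mathcal J_g\subset\mathrm{End}(V)$ (making it a compact symmetric space $SO(2n)/U(n)$), with respect to which geodesics and cut loci are taken. $V_J^{1,0},V_J^{0,1}$ are the $\pm\sqrt{-1}$-eigenspaces of $J$ in $V^{\mathbb C}$. Determinants such as $\det\frac{J_0+J_1}2$ are of operators on $V$; off the cut locus of $J_0$ this determinant is positive and positive roots are taken. Hilbert spaces: $\nu(x)=g(x,\cdot)$. $\mathcal H_0=\bigwedge^\bullet(V^{\mathbb C})^*$ with inner product $\langle\psi,\psi'\rangle=\langle(\bar\psi\wedge\star_0\psi')^{(2n)},\epsilon_g\rangle$, where $(\cdot)^{(2n)}$ is the top-degree part, $\epsilon_g\in\bigwedge^{2n}V$ the oriented unit volume element, $\star_0$ the complex-linear Hodge star of $\frac12g$. For $x\in V^{\mathbb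 C}$, $\nabla_x=\iota_x-\frac12\nu(x)\wedge\,\cdot$ on $\mathcal H_0$, and $\mathcal H_J=\{\psi\in\mathcal H_0:\nabla_x\psi=0\ \forall x\in V_J^{0,1}\}$. The bundle $\mathcal H\to\mathcal J_g$ with fibres $\mathcal H_J$ has the connection obtained by orthogonal projection of the trivial connection on $\mathcal J_g\times\mathcal H_0$. In part 3, $\langle\psi_1,\psi_0\rangle$ is the inner product in $\mathcal H_0$. Half-forms: $\mathcal V\to\mathcal J_g$ has fibres $V_J^{1,0}$ and the connection obtained from the trivial one on $\mathcal J_g\times V^{\mathbb C}$ by projecting onto $V_J^{1,0}$ along $V_J^{0,1}$; $\mathcal K^{-1}=\bigwedge^n\mathcal V$ has the induced connection; $\sqrt{\mathcal K^{-1}}$ is the unique line bundle with square $\mathcal K^{-1}$, with the induced connection. For $\mu\in\mathcal K_J^{-1}$, $\sqrt\mu$ denotes an element of $\sqrt{\mathcal K_J^{-1}}$ whose tensor square is $\mu$. The pairing of $\mu'\in\mathcal K^{-1}_{J'}$ and $\mu\in\mathcal K^{-1}_J$ is the sesquilinear form $\langle\mu',\mu\rangle=c_n\,(\bar\mu'\wedge\mu)/\epsilon_g$, with the constant $c_n=(-1)^{n(n-1)/2}(\sqrt{-1})^n$ making it positive definite for $J'=J$. It induces an inner product on $\sqrt{\mathcal K_{J}^{-1}}$ with $\langle\sqrt\mu,\sqrt\mu\rangle=\sqrt{\langle\mu,\mu\rangle}$, and, extending continuously along $\gamma$ from $J_0$, a pairing between $\sqrt{\mathcal K_{J_t}^{-1}}$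 and $\sqrt{\mathcal K_{J_0}^{-1}}$ with $\langle\sqrt{\mu'},\sqrt\mu\rangle^2=\langle\mu',\mu\rangle$. Here $J_{1/2}$ is the midpoint of $\gamma$, $J_{1/2}/\sqrt{-1}$ maps $V_{J_0}^{1,0}$ to $V_{J_1}^{1,0}$, $\det$ of it denotes the induced map $\bigwedge^nV_{J_0}^{1,0}\to\bigwedge^nV_{J_1}^{1,0}$, and its square root is the map $\sqrt{\mathcal K_{J_0}^{-1}}\to\sqrt{\mathcal K_{J_1}^{-1}}$ whose tensor square it is, chosen by continuity along $\gamma$ from the identity.
   Formalization: In part 3, "corresponds to the pairing" is made precise as: the pairing of Ψ1 and Ψ0 equals (det((J0+J1)/2))^{1/2} times the inner product of Ψ1 with the unitary transport of Ψ0; equality without this factor fails whenever the determinant is below 1. *)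

theory Defs
  imports "HOL-Analysis.Analysis"
begin

text \<open>
  \<open>V\<close> is a Euclidean space \<open>'a\<close> whose inner product is \<open>g\<close>. Its orientation is
  given by an orthonormal frame \<open>e 0, \<dots>, e (2n - 1)\<close> declared to be positive; the frame
  enters only through its orientation class. \<open>End(V)\<close> is the normed space \<open>'a \<Rightarrow>\<^sub>L 'a\<close>.
\<close>

definition orthonormal_frame :: "(nat \<Rightarrow> 'a::euclidean_space) \<Rightarrow> bool" where
  "orthonormal_frame e \<longleftrightarrow>
     (\<forall>i<DIM('a). \<forall>j<DIM('a). inner (e i) (e j) = (if i = j then 1 else 0))"

text \<open>The volume form of a metric \<open>h\<close> for which \<open>f\<close> is a positive orthonormal frame.\<close>

definition vol_form :: "('a::euclidean_space \<Rightarrow> 'a \<Rightarrow> real) \<Rightarrow> (nat \<Rightarrow> 'a) \<Rightarrow> 'a list \<Rightarrow> real" where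
  "vol_form h f vs =
     (if length vs = DIM('a)
      then \<Sum>p | p permutes {..<DIM('a)}. of_int (sign p) * (\<Prod>i<DIM('a). h (vs ! i) (f (p i)))
      else 0)"

definition det_op :: "(nat \<Rightarrow> 'a::euclidean_space) \<Rightarrow> ('a \<Rightarrow>\<^sub>L 'a) \<Rightarrow> real" where
  "det_op e A = vol_form inner e (map (\<lambda>i. blinfun_apply A (e i)) [0..<DIM('a)])"

definition trace_op :: "('a::euclidean_space \<Rightarrow>\<^sub>L 'a) \<Rightarrow> real" where
  "trace_op A = (\<Sum>b\<in>Basis. inner (blinfun_apply A b) b)"


section \<open>The Riemannian manifold of complex structures\<close>

text \<open>The orientation induced by \<open>J\<close> is that of the bases \<open>v\<^sub>1, J v\<^sub>1, \<dots>, v\<^sub>n, J v\<^sub>n\<close>.\<close>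

definition complex_structures :: "(nat \<Rightarrow> 'a::euclidean_space) \<Rightarrow> ('a \<Rightarrow>\<^sub>L 'a) set" where
  "complex_structures e =
     {J. J o\<^sub>L J = - id_blinfun \<and>
         (\<forall>x y. inner (blinfun_apply J x) (blinfun_apply J y) = inner x y) \<and>
         (\<forall>vs. let B = concat (map (\<lambda>v. [v, blinfun_apply J v]) vs) in
            length B = DIM('a) \<and> distinct B \<and> independent (set B) \<longrightarrow> 0 < vol_form inner e B)}"

definition tangent_space :: "(nat \<Rightarrow> 'a::euclidean_space) \<Rightarrow> ('a \<Rightarrow>\<^sub>L 'a) \<Rightarrow> ('a \<Rightarrow>\<^sub>L 'a) set" where
  "tangent_space e J =
     {X. \<exists>c. (\<forall>t. c t \<in> complex_structures e) \<and> c 0 = J \<and> (c has_vector_derivative X) (at (0::real))}"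

definition eta :: "('a::euclidean_space \<Rightarrow>\<^sub>L 'a) \<Rightarrow> ('a \<Rightarrow>\<^sub>L 'a) \<Rightarrow> real" where
  "eta X Y = - trace_op (X o\<^sub>L Y) / 4"

text \<open>
  The metric on the manifold is the restriction of the constant bilinear form \<open>eta\<close> on
  \<open>End(V)\<close>, so its Levi-Civita derivative along a curve is the tangential part of the ordinary
  derivative; a geodesic is a curve whose velocity is covariantly constant. In particular
  its speed is constant.
\<close>

definition geodesic_on :: "(nat \<Rightarrow> 'a::euclidean_space) \<Rightarrow> real set \<Rightarrow> (real \<Rightarrow> 'a \<Rightarrow>\<^sub>L 'a) \<Rightarrow> bool" where
  "geodesic_on e S c \<longleftrightarrow>
     (\<forall>t\<in>S. c t \<in> complex_structures e) \<and>
     (\<exists>c' c''. \<forall>t\<in>S. (c has_vector_derivative c' t) (at t within S) \<and>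
        (c' has_vector_derivative c'' t) (at t within S) \<and>
        (\<forall>X\<in>tangent_space e (c t). eta (c'' t) X = 0))"

text \<open>Stating the length with \<open>has_integral\<close> discards curves whose speed is not integrable.\<close>

definition riem_dist :: "(nat \<Rightarrow> 'a::euclidean_space) \<Rightarrow> ('a \<Rightarrow>\<^sub>L 'a) \<Rightarrow> ('a \<Rightarrow>\<^sub>L 'a) \<Rightarrow> real" where
  "riem_dist e J K = Inf {l. \<exists>c. c piecewise_C1_differentiable_on {0..1} \<and>
     (\<forall>t\<in>{0..1}. c t \<in> complex_structures e) \<and> c 0 = J \<and> c 1 = K \<and>
     ((\<lambda>t. sqrt (eta (vector_derivative c (at t)) (vector_derivative c (at t)))) has_integral l) {0..1}}"

text \<open>
  The cut point along a unit-speed geodesic ray is where the ray stops minimising the distance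
  to its origin.
\<close>

definition cut_locus :: "(nat \<Rightarrow> 'a::euclidean_space) \<Rightarrow> ('a \<Rightarrow>\<^sub>L 'a) \<Rightarrow> ('a \<Rightarrow>\<^sub>L 'a) set" where
  "cut_locus e J = {c (Sup {t. 0 \<le> t \<and> riem_dist e J (c t) = t}) | c.
     geodesic_on e {0..} c \<and> c 0 = J \<and>
     (\<forall>t\<ge>0. eta (vector_derivative c (at t within {0..})) (vector_derivative c (at t within {0..})) = 1) \<and>
     bdd_above {t. 0 \<le> t \<and> riem_dist e J (c t) = t}}"


section \<open>The complexification\<close>

text \<open>The pair \<open>(x, y)\<close> stands for \<open>x + \<i> y\<close> in \<open>V\<^sup>\<complex>\<close>.\<close>

type_synonym 'a cvec = "'a \<times> 'a"

definition cvec_scale :: "complex \<Rightarrow> 'a::real_vector cvec \<Rightarrow> 'a cvec" where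
  "cvec_scale c z = (Re c *\<^sub>R fst z - Im c *\<^sub>R snd z, Re c *\<^sub>R snd z + Im c *\<^sub>R fst z)"

definition cvec_map :: "('a::euclidean_space \<Rightarrow>\<^sub>L 'a) \<Rightarrow> 'a cvec \<Rightarrow> 'a cvec" where
  "cvec_map A z = (blinfun_apply A (fst z), blinfun_apply A (snd z))"

definition V10 :: "('a::euclidean_space \<Rightarrow>\<^sub>L 'a) \<Rightarrow> 'a cvec set" where
  "V10 J = {z. cvec_map J z = cvec_scale \<i> z}"

definition V01 :: "('a::euclidean_space \<Rightarrow>\<^sub>L 'a) \<Rightarrow> 'a cvec set" where
  "V01 J = {z. cvec_map J z = cvec_scale (- \<i>) z}"


section \<open>Exterior algebra\<close>

text \<open>
  An element of the complexified exterior algebra of the dual of a real vector space \<open>'b\<close> is a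
  function on lists whose restriction to lists of length \<open>k\<close>, for each \<open>k\<close>, is a
  complex-valued alternating \<open>k\<close>-form. With \<open>'b = 'a\<close> these are the forms on \<open>V\<close>; with
  \<open>'b = ('a \<Rightarrow>\<^sub>L real)\<close> they are the polyvectors of \<open>V\<close>. The wedge product is a sum over shuffles,
  so that \<open>(\<alpha> \<and> \<beta>)(v, w) = \<alpha>(v) \<beta>(w) - \<alpha>(w) \<beta>(v)\<close> for 1-forms.
\<close>

definition alternating_forms :: "('b::real_vector list \<Rightarrow> complex) set" where
  "alternating_forms = {\<psi>.
     (\<forall>us vs x y. \<psi> (us @ (x + y) # vs) = \<psi> (us @ x # vs) + \<psi> (us @ y # vs)) \<and>
     (\<forall>us vs r x. \<psi> (us @ (r *\<^sub>R x) # vs) = of_real r * \<psi> (us @ x # vs)) \<and>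
     (\<forall>us vs ws x. \<psi> (us @ x # vs @ x # ws) = 0)}"

definition wedge :: "('b list \<Rightarrow> complex) \<Rightarrow> ('b list \<Rightarrow> complex) \<Rightarrow> 'b list \<Rightarrow> complex" where
  "wedge \<psi> \<phi> vs = (\<Sum>I\<in>Pow {..<length vs}.
     (-1) ^ card {(i, j). i \<in> I \<and> j \<in> {..<length vs} - I \<and> j < i} *
     \<psi> (nths vs I) * \<phi> (nths vs (- I)))"

definition conj_form :: "('b list \<Rightarrow> complex) \<Rightarrow> 'b list \<Rightarrow> complex" where
  "conj_form \<psi> vs = cnj (\<psi> vs)"

definition one_form :: "('b \<Rightarrow> complex) \<Rightarrow> 'b list \<Rightarrow> complex" where
  "one_form \<alpha> vs = (if length vs = 1 then \<alpha> (hd vs) else 0)"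

text \<open>
  The Hodge star, extended complex linearly, of the metric \<open>h\<close> with positive orthonormal frame
  \<open>f\<close>; it satisfies \<open>\<alpha> \<and> \<star>\<beta> = (\<alpha>, \<beta>) vol\<close>.
\<close>

definition hodge_star ::
    "('a::euclidean_space \<Rightarrow> 'a \<Rightarrow> real) \<Rightarrow> (nat \<Rightarrow> 'a) \<Rightarrow> ('a list \<Rightarrow> complex) \<Rightarrow> 'a list \<Rightarrow> complex" where
  "hodge_star h f \<beta> vs = (\<Sum>I | I \<subseteq> {..<DIM('a)} \<and> card I + length vs = DIM('a).
     \<beta> (map f (sorted_list_of_set I)) * of_real (vol_form h f (map f (sorted_list_of_set I) @ vs)))"


section \<open>The bundle of Hilbert spaces\<close>

text \<open>
  \<open>sqrt 2 *\<^sub>R e i\<close> is the orthonormal frame of \<open>g / 2\<close>. Evaluating on the list \<open>e 0, e 1, \<dots>\<close>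
  pairs the top-degree part with the unit volume element of \<open>g\<close>.
\<close>

definition inner_H :: "(nat \<Rightarrow> 'a::euclidean_space) \<Rightarrow> ('a list \<Rightarrow> complex) \<Rightarrow> ('a list \<Rightarrow> complex) \<Rightarrow> complex" where
  "inner_H e \<psi> \<psi>' =
     wedge (conj_form \<psi>) (hodge_star (\<lambda>x y. inner x y / 2) (\<lambda>i. sqrt 2 *\<^sub>R e i) \<psi>') (map e [0..<DIM('a)])"

definition contract :: "'a cvec \<Rightarrow> ('a list \<Rightarrow> complex) \<Rightarrow> 'a list \<Rightarrow> complex" where
  "contract x \<psi> vs = \<psi> (fst x # vs) + \<i> * \<psi> (snd x # vs)"

definition nu :: "'a::euclidean_space cvec \<Rightarrow> 'a list \<Rightarrow> complex" where
  "nu x = one_form (\<lambda>v. Complex (inner (fst x) v) (inner (snd x) v))"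

definition nabla :: "'a::euclidean_space cvec \<Rightarrow> ('a list \<Rightarrow> complex) \<Rightarrow> 'a list \<Rightarrow> complex" where
  "nabla x \<psi> vs = contract x \<psi> vs - wedge (nu x) \<psi> vs / 2"

definition fibre_H :: "('a::euclidean_space \<Rightarrow>\<^sub>L 'a) \<Rightarrow> ('a list \<Rightarrow> complex) set" where
  "fibre_H J = {\<psi> \<in> alternating_forms. \<forall>x\<in>V01 J. \<forall>vs. nabla x \<psi> vs = 0}"

definition proj_H ::
    "(nat \<Rightarrow> 'a::euclidean_space) \<Rightarrow> ('a \<Rightarrow>\<^sub>L 'a) \<Rightarrow> ('a list \<Rightarrow> complex) \<Rightarrow> 'a list \<Rightarrow> complex" where
  "proj_H e J \<psi> = (THE \<phi>. \<phi> \<in> fibre_H J \<and> (\<forall>\<theta>\<in>fibre_H J. inner_H e \<theta> (\<lambda>vs. \<psi> vs - \<phi> vs) = 0))"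


section \<open>Covariant derivatives along a curve and parallel transport\<close>

text \<open>
  Each \<open>has_cov_*\<close> says that \<open>s\<close> is a differentiable section along the curve \<open>\<gamma>\<close>, defined on
  \<open>[0, 1]\<close>, of the respective bundle and that \<open>Ds\<close> is its covariant derivative.
  Spaces of forms are finite-dimensional, so differentiability is tested pointwise.
\<close>

definition has_cov_H ::
    "(nat \<Rightarrow> 'a::euclidean_space) \<Rightarrow> (real \<Rightarrow> 'a \<Rightarrow>\<^sub>L 'a) \<Rightarrow>
     (real \<Rightarrow> 'a list \<Rightarrow> complex) \<Rightarrow> (real \<Rightarrow> 'a list \<Rightarrow> complex) \<Rightarrow> bool" where
  "has_cov_H e \<gamma> s Ds \<longleftrightarrow> (\<forall>t\<in>{0..1}. s t \<in> fibre_H (\<gamma> t) \<and>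
     (\<exists>s'. (\<forall>vs. ((\<lambda>r. s r vs) has_vector_derivative s' vs) (at t within {0..1})) \<and>
           Ds t = proj_H e (\<gamma> t) s'))"

definition has_cov_V ::
    "(real \<Rightarrow> 'a::euclidean_space \<Rightarrow>\<^sub>L 'a) \<Rightarrow> (real \<Rightarrow> 'a cvec) \<Rightarrow> (real \<Rightarrow> 'a cvec) \<Rightarrow> bool" where
  "has_cov_V \<gamma> s Ds \<longleftrightarrow> (\<forall>t\<in>{0..1}. s t \<in> V10 (\<gamma> t) \<and>
     (\<exists>s'. (s has_vector_derivative s') (at t within {0..1}) \<and>
           Ds t \<in> V10 (\<gamma> t) \<and> s' - Ds t \<in> V01 (\<gamma> t)))"

text \<open>\<open>wedge_vecs [z\<^sub>1, \<dots>, z\<^sub>k]\<close> is the polyvector \<open>z\<^sub>1 \<and> \<dots> \<and> z\<^sub>k\<close>.\<close>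

definition wedge_vecs :: "'a::euclidean_space cvec list \<Rightarrow> ('a \<Rightarrow>\<^sub>L real) list \<Rightarrow> complex" where
  "wedge_vecs zs = foldr
     (\<lambda>z. wedge (one_form (\<lambda>\<alpha>. Complex (blinfun_apply \<alpha> (fst z)) (blinfun_apply \<alpha> (snd z)))))
     zs (\<lambda>\<alpha>s. if \<alpha>s = [] then 1 else 0)"

definition fibre_K :: "('a::euclidean_space \<Rightarrow>\<^sub>L 'a) \<Rightarrow> (('a \<Rightarrow>\<^sub>L real) list \<Rightarrow> complex) set" where
  "fibre_K J = {\<lambda>\<alpha>s. \<Sum>i<N. wedge_vecs (zs i) \<alpha>s | (N::nat) zs.
     \<forall>i<N. length (zs i) = DIM('a) div 2 \<and> set (zs i) \<subseteq> V10 J}"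

text \<open>
  The connection on the top exterior power is given by the Leibniz rule. As the power is a line
  bundle, every differentiable section along \<open>\<gamma>\<close> is a single wedge product of sections.
\<close>

definition has_cov_K ::
    "(real \<Rightarrow> 'a::euclidean_space \<Rightarrow>\<^sub>L 'a) \<Rightarrow> (real \<Rightarrow> ('a \<Rightarrow>\<^sub>L real) list \<Rightarrow> complex) \<Rightarrow>
     (real \<Rightarrow> ('a \<Rightarrow>\<^sub>L real) list \<Rightarrow> complex) \<Rightarrow> bool" where
  "has_cov_K \<gamma> s Ds \<longleftrightarrow> (\<exists>z Dz. (\<forall>i<DIM('a) div 2. has_cov_V \<gamma> (z i) (Dz i)) \<and>
     (\<forall>t\<in>{0..1}. let zs = map (\<lambda>i. z i t) [0..<DIM('a) div 2] in
        s t = wedge_vecs zs \<and>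
        Ds t = (\<lambda>\<alpha>s. \<Sum>i<DIM('a) div 2. wedge_vecs (zs[i := Dz i t]) \<alpha>s)))"

definition pair_K ::
    "(nat \<Rightarrow> 'a::euclidean_space) \<Rightarrow> (('a \<Rightarrow>\<^sub>L real) list \<Rightarrow> complex) \<Rightarrow>
     (('a \<Rightarrow>\<^sub>L real) list \<Rightarrow> complex) \<Rightarrow> complex" where
  "pair_K e \<mu>' \<mu> = (let n = DIM('a) div 2 in
     (-1) ^ (n * (n - 1) div 2) * \<i> ^ n *
     wedge (conj_form \<mu>') \<mu> (map (\<lambda>i. blinfun_inner_right (e i)) [0..<DIM('a)]))"

text \<open>
  A square root of the line bundle with fibres \<open>fibre_K\<close>: a complex line bundle with fibres
  \<open>L J\<close>, realised as a subbundle of a trivial bundle with fibre \<open>\<complex>\<^sup>k\<close>, together with an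
  isomorphism \<open>m J\<close> from \<open>L J \<otimes> L J\<close> onto \<open>fibre_K J\<close>, written as a bilinear map, depending
  continuously on \<open>J\<close>. Only the topology of \<open>L\<close> has to be prescribed: squaring is a local
  homeomorphism away from the zero section, and this determines the differentiable structure.
\<close>

definition sqrt_bundle ::
    "(nat \<Rightarrow> 'a::euclidean_space) \<Rightarrow> (('a \<Rightarrow>\<^sub>L 'a) \<Rightarrow> (complex ^ 'k) set) \<Rightarrow>
     (('a \<Rightarrow>\<^sub>L 'a) \<Rightarrow> complex ^ 'k \<Rightarrow> complex ^ 'k \<Rightarrow> ('a \<Rightarrow>\<^sub>L real) list \<Rightarrow> complex) \<Rightarrow> bool" where
  "sqrt_bundle e L m \<longleftrightarrow>
     (\<forall>J\<in>complex_structures e.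
        (\<exists>w. w \<noteq> 0 \<and> L J = range (\<lambda>c. c *s w)) \<and>
        (\<forall>w\<in>L J. \<forall>w'\<in>L J. m J w w' \<in> fibre_K J \<and>
           (\<forall>c \<alpha>s. m J (c *s w) w' \<alpha>s = c * m J w w' \<alpha>s \<and> m J w (c *s w') \<alpha>s = c * m J w w' \<alpha>s) \<and>
           (w \<noteq> 0 \<and> w' \<noteq> 0 \<longrightarrow> (\<exists>\<alpha>s. m J w w' \<alpha>s \<noteq> 0))) \<and>
        (\<exists>U s. open U \<and> J \<in> U \<and> continuous_on (complex_structures e \<inter> U) s \<and>
           (\<forall>K \<in> complex_structures e \<inter> U. s K \<in> L K \<and> s K \<noteq> 0) \<and>
           (\<forall>\<alpha>s. continuous_on (complex_structures e \<inter> U) (\<lambda>K. m K (s K) (s K) \<alpha>s))))"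

text \<open>
  The connection on the square root is the one with \<open>\<nabla>(\<sigma> \<otimes> \<sigma>) = 2 \<sigma> \<otimes> \<nabla>\<sigma>\<close>. This determines
  \<open>\<nabla>\<sigma>\<close> for a nowhere vanishing section \<open>\<sigma>\<close>, and any other section is \<open>f \<sigma>\<close> for a function \<open>f\<close>.
\<close>

definition has_cov_L ::
    "(('a::euclidean_space \<Rightarrow>\<^sub>L 'a) \<Rightarrow> (complex ^ 'k) set) \<Rightarrow>
     (('a \<Rightarrow>\<^sub>L 'a) \<Rightarrow> complex ^ 'k \<Rightarrow> complex ^ 'k \<Rightarrow> ('a \<Rightarrow>\<^sub>L real) list \<Rightarrow> complex) \<Rightarrow>
     (real \<Rightarrow> 'a \<Rightarrow>\<^sub>L 'a) \<Rightarrow> (real \<Rightarrow> complex ^ 'k) \<Rightarrow> (real \<Rightarrow> complex ^ 'k) \<Rightarrow> bool" where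
  "has_cov_L L m \<gamma> s Ds \<longleftrightarrow> (\<exists>\<sigma> D\<sigma> f f'.
     continuous_on {0..1} \<sigma> \<and>
     (\<forall>t\<in>{0..1}. \<sigma> t \<in> L (\<gamma> t) \<and> \<sigma> t \<noteq> 0 \<and> D\<sigma> t \<in> L (\<gamma> t)) \<and>
     has_cov_K \<gamma> (\<lambda>t. m (\<gamma> t) (\<sigma> t) (\<sigma> t)) (\<lambda>t \<alpha>s. 2 * m (\<gamma> t) (\<sigma> t) (D\<sigma> t) \<alpha>s) \<and>
     (\<forall>t\<in>{0..1}. (f has_vector_derivative f' t) (at t within {0..1}) \<and>
        s t = f t *s \<sigma> t \<and> Ds t = f' t *s \<sigma> t + f t *s D\<sigma> t))"

text \<open>
  Elements of \<open>\<H>\<^sub>J \<otimes> L J\<close> are realised as \<open>\<complex>\<^sup>k\<close>-valued forms, \<open>\<psi> \<otimes> w\<close> being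
  \<open>vs \<mapsto> \<psi> vs *s w\<close>.
\<close>

definition tensor_sum :: "nat \<Rightarrow> (nat \<Rightarrow> 'a list \<Rightarrow> complex) \<Rightarrow> (nat \<Rightarrow> complex ^ 'k) \<Rightarrow> 'a list \<Rightarrow> complex ^ 'k" where
  "tensor_sum N \<psi> w vs = (\<Sum>i<N. \<psi> i vs *s w i)"

definition tensor :: "('a list \<Rightarrow> complex) \<Rightarrow> complex ^ 'k \<Rightarrow> 'a list \<Rightarrow> complex ^ 'k" where
  "tensor \<psi> w vs = \<psi> vs *s w"

definition tensor_space :: "('a list \<Rightarrow> complex) set \<Rightarrow> (complex ^ 'k) set \<Rightarrow> ('a list \<Rightarrow> complex ^ 'k) set" where
  "tensor_space E F = {tensor_sum N \<psi> w | N \<psi> w. \<forall>i<N. \<psi> i \<in> E \<and> w i \<in> F}"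

definition has_cov_Hhat ::
    "(nat \<Rightarrow> 'a::euclidean_space) \<Rightarrow> (('a \<Rightarrow>\<^sub>L 'a) \<Rightarrow> (complex ^ 'k) set) \<Rightarrow>
     (('a \<Rightarrow>\<^sub>L 'a) \<Rightarrow> complex ^ 'k \<Rightarrow> complex ^ 'k \<Rightarrow> ('a \<Rightarrow>\<^sub>L real) list \<Rightarrow> complex) \<Rightarrow>
     (real \<Rightarrow> 'a \<Rightarrow>\<^sub>L 'a) \<Rightarrow> (real \<Rightarrow> 'a list \<Rightarrow> complex ^ 'k) \<Rightarrow> (real \<Rightarrow> 'a list \<Rightarrow> complex ^ 'k) \<Rightarrow> bool" where
  "has_cov_Hhat e L m \<gamma> S DS \<longleftrightarrow> (\<exists>N \<psi> D\<psi> s Ds.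
     (\<forall>i<N. has_cov_H e \<gamma> (\<psi> i) (D\<psi> i) \<and> has_cov_L L m \<gamma> (s i) (Ds i)) \<and>
     (\<forall>t\<in>{0..1}. S t = tensor_sum N (\<lambda>i. \<psi> i t) (\<lambda>i. s i t) \<and>
        DS t = (\<lambda>vs. tensor_sum N (\<lambda>i. D\<psi> i t) (\<lambda>i. s i t) vs + tensor_sum N (\<lambda>i. \<psi> i t) (\<lambda>i. Ds i t) vs)))"

text \<open>
  \<open>U\<close>, on the fibre \<open>E\<close> at the initial point, is the parallel transport for the given notion
  of parallel section: parallel sections with any initial value exist, and \<open>U\<close> gives
  their final value.
\<close>

definition is_transport :: "((real \<Rightarrow> 'v) \<Rightarrow> bool) \<Rightarrow> 'v set \<Rightarrow> ('v \<Rightarrow> 'v) \<Rightarrow> bool" where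
  "is_transport parallel E U \<longleftrightarrow>
     (\<forall>x\<in>E. \<forall>y. (\<exists>s. parallel s \<and> s 0 = x \<and> s 1 = y) \<longleftrightarrow> y = U x)"


section \<open>Half-form pairings, square roots of operators, tensor products\<close>

text \<open>
  The inner product on \<open>L J\<close> with \<open>\<langle>w, w\<rangle> = sqrt \<langle>w \<otimes> w, w \<otimes> w\<rangle>\<close>, recovered by polarisation
  and conjugate linear in its first argument.
\<close>

definition inner_L ::
    "(nat \<Rightarrow> 'a::euclidean_space) \<Rightarrow>
     (('a \<Rightarrow>\<^sub>L 'a) \<Rightarrow> complex ^ 'k \<Rightarrow> complex ^ 'k \<Rightarrow> ('a \<Rightarrow>\<^sub>L real) list \<Rightarrow> complex) \<Rightarrow>
     ('a \<Rightarrow>\<^sub>L 'a) \<Rightarrow> complex ^ 'k \<Rightarrow> complex ^ 'k \<Rightarrow> complex" where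
  "inner_L e m J w' w =
     (let q = (\<lambda>u. sqrt (Re (pair_K e (m J u u) (m J u u)))) in
      (\<Sum>k<4. (- \<i>) ^ k * of_real (q (w' + \<i> ^ k *s w))) / 4)"

text \<open>\<open>p t\<close> is the pairing of \<open>L (\<gamma> t)\<close> with \<open>L (\<gamma> 0)\<close>, extended continuously from \<open>t = 0\<close>.\<close>

definition halfform_pairing ::
    "(nat \<Rightarrow> 'a::euclidean_space) \<Rightarrow> (('a \<Rightarrow>\<^sub>L 'a) \<Rightarrow> (complex ^ 'k) set) \<Rightarrow>
     (('a \<Rightarrow>\<^sub>L 'a) \<Rightarrow> complex ^ 'k \<Rightarrow> complex ^ 'k \<Rightarrow> ('a \<Rightarrow>\<^sub>L real) list \<Rightarrow> complex) \<Rightarrow>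
     (real \<Rightarrow> 'a \<Rightarrow>\<^sub>L 'a) \<Rightarrow> (real \<Rightarrow> complex ^ 'k \<Rightarrow> complex ^ 'k \<Rightarrow> complex) \<Rightarrow> bool" where
  "halfform_pairing e L m \<gamma> p \<longleftrightarrow>
     (\<forall>t\<in>{0..1}. \<forall>w'\<in>L (\<gamma> t). \<forall>w\<in>L (\<gamma> 0).
        (\<forall>c. p t (c *s w') w = cnj c * p t w' w \<and> p t w' (c *s w) = c * p t w' w) \<and>
        (p t w' w)\<^sup>2 = pair_K e (m (\<gamma> t) w' w') (m (\<gamma> 0) w w)) \<and>
     (\<forall>w'\<in>L (\<gamma> 0). \<forall>w\<in>L (\<gamma> 0). p 0 w' w = inner_L e m (\<gamma> 0) w' w) \<and>
     (\<forall>s. \<forall>w\<in>L (\<gamma> 0). continuous_on {0..1} s \<and> (\<forall>t\<in>{0..1}. s t \<in> L (\<gamma> t)) \<longrightarrow>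
        continuous_on {0..1} (\<lambda>t. p t (s t) w))"

text \<open>
  \<open>R t\<close> is the square root, continuous in \<open>t\<close> from the identity, of the map induced by
  \<open>\<gamma> (t / 2) / \<i>\<close> on top exterior powers; \<open>\<gamma> (t / 2)\<close> is the midpoint of \<open>\<gamma>\<close> on \<open>[0, t]\<close>.
  Every element of the top exterior power is a single wedge product.
\<close>

definition halfform_root ::
    "(('a::euclidean_space \<Rightarrow>\<^sub>L 'a) \<Rightarrow> (complex ^ 'k) set) \<Rightarrow>
     (('a \<Rightarrow>\<^sub>L 'a) \<Rightarrow> complex ^ 'k \<Rightarrow> complex ^ 'k \<Rightarrow> ('a \<Rightarrow>\<^sub>L real) list \<Rightarrow> complex) \<Rightarrow>
     (real \<Rightarrow> 'a \<Rightarrow>\<^sub>L 'a) \<Rightarrow> (real \<Rightarrow> complex ^ 'k \<Rightarrow> complex ^ 'k) \<Rightarrow> bool" where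
  "halfform_root L m \<gamma> R \<longleftrightarrow>
     (\<forall>w\<in>L (\<gamma> 0). R 0 w = w \<and> continuous_on {0..1} (\<lambda>t. R t w) \<and>
        (\<forall>t\<in>{0..1}. R t w \<in> L (\<gamma> t) \<and> (\<forall>c. R t (c *s w) = c *s R t w) \<and>
           (\<forall>zs. length zs = DIM('a) div 2 \<and> set zs \<subseteq> V10 (\<gamma> 0) \<and> m (\<gamma> 0) w w = wedge_vecs zs \<longrightarrow>
              m (\<gamma> t) (R t w) (R t w) =
              wedge_vecs (map (\<lambda>z. cvec_scale (1 / \<i>) (cvec_map (\<gamma> (t / 2)) z)) zs))))"

definition is_tensor_map ::
    "('a list \<Rightarrow> complex) set \<Rightarrow> (complex ^ 'k) set \<Rightarrow>
     (('a list \<Rightarrow> complex) \<Rightarrow> 'a list \<Rightarrow> complex) \<Rightarrow> (complex ^ 'k \<Rightarrow> complex ^ 'k) \<Rightarrow>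
     (('a list \<Rightarrow> complex ^ 'k) \<Rightarrow> 'a list \<Rightarrow> complex ^ 'k) \<Rightarrow> bool" where
  "is_tensor_map E F A B T \<longleftrightarrow> (\<forall>N \<psi> w. (\<forall>i<N. \<psi> i \<in> E \<and> w i \<in> F) \<longrightarrow>
     T (tensor_sum N \<psi> w) = tensor_sum N (\<lambda>i. A (\<psi> i)) (\<lambda>i. B (w i)))"

definition is_tensor_form ::
    "('a list \<Rightarrow> complex) set \<Rightarrow> (complex ^ 'k) set \<Rightarrow> ('a list \<Rightarrow> complex) set \<Rightarrow> (complex ^ 'k) set \<Rightarrow>
     (('a list \<Rightarrow> complex) \<Rightarrow> ('a list \<Rightarrow> complex) \<Rightarrow> complex) \<Rightarrow>
     (complex ^ 'k \<Rightarrow> complex ^ 'k \<Rightarrow> complex) \<Rightarrow>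
     (('a list \<Rightarrow> complex ^ 'k) \<Rightarrow> ('a list \<Rightarrow> complex ^ 'k) \<Rightarrow> complex) \<Rightarrow> bool" where
  "is_tensor_form E1 F1 E0 F0 a b B \<longleftrightarrow> (\<forall>N \<psi> w M \<phi> v.
     (\<forall>i<N. \<psi> i \<in> E1 \<and> w i \<in> F1) \<and> (\<forall>j<M. \<phi> j \<in> E0 \<and> v j \<in> F0) \<longrightarrow>
     B (tensor_sum N \<psi> w) (tensor_sum M \<phi> v) = (\<Sum>i<N. \<Sum>j<M. a (\<psi> i) (\<phi> j) * b (w i) (v j)))"

end

theory Submission
  imports Defs
begin

text \<open>
  Along a geodesic the velocity is \<open>\<gamma>' = B \<gamma>\<close> for a constant skew operator \<open>B\<close> that
  anticommutes with \<open>\<gamma> 0\<close>, so \<open>\<gamma> t = exp (t B) \<gamma> 0\<close>. In a unitary eigenbasis of \<open>B\<^sup>2\<close> the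
  group \<open>exp (t B)\<close> rotates by angles \<open>t \<theta> i\<close>; if some angle reached \<open>\<pi>\<close>, rotating the other way
  round would be as short, so off the cut locus all \<open>\<theta> i < \<pi>\<close>, and
  \<open>det ((\<gamma> 0 + \<gamma> t) / 2) = (\<Prod>i. cos (t \<theta> i / 2))\<^sup>2\<close>.

  The operators \<open>\<nabla>\<close> generate a Clifford action for which \<open>\<H>\<^sub>J\<close> is the intersection of the
  ranges of \<open>n\<close> commuting projections, and the derivative of the projection onto \<open>\<H>\<^sub>J\<close> along \<open>\<gamma>\<close>
  is the commutator with the Clifford element \<open>K\<close> of \<open>B / 2\<close>. Applied to a vector \<open>\<psi>\<close> of the
  initial fibre, \<open>K\<close> becomes a scalar between the two fibres, the logarithmic derivative of
  \<open>\<kappa> t = (\<Prod>i. cos (t \<theta> i / 2))\<^bsup>1/2\<^esup>\<close>; hence \<open>P t \<psi> / \<kappa> t\<close> is parallel.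

  On \<open>V\<^sup>1\<^sup>,\<^sup>0\<close> the map \<open>\<gamma> (t / 2) / \<i>\<close> coincides with \<open>exp (t B / 2)\<close>, whose derivative \<open>B / 2\<close>
  exchanges \<open>V\<^sup>1\<^sup>,\<^sup>0\<close> and \<open>V\<^sup>0\<^sup>,\<^sup>1\<close>, so it is parallel in \<open>\<V>\<close>. The pairing of its top exterior power
  with the initial one is \<open>\<Prod>i. cos (t \<theta> i / 2)\<close> times the inner product, and the square roots
  are followed by continuity.
\<close>

subsection \<open>Exterior algebra and determinants\<close>

text \<open>All powers of the determinant come from one number, \<open>\<kappa> 1\<close>, whose
  fourth power is the determinant. Projection onto the final fibre shrinks norms by
  \<open>\<kappa> 1\<close>, and the half-form pairing is \<open>\<kappa> 1\<close> times the inner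
  product. So the pairing on the tensor product is the square root of the determinant times the
  inner product after transport, while in the pairing of a transported vector with an initial one
  the powers -1/4 and 1/4 cancel. The lift of \<open>exp (t B)\<close> to the spin group, which
  would conjugate the projections into each other, is not constructed: \<open>K\<close> is its
  infinitesimal form, and the vectors that generate the projections are rotated by
  \<open>exp (t B / 2)\<close>. Nor is the Riemannian distance computed: upper bounds from explicit
  curves show that a geodesic has stopped minimising. Parallel sections of the Hilbert spaces are
  unique because their inner products are constant. Half forms have no given frame along the curve.
  A continuous root of a parallel section of the square serves as one, and in it the covariant
  derivative is ordinary differentiation.\<close>

lemma wedge_Nil: "wedge \<psi> \<phi> [] = \<psi> [] * \<phi> []"
  by (simp add: wedge_def)

text \<open>Index 0 lies below every index of the complement, so putting it into the set creates no
  inversion.\<close>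

lemma card_inversions_insert_0:
  "card {(i, j). i \<in> insert 0 (Suc ` I) \<and> j \<in> {..<Suc n} - insert 0 (Suc ` I) \<and> j < i}
   = card {(i, j). i \<in> I \<and> j \<in> {..<n} - I \<and> j < i}"
proof -
  have "{(i, j). i \<in> insert 0 (Suc ` I) \<and> j \<in> {..<Suc n} - insert 0 (Suc ` I) \<and> j < i}
      = map_prod Suc Suc ` {(i, j). i \<in> I \<and> j \<in> {..<n} - I \<and> j < i}"
    (is "?L = ?R")
  proof (intro equalityI subsetI)
    fix p assume "p \<in> ?L"
    then obtain i j where p: "p = (i, j)" "i \<in> insert 0 (Suc ` I)" "j \<in> {..<Suc n}"
        "j \<notin> insert 0 (Suc ` I)" "j < i" by auto
    then obtain i' where "i = Suc i'" "i' \<in> I" by auto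
    moreover obtain j' where "j = Suc j'" using p(4) by (cases j) auto
    ultimately show "p \<in> ?R" using p by (force simp: image_iff)
  qed (auto simp: image_iff)
  moreover have "inj_on (map_prod Suc Suc) A" for A :: "(nat \<times> nat) set"
    by (auto simp: inj_on_def)
  ultimately show ?thesis by (simp add: card_image)
qed

text \<open>With 0 in the complement, each of the \<open>card I\<close> shifted indices is inverted
  against it.\<close>

lemma card_inversions_Suc:
  assumes "I \<subseteq> {..<n}"
  shows "card {(i, j). i \<in> Suc ` I \<and> j \<in> {..<Suc n} - Suc ` I \<and> j < i}
   = card {(i, j). i \<in> I \<and> j \<in> {..<n} - I \<and> j < i} + card I"
proof -
  let ?A = "{(i, j). i \<in> I \<and> j \<in> {..<n} - I \<and> j < i}"
  have fin: "finite I" using assms finite_subset by blast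
  have "?A \<subseteq> I \<times> {..<n}" by auto
  then have finA: "finite ?A" using fin finite_subset by blast
  have "{(i, j). i \<in> Suc ` I \<and> j \<in> {..<Suc n} - Suc ` I \<and> j < i}
      = map_prod Suc Suc ` ?A \<union> (\<lambda>i. (Suc i, 0)) ` I" (is "?L = ?R")
  proof (intro equalityI subsetI)
    fix p assume "p \<in> ?L"
    then obtain i j where p: "p = (Suc i, j)" "i \<in> I" "j < Suc n" "j \<notin> Suc ` I" "j < Suc i" by auto
    show "p \<in> ?R"
      using p by (cases j) (auto simp: image_iff)
  qed (use assms in \<open>auto simp: image_iff\<close>)
  moreover have "card (map_prod Suc Suc ` ?A \<union> (\<lambda>i. (Suc i, 0)) ` I)
      = card (map_prod Suc Suc ` ?A) + card ((\<lambda>i. (Suc i, 0::nat)) ` I)"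
    by (rule card_Un_disjoint) (use finA fin in auto)
  moreover have "card (map_prod Suc Suc ` ?A) = card ?A"
    by (intro card_image) (auto simp: inj_on_def)
  moreover have "card ((\<lambda>i. (Suc i, 0::nat)) ` I) = card I"
    by (intro card_image) (auto simp: inj_on_def)
  ultimately show ?thesis by simp
qed

lemma Pow_lessThan_Suc:
  "Pow {..<Suc n} = (\<lambda>I. insert 0 (Suc ` I)) ` Pow {..<n} \<union> (\<lambda>I. Suc ` I) ` Pow {..<n}"
  unfolding lessThan_Suc_eq_insert_0 Pow_insert by (auto simp: Pow_def subset_image_iff image_iff)

text \<open>The shuffles split by the factor that receives the first argument. If it is the right
  one, the argument passes all arguments of the left factor, hence the sign. Associativity and the
  rules for one-forms follow from this recursion by induction on the argument list.\<close>

lemma wedge_Cons: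
  "wedge \<psi> \<phi> (v # vs) = wedge (\<lambda>us. \<psi> (v # us)) \<phi> vs
     + wedge (\<lambda>us. (-1) ^ length us * \<psi> us) (\<lambda>us. \<phi> (v # us)) vs"
proof -
  let ?n = "length vs"
  let ?c = "\<lambda>n I. card {(i, j). i \<in> I \<and> j \<in> {..<n} - I \<and> j < (i::nat)}"
  let ?t = "\<lambda>I. (-1) ^ ?c (Suc ?n) I * \<psi> (nths (v # vs) I) * \<phi> (nths (v # vs) (- I))"
  have compl: "{j. Suc j \<notin> insert 0 (Suc ` I)} = - I" "{j. Suc j \<notin> Suc ` I} = - I"
    "{j. Suc j \<in> insert 0 (Suc ` I)} = I" "{j. Suc j \<in> Suc ` I} = I" for I by auto
  have inj1: "inj_on (\<lambda>I. insert 0 (Suc ` I)) A" for A :: "nat set set"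
    by (rule inj_onI) (metis (no_types, lifting) Diff_insert_absorb image_iff inj_Suc inj_image_eq_iff nat.distinct(1))
  have inj2: "inj_on (\<lambda>I. Suc ` I) A" for A :: "nat set set"
    by (rule inj_onI) (simp add: inj_image_eq_iff)
  have "wedge \<psi> \<phi> (v # vs) = (\<Sum>I\<in>Pow {..<Suc ?n}. ?t I)"
    by (simp add: wedge_def)
  also have "\<dots> = (\<Sum>I\<in>(\<lambda>I. insert 0 (Suc ` I)) ` Pow {..<?n}. ?t I) + (\<Sum>I\<in>(\<lambda>I. Suc ` I) ` Pow {..<?n}. ?t I)"
    unfolding Pow_lessThan_Suc by (rule sum.union_disjoint) auto
  also have "(\<Sum>I\<in>(\<lambda>I. insert 0 (Suc ` I)) ` Pow {..<?n}. ?t I)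
      = (\<Sum>I\<in>Pow {..<?n}. ?t (insert 0 (Suc ` I)))"
    by (rule sum.reindex[OF inj1, unfolded o_def])
  also have "\<dots> = wedge (\<lambda>us. \<psi> (v # us)) \<phi> vs"
    unfolding wedge_def
    by (rule sum.cong) (simp_all only: card_inversions_insert_0, simp add: nths_Cons compl)
  also have "(\<Sum>I\<in>(\<lambda>I. Suc ` I) ` Pow {..<?n}. ?t I) = (\<Sum>I\<in>Pow {..<?n}. ?t (Suc ` I))"
    by (rule sum.reindex[OF inj2, unfolded o_def])
  also have "\<dots> = wedge (\<lambda>us. (-1) ^ length us * \<psi> us) (\<lambda>us. \<phi> (v # us)) vs"
    unfolding wedge_def
  proof (rule sum.cong)
    fix I assume "I \<in> Pow {..<?n}"
    then have I: "I \<subseteq> {..<?n}" by simp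
    have "{i. i < ?n \<and> i \<in> I} = I" using I by auto
    then have "length (nths vs I) = card I" by (simp add: length_nths)
    then show "?t (Suc ` I) = (- 1) ^ ?c ?n I * ((- 1) ^ length (nths vs I) * \<psi> (nths vs I)) * \<phi> (v # nths vs (- I))"
      unfolding card_inversions_Suc[OF I] by (simp add: nths_Cons compl power_add)
  qed simp
  finally show ?thesis .
qed

lemma wedge_add_left: "wedge (\<lambda>us. \<psi> us + \<psi>' us) \<phi> vs = wedge \<psi> \<phi> vs + wedge \<psi>' \<phi> vs"
  by (simp add: wedge_def algebra_simps sum.distrib)

lemma wedge_add_right: "wedge \<psi> (\<lambda>us. \<phi> us + \<phi>' us) vs = wedge \<psi> \<phi> vs + wedge \<psi> \<phi>' vs"
  by (simp add: wedge_def algebra_simps sum.distrib)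

lemma wedge_scale_left: "wedge (\<lambda>us. c * \<psi> us) \<phi> vs = c * wedge \<psi> \<phi> vs"
  by (simp add: wedge_def algebra_simps sum_distrib_left)

lemma wedge_scale_right: "wedge \<psi> (\<lambda>us. c * \<phi> us) vs = c * wedge \<psi> \<phi> vs"
  by (simp add: wedge_def algebra_simps sum_distrib_left)

lemma wedge_sum_right: "wedge \<psi> (\<lambda>us. \<Sum>i\<in>A. \<phi> i us) vs = (\<Sum>i\<in>A. wedge \<psi> (\<phi> i) vs)"
proof (induction A rule: infinite_finite_induct)
  case (insert x F)
  then show ?case by (simp add: wedge_add_right)
qed (simp_all add: wedge_def)

lemma wedge_zero_left: "wedge (\<lambda>us. 0) \<phi> vs = 0"
  by (simp add: wedge_def)

lemma wedge_zero_right: "wedge \<psi> (\<lambda>us. 0) vs = 0"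
  by (simp add: wedge_def)

lemma conj_form_wedge: "conj_form (wedge \<psi> \<phi>) = wedge (conj_form \<psi>) (conj_form \<phi>)"
  by (rule ext) (simp add: conj_form_def wedge_def)

lemma length_nths_Compl: "length (nths vs I) + length (nths vs (- I)) = length vs"
  by (induction vs arbitrary: I) (auto simp: nths_Cons Collect_neg_eq)

text \<open>The grading involution is multiplicative. It appears because \<open>wedge_Cons\<close>
  twists the left factor, and associativity needs it for a left factor that is itself a
  product.\<close>

lemma twist_wedge: "(-1) ^ length vs * wedge \<psi> \<phi> vs
    = wedge (\<lambda>us. (-1) ^ length us * \<psi> us) (\<lambda>us. (-1) ^ length us * \<phi> us) vs"
proof -
  have "(-1) ^ length vs * (s * a * b)
      = s * ((-1) ^ length (nths vs I) * a) * ((-1) ^ length (nths vs (- I)) * b)" for s a b :: complex and I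
    by (simp add: length_nths_Compl[of vs I, symmetric] power_add)
  then show ?thesis unfolding wedge_def sum_distrib_left by (intro sum.cong refl)
qed

lemma wedge_assoc: "wedge (wedge \<psi> \<phi>) \<theta> vs = wedge \<psi> (wedge \<phi> \<theta>) vs"
proof (induction vs arbitrary: \<psi> \<phi> \<theta>)
  case (Cons v vs)
  show ?case
    by (simp add: wedge_Cons wedge_add_left wedge_add_right Cons.IH twist_wedge)
qed (simp add: wedge_Nil)

lemma wedge_one_form_Cons:
  "wedge (one_form \<alpha>) \<phi> (v # vs) = \<alpha> v * \<phi> vs - wedge (one_form \<alpha>) (\<lambda>us. \<phi> (v # us)) vs"
proof -
  have "(\<lambda>us. one_form \<alpha> (v # us)) = (\<lambda>us. \<alpha> v * (if us = [] then 1 else 0))"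
    by (auto simp: one_form_def)
  moreover have "wedge (\<lambda>us. if us = [] then 1 else 0) \<phi> vs = \<phi> vs" for \<phi> :: "'a list \<Rightarrow> complex" and vs
  proof (induction vs arbitrary: \<phi>)
    case (Cons v vs)
    have "(\<lambda>us. (- 1) ^ length us * (if us = [] then 1 else 0)) = (\<lambda>us::'a list. if us = [] then 1 else (0::complex))"
      by auto
    with Cons show ?case by (simp add: wedge_Cons wedge_zero_left)
  qed (simp add: wedge_Nil)
  moreover have "(\<lambda>us. (-1) ^ length us * one_form \<alpha> us) = (\<lambda>us. (-1) * one_form \<alpha> us)"
    by (auto simp: one_form_def)
  ultimately show ?thesis
    unfolding wedge_Cons by (simp only: wedge_scale_left) simp
qed

lemma wedge_one_form_Nil: "wedge (one_form \<alpha>) \<phi> [] = 0"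
  by (simp add: wedge_Nil one_form_def)

lemma wedge_one_form_eq_0:
  "(\<And>v. v \<in> set vs \<Longrightarrow> \<alpha> v = 0) \<Longrightarrow> wedge (one_form \<alpha>) \<phi> vs = 0"
  by (induction vs arbitrary: \<phi>) (auto simp: wedge_one_form_Nil wedge_one_form_Cons)

lemma wedge_one_form_add: "wedge (one_form (\<lambda>v. \<alpha> v + \<beta> v)) \<phi> vs = wedge (one_form \<alpha>) \<phi> vs + wedge (one_form \<beta>) \<phi> vs"
  by (induction vs arbitrary: \<phi>) (simp_all add: wedge_one_form_Nil wedge_one_form_Cons algebra_simps)

lemma wedge_one_form_scale: "wedge (one_form (\<lambda>v. c * \<alpha> v)) \<phi> vs = c * wedge (one_form \<alpha>) \<phi> vs"
  by (induction vs arbitrary: \<phi>) (simp_all add: wedge_one_form_Nil wedge_one_form_Cons algebra_simps)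

lemma wedge_diff_right: "wedge \<psi> (\<lambda>us. \<phi> us - \<phi>' us) vs = wedge \<psi> \<phi> vs - wedge \<psi> \<phi>' vs"
  by (simp add: wedge_def algebra_simps sum_subtractf)

lemma wedge_one_form_self: "wedge (one_form \<alpha>) (wedge (one_form \<alpha>) \<phi>) vs = 0"
  by (induction vs arbitrary: \<phi>)
    (simp_all add: wedge_one_form_Nil wedge_one_form_Cons wedge_diff_right wedge_scale_right)

lemma wedge_one_form_anticommute:
  "wedge (one_form \<alpha>) (wedge (one_form \<beta>) \<phi>) vs = - wedge (one_form \<beta>) (wedge (one_form \<alpha>) \<phi>) vs"
  by (induction vs arbitrary: \<phi>)
    (simp_all add: wedge_one_form_Nil wedge_one_form_Cons wedge_diff_right wedge_scale_right)

text \<open>Scalar multiplication and the embedding of scalars are parameters, so that one theory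
  covers real vectors (\<open>scaleR\<close>, \<open>of_real\<close>) and complexified vectors
  (\<open>cvec_scale\<close>, identity), whose complex scaling is not a type class
  operation.\<close>

definition alternating :: "('s \<Rightarrow> 'b \<Rightarrow> 'b) \<Rightarrow> ('s \<Rightarrow> complex) \<Rightarrow> ('b::ab_group_add list \<Rightarrow> complex) \<Rightarrow> bool" where
  "alternating sc h F \<longleftrightarrow>
     (\<forall>us vs x y. F (us @ (x + y) # vs) = F (us @ x # vs) + F (us @ y # vs)) \<and>
     (\<forall>us vs r x. F (us @ sc r x # vs) = h r * F (us @ x # vs)) \<and>
     (\<forall>us vs ws x. F (us @ x # vs @ x # ws) = 0)"

lemma alternating_forms_iff: "\<psi> \<in> alternating_forms \<longleftrightarrow> alternating scaleR of_real \<psi>"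
  by (simp add: alternating_forms_def alternating_def)

lemma alternating_add: "alternating sc h F \<Longrightarrow> F (us @ (x + y) # vs) = F (us @ x # vs) + F (us @ y # vs)"
  by (simp add: alternating_def)

lemma alternating_scale: "alternating sc h F \<Longrightarrow> F (us @ sc r x # vs) = h r * F (us @ x # vs)"
  by (simp add: alternating_def)

lemma alternating_repeat: "alternating sc h F \<Longrightarrow> F (us @ x # vs @ x # ws) = 0"
  by (simp add: alternating_def)

lemma alternating_zero: "alternating sc h F \<Longrightarrow> F (us @ 0 # vs) = 0"
  using alternating_add[of sc h F us 0 0 vs] by simp

lemma alternating_sum:
  "alternating sc h F \<Longrightarrow> F (us @ (\<Sum>k\<in>A. g k) # vs) = (\<Sum>k\<in>A. F (us @ g k # vs))"
  by (induction A rule: infinite_finite_induct) (simp_all add: alternating_zero alternating_add)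

lemma alternating_not_distinct:
  assumes "alternating sc h F" "\<not> distinct vs"
  shows "F vs = 0"
  using not_distinct_decomp[OF assms(2)] alternating_repeat[OF assms(1)] by fastforce

lemma alternating_swap:
  assumes "alternating sc h F"
  shows "F (us @ x # y # vs) = - F (us @ y # x # vs)"
proof -
  have z: "F (us @ w # w # vs) = 0" for w
    using alternating_repeat[OF assms, of us w "[]"] by simp
  have "F (us @ (x + y) # (x + y) # vs) = F (us @ x # y # vs) + F (us @ y # x # vs)"
    using alternating_add[OF assms, of us x y "(x + y) # vs"]
      alternating_add[OF assms, of "us @ [x]" x y vs] alternating_add[OF assms, of "us @ [y]" x y vs]
    by (simp add: z)
  then show ?thesis by (simp add: z add_eq_0_iff2)
qed

lemma alternating_move:
  assumes "alternating sc h F"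
  shows "F (us @ xs @ y # vs) = (-1) ^ length xs * F (us @ y # xs @ vs)"
proof (induction xs arbitrary: us)
  case (Cons x xs)
  have "F (us @ (x # xs) @ y # vs) = (-1) ^ length xs * F (us @ x # y # xs @ vs)"
    using Cons[of "us @ [x]"] by simp
  then show ?case by (simp add: alternating_swap[OF assms, of us x y])
qed simp

text \<open>Undoing a shuffle costs one transposition per inversion, so the sign in
  \<open>wedge\<close> is exactly the one that an alternating function picks up.\<close>

lemma alternating_nths:
  assumes "alternating sc h F"
  shows "F (us @ nths vs I @ nths vs (- I))
    = (-1) ^ card {(i, j). i \<in> I \<inter> {..<length vs} \<and> j \<in> {..<length vs} - I \<and> j < i} * F (us @ vs)"
proof (induction vs arbitrary: us I)
  case (Cons v vs)
  let ?n = "length vs"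
  define I0 where "I0 = {i. Suc i \<in> I}"
  define I' where "I' = I0 \<inter> {..<?n}"
  have nths1: "nths (v # vs) I = (if 0 \<in> I then [v] else []) @ nths vs I0"
    unfolding I0_def nths_Cons by simp
  have "{j. Suc j \<in> - I} = - I0" by (auto simp: I0_def)
  then have nths2: "nths (v # vs) (- I) = (if 0 \<in> I then [] else [v]) @ nths vs (- I0)"
    unfolding nths_Cons by simp
  have I': "I' \<subseteq> {..<?n}" by (simp add: I'_def)
  have diff: "{..<?n} - I0 = {..<?n} - I'" by (auto simp: I'_def)
  have "{i. i < ?n \<and> i \<in> I0} = I'" by (auto simp: I'_def)
  then have lenI': "length (nths vs I0) = card I'"
    by (simp add: length_nths)
  show ?case
  proof (cases "0 \<in> I")
    case True
    have "i \<in> I \<inter> {..<Suc ?n} \<longleftrightarrow> i \<in> insert 0 (Suc ` I')" for i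
      using True by (cases i) (simp_all add: I'_def I0_def image_iff)
    then have I: "I \<inter> {..<Suc ?n} = insert 0 (Suc ` I')" by blast
    then have "{..<Suc ?n} - I = {..<Suc ?n} - insert 0 (Suc ` I')" by blast
    then have c: "card {(i, j). i \<in> I \<inter> {..<length (v # vs)} \<and> j \<in> {..<length (v # vs)} - I \<and> j < i}
      = card {(i, j). i \<in> I' \<and> j \<in> {..<?n} - I' \<and> j < i}"
      unfolding list.size add_0_right add_Suc_right I by (simp only: card_inversions_insert_0)
    have "F (us @ nths (v # vs) I @ nths (v # vs) (- I)) = F ((us @ [v]) @ nths vs I0 @ nths vs (- I0))"
      unfolding nths1 nths2 using True by simp
    then show ?thesis unfolding c Cons.IH[of "us @ [v]" I0] diff I'_def[symmetric] by simp
  next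
    case False
    have "i \<in> I \<inter> {..<Suc ?n} \<longleftrightarrow> i \<in> Suc ` I'" for i
      using False by (cases i) (simp_all add: I'_def I0_def image_iff)
    then have I: "I \<inter> {..<Suc ?n} = Suc ` I'" by blast
    then have "{..<Suc ?n} - I = {..<Suc ?n} - Suc ` I'" by blast
    then have c: "card {(i, j). i \<in> I \<inter> {..<length (v # vs)} \<and> j \<in> {..<length (v # vs)} - I \<and> j < i}
      = card {(i, j). i \<in> I' \<and> j \<in> {..<?n} - I' \<and> j < i} + card I'"
      unfolding list.size add_0_right add_Suc_right I by (simp only: card_inversions_Suc[OF I'])
    have "F (us @ nths (v # vs) I @ nths (v # vs) (- I)) = (-1) ^ card I' * F ((us @ [v]) @ nths vs I0 @ nths vs (- I0))"
      unfolding nths1 nths2 using False alternating_move[OF assms, of us "nths vs I0" v] lenI' by simp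
    then show ?thesis unfolding c Cons.IH[of "us @ [v]" I0] diff I'_def[symmetric] by (simp add: power_add)
  qed
qed simp

text \<open>Permuting arguments changes at most a sign, and only vanishing is carried over, so the
  sign is never computed.\<close>

lemma alternating_mset_eq:
  assumes "alternating sc h F" "mset xs = mset ys" "F (us @ ys) = 0"
  shows "F (us @ xs) = 0"
  using assms(2,3)
proof (induction xs arbitrary: us ys)
  case (Cons x xs)
  then have "x \<in> set ys" by (metis list.set_intros(1) set_mset_mset)
  then obtain ys1 ys2 where ys: "ys = ys1 @ x # ys2" by (meson split_list)
  have "mset xs = mset (ys1 @ ys2)" using Cons.prems(1) ys by simp
  moreover have "F ((us @ [x]) @ ys1 @ ys2) = 0"
    using Cons.prems(2) alternating_move[OF assms(1), of us ys1 x ys2] ys by simp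
  ultimately show ?case using Cons.IH[of "ys1 @ ys2" "us @ [x]"] by simp
qed simp

text \<open>Expanding every argument in the vectors \<open>z\<close> leaves values on lists of these
  vectors; such a list has a repetition or is a permutation of an increasing one.\<close>

lemma alternating_vanish:
  assumes F: "alternating sc h F"
    and zero: "\<And>I. I \<subseteq> {..<n} \<Longrightarrow> F (map z (sorted_list_of_set I)) = 0"
    and vs: "\<And>v. v \<in> set vs \<Longrightarrow> \<exists>a. v = (\<Sum>k<n. sc (a k) (z k))"
  shows "F vs = 0"
proof -
  have basis: "F (map z ks) = 0" if "set ks \<subseteq> {..<n}" for ks
  proof (cases "distinct ks")
    case True
    have "mset (map z ks) = mset (map z (sorted_list_of_set (set ks)))"
      using True by (simp add: sorted_list_of_set_sort_remdups distinct_remdups_id)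
    from alternating_mset_eq[OF F this, of "[]"] show ?thesis using zero[OF that] by simp
  next
    case False
    then have "\<not> distinct (map z ks)" by (simp add: distinct_map)
    then show ?thesis by (rule alternating_not_distinct[OF F])
  qed
  \<comment> \<open>The prefix \<open>map z ks\<close> holds the arguments that have already been
    expanded.\<close>
  have "F (map z ks @ vs) = 0" if "set ks \<subseteq> {..<n}" for ks
    using that vs
  proof (induction vs arbitrary: ks)
    case (Cons v vs)
    from Cons.prems(2)[of v] obtain a where v: "v = (\<Sum>k<n. sc (a k) (z k))" by auto
    have "F (map z ks @ z k # vs) = 0" if "k < n" for k
      using Cons.IH[of "ks @ [k]"] Cons.prems that by simp
    then show ?case by (simp add: v alternating_sum[OF F] alternating_scale[OF F])
  qed (simp add: basis)
  from this[of "[]"] show ?thesis by simp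
qed

text \<open>Alternating functions of \<open>n\<close> arguments from the span of \<open>n\<close>
  vectors form at most a line. This stands in for determinants in what follows; the crosswise form
  avoids dividing by a value that may vanish.\<close>

lemma alternating_proportional:
  assumes F: "alternating sc h F" and G: "alternating sc h G"
    and len: "length vs = n"
    and vs: "\<And>v. v \<in> set vs \<Longrightarrow> \<exists>a. v = (\<Sum>k<n. sc (a k) (z k))"
  shows "F (map z [0..<n]) * G vs = G (map z [0..<n]) * F vs"
proof -
  \<comment> \<open>Cutting \<open>H\<close> off outside length \<open>n\<close> leaves the full
    index set as the only case to check on the basis.\<close>
  define H where "H = (\<lambda>us. if length us = n
      then F (map z [0..<n]) * G us - G (map z [0..<n]) * F us else 0)"
  have "alternating sc h H"
    unfolding alternating_def
  proof (intro conjI allI)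
    show "H (us @ (x + y) # vs) = H (us @ x # vs) + H (us @ y # vs)" for us vs x y
      by (simp add: H_def alternating_add[OF F] alternating_add[OF G] algebra_simps)
    show "H (us @ sc r x # vs) = h r * H (us @ x # vs)" for us vs r x
      by (simp add: H_def alternating_scale[OF F] alternating_scale[OF G] algebra_simps)
    show "H (us @ x # vs @ x # ws) = 0" for us vs ws x
      unfolding H_def alternating_repeat[OF F] alternating_repeat[OF G] by simp
  qed
  moreover have "H (map z (sorted_list_of_set I)) = 0" if "I \<subseteq> {..<n}" for I
  proof (cases "card I = n")
    case True
    then have "I = {..<n}" using that by (simp add: card_subset_eq)
    then show ?thesis by (simp add: H_def lessThan_atLeast0 algebra_simps)
  qed (simp add: H_def)
  ultimately have "H vs = 0" using alternating_vanish[of sc h H n z vs] vs by blast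
  then show ?thesis by (simp add: H_def len)
qed

section \<open>Orthonormal frames, the volume form and the determinant\<close>

lemma orthonormal_frame_expand:
  fixes e :: "nat \<Rightarrow> 'a::euclidean_space"
  assumes "orthonormal_frame e"
  shows "x = (\<Sum>i<DIM('a). (x \<bullet> e i) *\<^sub>R e i)"
proof -
  let ?N = "DIM('a)"
  have on: "e i \<bullet> e j = (if i = j then 1 else 0)" if "i < ?N" "j < ?N" for i j
    using assms that unfolding orthonormal_frame_def by blast
  have inj: "inj_on e {..<?N}"
  proof (rule inj_onI)
    fix i j assume "i \<in> {..<?N}" "j \<in> {..<?N}" "e i = e j"
    then show "i = j" using on[of i i] on[of i j] by (auto split: if_splits)
  qed
  have "0 \<notin> e ` {..<?N}" using on by force
  moreover have "pairwise orthogonal (e ` {..<?N})"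
    by (auto simp: pairwise_def orthogonal_def on)
  ultimately have "independent (e ` {..<?N})" by (rule pairwise_orthogonal_independent[rotated])
  then have sp: "span (e ` {..<?N}) = UNIV"
    using card_eq_dim[of "e ` {..<?N}" UNIV] inj by (simp add: card_image top.extremum_uniqueI)
  let ?y = "x - (\<Sum>i<?N. (x \<bullet> e i) *\<^sub>R e i)"
  have "?y \<bullet> e j = 0" if "j < ?N" for j
    using that by (simp add: inner_diff_left inner_sum_left on if_distrib cong: if_cong)
  have "orthogonal ?y y" if "y \<in> span (e ` {..<?N})" for y
    by (rule orthogonal_to_span[OF that]) (use \<open>\<And>j. j < ?N \<Longrightarrow> ?y \<bullet> e j = 0\<close> in \<open>auto simp: orthogonal_def\<close>)
  then have "orthogonal ?y ?y" using sp by blast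
  then show ?thesis by (simp add: orthogonal_def)
qed

lemma orthonormal_frame_inner:
  assumes "orthonormal_frame (e :: nat \<Rightarrow> 'a::euclidean_space)" "i < DIM('a)" "j < DIM('a)"
  shows "e i \<bullet> e j = (if i = j then 1 else 0)"
  using assms unfolding orthonormal_frame_def by blast

lemma prod_nth_middle:
  fixes g :: "'a \<Rightarrow> nat \<Rightarrow> 'c::comm_semiring_1"
  assumes "length (us @ x # vs) = N"
  shows "(\<Prod>k<N. g ((us @ x # vs) ! k) k) = g x (length us) * (\<Prod>k\<in>{..<N} - {length us}. g ((us @ y # vs) ! k) k)"
proof -
  have "(\<Prod>k<N. g ((us @ x # vs) ! k) k)
      = g ((us @ x # vs) ! length us) (length us) * (\<Prod>k\<in>{..<N} - {length us}. g ((us @ x # vs) ! k) k)"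
    using assms by (intro prod.remove) auto
  also have "(\<Prod>k\<in>{..<N} - {length us}. g ((us @ x # vs) ! k) k) = (\<Prod>k\<in>{..<N} - {length us}. g ((us @ y # vs) ! k) k)"
    by (intro prod.cong) (auto simp: nth_append nth_Cons split: nat.splits)
  finally show ?thesis by simp
qed

lemma vol_form_add:
  "vol_form inner e (us @ (x + y) # vs) = vol_form inner e (us @ x # vs) + vol_form inner (e :: nat \<Rightarrow> 'a::euclidean_space) (us @ y # vs)"
proof (cases "length (us @ x # vs) = DIM('a)")
  case True
  then have "length (us @ (x + y) # vs) = DIM('a)" "length (us @ y # vs) = DIM('a)" by auto
  note p = prod_nth_middle[OF True, of _ x] prod_nth_middle[OF this(1), of _ x] prod_nth_middle[OF this(2), of _ x]
  have "(\<Prod>k<DIM('a). ((us @ (x + y) # vs) ! k) \<bullet> e (p k))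
     = (\<Prod>k<DIM('a). ((us @ x # vs) ! k) \<bullet> e (p k)) + (\<Prod>k<DIM('a). ((us @ y # vs) ! k) \<bullet> e (p k))" for p
    using p[of "\<lambda>v k. v \<bullet> e (p k)"] by (simp add: inner_add_left algebra_simps)
  with True show ?thesis by (simp add: vol_form_def algebra_simps sum.distrib)
qed (auto simp: vol_form_def)

lemma vol_form_scale:
  "vol_form inner e (us @ (r *\<^sub>R x) # vs) = r * vol_form inner (e :: nat \<Rightarrow> 'a::euclidean_space) (us @ x # vs)"
proof (cases "length (us @ x # vs) = DIM('a)")
  case True
  then have "length (us @ (r *\<^sub>R x) # vs) = DIM('a)" by auto
  note p = prod_nth_middle[OF True, of _ x] prod_nth_middle[OF this(1), of _ x]
  have "(\<Prod>k<DIM('a). ((us @ (r *\<^sub>R x) # vs) ! k) \<bullet> e (p k))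
     = r * (\<Prod>k<DIM('a). ((us @ x # vs) ! k) \<bullet> e (p k))" for p
    using p[of "\<lambda>v k. v \<bullet> e (p k)"] by simp
  with True show ?thesis by (simp add: vol_form_def sum_distrib_left algebra_simps)
qed (auto simp: vol_form_def)

text \<open>Composing permutations with the transposition of the two equal arguments reverses every
  sign and preserves every product.\<close>

lemma vol_form_repeat: "vol_form inner (e :: nat \<Rightarrow> 'a::euclidean_space) (us @ x # vs @ x # ws) = 0"
proof (cases "length (us @ x # vs @ x # ws) = DIM('a)")
  case True
  let ?N = "DIM('a)" and ?L = "us @ x # vs @ x # ws"
  define i j where "i = length us" and "j = length us + Suc (length vs)"
  have ij: "i < ?N" "j < ?N" "i \<noteq> j" using True by (auto simp: i_def j_def)
  let ?\<tau> = "Transposition.transpose i j"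
  have perm: "?\<tau> permutes {..<?N}" using ij by (simp add: permutes_swap_id)
  have "?L ! i = x" "?L ! j = x" by (auto simp: i_def j_def nth_append)
  then have L: "?L ! ?\<tau> k = ?L ! k" for k by (simp add: Transposition.transpose_def)
  let ?S = "\<Sum>p | p permutes {..<?N}. of_int (sign p) * (\<Prod>k<?N. (?L ! k) \<bullet> e (p k))"
  have "?S = (\<Sum>p | p permutes {..<?N}. of_int (sign (p \<circ> ?\<tau>)) * (\<Prod>k<?N. (?L ! k) \<bullet> e ((p \<circ> ?\<tau>) k)))"
    by (rule sum_permutations_compose_right[OF perm])
  also have "\<dots> = (\<Sum>p | p permutes {..<?N}. - (of_int (sign p) * (\<Prod>k<?N. (?L ! k) \<bullet> e (p k))))"
  proof (rule sum.cong, simp)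
    fix p assume "p \<in> {p. p permutes {..<?N}}"
    then have p: "permutation p" using permutation_permutes by blast
    have "sign (p \<circ> ?\<tau>) = - sign p"
      using ij(3) by (simp add: sign_compose[OF p permutation_swap_id] sign_swap_id)
    moreover have "(\<Prod>k<?N. (?L ! k) \<bullet> e ((p \<circ> ?\<tau>) k)) = (\<Prod>k<?N. (?L ! k) \<bullet> e (p k))"
      using prod.permute[OF perm, of "\<lambda>k. (?L ! k) \<bullet> e (p k)"] by (simp add: o_def L)
    ultimately show "of_int (sign (p \<circ> ?\<tau>)) * (\<Prod>k<?N. (?L ! k) \<bullet> e ((p \<circ> ?\<tau>) k))
        = - (of_int (sign p) * (\<Prod>k<?N. (?L ! k) \<bullet> e (p k)))" by simp
  qed
  also have "\<dots> = - ?S" by (simp add: sum_negf)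
  finally show ?thesis using True by (simp add: vol_form_def)
qed (auto simp: vol_form_def)

lemma alternating_vol_form: "alternating scaleR of_real (\<lambda>vs. complex_of_real (vol_form inner e vs))"
  unfolding alternating_def by (simp only: vol_form_add vol_form_scale vol_form_repeat) simp

lemma vol_form_frame:
  assumes "orthonormal_frame (e :: nat \<Rightarrow> 'a::euclidean_space)"
  shows "vol_form inner e (map e [0..<DIM('a)]) = 1"
proof -
  let ?N = "DIM('a)"
  have "(\<Prod>k<?N. (map e [0..<?N] ! k) \<bullet> e (p k)) = (if p = id then 1 else 0)" if "p permutes {..<?N}" for p
  proof (cases "p = id")
    case False
    then obtain k where k: "p k \<noteq> k" by (auto simp: fun_eq_iff)
    then have "k < ?N" "p k < ?N" using that permutes_not_in permutes_in_image[OF that] by force+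
    then have "(map e [0..<?N] ! k) \<bullet> e (p k) = 0"
      using k by (simp add: orthonormal_frame_inner[OF assms])
    then have "(\<Prod>k<?N. (map e [0..<?N] ! k) \<bullet> e (p k)) = 0"
      using \<open>k < ?N\<close> by (intro prod_zero) auto
    then show ?thesis using False by simp
  qed (simp add: orthonormal_frame_inner[OF assms])
  then have "vol_form inner e (map e [0..<?N]) = (\<Sum>p | p permutes {..<?N}. of_int (sign p) * (if p = id then 1 else 0))"
    by (simp add: vol_form_def)
  also have "\<dots> = (\<Sum>p | p permutes {..<?N}. if p = id then 1 else 0)"
    by (intro sum.cong) (auto simp: sign_id)
  also have "\<dots> = 1"
    by (simp add: finite_permutations permutes_id)
  finally show ?thesis .
qed

lemma alternating_frame_top:
  fixes e :: "nat \<Rightarrow> 'a::euclidean_space"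
  assumes e: "orthonormal_frame e" and \<psi>: "alternating scaleR of_real \<psi>" and len: "length vs = DIM('a)"
  shows "\<psi> vs = of_real (vol_form inner e vs) * \<psi> (map e [0..<DIM('a)])"
proof -
  have "\<exists>a. v = (\<Sum>k<DIM('a). a k *\<^sub>R e k)" for v
    using orthonormal_frame_expand[OF e, of v] by (rule exI[of _ "\<lambda>k. v \<bullet> e k"])
  then show ?thesis
    using alternating_proportional[OF alternating_vol_form \<psi> len, of e e]
    by (simp add: vol_form_frame[OF e] mult.commute)
qed

lemma alternating_map:
  assumes "alternating sc h F" "\<And>x y. A (x + y) = A x + A y" "\<And>r x. A (sc' r x) = sc r (A x)"
  shows "alternating sc' h (\<lambda>vs. F (map A vs))"
  unfolding alternating_def
proof (intro conjI allI)
  show "F (map A (us @ x # vs @ x # ws)) = 0" for us vs ws x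
    using alternating_repeat[OF assms(1), of "map A us" "A x" "map A vs" "map A ws"] by simp
qed (simp_all add: assms(2,3) alternating_add[OF assms(1)] alternating_scale[OF assms(1)])

text \<open>As functions of \<open>vs\<close> both sides are top-degree forms, so their values on
  the frame decide, and there the left side is \<open>det_op\<close> by definition. Multiplicativity
  of the determinant is a consequence.\<close>

lemma vol_form_map:
  fixes e :: "nat \<Rightarrow> 'a::euclidean_space"
  assumes e: "orthonormal_frame e" and len: "length vs = DIM('a)"
  shows "vol_form inner e (map (blinfun_apply A) vs) = det_op e A * vol_form inner e vs"
proof -
  have "alternating scaleR of_real (\<lambda>vs. complex_of_real (vol_form inner e (map (blinfun_apply A) vs)))"
    by (rule alternating_map[OF alternating_vol_form]) (simp_all add: blinfun.add_right blinfun.scaleR_right)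
  from alternating_frame_top[OF e this len] show ?thesis
    by (simp add: det_op_def o_def mult.commute flip: of_real_mult)
qed

lemma det_op_compose:
  assumes e: "orthonormal_frame e"
  shows "det_op e (A o\<^sub>L B) = det_op e A * det_op e B"
  using vol_form_map[OF e, of "map (\<lambda>i. blinfun_apply B (e i)) [0..<DIM('a)]" A]
  by (simp add: det_op_def o_def)

lemma det_op_id: "orthonormal_frame e \<Longrightarrow> det_op e id_blinfun = 1"
  by (simp add: det_op_def vol_form_frame)

lemma sum_lessThan_double: "(\<Sum>j<2 * n. g j) = (\<Sum>i<n. g (2 * i) + g (2 * i + 1 :: nat))"
  by (induction n) (simp_all add: algebra_simps)

text \<open>The first-order condition at a minimum, in the form in which it makes a maximiser of
  \<open>\<bar>B x\<bar>\<^sup>2\<close> an eigenvector.\<close>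

lemma quadratic_nonneg_imp_linear_zero:
  fixes a c :: real
  assumes "\<And>t. 0 \<le> 2 * t * a + t^2 * c"
  shows "a = 0"
proof (rule ccontr)
  assume a: "a \<noteq> 0"
  show False
  proof (cases "c \<le> 0")
    case True
    have "0 \<le> - 2 * a\<^sup>2 + a\<^sup>2 * c"
      using assms[of "- a"] by (simp add: power2_eq_square)
    moreover have "a\<^sup>2 * c \<le> 0" using True by (simp add: mult_nonneg_nonpos)
    moreover have "a\<^sup>2 > 0" using a by simp
    ultimately show False by simp
  next
    case False
    have "2 * (- a / c) * a + (- a / c)\<^sup>2 * c = - (a\<^sup>2 / c)"
      using False by (simp add: power2_eq_square divide_simps)
    moreover have "a\<^sup>2 / c > 0" using a False by simp
    ultimately show False using assms[of "- a / c"] by simp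
  qed
qed

subsection \<open>Skew operators and one-parameter groups\<close>

text \<open>
  \<open>B\<^sup>2\<close> is symmetric and commutes with \<open>J\<close>, so the complex vector space \<open>(V, J)\<close> has a unitary
  basis of eigenvectors; each one maximises \<open>\<bar>B x\<bar>\<^sup>2\<close> over the unit vectors orthogonal
  to its predecessors.
\<close>

lemma unitary_eigenbasis_partial:
  fixes J B :: "'a::euclidean_space \<Rightarrow>\<^sub>L 'a"
  assumes JJ: "\<And>x. J (J x) = - x" and Jorth: "\<And>x y. J x \<bullet> J y = x \<bullet> y"
    and skew: "\<And>x y. B x \<bullet> y = - (x \<bullet> B y)" and BJ: "\<And>x. B (J x) = - J (B x)"
    and dim: "DIM('a) = 2 * n" and "k \<le> n"
  shows "\<exists>b \<theta>. (\<forall>i<k. 0 \<le> \<theta> i \<and> B (B (b i)) = (- (\<theta> i)\<^sup>2) *\<^sub>R b i) \<and>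
    (\<forall>i<k. \<forall>j<k. b i \<bullet> b j = (if i = j then 1 else 0) \<and> b i \<bullet> J (b j) = 0)"
  using \<open>k \<le> n\<close>
proof (induction k)
  case (Suc k)
  then obtain b \<theta> where eig: "\<And>i. i < k \<Longrightarrow> 0 \<le> \<theta> i \<and> B (B (b i)) = (- (\<theta> i)\<^sup>2) *\<^sub>R b i"
    and on: "\<And>i j. i < k \<Longrightarrow> j < k \<Longrightarrow> b i \<bullet> b j = (if i = j then 1 else 0) \<and> b i \<bullet> J (b j) = 0"
    by (metis Suc_leD)
  have Jskew: "J x \<bullet> y = - (x \<bullet> J y)" for x y
    using Jorth[of x "J y"] by (simp add: JJ)
  define W where "W = {x. \<forall>i<k. x \<bullet> b i = 0 \<and> x \<bullet> J (b i) = 0}"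
  have W_lin: "x + c *\<^sub>R y \<in> W" if "x \<in> W" "y \<in> W" for x y c
    using that by (auto simp: W_def inner_add_left)
  have W_scale: "c *\<^sub>R x \<in> W" if "x \<in> W" for x c
    using that by (auto simp: W_def)
  have W_J: "J x \<in> W" if "x \<in> W" for x
    using that by (auto simp: W_def Jskew JJ)
  have W_S: "B (B x) \<in> W" if "x \<in> W" for x
  proof -
    have "B (B x) \<bullet> y = x \<bullet> B (B y)" for y by (simp add: skew)
    then show ?thesis using that eig by (auto simp: W_def BJ blinfun.minus_right blinfun.scaleR_right)
  qed
  have "\<exists>x\<in>W. x \<noteq> 0"
  proof -
    let ?S = "b ` {..<k} \<union> (\<lambda>i. J (b i)) ` {..<k}"
    have "dim ?S \<le> card ?S" by (rule dim_le_card') simp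
    also have "\<dots> \<le> card (b ` {..<k}) + card ((\<lambda>i. J (b i)) ` {..<k})" by (rule card_Un_le)
    also have "\<dots> \<le> k + k" by (intro add_mono) (metis card_image_le card_lessThan finite_lessThan)+
    also have "\<dots> < DIM('a)" using Suc.prems dim by simp
    finally obtain x where "x \<noteq> 0" "\<And>y. y \<in> span ?S \<Longrightarrow> orthogonal x y"
      using orthogonal_to_subspace_exists by blast
    then have "x \<in> W" unfolding W_def orthogonal_def by (blast intro: span_base)
    with \<open>x \<noteq> 0\<close> show ?thesis by blast
  qed
  then obtain y where y: "y \<in> W" "y \<noteq> 0" by blast
  define C where "C = {x. x \<in> W \<and> norm x = 1}"
  have "closed W"
  proof -
    have "W = (\<Inter>i\<in>{..<k}. {x. x \<bullet> b i = 0} \<inter> {x. x \<bullet> J (b i) = 0})" by (auto simp: W_def)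
    also have "closed \<dots>"
      by (intro closed_INT ballI closed_Int closed_Collect_eq continuous_intros)
    finally show ?thesis .
  qed
  then have "compact C"
  proof -
    assume "closed W"
    have "C = sphere 0 1 \<inter> W" by (auto simp: C_def)
    then show ?thesis using \<open>closed W\<close> by (simp add: compact_Int_closed)
  qed
  moreover have "inverse (norm y) *\<^sub>R y \<in> C" using y by (simp add: C_def W_scale)
  moreover have "continuous_on C (\<lambda>x. B x \<bullet> B x)" by (intro continuous_intros)
  ultimately obtain x where x: "x \<in> C" and max: "\<And>y. y \<in> C \<Longrightarrow> B y \<bullet> B y \<le> B x \<bullet> B x"
    using continuous_attains_sup[of C "\<lambda>x. B x \<bullet> B x"] by blast
  define r where "r = norm (B x)"
  have rr: "B x \<bullet> B x = r\<^sup>2" by (simp add: r_def dot_square_norm)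
  have xW: "x \<in> W" "x \<bullet> x = 1" using x by (auto simp: C_def dot_square_norm)
  have nonneg: "0 \<le> r\<^sup>2 * (y \<bullet> y) - B y \<bullet> B y" if "y \<in> W" for y
  proof (cases "y = 0")
    case False
    then have "inverse (norm y) *\<^sub>R y \<in> C" using that by (simp add: C_def W_scale)
    from max[OF this] have "(inverse (norm y))\<^sup>2 * (B y \<bullet> B y) \<le> r\<^sup>2"
      by (simp add: rr blinfun.scaleR_right power2_eq_square mult.assoc)
    then show ?thesis using False
      by (simp add: dot_square_norm field_simps power_inverse)
  qed simp
  \<comment> \<open>The quadratic form
    \<open>r\<^sup>2 * (y \<bullet> y) - B y \<bullet> B y\<close> is nonnegative on
    \<open>W\<close> and vanishes at \<open>x\<close>. Its first variation at \<open>x\<close> in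
    the direction \<open>?z\<close> is twice \<open>?z \<bullet> ?z\<close>, because
    \<open>B\<close> is skew.\<close>
  have "r\<^sup>2 *\<^sub>R x + B (B x) = 0"
  proof -
    let ?z = "r\<^sup>2 *\<^sub>R x + B (B x)"
    have z: "?z \<in> W" using W_lin[OF W_S[OF xW(1)] xW(1), of "r\<^sup>2"] by (simp add: add.commute)
    have "0 \<le> 2 * t * (r\<^sup>2 * (x \<bullet> ?z) - B x \<bullet> B ?z) + t\<^sup>2 * (r\<^sup>2 * (?z \<bullet> ?z) - B ?z \<bullet> B ?z)" for t
      using nonneg[OF W_lin[OF xW(1) z, of t]] rr xW(2)
      by (simp only: blinfun.add_right blinfun.scaleR_right inner_add_left inner_add_right
          inner_scaleR_left inner_scaleR_right)
         (simp add: algebra_simps power2_eq_square inner_commute)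
    from quadratic_nonneg_imp_linear_zero[OF this]
    have "r\<^sup>2 * (x \<bullet> ?z) - B x \<bullet> B ?z = 0" .
    moreover have "B x \<bullet> B ?z = - (B (B x) \<bullet> ?z)" by (simp only: skew[of "B x"])
    ultimately have "?z \<bullet> ?z = 0" by (simp only: inner_add_left inner_scaleR_left)
    then show ?thesis by simp
  qed
  then have x_eig: "B (B x) = (- r\<^sup>2) *\<^sub>R x" by (simp add: eq_neg_iff_add_eq_0 add.commute)
  have "x \<bullet> J x = 0" using Jskew[of x x] by (simp add: inner_commute)
  moreover have "b i \<bullet> J x = 0" if "i < k" for i
    using xW(1) that Jskew[of "b i" x] by (auto simp: W_def inner_commute)
  ultimately show ?case
    using eig on xW x_eig
    by (intro exI[of _ "b(k := x)"] exI[of _ "\<theta>(k := r)"])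
       (auto simp: less_Suc_eq W_def inner_commute r_def)
qed simp

text \<open>The interleaving is that of the bases that define the orientation induced by
  \<open>J\<close>.\<close>

definition complex_frame :: "('a \<Rightarrow> 'a) \<Rightarrow> (nat \<Rightarrow> 'a) \<Rightarrow> nat \<Rightarrow> 'a" where
  "complex_frame J b j = (if even j then b (j div 2) else J (b (j div 2)))"

lemma complex_frame_simps [simp]: "complex_frame J b (2 * i) = b i" "complex_frame J b (Suc (2 * i)) = J (b i)"
  by (simp_all add: complex_frame_def)

lemma orthonormal_complex_frame:
  fixes J :: "'a::euclidean_space \<Rightarrow>\<^sub>L 'a"
  assumes Jorth: "\<And>x y. J x \<bullet> J y = x \<bullet> y"
    and dim: "DIM('a) = 2 * n"
    and on: "\<And>i j. i < n \<Longrightarrow> j < n \<Longrightarrow> b i \<bullet> b j = (if i = j then 1 else 0) \<and> b i \<bullet> J (b j) = 0"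
  shows "orthonormal_frame (complex_frame J b)"
  unfolding orthonormal_frame_def
proof (intro allI impI)
  fix i j assume "i < DIM('a)" "j < DIM('a)"
  then have ij: "i div 2 < n" "j div 2 < n" using dim by auto
  have "i = j \<longleftrightarrow> i div 2 = j div 2 \<and> (even i \<longleftrightarrow> even j)" by presburger
  then show "complex_frame J b i \<bullet> complex_frame J b j = (if i = j then 1 else 0)"
    using on[OF ij] on[OF ij(2,1)] by (auto simp: complex_frame_def Jorth inner_commute)
qed

lemma map_complex_frame:
  "map (complex_frame J b) [0..<2 * n] = concat (map (\<lambda>v. [v, J v]) (map b [0..<n]))"
  by (induction n) (simp_all add: complex_frame_def)

text \<open>The difference of two solutions has constant norm because \<open>B\<close> is skew.
  Identities between rotations are proved below by recognising both sides as solutions of one linear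
  equation.\<close>

lemma skew_flow_unique:
  fixes B :: "'a::euclidean_space \<Rightarrow>\<^sub>L 'a"
  assumes skew: "\<And>x y. B x \<bullet> y = - (x \<bullet> B y)" and S: "convex S" "t0 \<in> S" "t \<in> S"
    and Y: "\<And>t. t \<in> S \<Longrightarrow> (Y has_vector_derivative B o\<^sub>L Y t) (at t within S)"
    and Z: "\<And>t. t \<in> S \<Longrightarrow> (Z has_vector_derivative B o\<^sub>L Z t) (at t within S)"
    and init: "Y t0 = Z t0"
  shows "Y t = Z t"
proof (rule blinfun_eqI)
  fix x
  define v where "v = (\<lambda>t. Y t x - Z t x)"
  have v: "(v has_vector_derivative B (v t)) (at t within S)" if "t \<in> S" for t
  proof -
    have "((\<lambda>t. Y t x) has_vector_derivative (B o\<^sub>L Y t) x) (at t within S)"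
      by (rule bounded_linear.has_vector_derivative[OF blinfun.bounded_linear_left Y[OF that]])
    moreover have "((\<lambda>t. Z t x) has_vector_derivative (B o\<^sub>L Z t) x) (at t within S)"
      by (rule bounded_linear.has_vector_derivative[OF blinfun.bounded_linear_left Z[OF that]])
    ultimately show ?thesis
      unfolding v_def by (auto simp: blinfun.diff_right intro!: derivative_eq_intros)
  qed
  have d: "((\<lambda>t. v t \<bullet> v t) has_vector_derivative 0) (at t within S)" if "t \<in> S" for t
    using bounded_bilinear.has_vector_derivative[OF bounded_bilinear_inner v[OF that] v[OF that]]
      skew[of "v t" "v t"] by simp
  obtain c where c: "\<And>t. t \<in> S \<Longrightarrow> v t \<bullet> v t = c"
    by (rule has_vector_derivative_zero_constant[OF S(1) d]) blast+
  have "v t0 = 0" by (simp add: v_def init)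
  with c[OF S(2)] c[OF S(3)] have "v t = 0" by simp
  then show "Y t x = Z t x" by (simp add: v_def)
qed

text \<open>
  The one-parameter group \<open>exp (t B)\<close> of a skew operator \<open>B\<close>, through an orthonormal frame of
  eigenvectors of \<open>B\<^sup>2\<close>. If \<open>\<theta> i = 0\<close> then \<open>B (f i) = 0\<close>, so the value \<open>0\<close> of
  \<open>sin (t * \<theta> i) / \<theta> i\<close> does no harm.
\<close>

definition frame_proj :: "('a::euclidean_space) \<Rightarrow> 'a \<Rightarrow>\<^sub>L 'a" where
  "frame_proj v = blinfun_scaleR_left v o\<^sub>L blinfun_inner_right v"

definition rot :: "(nat \<Rightarrow> 'a::euclidean_space) \<Rightarrow> (nat \<Rightarrow> real) \<Rightarrow> ('a \<Rightarrow>\<^sub>L 'a) \<Rightarrow> real \<Rightarrow> 'a \<Rightarrow>\<^sub>L 'a" where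
  "rot f \<theta> B t = (\<Sum>i<DIM('a). cos (t * \<theta> i) *\<^sub>R frame_proj (f i)
     + (sin (t * \<theta> i) / \<theta> i) *\<^sub>R (B o\<^sub>L frame_proj (f i)))"

lemma frame_proj_apply: "frame_proj v x = (v \<bullet> x) *\<^sub>R v"
  by (simp add: frame_proj_def)

locale skew_frame =
  fixes f :: "nat \<Rightarrow> 'a::euclidean_space" and \<theta> :: "nat \<Rightarrow> real" and B :: "'a \<Rightarrow>\<^sub>L 'a"
  assumes frame: "orthonormal_frame f"
    and skew: "B x \<bullet> y = - (x \<bullet> B y)"
    and eig: "i < DIM('a) \<Longrightarrow> B (B (f i)) = (- (\<theta> i)\<^sup>2) *\<^sub>R f i"
begin

abbreviation "E \<equiv> rot f \<theta> B"

lemma B_norm: "i < DIM('a) \<Longrightarrow> B (f i) \<bullet> B (f i) = (\<theta> i)\<^sup>2"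
  using skew[of "f i" "B (f i)"] eig[of i] orthonormal_frame_inner[OF frame, of i i]
  by (simp add: skew[of "f i" "B (f i)"])

lemma B_zero: "i < DIM('a) \<Longrightarrow> \<theta> i = 0 \<Longrightarrow> B (f i) = 0"
  using B_norm[of i] by simp

lemma E_frame:
  assumes "i < DIM('a)"
  shows "E t (f i) = cos (t * \<theta> i) *\<^sub>R f i + (sin (t * \<theta> i) / \<theta> i) *\<^sub>R B (f i)"
proof -
  have "E t (f i) = (\<Sum>j<DIM('a). if j = i then cos (t * \<theta> i) *\<^sub>R f i + (sin (t * \<theta> i) / \<theta> i) *\<^sub>R B (f i) else 0)"
    unfolding rot_def blinfun.sum_left
    using assms
    by (intro sum.cong refl) (simp add: blinfun.add_left blinfun.scaleR_left frame_proj_apply orthonormal_frame_inner[OF frame])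
  with assms show ?thesis by simp
qed

lemma blinfun_eq_frameI:
  fixes X Y :: "'a \<Rightarrow>\<^sub>L 'a"
  assumes "\<And>i. i < DIM('a) \<Longrightarrow> X (f i) = Y (f i)"
  shows "X = Y"
proof (rule blinfun_eqI)
  fix x
  have "X (\<Sum>i<DIM('a). (x \<bullet> f i) *\<^sub>R f i) = Y (\<Sum>i<DIM('a). (x \<bullet> f i) *\<^sub>R f i)"
    by (simp add: blinfun.sum_right blinfun.scaleR_right assms)
  then show "X x = Y x" unfolding orthonormal_frame_expand[OF frame, symmetric] .
qed

lemma E_0: "E 0 = id_blinfun"
  by (rule blinfun_eq_frameI) (simp add: E_frame)

lemma E_deriv: "(E has_vector_derivative B o\<^sub>L E t) (at t within S)"
proof -
  have "(E has_vector_derivative (\<Sum>i<DIM('a). (- (\<theta> i * sin (t * \<theta> i))) *\<^sub>R frame_proj (f i)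
     + (\<theta> i * cos (t * \<theta> i) / \<theta> i) *\<^sub>R (B o\<^sub>L frame_proj (f i)))) (at t within S)"
    unfolding rot_def divide_inverse
    by (auto intro!: derivative_eq_intros simp: has_real_derivative_iff_has_vector_derivative[symmetric] mult_ac)
  moreover have "(\<Sum>i<DIM('a). (- (\<theta> i * sin (t * \<theta> i))) *\<^sub>R frame_proj (f i)
     + (\<theta> i * cos (t * \<theta> i) / \<theta> i) *\<^sub>R (B o\<^sub>L frame_proj (f i))) = B o\<^sub>L E t"
  proof (rule blinfun_eq_frameI)
    fix j assume j: "j < DIM('a)"
    have "(\<Sum>i<DIM('a). (- (\<theta> i * sin (t * \<theta> i))) *\<^sub>R frame_proj (f i)
       + (\<theta> i * cos (t * \<theta> i) / \<theta> i) *\<^sub>R (B o\<^sub>L frame_proj (f i))) (f j)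
      = (\<Sum>i<DIM('a). if i = j then (- (\<theta> j * sin (t * \<theta> j))) *\<^sub>R f j + (\<theta> j * cos (t * \<theta> j) / \<theta> j) *\<^sub>R B (f j) else 0)"
      unfolding blinfun.sum_left using j
      by (intro sum.cong refl) (simp add: blinfun.add_left blinfun.scaleR_left blinfun.minus_left blinfun.diff_left frame_proj_apply orthonormal_frame_inner[OF frame])
    also have "\<dots> = (- (\<theta> j * sin (t * \<theta> j))) *\<^sub>R f j + (\<theta> j * cos (t * \<theta> j) / \<theta> j) *\<^sub>R B (f j)"
      using j by simp
    also have "\<dots> = B (E t (f j))"
    proof (cases "\<theta> j = 0")
      case True
      then show ?thesis using B_zero[OF j] by (simp add: E_frame[OF j] blinfun.add_right blinfun.scaleR_right)
    next
      case False
      then show ?thesis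
        by (simp add: E_frame[OF j] blinfun.add_right blinfun.scaleR_right eig[OF j] power2_eq_square)
    qed
    finally show "(\<Sum>i<DIM('a). (- (\<theta> i * sin (t * \<theta> i))) *\<^sub>R frame_proj (f i)
       + (\<theta> i * cos (t * \<theta> i) / \<theta> i) *\<^sub>R (B o\<^sub>L frame_proj (f i))) (f j) = (B o\<^sub>L E t) (f j)" by simp
  qed
  ultimately show ?thesis by simp
qed

lemma E_deriv_affine: "((\<lambda>t. E (a + c * t)) has_vector_derivative c *\<^sub>R (B o\<^sub>L E (a + c * t))) (at t within S)"
proof -
  have "((\<lambda>t. a + c * t) has_vector_derivative c) (at t within S)"
    by (auto intro!: derivative_eq_intros simp: has_real_derivative_iff_has_vector_derivative[symmetric])
  from vector_diff_chain_within[OF this E_deriv] show ?thesis by (simp add: o_def)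
qed

lemma E_unique:
  assumes "\<And>t. (Y has_vector_derivative B o\<^sub>L Y t) (at t)"
    and "\<And>t. (Z has_vector_derivative B o\<^sub>L Z t) (at t)" and "Y 0 = Z 0"
  shows "Y t = Z t"
  using skew_flow_unique[of B UNIV 0 t Y Z] skew assms by simp

lemma blinfun_compose_assoc: "(X o\<^sub>L Y) o\<^sub>L Z = X o\<^sub>L (Y o\<^sub>L Z)"
  by (rule blinfun_eqI) simp

lemma B_E: "B o\<^sub>L E t = E t o\<^sub>L B"
proof (rule E_unique)
  show "((\<lambda>t. B o\<^sub>L E t) has_vector_derivative B o\<^sub>L (B o\<^sub>L E t)) (at t)" for t
    by (intro bounded_linear.has_vector_derivative[OF bounded_bilinear.bounded_linear_right[OF bounded_bilinear_blinfun_compose]] E_deriv)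
  show "((\<lambda>t. E t o\<^sub>L B) has_vector_derivative B o\<^sub>L (E t o\<^sub>L B)) (at t)" for t
    using bounded_linear.has_vector_derivative[OF bounded_bilinear.bounded_linear_left[OF bounded_bilinear_blinfun_compose, of B] E_deriv[of t UNIV]]
    by (simp add: blinfun_compose_assoc)
qed (auto simp: E_0 intro: blinfun_eqI)

lemma B_E_apply: "B (E t x) = E t (B x)"
  using B_E[of t] by (metis blinfun_apply_blinfun_compose)

lemma E_add: "E (s + t) = E s o\<^sub>L E t"
proof -
  have "E (t + 1 * s) = E s o\<^sub>L E t"
  proof (rule E_unique[of "\<lambda>s. E (t + 1 * s)" "\<lambda>s. E s o\<^sub>L E t"])
    show "((\<lambda>s. E (t + 1 * s)) has_vector_derivative B o\<^sub>L E (t + 1 * s)) (at s)" for s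
      using E_deriv_affine[of t 1 s UNIV] by simp
    show "((\<lambda>s. E s o\<^sub>L E t) has_vector_derivative B o\<^sub>L (E s o\<^sub>L E t)) (at s)" for s
      using bounded_linear.has_vector_derivative[OF bounded_bilinear.bounded_linear_left[OF bounded_bilinear_blinfun_compose, of "E t"] E_deriv[of s UNIV]]
      by (simp add: blinfun_compose_assoc)
  qed (auto simp: E_0 intro: blinfun_eqI)
  then show ?thesis by (simp add: add.commute)
qed

lemma E_add_apply: "E (s + t) x = E s (E t x)"
  by (simp add: E_add)

lemma E_minus_apply: "E t (E (- t) x) = x" "E (- t) (E t x) = x"
  using E_add_apply[of t "- t" x] E_add_apply[of "- t" t x] by (simp_all add: E_0)

lemma E_orth: "E t x \<bullet> E t y = x \<bullet> y"
proof -
  have "((\<lambda>t. E t x \<bullet> E t y) has_vector_derivative 0) (at t within UNIV)" for t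
  proof -
    have d: "((\<lambda>t. E t z) has_vector_derivative B (E t z)) (at t within UNIV)" for z
      using bounded_linear.has_vector_derivative[OF blinfun.bounded_linear_left E_deriv] by simp
    show ?thesis
      using bounded_bilinear.has_vector_derivative[OF bounded_bilinear_inner d d, of x y] skew[of "E t x" "E t y"]
      by (simp add: add.commute)
  qed
  then obtain c where "\<And>t. E t x \<bullet> E t y = c"
    using has_vector_derivative_zero_constant[of UNIV "\<lambda>t. E t x \<bullet> E t y"] by auto
  from this[of t] this[of 0] show ?thesis by (simp add: E_0)
qed

text \<open>Conjugation by \<open>J\<close> turns the flow of \<open>B\<close> into that of
  \<open>- B\<close>: after composition with \<open>J\<close> both sides solve the equation of
  \<open>- B\<close> with the same initial value.\<close>

lemma E_anticommute:
  fixes J :: "'a \<Rightarrow>\<^sub>L 'a"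
  assumes JB: "\<And>x. B (J x) = - J (B x)"
  shows "J (E t x) = E (- t) (J x)"
proof -
  have "E (0 + (- 1) * t) o\<^sub>L J = J o\<^sub>L E t"
  proof (rule skew_flow_unique[of "- B" UNIV 0 t "\<lambda>t. E (0 + (- 1) * t) o\<^sub>L J" "\<lambda>t. J o\<^sub>L E t"])
    show "((\<lambda>t. E (0 + (- 1) * t) o\<^sub>L J) has_vector_derivative - B o\<^sub>L (E (0 + (- 1) * t) o\<^sub>L J)) (at t within UNIV)" for t
      using bounded_linear.has_vector_derivative[OF bounded_bilinear.bounded_linear_left[OF bounded_bilinear_blinfun_compose, of J] E_deriv_affine[of 0 "- 1" t UNIV]]
      by (simp add: blinfun_compose_assoc bounded_bilinear.minus_left[OF bounded_bilinear_blinfun_compose])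
    have "J o\<^sub>L (B o\<^sub>L X) = - B o\<^sub>L (J o\<^sub>L X)" for X :: "'a \<Rightarrow>\<^sub>L 'a"
      by (rule blinfun_eqI) (simp add: blinfun.minus_left JB)
    then show "((\<lambda>t. J o\<^sub>L E t) has_vector_derivative - B o\<^sub>L (J o\<^sub>L E t)) (at t within UNIV)" for t
      using bounded_linear.has_vector_derivative[OF bounded_bilinear.bounded_linear_right[OF bounded_bilinear_blinfun_compose, of J] E_deriv[of t UNIV]]
      by (simp add: blinfun_compose_assoc bounded_bilinear.minus_left[OF bounded_bilinear_blinfun_compose])
  qed (auto simp: E_0 skew blinfun.minus_left intro: blinfun_eqI)
  then show ?thesis by (metis blinfun_apply_blinfun_compose add_0 mult_minus1)
qed

text \<open>\<open>E t\<close> is the square of \<open>E (t / 2)\<close>, so its determinant is a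
  square, and it is nonzero because \<open>E (- t)\<close> is the inverse.\<close>

lemma det_E_pos:
  assumes e: "orthonormal_frame e"
  shows "0 < det_op e (E t)"
proof -
  have "det_op e (E (- t)) * det_op e (E t) = 1"
    by (metis det_op_compose[OF e] E_add det_op_id[OF e] E_0 add.left_inverse)
  then have "det_op e (E t) \<noteq> 0" by auto
  moreover have "det_op e (E t) = (det_op e (E (t / 2)))\<^sup>2"
    by (metis det_op_compose[OF e] E_add field_sum_of_halves power2_eq_square)
  ultimately show ?thesis by simp
qed

end

section \<open>Complex structures, their tangent spaces and their geodesics\<close>

lemma complex_structureD:
  assumes "J \<in> complex_structures e"
  shows "J (J x) = - x" "J x \<bullet> J y = x \<bullet> y" "J x \<bullet> y = - (x \<bullet> J y)"
proof -
  have "J o\<^sub>L J = - id_blinfun" and orth: "\<And>x y. J x \<bullet> J y = x \<bullet> y"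
    using assms by (auto simp: complex_structures_def)
  then have sq: "J (J x) = - x" for x
    by (metis blinfun_apply_blinfun_compose blinfun_apply_id_blinfun blinfun.minus_left)
  show "J (J x) = - x" "J x \<bullet> J y = x \<bullet> y" by (fact sq orth)+
  show "J x \<bullet> y = - (x \<bullet> J y)" using orth[of x "J y"] by (simp add: sq)
qed

lemma complex_structure_vol_pos:
  assumes "J \<in> complex_structures e" "B = concat (map (\<lambda>v. [v, J v]) vs)"
    "length B = DIM('a)" "distinct B" "independent (set B)"
  shows "0 < vol_form inner e (B :: 'a::euclidean_space list)"
  using assms by (auto simp: complex_structures_def Let_def)

text \<open>\<open>K\<close> is the conjugate of \<open>J\<close> by \<open>g\<close>, whose inverse
  is \<open>h\<close>. A basis adapted to \<open>K\<close> is the image under \<open>g\<close> of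
  one adapted to \<open>J\<close>, so a positive determinant of \<open>g\<close> preserves the
  orientation.\<close>

lemma complex_structure_conj:
  fixes J g h K :: "'a::euclidean_space \<Rightarrow>\<^sub>L 'a"
  assumes e: "orthonormal_frame e" and J: "J \<in> complex_structures e"
    and gh: "\<And>x. g (h x) = x" and hg: "\<And>x. h (g x) = x" and pos: "0 < det_op e g"
    and K: "\<And>x. K (g x) = g (J x)" and orth: "\<And>x y. K x \<bullet> K y = x \<bullet> y"
  shows "K \<in> complex_structures e"
proof -
  have Kx: "K x = g (J (h x))" for x using K[of "h x"] by (simp add: gh)
  have "K o\<^sub>L K = - id_blinfun"
    by (rule blinfun_eqI)
       (simp add: Kx hg complex_structureD(1)[OF J] blinfun.minus_left blinfun.minus_right gh)
  moreover have "0 < vol_form inner e B"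
    if B: "B = concat (map (\<lambda>v. [v, K v]) vs)" and len: "length B = DIM('a)"
      and dist: "distinct B" and indep: "independent (set B)" for B vs
  proof -
    let ?B = "concat (map (\<lambda>v. [v, J v]) (map h vs))"
    have "map g (concat (map (\<lambda>v. [v, J v]) (map h vs))) = concat (map (\<lambda>v. [v, K v]) vs)" for vs
      by (induction vs) (simp_all add: Kx gh)
    then have gB: "map g ?B = B" by (simp add: B)
    have inj: "inj (blinfun_apply h)" using gh by (metis injI)
    have hB: "?B = map h B" using gB by (simp add: o_def hg flip: gB)
    have "distinct ?B" unfolding hB using dist inj_on_subset[OF inj] by (simp add: distinct_map)
    moreover have "independent (set ?B)" unfolding hB set_map
      using linear_independent_injective_image[of "blinfun_apply h" "set B"] indep inj
      inj_on_subset[OF inj]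
      by (simp add: bounded_linear.linear[OF blinfun.bounded_linear_right])
    moreover have lenB: "length ?B = DIM('a)" unfolding hB using len by simp
    ultimately have "0 < vol_form inner e ?B"
      by (intro complex_structure_vol_pos[OF J refl])
    then show ?thesis using vol_form_map[OF e lenB, of g] pos gB by simp
  qed
  ultimately show ?thesis using orth by (auto simp: complex_structures_def Let_def)
qed

text \<open>As \<open>J\<close> reverses the flow, \<open>E t o\<^sub>L J\<close> is the conjugate
  of \<open>J\<close> by the half rotation \<open>E (t / 2)\<close>.\<close>

lemma (in skew_frame) rot_complex_structure:
  assumes e: "orthonormal_frame e" and J: "J \<in> complex_structures e"
    and JB: "\<And>x. B (J x) = - J (B x)"
  shows "E t o\<^sub>L J \<in> complex_structures e"
proof (rule complex_structure_conj[OF e J, of "E (t / 2)" "E (- t / 2)"])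
  show "0 < det_op e (E (t / 2))" by (rule det_E_pos[OF e])
  show "(E t o\<^sub>L J) (E (t / 2) x) = E (t / 2) (J x)" for x
    using E_anticommute[OF JB, of "t / 2"] E_add_apply[of t "- (t / 2)" "J x"] by simp
  show "(E t o\<^sub>L J) x \<bullet> (E t o\<^sub>L J) y = x \<bullet> y" for x y
    by (simp add: E_orth complex_structureD[OF J])
qed (use E_minus_apply[of "t / 2"] in simp_all)

lemma trace_frame:
  fixes A :: "'a::euclidean_space \<Rightarrow>\<^sub>L 'a"
  assumes f: "orthonormal_frame f"
  shows "trace_op A = (\<Sum>i<DIM('a). A (f i) \<bullet> f i)"
proof -
  have "A b \<bullet> b = (\<Sum>i<DIM('a). (b \<bullet> f i) * (A (f i) \<bullet> b))" for b
    using orthonormal_frame_expand[OF f, of b]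
    by (metis (mono_tags, lifting) blinfun.scaleR_right blinfun.sum_right inner_scaleR_left inner_sum_left sum.cong)
  then have "trace_op A = (\<Sum>b\<in>Basis. \<Sum>i<DIM('a). (b \<bullet> f i) * (A (f i) \<bullet> b))"
    by (simp add: trace_op_def)
  also have "\<dots> = (\<Sum>i<DIM('a). \<Sum>b\<in>Basis. (A (f i) \<bullet> b) * (f i \<bullet> b))"
    by (subst sum.swap) (simp add: inner_commute mult.commute)
  also have "\<dots> = (\<Sum>i<DIM('a). A (f i) \<bullet> f i)"
    by (simp only: euclidean_inner[symmetric])
  finally show ?thesis .
qed

lemma trace_commute: "trace_op (X o\<^sub>L Y) = trace_op (Y o\<^sub>L X)" for X Y :: "'a::euclidean_space \<Rightarrow>\<^sub>L 'a"
proof -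
  have *: "X (Y b) \<bullet> b = (\<Sum>c\<in>Basis. (Y b \<bullet> c) * (X c \<bullet> b))" for X Y :: "'a \<Rightarrow>\<^sub>L 'a" and b
  proof -
    have "X (Y b) = X (\<Sum>c\<in>Basis. (Y b \<bullet> c) *\<^sub>R c)" by (simp only: euclidean_representation)
    then show ?thesis by (simp add: blinfun.sum_right blinfun.scaleR_right inner_sum_left)
  qed
  show ?thesis
    unfolding trace_op_def blinfun_apply_blinfun_compose *
    by (subst sum.swap) (simp add: mult.commute)
qed

lemma trace_minus: "trace_op (- X) = - trace_op X"
  by (simp add: trace_op_def blinfun.minus_left sum_negf)

lemma eta_add_diff: "eta (Y + Z) X = 2 * eta Y X - eta (Y - Z) X"
  by (simp add: eta_def trace_op_def blinfun.add_left blinfun.diff_left inner_add_left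
      inner_diff_left sum.distrib sum_subtractf field_simps)

text \<open>On skew operators \<open>eta\<close> is positive, a quarter of the squared
  Hilbert-Schmidt norm; on symmetric ones it is negative.\<close>

lemma eta_skew:
  fixes X :: "'a::euclidean_space \<Rightarrow>\<^sub>L 'a"
  assumes "\<And>x y. X x \<bullet> y = - (x \<bullet> X y)"
  shows "eta X X = (\<Sum>b\<in>Basis. X b \<bullet> X b) / 4"
  using assms[of "X _"] by (simp add: eta_def trace_op_def sum_negf)

lemma eta_skew_eq_0:
  fixes X :: "'a::euclidean_space \<Rightarrow>\<^sub>L 'a"
  assumes skew: "\<And>x y. X x \<bullet> y = - (x \<bullet> X y)" and "eta X X = 0"
  shows "X = 0"
proof (rule blinfun_euclidean_eqI)
  fix b :: 'a assume "b \<in> Basis"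
  then show "X b = (0 :: 'a \<Rightarrow>\<^sub>L 'a) b"
    using assms(2) unfolding eta_skew[OF skew] by (simp add: sum_nonneg_eq_0_iff)
qed

text \<open>Conjugation by \<open>J\<close> preserves the trace and changes the sign of
  \<open>Y o\<^sub>L X\<close>.\<close>

lemma eta_commuting_anticommuting:
  fixes J X Y :: "'a::euclidean_space \<Rightarrow>\<^sub>L 'a"
  assumes JJ: "\<And>x. J (J x) = - x"
    and X: "\<And>x. X (J x) = - J (X x)" and Y: "\<And>x. Y (J x) = J (Y x)"
  shows "eta Y X = 0"
proof -
  have "trace_op (Y o\<^sub>L X) = - trace_op ((Y o\<^sub>L X o\<^sub>L J) o\<^sub>L J)"
    unfolding trace_minus[symmetric]
    by (rule arg_cong[of _ _ trace_op], rule blinfun_eqI) (simp add: blinfun.minus_left JJ blinfun.minus_right)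
  also have "\<dots> = - trace_op (J o\<^sub>L (Y o\<^sub>L X o\<^sub>L J))" by (simp add: trace_commute)
  also have "J o\<^sub>L (Y o\<^sub>L X o\<^sub>L J) = Y o\<^sub>L X"
    by (rule blinfun_eqI) (simp add: X Y[symmetric] blinfun.minus_right JJ)
  finally show ?thesis by (simp add: eta_def)
qed

lemma blinfun_apply_deriv:
  "(c has_vector_derivative c') F \<Longrightarrow> ((\<lambda>t. blinfun_apply (c t) x) has_vector_derivative blinfun_apply c' x) F"
  by (rule bounded_linear.has_vector_derivative[OF blinfun.bounded_linear_left])

lemma complex_structures_velocity:
  assumes c: "(c has_vector_derivative X) (at t within S)" and "at t within S \<noteq> bot" "t \<in> S"
    and cs: "\<And>s. s \<in> S \<Longrightarrow> c s \<in> complex_structures e"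
  shows "X x \<bullet> y = - (x \<bullet> X y)" "X (c t x) = - c t (X x)"
proof -
  have "((\<lambda>s. c s x \<bullet> y + x \<bullet> c s y) has_vector_derivative X x \<bullet> y + x \<bullet> X y) (at t within S)"
    by (intro has_vector_derivative_add
        bounded_linear.has_vector_derivative[OF bounded_linear_inner_left blinfun_apply_deriv[OF c]]
        bounded_linear.has_vector_derivative[OF bounded_linear_inner_right blinfun_apply_deriv[OF c]])
  moreover have "((\<lambda>s. c s x \<bullet> y + x \<bullet> c s y) has_vector_derivative 0) (at t within S)"
    by (rule has_vector_derivative_transform[OF \<open>t \<in> S\<close> _ has_vector_derivative_const])
       (use complex_structureD(3)[OF cs] in simp)
  ultimately have "X x \<bullet> y + x \<bullet> X y = 0" by (rule vector_derivative_unique_within[OF assms(2)])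
  then show "X x \<bullet> y = - (x \<bullet> X y)" by simp
  have "((\<lambda>s. c s (c s x)) has_vector_derivative c t (X x) + X (c t x)) (at t within S)"
    by (rule bounded_bilinear.has_vector_derivative[OF bounded_bilinear_blinfun_apply c blinfun_apply_deriv[OF c]])
  moreover have "((\<lambda>s. c s (c s x)) has_vector_derivative 0) (at t within S)"
    by (rule has_vector_derivative_transform[OF \<open>t \<in> S\<close> _ has_vector_derivative_const])
       (use complex_structureD(1)[OF cs] in simp)
  ultimately have "c t (X x) + X (c t x) = 0" by (rule vector_derivative_unique_within[OF assms(2)])
  then show "X (c t x) = - c t (X x)" by (simp add: eq_neg_iff_add_eq_0 add.commute)
qed

lemma skew_eigenframe:
  fixes J B :: "'a::euclidean_space \<Rightarrow>\<^sub>L 'a"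
  assumes J: "J \<in> complex_structures e" and dim: "DIM('a) = 2 * n"
    and skew: "\<And>x y. B x \<bullet> y = - (x \<bullet> B y)" and JB: "\<And>x. B (J x) = - J (B x)"
  obtains b \<theta> where
    "\<And>i. i < n \<Longrightarrow> 0 \<le> \<theta> i" "\<And>i. i < n \<Longrightarrow> B (B (b i)) = (- (\<theta> i)\<^sup>2) *\<^sub>R b i"
    "orthonormal_frame (complex_frame J b)"
    "skew_frame (complex_frame J b) (\<lambda>j. \<theta> (j div 2)) B"
proof -
  obtain b \<theta> where eig: "\<And>i. i < n \<Longrightarrow> 0 \<le> \<theta> i \<and> B (B (b i)) = (- (\<theta> i)\<^sup>2) *\<^sub>R b i"
    and on: "\<And>i j. i < n \<Longrightarrow> j < n \<Longrightarrow> b i \<bullet> b j = (if i = j then 1 else 0) \<and> b i \<bullet> J (b j) = 0"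
    using unitary_eigenbasis_partial[of J B n n] complex_structureD[OF J] skew JB dim by (metis order.refl)
  have frame: "orthonormal_frame (complex_frame J b)"
    by (rule orthonormal_complex_frame[OF complex_structureD(2)[OF J] dim on])
  moreover have "skew_frame (complex_frame J b) (\<lambda>j. \<theta> (j div 2)) B"
  proof
    show "B (B (complex_frame J b i)) = (- (\<theta> (i div 2))\<^sup>2) *\<^sub>R complex_frame J b i" if "i < DIM('a)" for i
      using eig[of "i div 2"] that dim
      by (auto simp: complex_frame_def JB blinfun.minus_right blinfun.scaleR_right)
  qed (use frame skew in auto)
  ultimately show thesis using that eig by blast
qed

lemma tangent_spaceI:
  fixes J X :: "'a::euclidean_space \<Rightarrow>\<^sub>L 'a"
  assumes e: "orthonormal_frame e" and J: "J \<in> complex_structures e" and dim: "DIM('a) = 2 * n"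
    and skew: "\<And>x y. X x \<bullet> y = - (x \<bullet> X y)" and JX: "\<And>x. X (J x) = - J (X x)"
  shows "X \<in> tangent_space e J"
proof -
  \<comment> \<open>The curve \<open>exp (t B) J\<close> has initial velocity \<open>B J\<close>,
    and \<open>- X J J = X\<close>.\<close>
  let ?B = "- (X o\<^sub>L J)"
  note JD = complex_structureD[OF J]
  have "?B x \<bullet> y = - (x \<bullet> ?B y)" for x y
    by (simp add: blinfun.minus_left skew JD(3) JX)
  moreover have JB: "?B (J x) = - J (?B x)" for x
    by (simp add: blinfun.minus_left blinfun.minus_right JX JD(1))
  ultimately obtain b \<theta> where "skew_frame (complex_frame J b) (\<lambda>j. \<theta> (j div 2)) ?B"
    using skew_eigenframe[OF J dim, of ?B] by metis
  then interpret skew_frame "complex_frame J b" "\<lambda>j. \<theta> (j div 2)" ?B .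
  have "((\<lambda>t. E t o\<^sub>L J) has_vector_derivative (?B o\<^sub>L E 0) o\<^sub>L J) (at 0)"
    by (rule bounded_linear.has_vector_derivative[OF bounded_bilinear.bounded_linear_left[OF bounded_bilinear_blinfun_compose] E_deriv])
  moreover have "(?B o\<^sub>L E 0) o\<^sub>L J = X"
    by (rule blinfun_eqI) (simp add: E_0 blinfun.minus_left blinfun.minus_right JD(1))
  moreover have "E t o\<^sub>L J \<in> complex_structures e" for t
    using rot_complex_structure[OF e J JB] .
  moreover have "E 0 o\<^sub>L J = J" by (simp add: E_0 blinfun_eqI)
  ultimately show ?thesis unfolding tangent_space_def
    by (intro CollectI exI[of _ "\<lambda>t. E t o\<^sub>L J"]) simp
qed

lemma tangent_spaceD:
  assumes "X \<in> tangent_space e J"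
  shows "X x \<bullet> y = - (x \<bullet> X y)" "X (J x) = - J (X x)"
proof -
  from assms obtain c where c: "\<And>t. c t \<in> complex_structures e" "c 0 = J"
      "(c has_vector_derivative X) (at (0::real))"
    by (auto simp: tangent_space_def)
  show "X x \<bullet> y = - (x \<bullet> X y)" "X (J x) = - J (X x)"
    using complex_structures_velocity[of c X 0 UNIV e] c by auto
qed

text \<open>
  Differentiating \<open>c\<^sup>2 = -1\<close> twice and using that \<open>c''\<close> has no tangential part gives
  \<open>c'' c = c c''\<close>, hence \<open>c'' = c c'\<^sup>2\<close>, so that \<open>B = - c' c\<close> is constant along the geodesic.
\<close>

lemma geodesic_velocity:
  fixes \<gamma> :: "real \<Rightarrow> 'a::euclidean_space \<Rightarrow>\<^sub>L 'a"
  assumes e: "orthonormal_frame e" and dim: "DIM('a) = 2 * n" and geo: "geodesic_on e {0..1} \<gamma>"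
  obtains B :: "'a \<Rightarrow>\<^sub>L 'a" where "\<And>x y. B x \<bullet> y = - (x \<bullet> B y)" "\<And>x. B (\<gamma> 0 x) = - \<gamma> 0 (B x)"
    "\<And>t. t \<in> {0..1} \<Longrightarrow> (\<gamma> has_vector_derivative B o\<^sub>L \<gamma> t) (at t within {0..1})"
proof -
  let ?I = "{0..1::real}"
  from geo obtain c' c'' where cs: "\<And>t. t \<in> ?I \<Longrightarrow> \<gamma> t \<in> complex_structures e"
    and d1: "\<And>t. t \<in> ?I \<Longrightarrow> (\<gamma> has_vector_derivative c' t) (at t within ?I)"
    and d2: "\<And>t. t \<in> ?I \<Longrightarrow> (c' has_vector_derivative c'' t) (at t within ?I)"
    and perp: "\<And>t X. t \<in> ?I \<Longrightarrow> X \<in> tangent_space e (\<gamma> t) \<Longrightarrow> eta (c'' t) X = 0"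
    unfolding geodesic_on_def by blast
  have nb: "at t within ?I \<noteq> bot" if "t \<in> ?I" for t
    using that by (simp add: trivial_limit_within islimpt_Icc)
  have v: "c' t x \<bullet> y = - (x \<bullet> c' t y)" "c' t (\<gamma> t x) = - \<gamma> t (c' t x)" if "t \<in> ?I" for t x y
    using complex_structures_velocity[OF d1[OF that] nb[OF that] that cs] by auto
  have skew2: "c'' t x \<bullet> y = - (x \<bullet> c'' t y)" if t: "t \<in> ?I" for t x y
  proof -
    have "((\<lambda>s. c' s x \<bullet> y + x \<bullet> c' s y) has_vector_derivative c'' t x \<bullet> y + x \<bullet> c'' t y) (at t within ?I)"
      by (intro has_vector_derivative_add
        bounded_linear.has_vector_derivative[OF bounded_linear_inner_left blinfun_apply_deriv[OF d2[OF t]]]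
        bounded_linear.has_vector_derivative[OF bounded_linear_inner_right blinfun_apply_deriv[OF d2[OF t]]])
    moreover have "((\<lambda>s. c' s x \<bullet> y + x \<bullet> c' s y) has_vector_derivative 0) (at t within ?I)"
      by (rule has_vector_derivative_transform[OF t _ has_vector_derivative_const]) (simp add: v)
    ultimately have "c'' t x \<bullet> y + x \<bullet> c'' t y = 0" by (rule vector_derivative_unique_within[OF nb[OF t]])
    then show ?thesis by simp
  qed
  have second: "c'' t (\<gamma> t x) + 2 *\<^sub>R c' t (c' t x) + \<gamma> t (c'' t x) = 0" if t: "t \<in> ?I" for t x
  proof -
    have "((\<lambda>s. c' s (\<gamma> s x) + \<gamma> s (c' s x)) has_vector_derivative
        (c' t (c' t x) + c'' t (\<gamma> t x)) + (\<gamma> t (c'' t x) + c' t (c' t x))) (at t within ?I)"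
      by (intro has_vector_derivative_add
        bounded_bilinear.has_vector_derivative[OF bounded_bilinear_blinfun_apply d2[OF t] blinfun_apply_deriv[OF d1[OF t]]]
        bounded_bilinear.has_vector_derivative[OF bounded_bilinear_blinfun_apply d1[OF t] blinfun_apply_deriv[OF d2[OF t]]])
    moreover have "((\<lambda>s. c' s (\<gamma> s x) + \<gamma> s (c' s x)) has_vector_derivative 0) (at t within ?I)"
      by (rule has_vector_derivative_transform[OF t _ has_vector_derivative_const]) (simp add: v)
    ultimately have "(c' t (c' t x) + c'' t (\<gamma> t x)) + (\<gamma> t (c'' t x) + c' t (c' t x)) = 0"
      by (rule vector_derivative_unique_within[OF nb[OF t]])
    then show ?thesis by (simp add: scaleR_2 algebra_simps)
  qed
  have comm: "c'' t (\<gamma> t x) = \<gamma> t (c'' t x)" if t: "t \<in> ?I" for t x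
  proof -
    let ?J = "\<gamma> t"
    note JD = complex_structureD[OF cs[OF t]]
    \<comment> \<open>\<open>X\<close> is twice the part of \<open>c'' t\<close> that anticommutes
      with \<open>?J\<close>, that is, its tangential part;
      \<open>c'' t - (?J o\<^sub>L c'' t o\<^sub>L ?J)\<close> is twice the part that
      commutes.\<close>
    define X where "X = c'' t + (?J o\<^sub>L c'' t o\<^sub>L ?J)"
    have Xx: "X x = c'' t x + ?J (c'' t (?J x))" for x by (simp add: X_def blinfun.add_left)
    have skewX: "X x \<bullet> y = - (x \<bullet> X y)" for x y
      by (simp add: Xx inner_add_left inner_add_right skew2[OF t] JD(3))
    have XJ: "X (?J x) = - ?J (X x)" for x
      by (simp add: Xx blinfun.add_right blinfun.minus_right JD(1))
    have "eta (c'' t) X = 0" by (rule perp[OF t tangent_spaceI[OF e cs[OF t] dim skewX XJ]])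
    moreover have "eta (c'' t - (?J o\<^sub>L c'' t o\<^sub>L ?J)) X = 0"
      by (rule eta_commuting_anticommuting[OF JD(1) XJ])
         (simp add: blinfun.diff_left blinfun.diff_right blinfun.minus_right JD(1))
    moreover have "eta X X = 2 * eta (c'' t) X - eta (c'' t - (?J o\<^sub>L c'' t o\<^sub>L ?J)) X"
      using eta_add_diff[of "c'' t" "?J o\<^sub>L c'' t o\<^sub>L ?J" X] by (simp flip: X_def)
    ultimately have "X = 0" using eta_skew_eq_0[OF skewX] by simp
    then have "X (?J x) = 0" by simp
    then show ?thesis by (simp add: Xx JD(1) blinfun.minus_right)
  qed
  have c''_eq: "c'' t x = \<gamma> t (c' t (c' t x))" if t: "t \<in> ?I" for t x
  proof -
    have "\<gamma> t (2 *\<^sub>R \<gamma> t (c'' t x) + 2 *\<^sub>R c' t (c' t x)) = 0"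
      using second[OF t, of x] by (simp add: comm[OF t] scaleR_2 algebra_simps)
    then show ?thesis
      by (simp add: blinfun.add_right blinfun.scaleR_right complex_structureD(1)[OF cs[OF t]] flip: scaleR_add_right)
  qed
  define B where "B = - (c' 0 o\<^sub>L \<gamma> 0)"
  have "((\<lambda>t. - (c' t o\<^sub>L \<gamma> t)) has_vector_derivative 0) (at t within ?I)" if t: "t \<in> ?I" for t
  proof -
    have "((\<lambda>t. - (c' t o\<^sub>L \<gamma> t)) has_vector_derivative - ((c' t o\<^sub>L c' t) + (c'' t o\<^sub>L \<gamma> t))) (at t within ?I)"
      by (intro has_vector_derivative_minus
          bounded_bilinear.has_vector_derivative[OF bounded_bilinear_blinfun_compose d2[OF t] d1[OF t]])
    moreover have "- ((c' t o\<^sub>L c' t) + (c'' t o\<^sub>L \<gamma> t)) = 0"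
      by (rule blinfun_eqI)
         (simp add: blinfun.add_left blinfun.diff_left blinfun.minus_left c''_eq[OF t] v(2)[OF t]
           blinfun.minus_right complex_structureD(1)[OF cs[OF t]])
    ultimately show ?thesis by metis
  qed
  then obtain C where C: "\<And>t. t \<in> ?I \<Longrightarrow> - (c' t o\<^sub>L \<gamma> t) = C"
    using has_vector_derivative_zero_constant[of ?I "\<lambda>t. - (c' t o\<^sub>L \<gamma> t)"] by auto
  have "(- (c' t o\<^sub>L \<gamma> t)) o\<^sub>L \<gamma> t = c' t" if t: "t \<in> ?I" for t
    by (rule blinfun_eqI) (simp add: blinfun.minus_left blinfun.minus_right complex_structureD(1)[OF cs[OF t]])
  then have c': "c' t = C o\<^sub>L \<gamma> t" if "t \<in> ?I" for t using that C by metis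
  have C0: "C = - (c' 0 o\<^sub>L \<gamma> 0)" using C[of 0] by simp
  have 0: "(0::real) \<in> ?I" by simp
  note JD = complex_structureD[OF cs[OF 0]]
  show thesis
  proof (rule that[of C])
    show "C x \<bullet> y = - (x \<bullet> C y)" for x y
      by (simp add: C0 blinfun.minus_left v(1)[OF 0] JD(3) v(2)[OF 0])
    show "C (\<gamma> 0 x) = - \<gamma> 0 (C x)" for x
      by (simp add: C0 blinfun.minus_left blinfun.minus_right v(2)[OF 0] JD(1))
    show "(\<gamma> has_vector_derivative C o\<^sub>L \<gamma> t) (at t within ?I)" if "t \<in> ?I" for t
      using d1[OF that] c'[OF that] by simp
  qed
qed

section \<open>The determinant of the mean of two complex structures\<close>

lemma prod_lessThan_double: "(\<Prod>j<2 * n. g j) = (\<Prod>i<n. g (2 * i) * g (2 * i + 1 :: nat) :: real)"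
  by (induction n) (simp_all add: algebra_simps)

lemma rot_along_flow:
  assumes "skew_frame f \<theta> B"
    and deriv: "\<And>t. t \<in> {0..1} \<Longrightarrow> (\<gamma> has_vector_derivative B o\<^sub>L \<gamma> t) (at t within {0..1})"
    and t: "t \<in> {0..1}"
  shows "\<gamma> t = rot f \<theta> B t o\<^sub>L \<gamma> 0"
proof -
  interpret skew_frame f \<theta> B by fact
  show ?thesis
  proof (rule skew_flow_unique[of B "{0..1}" 0 t \<gamma> "\<lambda>t. E t o\<^sub>L \<gamma> 0"])
    fix t :: real
    show "((\<lambda>t. E t o\<^sub>L \<gamma> 0) has_vector_derivative B o\<^sub>L (E t o\<^sub>L \<gamma> 0)) (at t within {0..1})"
      using bounded_linear.has_vector_derivative[OF bounded_bilinear.bounded_linear_left[OF bounded_bilinear_blinfun_compose, of "\<gamma> 0"] E_deriv[of t]]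
      by (simp add: blinfun_compose_assoc)
  qed (use skew deriv t in \<open>auto simp: E_0 intro: blinfun_eqI\<close>)
qed

lemma det_op_diagonal:
  fixes A :: "'a::euclidean_space \<Rightarrow>\<^sub>L 'a"
  assumes e: "orthonormal_frame e" and pos: "vol_form inner e (map f [0..<DIM('a)]) \<noteq> 0"
    and A: "\<And>j. j < DIM('a) \<Longrightarrow> A (f j) = c j *\<^sub>R f j"
  shows "det_op e A = (\<Prod>j<DIM('a). c j)"
proof -
  have "vol_form inner e (us @ map (\<lambda>j. c j *\<^sub>R f j) [0..<k] @ vs) = (\<Prod>j<k. c j) * vol_form inner e (us @ map f [0..<k] @ vs)"
    for us vs k
    by (induction k arbitrary: vs) (simp_all add: vol_form_scale[of e "us @ map _ _", simplified])
  from this[of "[]" "DIM('a)" "[]"]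
  have "vol_form inner e (map (\<lambda>j. c j *\<^sub>R f j) [0..<DIM('a)]) = (\<Prod>j<DIM('a). c j) * vol_form inner e (map f [0..<DIM('a)])"
    by simp
  moreover have "map (blinfun_apply A) (map f [0..<DIM('a)]) = map (\<lambda>j. c j *\<^sub>R f j) [0..<DIM('a)]"
    by (auto simp: A)
  moreover have "vol_form inner e (map (blinfun_apply A) (map f [0..<DIM('a)])) = det_op e A * vol_form inner e (map f [0..<DIM('a)])"
    by (rule vol_form_map[OF e]) simp
  ultimately have "det_op e A * vol_form inner e (map f [0..<DIM('a)]) = (\<Prod>j<DIM('a). c j) * vol_form inner e (map f [0..<DIM('a)])"
    by (simp only:)
  then show ?thesis using pos by simp
qed

lemma orthonormal_frame_distinct_independent:
  fixes f :: "nat \<Rightarrow> 'a::euclidean_space"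
  assumes "orthonormal_frame f"
  shows "distinct (map f [0..<DIM('a)])" "independent (set (map f [0..<DIM('a)]))"
proof -
  note on = orthonormal_frame_inner[OF assms]
  have inj: "inj_on f {..<DIM('a)}"
  proof (rule inj_onI)
    fix i j assume "i \<in> {..<DIM('a)}" "j \<in> {..<DIM('a)}" "f i = f j"
    then show "i = j" using on[of i i] on[of i j] by (auto split: if_splits)
  qed
  then show "distinct (map f [0..<DIM('a)])" by (simp add: distinct_map lessThan_atLeast0)
  have "0 \<notin> f ` {..<DIM('a)}" using on by force
  moreover have "pairwise orthogonal (f ` {..<DIM('a)})"
    by (auto simp: pairwise_def orthogonal_def on)
  ultimately show "independent (set (map f [0..<DIM('a)]))"
    using pairwise_orthogonal_independent by (simp add: lessThan_atLeast0)
qed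

lemma complex_frame_positive:
  fixes J :: "'a::euclidean_space \<Rightarrow>\<^sub>L 'a"
  assumes dim: "DIM('a) = 2 * n" and J: "J \<in> complex_structures e" and f: "orthonormal_frame (complex_frame J b)"
  shows "0 < vol_form inner e (map (complex_frame J b) [0..<DIM('a)])"
proof (rule complex_structure_vol_pos[OF J _ _ orthonormal_frame_distinct_independent[OF f]])
  show "map (complex_frame J b) [0..<DIM('a)] = concat (map (\<lambda>v. [v, J v]) (map b [0..<n]))"
    by (simp only: dim map_complex_frame)
qed simp

text \<open>\<open>J\<close> maps an adapted basis to an adapted basis, so the determinant is
  positive; its square is the determinant of minus the identity in even dimension.\<close>

lemma det_complex_structure:
  fixes J :: "'a::euclidean_space \<Rightarrow>\<^sub>L 'a"
  assumes e: "orthonormal_frame e" and dim: "DIM('a) = 2 * n" and J: "J \<in> complex_structures e"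
    and f: "orthonormal_frame (complex_frame J b)"
  shows "det_op e J = 1"
proof -
  let ?f = "map (complex_frame J b) [0..<DIM('a)]"
  have pos: "0 < vol_form inner e ?f" by (rule complex_frame_positive[OF dim J f])
  have inj: "inj (blinfun_apply J)"
    by (metis complex_structureD(1)[OF J] injI neg_equal_iff_equal)
  have "0 < vol_form inner e (map J ?f)"
  proof (rule complex_structure_vol_pos[OF J])
    show "map J ?f = concat (map (\<lambda>v. [v, J v]) (map (\<lambda>i. J (b i)) [0..<n]))"
      unfolding dim map_complex_frame by (induction n) simp_all
    show "distinct (map J ?f)"
      using orthonormal_frame_distinct_independent(1)[OF f] inj_on_subset[OF inj]
      unfolding distinct_map[of J] by blast
    show "independent (set (map J ?f))"
      unfolding set_map[of J]
      by (rule linear_independent_injective_image[OF bounded_linear.linear[OF blinfun.bounded_linear_right]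
            orthonormal_frame_distinct_independent(2)[OF f] inj_on_subset[OF inj]]) simp
  qed simp
  then have "0 < det_op e J" using vol_form_map[OF e, of ?f J] pos by (simp add: zero_less_mult_iff)
  moreover have "det_op e J * det_op e J = 1"
  proof -
    have "J o\<^sub>L J = - id_blinfun"
      by (rule blinfun_eqI) (simp add: complex_structureD(1)[OF J] blinfun.minus_left)
    then have "det_op e J * det_op e J = det_op e (- id_blinfun)" by (simp flip: det_op_compose[OF e])
    also have "\<dots> = (\<Prod>j<DIM('a). - 1)"
      by (rule det_op_diagonal[OF e, of "complex_frame J b"]) (use pos in \<open>simp_all add: blinfun.minus_left\<close>)
    also have "\<dots> = 1" by (simp add: dim power_mult)
    finally show ?thesis .
  qed
  ultimately show ?thesis by (metis abs_of_pos abs_square_eq_1 power2_eq_square)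
qed

text \<open>\<open>J\<close> intertwines \<open>E t\<close> with its inverse, so the two have equal
  determinants with product 1.\<close>

lemma (in skew_frame) det_E:
  assumes e: "orthonormal_frame e" and J: "J \<in> complex_structures e" and JB: "\<And>x. B (J x) = - J (B x)"
  shows "det_op e (E t) = 1"
proof -
  have "det_op e (E (- t)) * det_op e (E t) = 1"
    by (metis det_op_compose[OF e] E_add det_op_id[OF e] E_0 add.left_inverse)
  moreover have "det_op e J \<noteq> 0"
  proof
    assume "det_op e J = 0"
    moreover have "(- J) o\<^sub>L J = id_blinfun"
      by (rule blinfun_eqI) (simp add: complex_structureD(1)[OF J] blinfun.minus_left)
    then have "det_op e (- J) * det_op e J = 1" by (metis det_op_compose[OF e] det_op_id[OF e])
    ultimately show False by simp
  qed
  moreover have "J o\<^sub>L E t = E (- t) o\<^sub>L J"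
    by (rule blinfun_eqI) (simp add: E_anticommute[OF JB])
  then have "det_op e J * det_op e (E t) = det_op e (E (- t)) * det_op e J"
    by (metis det_op_compose[OF e])
  ultimately have "det_op e (E t) * det_op e (E t) = 1" by auto
  then show ?thesis using det_E_pos[OF e, of t]
    by (metis abs_of_pos abs_square_eq_1 power2_eq_square)
qed

lemma (in skew_frame) E_sum_frame:
  "i < DIM('a) \<Longrightarrow> E t (f i) + E (- t) (f i) = (2 * cos (t * \<theta> i)) *\<^sub>R f i"
  by (simp add: E_frame scaleR_2 flip: scaleR_scaleR)

text \<open>Factoring out the midpoint rotation leaves the symmetric operator \<open>C\<close>, the
  mean of two opposite half rotations. It is diagonal, and the entry
  \<open>cos (\<theta> i / 2)\<close> occurs for \<open>b i\<close> and again for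
  \<open>J (b i)\<close>, hence the square.\<close>

lemma det_half_sum:
  fixes J :: "'a::euclidean_space \<Rightarrow>\<^sub>L 'a"
  assumes e: "orthonormal_frame e" and dim: "DIM('a) = 2 * n" and J: "J \<in> complex_structures e"
    and sf: "skew_frame (complex_frame J b) (\<lambda>j. \<theta> (j div 2)) B" and JB: "\<And>x. B (J x) = - J (B x)"
  shows "det_op e ((1/2) *\<^sub>R (J + (rot (complex_frame J b) (\<lambda>j. \<theta> (j div 2)) B 1 o\<^sub>L J))) = (\<Prod>i<n. cos (\<theta> i / 2))\<^sup>2"
proof -
  interpret skew_frame "complex_frame J b" "\<lambda>j. \<theta> (j div 2)" B by fact
  define C where "C = (1/2) *\<^sub>R (E (1/2) + E (- (1/2)))"
  have "(1/2) *\<^sub>R (J + (E 1 o\<^sub>L J)) = E (1/2) o\<^sub>L C o\<^sub>L J"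
    by (rule blinfun_eqI)
       (use E_add_apply[of "1/2" "1/2"] in \<open>simp add: C_def blinfun.add_left blinfun.scaleR_left blinfun.scaleR_right
          blinfun.add_right E_minus_apply add.commute\<close>)
  then have "det_op e ((1/2) *\<^sub>R (J + (E 1 o\<^sub>L J))) = det_op e C"
    by (simp add: det_op_compose[OF e] det_E[OF e J JB] det_complex_structure[OF e dim J frame])
  also have "\<dots> = (\<Prod>j<DIM('a). cos (1/2 * \<theta> (j div 2)))"
  proof (rule det_op_diagonal[OF e, of "complex_frame J b"])
    show "C (complex_frame J b j) = cos (1/2 * \<theta> (j div 2)) *\<^sub>R complex_frame J b j" if "j < DIM('a)" for j
      using E_sum_frame[OF that, of "1/2"] by (simp add: C_def blinfun.add_left blinfun.scaleR_left)
  qed (use complex_frame_positive[OF dim J frame] in simp)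
  also have "\<dots> = (\<Prod>i<n. cos (\<theta> i / 2))\<^sup>2"
    unfolding dim prod_lessThan_double by (simp add: prod.distrib power2_eq_square)
  finally show ?thesis .
qed

subsection \<open>The cut locus\<close>

text \<open>At corners and at the two ends \<open>vector_derivative\<close> need not be tangent to
  the manifold, so \<open>eta\<close> could be negative there. These finitely many points do not
  affect the integral. The bound makes the infimum in \<open>riem_dist\<close> one over a set
  bounded below.\<close>

lemma length_nonneg:
  assumes c: "c piecewise_C1_differentiable_on {0..1}" "\<forall>t\<in>{0..1}. c t \<in> complex_structures e"
    and int: "((\<lambda>t. sqrt (eta (vector_derivative c (at t)) (vector_derivative c (at t)))) has_integral l) {0..1}"
  shows "0 \<le> l"
proof -
  from c(1) obtain S where S: "finite S" "c C1_differentiable_on ({0..1} - S)"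
    by (auto simp: piecewise_C1_differentiable_on_def)
  let ?g = "\<lambda>t. sqrt (eta (vector_derivative c (at t)) (vector_derivative c (at t)))"
  have nonneg: "0 \<le> ?g t" if t: "t \<in> {0<..<1} - S" for t
  proof -
    from S(2) t have "(c has_vector_derivative vector_derivative c (at t)) (at t)"
      unfolding C1_differentiable_on_def
      by (metis C1_differentiable_on_eq Diff_iff S(2) atLeastAtMost_iff greaterThanLessThan_iff less_eq_real_def vector_derivative_works)
    then have "(c has_vector_derivative vector_derivative c (at t)) (at t within {0<..<1})"
      by (rule has_vector_derivative_at_within)
    moreover have "at t within {0<..<1} = at t" using t by (intro at_within_open) auto
    then have "at t within {0<..<1} \<noteq> bot" by simp
    ultimately have "vector_derivative c (at t) x \<bullet> y = - (x \<bullet> vector_derivative c (at t) y)" for x y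
      using complex_structures_velocity[of c _ t "{0<..<1}" e] t c(2) by auto
    note sk = this
    show ?thesis unfolding eta_skew[OF sk] by (simp add: sum_nonneg)
  qed
  have "((\<lambda>t. if t \<in> {0<..<1} - S then ?g t else 0) has_integral l) {0..1}"
    by (rule has_integral_spike_finite[of "insert 0 (insert 1 S)", OF _ _ int]) (use S(1) in auto)
  then show ?thesis by (rule has_integral_nonneg) (use nonneg in auto)
qed

lemma riem_dist_le:
  assumes "c piecewise_C1_differentiable_on {0..1}" "\<forall>t\<in>{0..1}. c t \<in> complex_structures e" "c 0 = J" "c 1 = K"
    "((\<lambda>t. sqrt (eta (vector_derivative c (at t)) (vector_derivative c (at t)))) has_integral l) {0..1}"
  shows "riem_dist e J K \<le> l"
  unfolding riem_dist_def
  by (rule cInf_lower) (use assms length_nonneg in \<open>auto intro!: bdd_belowI[of _ 0]\<close>)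

lemma riem_dist_self:
  assumes "J \<in> complex_structures e"
  shows "riem_dist e J J = 0"
proof (rule antisym)
  have len0: "((\<lambda>t::real. sqrt (eta (vector_derivative (\<lambda>t. J) (at t)) (vector_derivative (\<lambda>t. J) (at t)))) has_integral 0) {0..1}"
    by (simp add: eta_def trace_op_def)
  have C1: "(\<lambda>t. J) piecewise_C1_differentiable_on {0..1}"
    by (rule C1_differentiable_imp_piecewise) (simp add: C1_differentiable_on_def; metis has_vector_derivative_const continuous_on_const)
  show "riem_dist e J J \<le> 0"
    by (rule riem_dist_le[OF C1 _ refl refl len0]) (use assms in simp)
  show "0 \<le> riem_dist e J J"
    unfolding riem_dist_def
  proof (rule cInf_greatest)
    show "{l. \<exists>c. c piecewise_C1_differentiable_on {0..1} \<and>
     (\<forall>t\<in>{0..1}. c t \<in> complex_structures e) \<and> c 0 = J \<and> c 1 = J \<and>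
     ((\<lambda>t. sqrt (eta (vector_derivative c (at t)) (vector_derivative c (at t)))) has_integral l) {0..1}} \<noteq> {}"
      using C1 len0 assms by blast
  qed (auto intro: length_nonneg)
qed

lemma eta_scale: "eta (r *\<^sub>R X) (r *\<^sub>R X) = r\<^sup>2 * eta X X"
  by (simp add: eta_def trace_op_def blinfun.scaleR_left blinfun.scaleR_right sum_distrib_left power2_eq_square mult.assoc)

context skew_frame
begin

lemma eta_velocity:
  fixes J :: "'a \<Rightarrow>\<^sub>L 'a"
  assumes e: "orthonormal_frame e" and J: "J \<in> complex_structures e" and JB: "\<And>x. B (J x) = - J (B x)"
  shows "eta (B o\<^sub>L J) (B o\<^sub>L J) = (\<Sum>i<DIM('a). (\<theta> i)\<^sup>2) / 4"
proof -
  have "(B o\<^sub>L J) o\<^sub>L (B o\<^sub>L J) = B o\<^sub>L B"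
    by (rule blinfun_eqI) (simp add: JB complex_structureD(1)[OF J] blinfun.minus_right)
  then show ?thesis
    by (simp add: eta_def trace_frame[OF frame] eig orthonormal_frame_inner[OF frame] sum_negf)
qed

lemma rot_anticommute:
  fixes J :: "'a \<Rightarrow>\<^sub>L 'a"
  assumes JB: "\<And>x. B (J x) = - J (B x)"
  shows "B ((E t o\<^sub>L J) x) = - (E t o\<^sub>L J) (B x)"
  by (simp add: B_E_apply JB blinfun.minus_right)

lemma rot_curve_deriv:
  "((\<lambda>s. E (r * s) o\<^sub>L J) has_vector_derivative r *\<^sub>R (B o\<^sub>L (E (r * s) o\<^sub>L J))) (at s within S)" for J :: "'a \<Rightarrow>\<^sub>L 'a"
  using bounded_linear.has_vector_derivative[OF bounded_bilinear.bounded_linear_left[OF bounded_bilinear_blinfun_compose, of J] E_deriv_affine[of 0 r s S]]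
  by (simp add: blinfun_compose_assoc bounded_bilinear.scaleR_left[OF bounded_bilinear_blinfun_compose])

lemma riem_dist_rot:
  assumes e: "orthonormal_frame e" and J: "J \<in> complex_structures e" and JB: "\<And>x. B (J x) = - J (B x)"
  shows "riem_dist e J (E 1 o\<^sub>L J) \<le> sqrt ((\<Sum>i<DIM('a). (\<theta> i)\<^sup>2) / 4)"
proof (rule riem_dist_le)
  let ?c = "\<lambda>t. E t o\<^sub>L J"
  have cs: "?c t \<in> complex_structures e" for t by (rule rot_complex_structure[OF e J JB])
  have deriv: "(?c has_vector_derivative B o\<^sub>L ?c t) (at t)" for t
    using rot_curve_deriv[of 1 J t UNIV] by simp
  show "?c piecewise_C1_differentiable_on {0..1}"
  proof (rule C1_differentiable_imp_piecewise)
    have "continuous_on {0..1} (\<lambda>t. B o\<^sub>L ?c t)"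
      by (intro bounded_linear.continuous_on[OF bounded_bilinear.bounded_linear_right[OF bounded_bilinear_blinfun_compose]]
          continuous_on_vector_derivative[of _ _ "\<lambda>t. B o\<^sub>L ?c t"] has_vector_derivative_at_within[OF deriv])
    then show "?c C1_differentiable_on {0..1}"
      unfolding C1_differentiable_on_def by (intro exI[of _ "\<lambda>t. B o\<^sub>L ?c t"]) (simp add: deriv)
  qed
  show "((\<lambda>t. sqrt (eta (vector_derivative ?c (at t)) (vector_derivative ?c (at t)))) has_integral
      sqrt ((\<Sum>i<DIM('a). (\<theta> i)\<^sup>2) / 4)) {0..1}"
    unfolding vector_derivative_at[OF deriv] eta_velocity[OF e cs rot_anticommute[OF JB]]
    using has_integral_const_real[of _ 0 1] by simp
qed (use rot_complex_structure[OF e J JB] in \<open>auto simp: E_0 intro: blinfun_eqI\<close>)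

text \<open>\<open>B'\<close> is \<open>B\<close> followed by a scaling \<open>P\<close> of the
  eigenspaces of \<open>B\<^sup>2\<close>. Equal angles must be scaled equally, since only then does
  \<open>P\<close> commute with \<open>B\<close> and keep \<open>B'\<close> skew.\<close>

lemma rescale:
  fixes r :: "nat \<Rightarrow> real"
  assumes nonneg: "\<And>i. i < DIM('a) \<Longrightarrow> 0 \<le> \<theta> i"
    and r: "\<And>i j. i < DIM('a) \<Longrightarrow> j < DIM('a) \<Longrightarrow> \<theta> i = \<theta> j \<Longrightarrow> r i = r j"
  obtains B' :: "'a \<Rightarrow>\<^sub>L 'a" where "skew_frame f (\<lambda>i. r i * \<theta> i) B'" "\<And>i. i < DIM('a) \<Longrightarrow> B' (f i) = r i *\<^sub>R B (f i)"
proof -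
  define P where "P = (\<Sum>i<DIM('a). r i *\<^sub>R frame_proj (f i))"
  have Px: "P x = (\<Sum>i<DIM('a). (r i * (f i \<bullet> x)) *\<^sub>R f i)" for x
    by (simp add: P_def blinfun.sum_left blinfun.scaleR_left frame_proj_apply)
  have P_inner: "P x \<bullet> f k = r k * (x \<bullet> f k)" if "k < DIM('a)" for x k
    using that by (simp add: Px inner_sum_left orthonormal_frame_inner[OF frame] if_distrib cong: if_cong) (simp add: inner_commute)
  have frame_eq: "x = y" if "\<And>k. k < DIM('a) \<Longrightarrow> x \<bullet> f k = y \<bullet> f k" for x y
    using orthonormal_frame_expand[OF frame, of x] orthonormal_frame_expand[OF frame, of y] that
    by (metis (no_types, lifting) lessThan_iff sum.cong)
  have Pf: "P (f i) = r i *\<^sub>R f i" if "i < DIM('a)" for i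
    by (rule frame_eq) (simp add: P_inner orthonormal_frame_inner[OF frame] that)
  have P_sym: "P x \<bullet> y = x \<bullet> P y" for x y
    by (simp add: Px inner_sum_left inner_sum_right inner_commute mult_ac)
  have PBf: "P (B (f i)) = r i *\<^sub>R B (f i)" if i: "i < DIM('a)" for i
  proof (rule frame_eq)
    fix k assume k: "k < DIM('a)"
    \<comment> \<open>\<open>B (f i)\<close> is again an eigenvector of the symmetric operator
      \<open>B\<^sup>2\<close>, with the eigenvalue of \<open>f i\<close>, hence orthogonal to
      \<open>f k\<close> if the angles differ.\<close>
    have "r k = r i \<or> B (f i) \<bullet> f k = 0"
    proof (cases "\<theta> i = \<theta> k")
      case False
      have "B (B (B (f i))) \<bullet> f k = - (\<theta> i)\<^sup>2 * (B (f i) \<bullet> f k)"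
        using eig[OF i] by (simp add: blinfun.minus_right blinfun.scaleR_right)
      moreover have "B (B (B (f i))) \<bullet> f k = B (f i) \<bullet> B (B (f k))" by (simp only: skew[of "B (B (f i))"] skew[of "B (f i)"] minus_minus inner_minus_right)
      then have "B (B (B (f i))) \<bullet> f k = - (\<theta> k)\<^sup>2 * (B (f i) \<bullet> f k)" using eig[OF k] by simp
      ultimately have "(\<theta> i)\<^sup>2 * (B (f i) \<bullet> f k) = (\<theta> k)\<^sup>2 * (B (f i) \<bullet> f k)" by linarith
      moreover have "(\<theta> i)\<^sup>2 \<noteq> (\<theta> k)\<^sup>2" using False nonneg[OF i] nonneg[OF k] by simp
      ultimately show ?thesis by simp
    next
      case True
      then show ?thesis using r[OF k i] by simp
    qed
    then show "P (B (f i)) \<bullet> f k = (r i *\<^sub>R B (f i)) \<bullet> f k" by (auto simp: P_inner k)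
  qed
  have "P o\<^sub>L B = B o\<^sub>L P"
    by (rule blinfun_eq_frameI) (simp add: PBf Pf blinfun.scaleR_right)
  then have PB: "P (B x) = B (P x)" for x by (metis blinfun_apply_blinfun_compose)
  have "skew_frame f (\<lambda>i. r i * \<theta> i) (B o\<^sub>L P)"
  proof
    show "(B o\<^sub>L P) x \<bullet> y = - (x \<bullet> (B o\<^sub>L P) y)" for x y
      by (simp add: skew P_sym PB)
    show "(B o\<^sub>L P) ((B o\<^sub>L P) (f i)) = (- (r i * \<theta> i)\<^sup>2) *\<^sub>R f i" if "i < DIM('a)" for i
      using that by (simp add: Pf PB blinfun.scaleR_right eig power_mult_distrib power2_eq_square)
  qed (rule frame)
  then show thesis using that[of "B o\<^sub>L P"] by (simp add: Pf blinfun.scaleR_right)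
qed

end

text \<open>\<open>b i\<close> and \<open>J (b i)\<close> receive the same scaling factor, so
  scaling respects the complex structure.\<close>

lemma complex_frame_anticommute:
  fixes J B' :: "'a::euclidean_space \<Rightarrow>\<^sub>L 'a"
  assumes "skew_frame (complex_frame J b) \<theta> B" and dim: "DIM('a) = 2 * n" and JJ: "\<And>x. J (J x) = - x"
    and JB: "\<And>x. B (J x) = - J (B x)"
    and B': "\<And>i. i < DIM('a) \<Longrightarrow> B' (complex_frame J b i) = r (i div 2) *\<^sub>R B (complex_frame J b i)"
  shows "B' (J x) = - J (B' x)"
proof -
  interpret skew_frame "complex_frame J b" \<theta> B by fact
  have b: "B' (b i) = r i *\<^sub>R B (b i)" "B' (J (b i)) = - (r i *\<^sub>R J (B (b i)))" if "i < n" for i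
    using B'[of "2 * i"] B'[of "Suc (2 * i)"] that dim by (simp_all add: JB)
  have "B' o\<^sub>L J = - (J o\<^sub>L B')"
  proof (rule blinfun_eq_frameI)
    fix i assume "i < DIM('a)"
    then have "i div 2 < n" using dim by auto
    then show "(B' o\<^sub>L J) (complex_frame J b i) = (- (J o\<^sub>L B')) (complex_frame J b i)"
      using b[of "i div 2"]
      by (cases "even i") (simp_all add: complex_frame_def JJ blinfun.minus_left blinfun.minus_right blinfun.scaleR_right)
  qed
  then show ?thesis by (metis blinfun_apply_blinfun_compose blinfun.minus_left)
qed

text \<open>
  Beyond the time at which some rotation angle equals \<open>\<pi>\<close> the one-parameter group can be
  replaced by a shorter one, rotating by \<open>\<alpha> - 2 * \<pi>\<close> instead of \<open>\<alpha>\<close>.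
\<close>

lemma riem_dist_beyond_pi:
  fixes J :: "'a::euclidean_space \<Rightarrow>\<^sub>L 'a"
  assumes e: "orthonormal_frame e" and dim: "DIM('a) = 2 * n" and J: "J \<in> complex_structures e"
    and sf: "skew_frame (complex_frame J b) (\<lambda>j. \<theta> (j div 2)) B" and JB: "\<And>x. B (J x) = - J (B x)"
    and nonneg: "\<And>i. i < n \<Longrightarrow> 0 \<le> \<theta> i" and k: "k < n" "pi < u * \<theta> k" and u: "0 < u"
  shows "riem_dist e J (rot (complex_frame J b) (\<lambda>j. \<theta> (j div 2)) B u o\<^sub>L J)
    < u * sqrt ((\<Sum>j<DIM('a). (\<theta> (j div 2))\<^sup>2) / 4)"
proof -
  interpret skew_frame "complex_frame J b" "\<lambda>j. \<theta> (j div 2)" B by fact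
  define \<Theta> where "\<Theta> = \<theta> k"
  have \<Theta>: "pi < u * \<Theta>" "\<Theta> \<noteq> 0" using k u by (auto simp: \<Theta>_def)
  \<comment> \<open>All angles equal to \<open>\<Theta>\<close> are changed together, as
    \<open>rescale\<close> demands; all other ones are just multiplied by \<open>u\<close>.\<close>
  define r where "r = (\<lambda>i. if \<theta> i = \<Theta> then (u * \<Theta> - 2 * pi) / \<Theta> else u)"
  obtain B' where sf': "skew_frame (complex_frame J b) (\<lambda>j. r (j div 2) * \<theta> (j div 2)) B'"
    and B': "\<And>j. j < DIM('a) \<Longrightarrow> B' (complex_frame J b j) = r (j div 2) *\<^sub>R B (complex_frame J b j)"
    using rescale[of "\<lambda>j. r (j div 2)"] nonneg dim by (auto simp: r_def)
  interpret S': skew_frame "complex_frame J b" "\<lambda>j. r (j div 2) * \<theta> (j div 2)" B' by fact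
  have JB': "B' (J x) = - J (B' x)" for x
    by (rule complex_frame_anticommute[OF sf dim complex_structureD(1)[OF J] JB B'])
  have "S'.E 1 = E u"
  proof (rule blinfun_eq_frameI)
    fix j assume j: "j < DIM('a)"
    let ?i = "j div 2"
    have "cos (r ?i * \<theta> ?i) = cos (u * \<theta> ?i) \<and> sin (r ?i * \<theta> ?i) / (r ?i * \<theta> ?i) * r ?i = sin (u * \<theta> ?i) / \<theta> ?i"
    proof (cases "\<theta> ?i = \<Theta>")
      case True
      then have "r ?i * \<theta> ?i = u * \<theta> ?i - 2 * pi" using \<Theta> by (simp add: r_def)
      moreover have "sin (u * \<theta> ?i - 2 * pi) = sin (u * \<theta> ?i)" "cos (u * \<theta> ?i - 2 * pi) = cos (u * \<theta> ?i)"
        by (simp_all add: sin_diff cos_diff)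
      ultimately have sc: "sin (r ?i * \<theta> ?i) = sin (u * \<theta> ?i)" "cos (r ?i * \<theta> ?i) = cos (u * \<theta> ?i)" by simp_all
      show ?thesis
      \<comment> \<open>If \<open>u * \<Theta> = 2 * pi\<close> the new angle is 0. The quotient
        then takes its default value 0, which is right because \<open>sin (u * \<Theta>) = 0\<close>
        as well.\<close>
      proof (cases "r ?i = 0")
        case True
        then show ?thesis using sc by simp
      next
        case False
        then show ?thesis unfolding sc by simp
      qed
    next
      case False
      then show ?thesis using u by (simp add: r_def)
    qed
    then show "S'.E 1 (complex_frame J b j) = E u (complex_frame J b j)"
      unfolding S'.E_frame[OF j] E_frame[OF j] B'[OF j] by (simp add: mult.commute)
  qed
  then have "riem_dist e J (E u o\<^sub>L J) \<le> sqrt ((\<Sum>j<DIM('a). (r (j div 2) * \<theta> (j div 2))\<^sup>2) / 4)"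
    using S'.riem_dist_rot[OF e J JB'] by simp
  also have "\<dots> < sqrt ((\<Sum>j<DIM('a). (u * \<theta> (j div 2))\<^sup>2) / 4)"
  proof -
    have lt: "(u * \<Theta> - 2 * pi)\<^sup>2 < (u * \<Theta>)\<^sup>2"
    proof -
      have "(u * \<Theta>)\<^sup>2 - (u * \<Theta> - 2 * pi)\<^sup>2 = 4 * pi * (u * \<Theta> - pi)"
        by (simp add: power2_eq_square algebra_simps)
      also have "\<dots> > 0" using \<Theta> by simp
      finally show ?thesis by simp
    qed
    have "(r i * \<theta> i)\<^sup>2 \<le> (u * \<theta> i)\<^sup>2" for i
      using lt \<Theta> by (auto simp: r_def)
    moreover have "(r ((2 * k) div 2) * \<theta> ((2 * k) div 2))\<^sup>2 < (u * \<theta> ((2 * k) div 2))\<^sup>2"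
      using lt \<Theta> by (simp add: r_def flip: \<Theta>_def)
    ultimately have "(\<Sum>j<DIM('a). (r (j div 2) * \<theta> (j div 2))\<^sup>2) < (\<Sum>j<DIM('a). (u * \<theta> (j div 2))\<^sup>2)"
      using k(1) dim by (intro sum_strict_mono_ex1 bexI[of _ "2 * k"]) auto
    then show ?thesis by simp
  qed
  also have "\<dots> = u * sqrt ((\<Sum>j<DIM('a). (\<theta> (j div 2))\<^sup>2) / 4)"
    using u by (simp add: power_mult_distrib real_sqrt_mult real_sqrt_divide flip: sum_distrib_left)
  finally show ?thesis .
qed

text \<open>Let \<open>l\<close> be the length of the curve. If some angle were at least pi, the
  unit-speed ray along the curve would not minimise beyond arc length \<open>l\<close>, so its cut
  point would lie on the curve itself.\<close>

lemma angles_less_pi: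
  fixes J :: "'a::euclidean_space \<Rightarrow>\<^sub>L 'a"
  assumes e: "orthonormal_frame e" and dim: "DIM('a) = 2 * n" and J: "J \<in> complex_structures e"
    and sf: "skew_frame (complex_frame J b) (\<lambda>j. \<theta> (j div 2)) B" and JB: "\<And>x. B (J x) = - J (B x)"
    and nonneg: "\<And>i. i < n \<Longrightarrow> 0 \<le> \<theta> i"
    and cut: "\<forall>t\<in>{0..1}. rot (complex_frame J b) (\<lambda>j. \<theta> (j div 2)) B t o\<^sub>L J \<notin> cut_locus e J"
    and "k < n"
  shows "\<theta> k < pi"
proof (rule ccontr)
  interpret skew_frame "complex_frame J b" "\<lambda>j. \<theta> (j div 2)" B by fact
  assume "\<not> \<theta> k < pi"
  then have k: "pi \<le> \<theta> k" by simp
  define l where "l = sqrt ((\<Sum>j<DIM('a). (\<theta> (j div 2))\<^sup>2) / 4)"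
  have "0 < (\<theta> ((2 * k) div 2))\<^sup>2" using k pi_gt_zero by (simp del: pi_gt_zero)
  also have "\<dots> \<le> (\<Sum>j<DIM('a). (\<theta> (j div 2))\<^sup>2)"
    using \<open>k < n\<close> dim by (intro member_le_sum) auto
  finally have l: "0 < l" by (simp add: l_def)
  have ll: "(\<Sum>j<DIM('a). (\<theta> (j div 2))\<^sup>2) / 4 = l\<^sup>2" by (simp add: l_def sum_nonneg)
  define c where "c = (\<lambda>s. E (inverse l * s) o\<^sub>L J)"
  have cs: "c s \<in> complex_structures e" for s unfolding c_def by (rule rot_complex_structure[OF e J JB])
  have c_anti: "B (c s x) = - c s (B x)" for s x unfolding c_def by (rule rot_anticommute[OF JB])
  have d1: "(c has_vector_derivative inverse l *\<^sub>R (B o\<^sub>L c s)) (at s within S)" for s S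
    unfolding c_def by (rule rot_curve_deriv)
  have d2: "((\<lambda>s. inverse l *\<^sub>R (B o\<^sub>L c s)) has_vector_derivative inverse l *\<^sub>R (B o\<^sub>L (inverse l *\<^sub>R (B o\<^sub>L c s)))) (at s within S)" for s S
    by (rule bounded_linear.has_vector_derivative[OF bounded_linear_compose[OF bounded_linear_scaleR_right bounded_bilinear.bounded_linear_right[OF bounded_bilinear_blinfun_compose]] d1])
  have geo: "geodesic_on e {0..} c"
  proof -
    have "eta (inverse l *\<^sub>R (B o\<^sub>L (inverse l *\<^sub>R (B o\<^sub>L c s)))) X = 0" if "X \<in> tangent_space e (c s)" for s X
      by (rule eta_commuting_anticommuting[OF complex_structureD(1)[OF cs[of s]] tangent_spaceD(2)[OF that]])
         (simp add: blinfun.scaleR_left blinfun.scaleR_right blinfun.minus_right c_anti)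
    with d1 d2 have body: "\<forall>s\<in>{0..}. (c has_vector_derivative inverse l *\<^sub>R (B o\<^sub>L c s)) (at s within {0..}) \<and>
        ((\<lambda>s. inverse l *\<^sub>R (B o\<^sub>L c s)) has_vector_derivative inverse l *\<^sub>R (B o\<^sub>L (inverse l *\<^sub>R (B o\<^sub>L c s)))) (at s within {0..}) \<and>
        (\<forall>X\<in>tangent_space e (c s). eta (inverse l *\<^sub>R (B o\<^sub>L (inverse l *\<^sub>R (B o\<^sub>L c s)))) X = 0)"
      by blast
    show ?thesis unfolding geodesic_on_def
    proof
      show "\<forall>t\<in>{0..}. c t \<in> complex_structures e" using cs by blast
    qed (rule exI, rule exI, rule body)
  qed
  have unit: "eta (vector_derivative c (at t within {0..})) (vector_derivative c (at t within {0..})) = 1" if "t \<ge> 0" for t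
  proof -
    have "at t within {0..} \<noteq> bot"
    proof -
      have "at t within {t..t + 1} \<noteq> bot" by (simp add: trivial_limit_within islimpt_Icc)
      moreover have "at t within {t..t + 1} \<le> at t within {0..}" using that by (intro at_le) auto
      ultimately show ?thesis by (metis bot.extremum_uniqueI)
    qed
    then have "vector_derivative c (at t within {0..}) = inverse l *\<^sub>R (B o\<^sub>L c t)"
      by (rule vector_derivative_within[OF _ d1])
    then show ?thesis
      using l by (simp add: eta_scale eta_velocity[OF e cs c_anti] ll power_inverse)
  qed
  let ?A = "{t. 0 \<le> t \<and> riem_dist e J (c t) = t}"
  have "t \<le> l" if t: "t \<in> ?A" for t
  proof (rule ccontr)
    assume "\<not> t \<le> l"
    \<comment> \<open>Arc length beyond \<open>l\<close> means parameter beyond 1, which makes the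
      angle exceed pi strictly even when \<open>\<theta> k\<close> equals pi.\<close>
    then have "1 < inverse l * t" using l by (simp add: field_simps)
    moreover have "0 < \<theta> k" using k pi_gt_zero by linarith
    ultimately have "pi < (inverse l * t) * \<theta> k" using k by (smt (verit) mult_less_cancel_right1 mult_less_cancel_right2)
    from riem_dist_beyond_pi[OF e dim J sf JB nonneg \<open>k < n\<close> this]
    have "riem_dist e J (c t) < (inverse l * t) * l" using \<open>1 < inverse l * t\<close> by (simp add: c_def l_def)
    also have "\<dots> = t" using l by simp
    finally show False using t by simp
  qed
  note le = this
  have bdd: "bdd_above ?A" using le by (intro bdd_aboveI[of _ l]) auto
  have c0: "c 0 = J" by (auto simp: c_def E_0 intro: blinfun_eqI)
  then have "0 \<in> ?A" using riem_dist_self[OF J] by simp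
  then have "0 \<le> Sup ?A" "Sup ?A \<le> l" using bdd le by (auto intro: cSup_upper cSup_least)
  then have "inverse l * Sup ?A \<in> {0..1}" using l by (simp add: field_simps)
  then have "c (Sup ?A) \<notin> cut_locus e J" using cut by (simp add: c_def)
  moreover have "c (Sup ?A) \<in> cut_locus e J"
    unfolding cut_locus_def using geo c0 unit bdd by blast
  ultimately show False by simp
qed

subsection \<open>Clifford multiplication\<close>

text \<open>This is \<open>nabla\<close> at a real vector. It is a Clifford multiplication,
  normalised such that \<open>cl v\<close> has square \<open>- (v \<bullet> v) / 2\<close>.\<close>

definition cl :: "'a::euclidean_space \<Rightarrow> ('a list \<Rightarrow> complex) \<Rightarrow> 'a list \<Rightarrow> complex" where
  "cl v \<psi> vs = \<psi> (v # vs) - wedge (one_form (\<lambda>w. of_real (v \<bullet> w))) \<psi> vs / 2"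

lemma nabla_eq: "nabla x \<psi> vs = cl (fst x) \<psi> vs + \<i> * cl (snd x) \<psi> vs"
proof -
  have "nu x = one_form (\<lambda>v. of_real (fst x \<bullet> v) + \<i> * of_real (snd x \<bullet> v))"
    by (simp add: nu_def complex_eq_iff one_form_def fun_eq_iff)
  then show ?thesis
    by (simp add: nabla_def contract_def cl_def wedge_one_form_add wedge_one_form_scale field_simps)
qed

lemma alternating_Cons: "alternating sc h F \<Longrightarrow> alternating sc h (\<lambda>us. F (v # us))"
  unfolding alternating_def by (metis append_Cons)

text \<open>Only the shuffles that feed \<open>x\<close> to the one-form survive; in all others
  \<open>x\<close> is an argument of \<open>\<phi>\<close>.\<close>

lemma wedge_one_form_skip:
  assumes "\<And>us. x \<in> set us \<Longrightarrow> \<phi> us = 0"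
  shows "wedge (one_form \<alpha>) \<phi> (vs @ x # ws) = (-1) ^ length vs * \<alpha> x * \<phi> (vs @ ws)"
  using assms
proof (induction vs arbitrary: \<phi>)
  case Nil
  then have "(\<lambda>us. \<phi> (x # us)) = (\<lambda>us. 0)" by (intro ext) simp
  then show ?case by (simp add: wedge_one_form_Cons wedge_zero_right)
next
  case (Cons v vs)
  then show ?case using Cons.IH[of "\<lambda>us. \<phi> (v # us)"] by (simp add: wedge_one_form_Cons)
qed

lemma alternating_vanish_repeat:
  assumes "alternating sc h F" "x \<in> set us"
  shows "F (vs @ x # us) = 0"
  using split_list[OF assms(2)] alternating_repeat[OF assms(1)] by auto

lemma alternating_wedge_one_form:
  assumes \<phi>: "alternating sc h \<phi>" and add: "\<And>x y. \<alpha> (x + y) = \<alpha> x + \<alpha> y" and scale: "\<And>r x. \<alpha> (sc r x) = h r * \<alpha> x"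
  shows "alternating sc h (wedge (one_form \<alpha>) \<phi>)"
  unfolding alternating_def
proof (intro conjI allI)
  fix us vs x y
  show "wedge (one_form \<alpha>) \<phi> (us @ (x + y) # vs) = wedge (one_form \<alpha>) \<phi> (us @ x # vs) + wedge (one_form \<alpha>) \<phi> (us @ y # vs)"
    using \<phi>
  proof (induction us arbitrary: \<phi>)
    case Nil
    show ?case using alternating_add[OF Nil, of "[]"]
      by (simp add: wedge_one_form_Cons add wedge_add_right algebra_simps)
  next
    case (Cons u us)
    show ?case using Cons.IH[OF alternating_Cons[OF Cons.prems, of u]]
      by (simp add: wedge_one_form_Cons alternating_add[OF Cons.prems] algebra_simps)
  qed
next
  fix us vs r x
  show "wedge (one_form \<alpha>) \<phi> (us @ sc r x # vs) = h r * wedge (one_form \<alpha>) \<phi> (us @ x # vs)"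
    using \<phi>
  proof (induction us arbitrary: \<phi>)
    case Nil
    show ?case using alternating_scale[OF Nil, of "[]"]
      by (simp add: wedge_one_form_Cons scale wedge_scale_right algebra_simps)
  next
    case (Cons u us)
    show ?case using Cons.IH[OF alternating_Cons[OF Cons.prems, of u]]
      by (simp add: wedge_one_form_Cons alternating_scale[OF Cons.prems] algebra_simps)
  qed
next
  fix us vs ws x
  show "wedge (one_form \<alpha>) \<phi> (us @ x # vs @ x # ws) = 0"
    using \<phi>
  proof (induction us arbitrary: \<phi>)
    case Nil
    have "wedge (one_form \<alpha>) (\<lambda>us. \<phi> (x # us)) (vs @ x # ws) = (-1) ^ length vs * \<alpha> x * \<phi> (x # vs @ ws)"
      by (rule wedge_one_form_skip) (use alternating_vanish_repeat[OF Nil, of x _ "[]"] in simp)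
    moreover have "\<phi> (vs @ x # ws) = (-1) ^ length vs * \<phi> (x # vs @ ws)"
      using alternating_move[OF Nil, of "[]"] by simp
    ultimately show ?case by (simp add: wedge_one_form_Cons)
  next
    case (Cons u us)
    show ?case using Cons.IH[OF alternating_Cons[OF Cons.prems, of u]] alternating_repeat[OF Cons.prems, of us x vs ws]
      by (simp add: wedge_one_form_Cons)
  qed
qed

lemma alternating_lincomb:
  assumes F: "alternating sc h F" and G: "alternating sc h G"
  shows "alternating sc h (\<lambda>vs. c * F vs + d * G vs)"
  unfolding alternating_def
proof (intro conjI allI)
  show "c * F (us @ (x + y) # vs) + d * G (us @ (x + y) # vs)
    = c * F (us @ x # vs) + d * G (us @ x # vs) + (c * F (us @ y # vs) + d * G (us @ y # vs))" for us vs x y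
    by (simp add: alternating_add[OF F] alternating_add[OF G] algebra_simps)
  show "c * F (us @ sc r x # vs) + d * G (us @ sc r x # vs) = h r * (c * F (us @ x # vs) + d * G (us @ x # vs))" for us vs r x
    by (simp add: alternating_scale[OF F] alternating_scale[OF G] algebra_simps)
  show "c * F (us @ x # vs @ x # ws) + d * G (us @ x # vs @ x # ws) = 0" for us vs ws x
    unfolding alternating_repeat[OF F] alternating_repeat[OF G] by simp
qed

lemma alternating_forms_add [intro, simp]: "\<psi> \<in> alternating_forms \<Longrightarrow> \<phi> \<in> alternating_forms \<Longrightarrow> (\<lambda>vs. \<psi> vs + \<phi> vs) \<in> alternating_forms"
  using alternating_lincomb[of scaleR of_real \<psi> \<phi> 1 1] by (simp add: alternating_forms_iff)

lemma alternating_forms_diff [intro, simp]: "\<psi> \<in> alternating_forms \<Longrightarrow> \<phi> \<in> alternating_forms \<Longrightarrow> (\<lambda>vs. \<psi> vs - \<phi> vs) \<in> alternating_forms"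
  using alternating_lincomb[of scaleR of_real \<psi> \<phi> 1 "-1"] by (simp add: alternating_forms_iff)

lemma alternating_forms_scale [intro, simp]: "\<psi> \<in> alternating_forms \<Longrightarrow> (\<lambda>vs. c * \<psi> vs) \<in> alternating_forms"
  using alternating_lincomb[of scaleR of_real \<psi> \<psi> c 0] by (simp add: alternating_forms_iff)

lemma alternating_forms_zero [intro, simp]: "(\<lambda>vs. 0) \<in> alternating_forms"
  by (simp add: alternating_forms_def)

lemma alternating_forms_sum [intro, simp]:
  "(\<And>i. i \<in> A \<Longrightarrow> \<psi> i \<in> alternating_forms) \<Longrightarrow> (\<lambda>vs. \<Sum>i\<in>A. \<psi> i vs) \<in> alternating_forms"
  by (induction A rule: infinite_finite_induct) auto

lemma cl_alternating [intro, simp]: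
  assumes "\<psi> \<in> alternating_forms"
  shows "cl v \<psi> \<in> alternating_forms"
proof -
  have \<psi>: "alternating scaleR of_real \<psi>" using assms by (simp add: alternating_forms_iff)
  have "alternating scaleR of_real (\<lambda>vs. 1 * \<psi> (v # vs) + (- 1/2) * wedge (one_form (\<lambda>w. of_real (v \<bullet> w))) \<psi> vs)"
    by (intro alternating_lincomb alternating_Cons[OF \<psi>] alternating_wedge_one_form[OF \<psi>])
       (simp_all add: inner_add_right)
  moreover have "cl v \<psi> = (\<lambda>vs. 1 * \<psi> (v # vs) + (- 1/2) * wedge (one_form (\<lambda>w. of_real (v \<bullet> w))) \<psi> vs)"
    by (rule ext) (simp add: cl_def)
  ultimately show ?thesis by (simp add: alternating_forms_iff)
qed

lemma cl_add: "cl v (\<lambda>us. \<psi> us + \<phi> us) vs = cl v \<psi> vs + cl v \<phi> vs"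
  by (simp add: cl_def wedge_add_right field_simps)

lemma cl_diff: "cl v (\<lambda>us. \<psi> us - \<phi> us) vs = cl v \<psi> vs - cl v \<phi> vs"
  by (simp add: cl_def wedge_diff_right field_simps)

lemma cl_scale: "cl v (\<lambda>us. c * \<psi> us) vs = c * cl v \<psi> vs"
  by (simp add: cl_def wedge_scale_right field_simps)

lemma cl_sum: "cl v (\<lambda>us. \<Sum>i\<in>A. \<psi> i us) vs = (\<Sum>i\<in>A. cl v (\<psi> i) vs)"
  by (simp add: cl_def wedge_sum_right sum_subtractf sum_divide_distrib)

lemma cl_add_vec: "\<psi> \<in> alternating_forms \<Longrightarrow> cl (x + y) \<psi> vs = cl x \<psi> vs + cl y \<psi> vs"
  using alternating_add[of scaleR of_real \<psi> "[]" x y vs]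
  by (simp add: alternating_forms_iff cl_def inner_add_left wedge_one_form_add field_simps)

lemma cl_scale_vec: "\<psi> \<in> alternating_forms \<Longrightarrow> cl (r *\<^sub>R x) \<psi> vs = of_real r * cl x \<psi> vs"
  using alternating_scale[of scaleR of_real \<psi> "[]" r x vs]
  by (simp add: alternating_forms_iff cl_def wedge_one_form_scale field_simps)

lemma cl_minus_vec: "\<psi> \<in> alternating_forms \<Longrightarrow> cl (- x) \<psi> vs = - cl x \<psi> vs"
  using cl_scale_vec[of \<psi> "-1" x vs] by simp

lemma cl_zero_vec: "\<psi> \<in> alternating_forms \<Longrightarrow> cl 0 \<psi> vs = 0"
  using cl_scale_vec[of \<psi> 0 0 vs] by simp

lemma cl_sum_vec: "\<psi> \<in> alternating_forms \<Longrightarrow> cl (\<Sum>i\<in>A. r i *\<^sub>R x i) \<psi> vs = (\<Sum>i\<in>A. of_real (r i) * cl (x i) \<psi> vs)"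
  by (induction A rule: infinite_finite_induct) (simp_all add: cl_zero_vec cl_add_vec cl_scale_vec)

text \<open>In the anticommutator the double contractions and the double wedge products cancel, and
  each of the two orders contributes half of \<open>v \<bullet> w\<close>.\<close>

lemma cl_anticommute:
  assumes "\<psi> \<in> alternating_forms"
  shows "cl v (cl w \<psi>) vs = - of_real (v \<bullet> w) * \<psi> vs - cl w (cl v \<psi>) vs"
proof -
  let ?W = "\<lambda>v. wedge (one_form (\<lambda>u. complex_of_real (v \<bullet> u)))"
  have cl: "cl v \<phi> = (\<lambda>us. \<phi> (v # us) - 1/2 * ?W v \<phi> us)" for v :: 'a and \<phi>
    by (rule ext) (simp add: cl_def)
  have eq: "cl v (cl w \<psi>) vs = \<psi> (w # v # vs) - 1/2 * (of_real (w \<bullet> v) * \<psi> vs - ?W w (\<lambda>us. \<psi> (v # us)) vs)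
      - 1/2 * (?W v (\<lambda>us. \<psi> (w # us)) vs - 1/2 * ?W v (?W w \<psi>) vs)" for v w
    by (subst (1 2) cl) (simp only: wedge_diff_right wedge_scale_right wedge_one_form_Cons)
  have swap: "\<psi> (v # w # vs) = - \<psi> (w # v # vs)"
    using alternating_swap[of scaleR of_real \<psi> "[]" v w vs] assms by (simp add: alternating_forms_iff)
  have anti: "?W v (?W w \<psi>) vs = - ?W w (?W v \<psi>) vs" by (rule wedge_one_form_anticommute)
  have "cl v (cl w \<psi>) vs + cl w (cl v \<psi>) vs = - of_real (v \<bullet> w) * \<psi> vs"
    unfolding eq[of v w] eq[of w v] swap anti by (simp add: inner_commute[of w v] algebra_simps)
  then show ?thesis by (simp add: algebra_simps)
qed

lemma cl_square: "\<psi> \<in> alternating_forms \<Longrightarrow> cl v (cl v \<psi>) vs = - of_real (v \<bullet> v) / 2 * \<psi> vs"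
  using cl_anticommute[of \<psi> v v vs] by (simp add: field_simps)

text \<open>\<open>V01 J\<close> is parametrised by the vectors \<open>v + \<i> J v\<close> with
  real \<open>v\<close>, which turns the defining equations into a condition on \<open>cl\<close>
  alone.\<close>

lemma fibre_H_iff:
  fixes J :: "'a::euclidean_space \<Rightarrow>\<^sub>L 'a"
  assumes JJ: "\<And>x. J (J x) = - x"
  shows "\<psi> \<in> fibre_H J \<longleftrightarrow> \<psi> \<in> alternating_forms \<and> (\<forall>v. cl (J v) \<psi> = (\<lambda>vs. \<i> * cl v \<psi> vs))"
proof -
  have "V01 J = (\<lambda>v. (v, J v)) ` UNIV"
    by (auto simp: V01_def cvec_map_def cvec_scale_def image_iff JJ)
  then have "(\<forall>x\<in>V01 J. \<forall>vs. nabla x \<psi> vs = 0) \<longleftrightarrow> (\<forall>v vs. cl v \<psi> vs + \<i> * cl (J v) \<psi> vs = 0)"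
    by (auto simp: nabla_eq)
  also have "\<dots> \<longleftrightarrow> (\<forall>v. cl (J v) \<psi> = (\<lambda>vs. \<i> * cl v \<psi> vs))"
  proof -
    have "a + \<i> * b = 0 \<longleftrightarrow> b = \<i> * a" for a b :: complex
      by (auto simp: complex_eq_iff)
    then show ?thesis by (simp add: fun_eq_iff)
  qed
  finally show ?thesis by (simp add: fibre_H_def)
qed

subsection \<open>The inner product of forms\<close>

definition frame_list :: "(nat \<Rightarrow> 'a) \<Rightarrow> nat set \<Rightarrow> 'a list" where
  "frame_list e I = map e (sorted_list_of_set I)"

lemma nths_upt: "I \<subseteq> {..<N} \<Longrightarrow> nths [0..<N] I = sorted_list_of_set I"
proof -
  assume I: "I \<subseteq> {..<N}"
  have "x \<in> set (nths [0..<N] I)" if "x \<in> I" for x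
    using I that by (auto simp: set_nths intro!: exI[of _ x])
  then have "set (nths [0..<N] I) = I" by (auto simp: set_nths)
  moreover have "sorted (nths [0..<N] I)" by (rule sorted_nths) simp
  moreover have "distinct (nths [0..<N] I)" by (simp add: distinct_nthsI)
  ultimately show ?thesis using sorted_list_of_set.idem_if_sorted_distinct[of "nths [0..<N] I"] by simp
qed

lemma alternating_scale_list:
  assumes "alternating scaleR of_real F"
  shows "F (us @ map (\<lambda>i. c *\<^sub>R e i) ks @ vs) = of_real c ^ length ks * F (us @ map e ks @ vs)"
proof (induction ks arbitrary: us)
  case (Cons k ks)
  then show ?case using Cons[of "us @ [c *\<^sub>R e k]"] by (simp add: alternating_scale[OF assms])
qed simp

lemma sqrt2_power_double: "complex_of_real (sqrt 2) ^ m * complex_of_real (sqrt 2) ^ m = 2 ^ m"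
  by (simp flip: power_mult_distrib of_real_mult)

text \<open>Of all index sets only \<open>I\<close> completes the complement to a list without
  repetition. The \<open>card I\<close> frame vectors, scaled by \<open>sqrt 2\<close>, enter both
  \<open>\<psi>\<close> and the volume form, hence \<open>2 ^ card I\<close>; the volume form of
  \<open>g / 2\<close> is that of \<open>g\<close> divided by \<open>2 ^ n\<close>.\<close>

lemma hodge_star_frame_list:
  fixes e :: "nat \<Rightarrow> 'a::euclidean_space"
  assumes e: "orthonormal_frame e" and dim: "DIM('a) = 2 * n" and \<psi>: "\<psi> \<in> alternating_forms" and I: "I \<subseteq> {..<DIM('a)}"
  shows "hodge_star (\<lambda>x y. inner x y / 2) (\<lambda>i. sqrt 2 *\<^sub>R e i) \<psi> (frame_list e ({..<DIM('a)} - I))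
    = (-1) ^ card {(i, j). i \<in> I \<and> j \<in> {..<DIM('a)} - I \<and> j < i} * (2 ^ card I / 2 ^ n) * \<psi> (frame_list e I)"
proof -
  let ?N = "DIM('a)"
  let ?f = "\<lambda>i. sqrt 2 *\<^sub>R e i" and ?h = "\<lambda>x y :: 'a. inner x y / 2" and ?C = "frame_list e ({..<?N} - I)"
  note alt\<psi> = \<psi>[unfolded alternating_forms_iff]
  have finI: "finite I" using I finite_subset by blast
  have vol: "complex_of_real (vol_form ?h ?f vs) = of_real (vol_form inner e vs) / 2 ^ n" for vs
  proof -
    have "(\<Prod>i<?N. ?h (vs ! i) (?f (p i))) = (\<Prod>i<?N. (vs ! i) \<bullet> e (p i)) / 2 ^ n" for p
    proof -
      have h: "?h x (?f k) = inverse (sqrt 2) * (x \<bullet> e k)" for x k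
        by (simp add: field_simps flip: real_sqrt_mult)
      then have "(\<Prod>i<?N. ?h (vs ! i) (?f (p i))) = inverse (sqrt 2) ^ ?N * (\<Prod>i<?N. (vs ! i) \<bullet> e (p i))"
        by (simp only: h prod.distrib prod_constant card_lessThan)
      moreover have "inverse (sqrt 2) ^ ?N = 1 / 2 ^ n"
        by (simp add: dim power_mult power_inverse inverse_eq_divide power_divide)
      ultimately show ?thesis by simp
    qed
    then have "vol_form ?h ?f vs = vol_form inner e vs / 2 ^ n"
      by (simp add: vol_form_def sum_divide_distrib)
    then show ?thesis by simp
  qed
  have cardC: "card I + length ?C = ?N"
    using I finI by (simp add: frame_list_def card_Diff_subset) (metis card_lessThan card_mono finite_lessThan le_add_diff_inverse)
  let ?t = "\<lambda>I'. \<psi> (map ?f (sorted_list_of_set I')) * of_real (vol_form ?h ?f (map ?f (sorted_list_of_set I') @ ?C))"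
  have zero: "?t I' = 0" if I': "I' \<subseteq> {..<?N}" "card I' + length ?C = ?N" "I' \<noteq> I" for I'
  proof -
    have fin': "finite I'" using I' finite_subset by blast
    have "card I' = card I" using I'(2) cardC by simp
    then have "\<not> I' \<subseteq> I" using I'(3) finI card_subset_eq by blast
    then obtain k where k: "k \<in> I'" "k \<notin> I" by blast
    then have "e k \<in> set (map e (sorted_list_of_set I'))" "e k \<in> set ?C"
      using I' fin' by (auto simp: frame_list_def)
    then have "\<not> distinct (map e (sorted_list_of_set I') @ ?C)" by auto
    then have "complex_of_real (vol_form inner e (map e (sorted_list_of_set I') @ ?C)) = 0"
      by (rule alternating_not_distinct[OF alternating_vol_form])
    then show ?thesis
      using alternating_scale_list[OF alternating_vol_form[of e], of "[]" "sqrt 2" e "sorted_list_of_set I'" ?C]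
      by (simp add: vol)
  qed
  have "hodge_star ?h ?f \<psi> ?C = (\<Sum>I' | I' \<subseteq> {..<?N} \<and> card I' + length ?C = ?N. if I' = I then ?t I else 0)"
    unfolding hodge_star_def by (intro sum.cong refl) (use zero in auto)
  also have "\<dots> = ?t I" using I cardC by simp
  also have "\<dots> = 2 ^ card I / 2 ^ n * \<psi> (frame_list e I) * of_real (vol_form inner e (frame_list e I @ ?C))"
    using alternating_scale_list[OF alt\<psi>, of "[]" "sqrt 2" e "sorted_list_of_set I" "[]"]
      alternating_scale_list[OF alternating_vol_form[of e], of "[]" "sqrt 2" e "sorted_list_of_set I" ?C]
      sqrt2_power_double[of "card I"]
    by (simp add: vol frame_list_def)
  also have "complex_of_real (vol_form inner e (frame_list e I @ ?C)) = (-1) ^ card {(i, j). i \<in> I \<and> j \<in> {..<?N} - I \<and> j < i}"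
  proof -
    have "nths [0..<?N] (- I) = nths [0..<?N] ({..<?N} - I)"
      by (simp add: nths_def) (rule arg_cong[of _ _ "map fst"], rule filter_cong, auto simp: in_set_zip)
    then have "nths (map e [0..<?N]) I = frame_list e I" "nths (map e [0..<?N]) (- I) = ?C"
      using I by (simp_all add: nths_map nths_upt frame_list_def)
    moreover have "I \<inter> {..<?N} = I" using I by blast
    ultimately show ?thesis
      using alternating_nths[OF alternating_vol_form[of e], of "[]" "map e [0..<?N]" I]
      by (simp add: vol_form_frame[OF e])
  qed
  finally show ?thesis by (simp add: mult_ac)
qed

text \<open>The sign of each shuffle in \<open>wedge\<close> cancels the sign from the Hodge star.
  What remains is a weighted sum over basis lists, manifestly Hermitian and positive, and it is used
  instead of the star from here on.\<close>

lemma inner_H_eq: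
  fixes e :: "nat \<Rightarrow> 'a::euclidean_space"
  assumes e: "orthonormal_frame e" and dim: "DIM('a) = 2 * n" and \<psi>': "\<psi>' \<in> alternating_forms"
  shows "inner_H e \<psi> \<psi>' = (\<Sum>I\<in>Pow {..<DIM('a)}. 2 ^ card I / 2 ^ n * cnj (\<psi> (frame_list e I)) * \<psi>' (frame_list e I))"
  unfolding inner_H_def wedge_def length_map length_upt diff_zero
proof (rule sum.cong)
  let ?N = "DIM('a)" and ?c = "\<lambda>I. card {(i, j). i \<in> I \<and> j \<in> {..<DIM('a)} - I \<and> j < (i::nat)}"
  fix I assume "I \<in> Pow {..<?N}"
  then have I: "I \<subseteq> {..<?N}" by simp
  have "nths [0..<?N] (- I) = nths [0..<?N] ({..<?N} - I)"
    by (simp add: nths_def) (rule arg_cong[of _ _ "map fst"], rule filter_cong, auto simp: in_set_zip)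
  then have n: "nths (map e [0..<?N]) I = frame_list e I" "nths (map e [0..<?N]) (- I) = frame_list e ({..<?N} - I)"
    using I by (simp_all add: nths_map nths_upt frame_list_def)
  have "(- 1 :: complex) ^ m * x * ((- 1) ^ m * y * z) = y * x * z" for m x y z
    by (simp add: mult_ac flip: power_add)
  then show "(- 1) ^ ?c I * conj_form \<psi> (nths (map e [0..<?N]) I) *
      hodge_star (\<lambda>x y. inner x y / 2) (\<lambda>i. sqrt 2 *\<^sub>R e i) \<psi>' (nths (map e [0..<?N]) (- I))
    = 2 ^ card I / 2 ^ n * cnj (\<psi> (frame_list e I)) * \<psi>' (frame_list e I)"
    unfolding n hodge_star_frame_list[OF e dim \<psi>' I] conj_form_def by metis
qed simp

locale oriented_frame =
  fixes e :: "nat \<Rightarrow> 'a::euclidean_space" and n :: nat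
  assumes e: "orthonormal_frame e" and dim: "DIM('a) = 2 * n"
begin

abbreviation ip :: "('a list \<Rightarrow> complex) \<Rightarrow> ('a list \<Rightarrow> complex) \<Rightarrow> complex" where "ip \<equiv> inner_H e"

lemmas ip_eq = inner_H_eq[OF e dim]

lemma ip_add_right: "\<phi> \<in> alternating_forms \<Longrightarrow> \<phi>' \<in> alternating_forms \<Longrightarrow> ip \<psi> (\<lambda>vs. \<phi> vs + \<phi>' vs) = ip \<psi> \<phi> + ip \<psi> \<phi>'"
  by (simp add: ip_eq algebra_simps add_divide_distrib sum.distrib)

lemma ip_diff_right: "\<phi> \<in> alternating_forms \<Longrightarrow> \<phi>' \<in> alternating_forms \<Longrightarrow> ip \<psi> (\<lambda>vs. \<phi> vs - \<phi>' vs) = ip \<psi> \<phi> - ip \<psi> \<phi>'"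
  by (simp add: ip_eq algebra_simps diff_divide_distrib sum_subtractf)

lemma ip_scale_right: "\<phi> \<in> alternating_forms \<Longrightarrow> ip \<psi> (\<lambda>vs. c * \<phi> vs) = c * ip \<psi> \<phi>"
  by (simp add: ip_eq sum_distrib_left mult_ac)

lemma ip_zero_right: "ip \<psi> (\<lambda>vs. 0) = 0"
  by (simp add: ip_eq)

lemma ip_sum_right: "(\<And>i. i \<in> A \<Longrightarrow> \<phi> i \<in> alternating_forms) \<Longrightarrow> ip \<psi> (\<lambda>vs. \<Sum>i\<in>A. \<phi> i vs) = (\<Sum>i\<in>A. ip \<psi> (\<phi> i))"
  by (induction A rule: infinite_finite_induct) (simp_all add: ip_zero_right ip_add_right)

lemma ip_cnj: "\<phi> \<in> alternating_forms \<Longrightarrow> \<psi> \<in> alternating_forms \<Longrightarrow> ip \<psi> \<phi> = cnj (ip \<phi> \<psi>)"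
  by (simp add: ip_eq mult_ac)

lemma ip_scale_left: "\<phi> \<in> alternating_forms \<Longrightarrow> ip (\<lambda>vs. c * \<psi> vs) \<phi> = cnj c * ip \<psi> \<phi>"
  by (simp add: ip_eq sum_distrib_left mult_ac)

lemma ip_diff_left: "\<phi> \<in> alternating_forms \<Longrightarrow> ip (\<lambda>vs. \<psi> vs - \<psi>' vs) \<phi> = ip \<psi> \<phi> - ip \<psi>' \<phi>"
  by (simp add: ip_eq algebra_simps diff_divide_distrib sum_subtractf)

lemma ip_sum_left: "\<phi> \<in> alternating_forms \<Longrightarrow> ip (\<lambda>vs. \<Sum>i\<in>A. \<psi> i vs) \<phi> = (\<Sum>i\<in>A. ip (\<psi> i) \<phi>)"
  by (simp add: ip_eq sum_distrib_left sum_distrib_right) (rule sum.swap)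

lemma frame_list_vanish:
  assumes "\<psi> \<in> alternating_forms" "\<And>I. I \<subseteq> {..<DIM('a)} \<Longrightarrow> \<psi> (frame_list e I) = 0"
  shows "\<psi> = (\<lambda>vs. 0)"
proof
  fix vs :: "'a list"
  show "\<psi> vs = 0"
  proof (rule alternating_vanish[of scaleR of_real \<psi> "DIM('a)" e])
    show "\<exists>a. v = (\<Sum>k<DIM('a). a k *\<^sub>R e k)" for v
      using orthonormal_frame_expand[OF e, of v] by (rule exI[of _ "\<lambda>k. v \<bullet> e k"])
  qed (use assms in \<open>simp_all add: alternating_forms_iff frame_list_def\<close>)
qed

lemma ip_self: "\<psi> \<in> alternating_forms \<Longrightarrow> ip \<psi> \<psi> = of_real (\<Sum>I\<in>Pow {..<DIM('a)}. 2 ^ card I / 2 ^ n * (cmod (\<psi> (frame_list e I)))\<^sup>2)"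
  unfolding ip_eq of_real_sum of_real_mult complex_norm_square
  by (rule sum.cong) (simp_all add: mult_ac)

lemma ip_definite:
  assumes "\<psi> \<in> alternating_forms" "ip \<psi> \<psi> = 0"
  shows "\<psi> = (\<lambda>vs. 0)"
proof (rule frame_list_vanish[OF assms(1)])
  fix I assume I: "I \<subseteq> {..<DIM('a)}"
  have "(\<Sum>I\<in>Pow {..<DIM('a)}. 2 ^ card I / 2 ^ n * (cmod (\<psi> (frame_list e I)))\<^sup>2) = 0"
    using assms(2) unfolding ip_self[OF assms(1)] by (simp only: of_real_eq_0_iff)
  then have "\<forall>I\<in>Pow {..<DIM('a)}. 2 ^ card I / 2 ^ n * (cmod (\<psi> (frame_list e I)))\<^sup>2 = 0"
    by (subst (asm) sum_nonneg_eq_0_iff) simp_all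
  then show "\<psi> (frame_list e I) = 0" using I by simp
qed

lemma alternating_insort:
  assumes "alternating sc h F"
  shows "F (us @ map e (insort k ks)) = (-1) ^ length (takeWhile (\<lambda>i. i < k) ks) * F (us @ e k # map e ks)"
proof (induction ks arbitrary: us)
  case (Cons i ks)
  then show ?case using Cons[of "us @ [e i]"] alternating_swap[OF assms, of us "e k" "e i"] by auto
qed simp

text \<open>The sign \<open>s\<close> is the same for all alternating functions, so it cancels
  between the two arguments of \<open>ip\<close>.\<close>

lemma frame_list_insert:
  assumes "k < DIM('a)" "I \<subseteq> {..<DIM('a)}" "k \<notin> I"
  obtains s :: complex where "cnj s * s = 1"
    "\<And>F. alternating scaleR of_real F \<Longrightarrow> F (frame_list e (insert k I)) = s * F (e k # frame_list e I)"
proof -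
  have fin: "finite I" using assms finite_subset by blast
  let ?m = "length (takeWhile (\<lambda>i. i < k) (sorted_list_of_set I))"
  show thesis
  proof (rule that[of "(-1) ^ ?m"])
    show "F (frame_list e (insert k I)) = (-1) ^ ?m * F (e k # frame_list e I)" if "alternating scaleR of_real F" for F
      using alternating_insort[OF that, of "[]" k "sorted_list_of_set I"] fin assms(3)
      by (simp add: frame_list_def sorted_list_of_set_insert_remove)
  qed (simp flip: power_mult_distrib)
qed

text \<open>Subsets are paired by inserting \<open>k\<close>. The wedge product lives on those that
  contain \<open>k\<close> and the contraction on those that do not; inserting \<open>k\<close>
  doubles the weight \<open>2 ^ card I\<close>, which gives the factor 2.\<close>

lemma ip_wedge_contract:
  assumes k: "k < DIM('a)" and \<phi>: "\<phi> \<in> alternating_forms" and \<psi>: "\<psi> \<in> alternating_forms"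
  shows "ip (wedge (one_form (\<lambda>w. of_real (e k \<bullet> w))) \<phi>) \<psi> = 2 * ip \<phi> (\<lambda>vs. \<psi> (e k # vs))"
proof -
  let ?N = "DIM('a)" and ?\<alpha> = "\<lambda>w. complex_of_real (e k \<bullet> w)"
  let ?w = "wedge (one_form ?\<alpha>) \<phi>"
  let ?A = "Pow ({..<?N} - {k})"
  have alt\<psi>: "alternating scaleR of_real \<psi>" and alt\<phi>: "alternating scaleR of_real \<phi>"
    using \<phi> \<psi> by (simp_all add: alternating_forms_iff)
  have altw: "alternating scaleR of_real ?w"
    by (rule alternating_wedge_one_form[OF alt\<phi>]) (simp_all add: inner_add_right)
  have \<psi>k: "(\<lambda>vs. \<psi> (e k # vs)) \<in> alternating_forms"
    using alternating_Cons[OF alt\<psi>] by (simp add: alternating_forms_iff)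
  have orth: "?\<alpha> v = 0" if v: "v \<in> set (frame_list e I)" and I: "I \<subseteq> {..<?N} - {k}" for v I
  proof -
    have "finite I" using I finite_subset by blast
    then obtain j where "j \<in> I" "v = e j" using v by (auto simp: frame_list_def)
    moreover have "j < ?N" "j \<noteq> k" using I \<open>j \<in> I\<close> by auto
    ultimately show ?thesis using k by (simp add: orthonormal_frame_inner[OF e])
  qed
  have Pow_eq: "Pow {..<?N} = ?A \<union> insert k ` ?A" "?A \<inter> insert k ` ?A = {}"
  proof -
    have "{..<?N} = insert k ({..<?N} - {k})" using k by auto
    then show "Pow {..<?N} = ?A \<union> insert k ` ?A" using Pow_insert by metis
  qed auto
  have inj: "inj_on (insert k) ?A" by (auto simp: inj_on_def)
  have split: "(\<Sum>I\<in>Pow {..<?N}. g I) = (\<Sum>I\<in>?A. g I) + (\<Sum>I\<in>?A. g (insert k I))" for g :: "nat set \<Rightarrow> complex"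
    unfolding Pow_eq(1) using Pow_eq(2) by (subst sum.union_disjoint) (simp_all add: sum.reindex[OF inj])
  let ?g = "\<lambda>I. 2 ^ card I / 2 ^ n * cnj (?w (frame_list e I)) * \<psi> (frame_list e I)"
  let ?g' = "\<lambda>I. 2 ^ card I / 2 ^ n * cnj (\<phi> (frame_list e I)) * \<psi> (e k # frame_list e I)"
  have g0: "?g I = 0" if "I \<in> ?A" for I
    using wedge_one_form_eq_0[of "frame_list e I" ?\<alpha> \<phi>] orth[of _ I] that by simp
  have g1: "?g (insert k I) = 2 * ?g' I" if "I \<in> ?A" for I
  proof -
    have I: "I \<subseteq> {..<?N}" "k \<notin> I" "I \<subseteq> {..<?N} - {k}" and fin: "finite I" using that finite_subset by auto
    obtain s :: complex where s: "cnj s * s = 1"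
      "\<And>F. alternating scaleR of_real F \<Longrightarrow> F (frame_list e (insert k I)) = s * F (e k # frame_list e I)"
      using frame_list_insert[OF k I(1,2)] by blast
    have "?w (e k # frame_list e I) = \<phi> (frame_list e I)"
      using wedge_one_form_eq_0[of "frame_list e I" ?\<alpha>] orth[of _ I] I(3)
      by (simp add: wedge_one_form_Cons orthonormal_frame_inner[OF e] k)
    then have "cnj (?w (frame_list e (insert k I))) * \<psi> (frame_list e (insert k I))
      = (cnj s * s) * (cnj (\<phi> (frame_list e I)) * \<psi> (e k # frame_list e I))"
      unfolding s(2)[OF altw] s(2)[OF alt\<psi>] by simp
    then have "cnj (?w (frame_list e (insert k I))) * \<psi> (frame_list e (insert k I))
      = cnj (\<phi> (frame_list e I)) * \<psi> (e k # frame_list e I)" using s(1) by simp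
    then show ?thesis using fin I(2) by (simp add: mult.assoc)
  qed
  have g2: "?g' (insert k I) = 0" if "I \<in> ?A" for I
  proof -
    have "finite I" using that finite_subset[of I "{..<?N}"] by auto
    then have "e k \<in> set (frame_list e (insert k I))"
      by (simp add: frame_list_def set_insort_key)
    then have "\<psi> (e k # frame_list e (insert k I)) = 0"
      using alternating_vanish_repeat[OF alt\<psi>, of "e k" _ "[]"] by simp
    then show ?thesis by simp
  qed
  have "(\<Sum>I\<in>?A. ?g I) = (\<Sum>I\<in>?A. 2 * ?g' (insert k I))"
    by (intro sum.cong refl) (simp only: g0 g2 mult_zero_right)
  moreover have "(\<Sum>I\<in>?A. ?g (insert k I)) = (\<Sum>I\<in>?A. 2 * ?g' I)"
    by (intro sum.cong refl) (simp only: g1)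
  ultimately have "(\<Sum>I\<in>Pow {..<?N}. ?g I) = (\<Sum>I\<in>Pow {..<?N}. 2 * ?g' I)"
    unfolding split by (simp only: add.commute)
  then show ?thesis by (simp only: ip_eq[OF \<psi>] ip_eq[OF \<psi>k] sum_distrib_left)
qed

text \<open>By \<open>ip_wedge_contract\<close> half of the wedge product is the adjoint of the
  contraction, so \<open>cl (e k)\<close> is an operator minus its adjoint. This is where the star
  of \<open>g / 2\<close> fits the factor 1/2 in \<open>nabla\<close>.\<close>

lemma ip_cl_frame:
  assumes k: "k < DIM('a)" and \<phi>: "\<phi> \<in> alternating_forms" and \<psi>: "\<psi> \<in> alternating_forms"
  shows "ip \<phi> (cl (e k) \<psi>) = - ip (cl (e k) \<phi>) \<psi>"
proof -
  let ?W = "wedge (one_form (\<lambda>w. complex_of_real (e k \<bullet> w)))"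
  have cl: "cl (e k) \<phi> = (\<lambda>us. \<phi> (e k # us) - 1/2 * ?W \<phi> us)" for \<phi>
    by (rule ext) (simp add: cl_def)
  have c: "(\<lambda>us. \<phi> (e k # us)) \<in> alternating_forms" if "\<phi> \<in> alternating_forms" for \<phi> :: "'a list \<Rightarrow> complex"
    using that alternating_Cons by (auto simp: alternating_forms_iff)
  have w: "?W \<phi> \<in> alternating_forms" if "\<phi> \<in> alternating_forms" for \<phi>
    using that alternating_wedge_one_form[of scaleR of_real \<phi>] by (auto simp: alternating_forms_iff inner_add_right)
  have "ip \<phi> (cl (e k) \<psi>) = ip \<phi> (\<lambda>us. \<psi> (e k # us)) - 1/2 * ip \<phi> (?W \<psi>)"
    unfolding cl by (simp only: ip_diff_right ip_scale_right alternating_forms_scale c[OF \<psi>] w[OF \<psi>])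
  also have "ip \<phi> (?W \<psi>) = 2 * ip (\<lambda>us. \<phi> (e k # us)) \<psi>"
    using ip_wedge_contract[OF k \<psi> \<phi>] ip_cnj[OF w[OF \<psi>] \<phi>] ip_cnj[OF \<psi> c[OF \<phi>]] by simp
  also have "ip \<phi> (\<lambda>us. \<psi> (e k # us)) = 1/2 * ip (?W \<phi>) \<psi>"
    using ip_wedge_contract[OF k \<phi> \<psi>] by simp
  finally show ?thesis
    unfolding cl[of \<phi>] by (simp only: ip_diff_left[OF \<psi>] ip_scale_left[OF \<psi>]) simp
qed

lemma ip_cl:
  assumes \<phi>: "\<phi> \<in> alternating_forms" and \<psi>: "\<psi> \<in> alternating_forms"
  shows "ip \<phi> (cl v \<psi>) = - ip (cl v \<phi>) \<psi>"
proof -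
  have exp: "cl v \<xi> = (\<lambda>vs. \<Sum>k<DIM('a). of_real (v \<bullet> e k) * cl (e k) \<xi> vs)" if "\<xi> \<in> alternating_forms" for \<xi>
  proof
    fix vs
    have "cl v \<xi> vs = cl (\<Sum>k<DIM('a). (v \<bullet> e k) *\<^sub>R e k) \<xi> vs"
      by (simp only: orthonormal_frame_expand[OF e, of v, symmetric])
    then show "cl v \<xi> vs = (\<Sum>k<DIM('a). of_real (v \<bullet> e k) * cl (e k) \<xi> vs)"
      by (simp only: cl_sum_vec[OF that])
  qed
  have "ip \<phi> (cl v \<psi>) = (\<Sum>k<DIM('a). of_real (v \<bullet> e k) * ip \<phi> (cl (e k) \<psi>))"
    unfolding exp[OF \<psi>] using \<psi> by (simp add: ip_sum_right ip_scale_right)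
  also have "\<dots> = - (\<Sum>k<DIM('a). of_real (v \<bullet> e k) * ip (cl (e k) \<phi>) \<psi>)"
    using ip_cl_frame[OF _ \<phi> \<psi>] by (simp add: sum_negf)
  also have "(\<Sum>k<DIM('a). of_real (v \<bullet> e k) * ip (cl (e k) \<phi>) \<psi>) = ip (cl v \<phi>) \<psi>"
    unfolding exp[OF \<phi>] by (simp add: ip_sum_left[OF \<psi>] ip_scale_left[OF \<psi>])
  finally show ?thesis .
qed

subsection \<open>The orthogonal projection\<close>

lemma fibre_H_lincomb:
  assumes "\<psi> \<in> fibre_H J" "\<phi> \<in> fibre_H J"
  shows "(\<lambda>vs. c * \<psi> vs + d * \<phi> vs) \<in> fibre_H J"
proof -
  have "nabla x (\<lambda>vs. c * \<psi> vs + d * \<phi> vs) vs = c * nabla x \<psi> vs + d * nabla x \<phi> vs" for x vs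
    by (simp add: nabla_eq cl_add cl_scale algebra_simps)
  then show ?thesis using assms by (simp add: fibre_H_def)
qed

lemma proj_H_eqI:
  assumes \<psi>: "\<psi> \<in> alternating_forms" and \<phi>: "\<phi> \<in> fibre_H J"
    and orth: "\<And>\<theta>. \<theta> \<in> fibre_H J \<Longrightarrow> ip \<theta> \<psi> = ip \<theta> \<phi>"
  shows "proj_H e J \<psi> = \<phi>"
  unfolding proj_H_def
proof (rule the_equality)
  have alt: "\<theta> \<in> alternating_forms" if "\<theta> \<in> fibre_H J" for \<theta>
    using that by (simp add: fibre_H_def)
  show "\<phi> \<in> fibre_H J \<and> (\<forall>\<theta>\<in>fibre_H J. ip \<theta> (\<lambda>vs. \<psi> vs - \<phi> vs) = 0)"
    using \<phi> orth \<psi> alt by (simp add: ip_diff_right)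
  fix \<phi>' assume \<phi>': "\<phi>' \<in> fibre_H J \<and> (\<forall>\<theta>\<in>fibre_H J. ip \<theta> (\<lambda>vs. \<psi> vs - \<phi>' vs) = 0)"
  let ?d = "\<lambda>vs. \<phi>' vs - \<phi> vs"
  have "(\<lambda>vs. 1 * \<phi>' vs + (- 1) * \<phi> vs) \<in> fibre_H J"
    by (rule fibre_H_lincomb) (use \<phi> \<phi>' in auto)
  then have d: "?d \<in> fibre_H J" by simp
  have "ip ?d (\<lambda>vs. \<psi> vs - \<phi>' vs) = 0" using \<phi>' d by blast
  then have "ip ?d \<psi> = ip ?d \<phi>'" using \<phi>' \<psi> alt by (simp add: ip_diff_right)
  then have "ip ?d ?d = 0" using orth[OF d] \<phi> \<phi>' alt by (simp add: ip_diff_right)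
  then have "?d = (\<lambda>vs. 0)" by (rule ip_definite[OF alt[OF d]])
  then show "\<phi>' = \<phi>" by (metis (no_types, lifting) eq_iff_diff_eq_0 ext)
qed

text \<open>For orthonormal \<open>v\<close> and \<open>w\<close> the operator
  \<open>\<i> * cl v (cl w \<psi>)\<close> in \<open>\<psi>\<close> has square 1/4, so adding 1/2
  gives a projection. Its range consists of the forms on which \<open>cl w\<close> acts as
  \<open>\<i>\<close> times \<open>cl v\<close>.\<close>

definition proj_step :: "'a \<Rightarrow> 'a \<Rightarrow> ('a list \<Rightarrow> complex) \<Rightarrow> 'a list \<Rightarrow> complex" where
  "proj_step v w \<psi> vs = 1/2 * \<psi> vs + \<i> * cl v (cl w \<psi>) vs"

text \<open>
  For a unitary basis \<open>b\<close> of \<open>(V, J)\<close> the operators \<open>proj_step (b i) (J (b i))\<close> are commuting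
  orthogonal projections and the intersection of their ranges is \<open>fibre_H J\<close>.
\<close>

definition vacuum_proj :: "('a \<Rightarrow> 'a) \<Rightarrow> (nat \<Rightarrow> 'a) \<Rightarrow> ('a list \<Rightarrow> complex) \<Rightarrow> 'a list \<Rightarrow> complex" where
  "vacuum_proj J b \<psi> = foldr (\<lambda>i. proj_step (b i) (J (b i))) [0..<n] \<psi>"

lemma proj_step_alternating [simp, intro]: "\<psi> \<in> alternating_forms \<Longrightarrow> proj_step v w \<psi> \<in> alternating_forms"
proof -
  assume "\<psi> \<in> alternating_forms"
  then have "(\<lambda>vs. 1/2 * \<psi> vs + \<i> * cl v (cl w \<psi>) vs) \<in> alternating_forms" by (intro alternating_forms_add alternating_forms_scale cl_alternating)
  then show ?thesis by (simp add: proj_step_def[abs_def])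
qed

lemma foldr_proj_step_alternating: "\<psi> \<in> alternating_forms \<Longrightarrow> foldr (\<lambda>i. proj_step (v i) (w i)) is \<psi> \<in> alternating_forms"
  by (induction "is") auto

text \<open>\<open>cl v\<close> and \<open>cl w\<close> are skew-adjoint and anticommute, so
  \<open>\<i>\<close> times their product is self-adjoint.\<close>

lemma ip_proj_step:
  assumes \<phi>: "\<phi> \<in> alternating_forms" and \<psi>: "\<psi> \<in> alternating_forms" and vw: "v \<bullet> w = 0"
  shows "ip \<phi> (proj_step v w \<psi>) = ip (proj_step v w \<phi>) \<psi>"
proof -
  have "cl v (cl w \<phi>) = (\<lambda>vs. - 1 * cl w (cl v \<phi>) vs)"
    by (rule ext) (simp add: cl_anticommute[OF \<phi>, of v w] vw)
  then have "ip (cl v (cl w \<phi>)) \<psi> = - ip (cl w (cl v \<phi>)) \<psi>"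
    using ip_scale_left[OF \<psi>, of "-1" "cl w (cl v \<phi>)"] by simp
  moreover have "ip \<phi> (cl v (cl w \<psi>)) = ip (cl w (cl v \<phi>)) \<psi>"
    using \<phi> \<psi> by (simp add: ip_cl)
  moreover have "ip \<phi> (proj_step v w \<psi>) = 1/2 * ip \<phi> \<psi> + \<i> * ip \<phi> (cl v (cl w \<psi>))"
    unfolding proj_step_def[abs_def] using \<psi> by (simp only: ip_add_right ip_scale_right alternating_forms_scale cl_alternating)
  moreover have "ip (proj_step v w \<phi>) \<psi> = cnj (1/2 * ip \<psi> \<phi> + \<i> * ip \<psi> (cl v (cl w \<phi>)))"
    unfolding ip_cnj[OF \<psi> proj_step_alternating[OF \<phi>]]
    unfolding proj_step_def[abs_def] using \<phi> by (simp only: ip_add_right ip_scale_right alternating_forms_scale cl_alternating)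
  ultimately show ?thesis
    using ip_cnj[OF \<psi> \<phi>] ip_cnj[OF \<psi> cl_alternating[OF cl_alternating[OF \<phi>, of w], of v]] by simp
qed

end

locale complex_frame_setting = oriented_frame e n for e :: "nat \<Rightarrow> 'a::euclidean_space" and n +
  fixes J :: "'a \<Rightarrow>\<^sub>L 'a" and b :: "nat \<Rightarrow> 'a"
  assumes JJ: "J (J x) = - x" and Jorth: "J x \<bullet> J y = x \<bullet> y"
    and frame: "orthonormal_frame (complex_frame J b)"
begin

lemma b_inner:
  assumes "i < n" "j < n"
  shows "b i \<bullet> b j = (if i = j then 1 else 0)" "b i \<bullet> J (b j) = 0" "J (b i) \<bullet> b j = 0"
    "J (b i) \<bullet> J (b j) = (if i = j then 1 else 0)"
proof -
  have d: "2 * i < DIM('a)" "Suc (2 * i) < DIM('a)" "2 * j < DIM('a)" "Suc (2 * j) < DIM('a)"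
    using assms dim by auto
  note o = orthonormal_frame_inner[OF frame]
  show "b i \<bullet> b j = (if i = j then 1 else 0)" using o[OF d(1,3)] by simp
  have "2 * i \<noteq> Suc (2 * j)" "Suc (2 * i) \<noteq> 2 * j" by presburger+
  then show "b i \<bullet> J (b j) = 0" "J (b i) \<bullet> b j = 0" using o[OF d(1,4)] o[OF d(2,3)] by simp_all
  show "J (b i) \<bullet> J (b j) = (if i = j then 1 else 0)" using o[OF d(2,4)] by simp
qed

lemma frame_sum: "x = (\<Sum>i<n. (x \<bullet> b i) *\<^sub>R b i + (x \<bullet> J (b i)) *\<^sub>R J (b i))"
  using orthonormal_frame_expand[OF frame, of x] unfolding dim sum_lessThan_double by simp

lemma fibre_H_basis:
  assumes \<psi>: "\<psi> \<in> alternating_forms" and b: "\<And>i vs. i < n \<Longrightarrow> cl (J (b i)) \<psi> vs = \<i> * cl (b i) \<psi> vs"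
  shows "\<psi> \<in> fibre_H J"
  unfolding fibre_H_iff[OF JJ]
proof (intro conjI allI ext \<psi>)
  fix v vs
  have "J v = (\<Sum>i<n. (v \<bullet> b i) *\<^sub>R J (b i) + (v \<bullet> J (b i)) *\<^sub>R (- b i))"
    by (subst frame_sum[of v]) (simp only: blinfun.sum_right blinfun.add_right blinfun.scaleR_right JJ)
  then have "cl (J v) \<psi> vs = (\<Sum>i<n. of_real (v \<bullet> b i) * cl (J (b i)) \<psi> vs + of_real (v \<bullet> J (b i)) * cl (- b i) \<psi> vs)"
    by (simp only: sum.distrib cl_add_vec[OF \<psi>] cl_sum_vec[OF \<psi>])
  also have "\<dots> = \<i> * (\<Sum>i<n. of_real (v \<bullet> b i) * cl (b i) \<psi> vs + of_real (v \<bullet> J (b i)) * cl (J (b i)) \<psi> vs)"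
    unfolding sum_distrib_left by (intro sum.cong refl) (simp add: b cl_minus_vec[OF \<psi>] algebra_simps)
  also have "(\<Sum>i<n. of_real (v \<bullet> b i) * cl (b i) \<psi> vs + of_real (v \<bullet> J (b i)) * cl (J (b i)) \<psi> vs) = cl v \<psi> vs"
    by (subst (3) frame_sum[of v]) (simp only: sum.distrib cl_add_vec[OF \<psi>] cl_sum_vec[OF \<psi>])
  finally show "cl (J v) \<psi> vs = \<i> * cl v \<psi> vs" .
qed

lemma fibre_HD: "\<psi> \<in> fibre_H J \<Longrightarrow> \<psi> \<in> alternating_forms" "\<psi> \<in> fibre_H J \<Longrightarrow> cl (J v) \<psi> = (\<lambda>vs. \<i> * cl v \<psi> vs)"
  using fibre_H_iff[OF JJ] by blast+

lemma proj_step_fix: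
  assumes \<psi>: "\<psi> \<in> fibre_H J" and "i < n"
  shows "proj_step (b i) (J (b i)) \<psi> = \<psi>"
proof
  fix vs
  have "cl (b i) (cl (J (b i)) \<psi>) vs = \<i> * (- 1/2 * \<psi> vs)"
    unfolding fibre_HD(2)[OF \<psi>] cl_scale cl_square[OF fibre_HD(1)[OF \<psi>]] using b_inner(1)[OF assms(2,2)] by simp
  then show "proj_step (b i) (J (b i)) \<psi> vs = \<psi> vs" by (simp add: proj_step_def)
qed

lemma proj_step_annihilated:
  assumes \<psi>: "\<psi> \<in> alternating_forms" and i: "i < n"
  shows "cl (J (b i)) (proj_step (b i) (J (b i)) \<psi>) vs = \<i> * cl (b i) (proj_step (b i) (J (b i)) \<psi>) vs"
proof -
  have 1: "cl (J (b i)) (cl (b i) (cl (J (b i)) \<psi>)) vs = 1/2 * cl (b i) \<psi> vs"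
  proof -
    have "cl (J (b i)) (cl (b i) (cl (J (b i)) \<psi>)) vs = - cl (b i) (cl (J (b i)) (cl (J (b i)) \<psi>)) vs"
      using cl_anticommute[of "cl (J (b i)) \<psi>" "J (b i)" "b i" vs] \<psi> b_inner(3)[OF i i] by simp
    also have "cl (J (b i)) (cl (J (b i)) \<psi>) = (\<lambda>vs. (- 1/2) * \<psi> vs)"
      by (rule ext) (use cl_square[OF \<psi>, of "J (b i)"] b_inner(4)[OF i i] in simp)
    finally show ?thesis by (simp only: cl_scale) simp
  qed
  have 2: "cl (b i) (cl (b i) (cl (J (b i)) \<psi>)) vs = - 1/2 * cl (J (b i)) \<psi> vs"
    using cl_square[of "cl (J (b i)) \<psi>" "b i" vs] \<psi> b_inner(1)[OF i i] by simp
  show ?thesis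
    unfolding proj_step_def[abs_def] cl_add cl_scale 1 2 by (simp add: algebra_simps)
qed

text \<open>\<open>cl x\<close> changes sign once at \<open>cl v\<close> and once at
  \<open>cl w\<close>.\<close>

lemma proj_step_commutes:
  assumes \<psi>: "\<psi> \<in> alternating_forms" and "x \<bullet> v = 0" "x \<bullet> w = 0"
  shows "cl x (proj_step v w \<psi>) vs = proj_step v w (cl x \<psi>) vs"
proof -
  have "cl x (cl v (cl w \<psi>)) vs = - cl v (cl x (cl w \<psi>)) vs"
    using cl_anticommute[of "cl w \<psi>" x v vs] assms by simp
  also have "cl x (cl w \<psi>) = (\<lambda>vs. - 1 * cl w (cl x \<psi>) vs)"
    by (rule ext) (use cl_anticommute[OF \<psi>, of x w] assms in simp)
  finally have "cl x (cl v (cl w \<psi>)) vs = cl v (cl w (cl x \<psi>)) vs" by (simp only: cl_scale) simp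
  then show ?thesis unfolding proj_step_def[abs_def] cl_add cl_scale by simp
qed

lemma proj_step_lin: "proj_step v w (\<lambda>us. c * \<psi> us) vs = c * proj_step v w \<psi> vs"
  by (simp add: proj_step_def cl_scale[abs_def] algebra_simps)

lemma vacuum_proj_fibre:
  assumes \<psi>: "\<psi> \<in> alternating_forms"
  shows "vacuum_proj J b \<psi> \<in> fibre_H J"
proof (rule fibre_H_basis)
  show "vacuum_proj J b \<psi> \<in> alternating_forms"
    unfolding vacuum_proj_def by (rule foldr_proj_step_alternating[OF \<psi>])
  \<comment> \<open>The factor with index \<open>i\<close> enforces the relation for
    \<open>b i\<close>; the factors applied after it involve vectors orthogonal to
    \<open>b i\<close> and \<open>J (b i)\<close> and preserve it.\<close>
  have "cl (J (b i)) (foldr (\<lambda>i. proj_step (b i) (J (b i))) is \<psi>) = (\<lambda>vs. \<i> * cl (b i) (foldr (\<lambda>i. proj_step (b i) (J (b i))) is \<psi>) vs)"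
    if "i \<in> set is" "set is \<subseteq> {..<n}" for i "is"
    using that
  proof (induction "is")
    case (Cons j js)
    let ?\<phi> = "foldr (\<lambda>i. proj_step (b i) (J (b i))) js \<psi>"
    have \<phi>: "?\<phi> \<in> alternating_forms" by (rule foldr_proj_step_alternating[OF \<psi>])
    show ?case
    proof (cases "i = j")
      case True
      then show ?thesis using proj_step_annihilated[OF \<phi>, of i] Cons.prems by (intro ext) simp
    next
      case False
      then have IH: "cl (J (b i)) ?\<phi> = (\<lambda>vs. \<i> * cl (b i) ?\<phi> vs)" using Cons by auto
      have ij: "i < n" "j < n" using Cons.prems by auto
      show ?thesis
      proof
        fix vs
        have "cl (J (b i)) (proj_step (b j) (J (b j)) ?\<phi>) vs = proj_step (b j) (J (b j)) (cl (J (b i)) ?\<phi>) vs"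
          by (rule proj_step_commutes[OF \<phi>]) (use b_inner[OF ij] False in auto)
        also have "\<dots> = \<i> * proj_step (b j) (J (b j)) (cl (b i) ?\<phi>) vs"
          unfolding IH by (rule proj_step_lin)
        also have "proj_step (b j) (J (b j)) (cl (b i) ?\<phi>) vs = cl (b i) (proj_step (b j) (J (b j)) ?\<phi>) vs"
          by (rule proj_step_commutes[OF \<phi>, symmetric]) (use b_inner[OF ij] False in auto)
        finally show "cl (J (b i)) (foldr (\<lambda>i. proj_step (b i) (J (b i))) (j # js) \<psi>) vs
            = \<i> * cl (b i) (foldr (\<lambda>i. proj_step (b i) (J (b i))) (j # js) \<psi>) vs" by simp
      qed
    qed
  qed simp
  from this[of _ "[0..<n]"] show "cl (J (b i)) (vacuum_proj J b \<psi>) vs = \<i> * cl (b i) (vacuum_proj J b \<psi>) vs" if "i < n" for i vs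
    using that by (simp add: vacuum_proj_def lessThan_atLeast0)
qed

lemma vacuum_proj_fix:
  assumes \<psi>: "\<psi> \<in> fibre_H J"
  shows "vacuum_proj J b \<psi> = \<psi>"
proof -
  have "foldr (\<lambda>i. proj_step (b i) (J (b i))) is \<psi> = \<psi>" if "set is \<subseteq> {..<n}" for "is"
    using that by (induction "is") (simp_all add: proj_step_fix[OF \<psi>])
  then show ?thesis by (simp add: vacuum_proj_def lessThan_atLeast0)
qed

lemma ip_vacuum_proj:
  assumes \<theta>: "\<theta> \<in> fibre_H J" and \<psi>: "\<psi> \<in> alternating_forms"
  shows "ip \<theta> (vacuum_proj J b \<psi>) = ip \<theta> \<psi>"
proof -
  have "ip \<theta> (foldr (\<lambda>i. proj_step (b i) (J (b i))) is \<psi>) = ip \<theta> \<psi>" if "set is \<subseteq> {..<n}" for "is"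
    using that
    by (induction "is")
       (simp_all add: ip_proj_step[OF fibre_HD(1)[OF \<theta>] foldr_proj_step_alternating[OF \<psi>]] b_inner proj_step_fix[OF \<theta>])
  then show ?thesis by (simp add: vacuum_proj_def lessThan_atLeast0)
qed

lemma proj_H_eq: "\<psi> \<in> alternating_forms \<Longrightarrow> proj_H e J \<psi> = vacuum_proj J b \<psi>"
  by (rule proj_H_eqI) (simp_all add: vacuum_proj_fibre ip_vacuum_proj)

end

subsection \<open>Parallel transport of the Hilbert spaces\<close>

definition has_form_derivative ::
  "(real \<Rightarrow> 'a list \<Rightarrow> complex) \<Rightarrow> ('a list \<Rightarrow> complex) \<Rightarrow> real \<Rightarrow> real set \<Rightarrow> bool" where
  "has_form_derivative \<psi> \<psi>' t S \<longleftrightarrow> (\<forall>vs. ((\<lambda>r. \<psi> r vs) has_vector_derivative \<psi>' vs) (at t within S))"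

lemma alternating_form_derivative:
  assumes d: "has_form_derivative \<psi> \<psi>' t S" and t: "t \<in> S" "at t within S \<noteq> bot"
    and alt: "\<And>r. r \<in> S \<Longrightarrow> \<psi> r \<in> alternating_forms"
  shows "\<psi>' \<in> alternating_forms"
proof -
  have dv: "((\<lambda>r. \<psi> r vs) has_vector_derivative \<psi>' vs) (at t within S)" for vs
    using d by (simp add: has_form_derivative_def)
  have unique: "X = Y" if "(f has_vector_derivative X) (at t within S)" "(g has_vector_derivative Y) (at t within S)"
    "\<And>r. r \<in> S \<Longrightarrow> f r = g r" for f g :: "real \<Rightarrow> complex" and X Y
    by (rule vector_derivative_unique_within[OF t(2) that(1) has_vector_derivative_transform[OF t(1) that(3) that(2)]])
  have alt': "alternating scaleR of_real (\<psi> r)" if "r \<in> S" for r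
    using alt[OF that] by (simp add: alternating_forms_iff)
  show ?thesis unfolding alternating_forms_iff alternating_def
  proof (intro conjI allI)
    show "\<psi>' (us @ (x + y) # vs) = \<psi>' (us @ x # vs) + \<psi>' (us @ y # vs)" for us vs x y
      by (rule unique[OF dv has_vector_derivative_add[OF dv dv]]) (rule alternating_add[OF alt'])
    show "\<psi>' (us @ (r *\<^sub>R x) # vs) = of_real r * \<psi>' (us @ x # vs)" for us vs r x
      by (rule unique[OF dv has_vector_derivative_mult_right[OF dv]]) (rule alternating_scale[OF alt'])
    show "\<psi>' (us @ x # vs @ x # ws) = 0" for us vs ws x
      by (rule unique[OF dv has_vector_derivative_const]) (rule alternating_repeat[OF alt'])
  qed
qed

lemma cl_derivative:
  fixes v :: "real \<Rightarrow> 'a::euclidean_space"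
  assumes v: "(v has_vector_derivative v') (at t within S)" and \<psi>: "has_form_derivative \<psi> \<psi>' t S"
    and alt: "\<And>r. r \<in> S \<Longrightarrow> \<psi> r \<in> alternating_forms" and alt': "\<psi>' \<in> alternating_forms" and t: "t \<in> S"
  shows "has_form_derivative (\<lambda>r. cl (v r) (\<psi> r)) (\<lambda>vs. cl v' (\<psi> t) vs + cl (v t) \<psi>' vs) t S"
  unfolding has_form_derivative_def
proof
  fix vs
  have inner: "((\<lambda>r. complex_of_real (v r \<bullet> u)) has_vector_derivative of_real (v' \<bullet> u)) (at t within S)" for u
    by (intro has_vector_derivative_of_real)
      (simp add: has_real_derivative_iff_has_vector_derivative
        bounded_linear.has_vector_derivative[OF bounded_linear_inner_left v])
  \<comment> \<open>The moving vector stands in an argument slot of a moving form. Expanding it in a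
    fixed basis turns the derivative into an ordinary product rule.\<close>
  have expand: "\<phi> (x # vs) = (\<Sum>b\<in>Basis. of_real (x \<bullet> b) * \<phi> (b # vs))" if "\<phi> \<in> alternating_forms" for \<phi> and x :: 'a
  proof -
    have a: "alternating scaleR of_real \<phi>" using that by (simp add: alternating_forms_iff)
    have "\<phi> ([] @ (\<Sum>b\<in>Basis. (x \<bullet> b) *\<^sub>R b) # vs) = (\<Sum>b\<in>Basis. \<phi> ([] @ ((x \<bullet> b) *\<^sub>R b) # vs))"
      by (rule alternating_sum[OF a])
    then show ?thesis
      by (simp only: alternating_scale[OF a, of "[]", unfolded append_Nil] euclidean_representation append_Nil)
  qed
  have "((\<lambda>r. \<Sum>b\<in>Basis. of_real (v r \<bullet> b) * \<psi> r (b # vs)) has_vector_derivative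
      (\<Sum>b\<in>Basis. of_real (v t \<bullet> b) * \<psi>' (b # vs) + of_real (v' \<bullet> b) * \<psi> t (b # vs))) (at t within S)"
    by (intro has_vector_derivative_sum has_vector_derivative_mult inner) (use \<psi> in \<open>simp add: has_form_derivative_def\<close>)
  also have "(\<Sum>b\<in>Basis. of_real (v t \<bullet> b) * \<psi>' (b # vs) + of_real (v' \<bullet> b) * \<psi> t (b # vs))
      = \<psi>' (v t # vs) + \<psi> t (v' # vs)"
    unfolding expand[OF alt', of "v t"] expand[OF alt[OF t], of v'] by (simp only: sum.distrib)
  finally have c: "((\<lambda>r. \<psi> r (v r # vs)) has_vector_derivative \<psi>' (v t # vs) + \<psi> t (v' # vs)) (at t within S)"
    by (rule has_vector_derivative_transform[OF t, rotated]) (rule expand[OF alt])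
  have w: "((\<lambda>r. wedge (one_form (\<lambda>u. of_real (v r \<bullet> u))) (\<phi> r) vs) has_vector_derivative
      wedge (one_form (\<lambda>u. of_real (v' \<bullet> u))) (\<phi> t) vs + wedge (one_form (\<lambda>u. of_real (v t \<bullet> u))) \<phi>' vs) (at t within S)"
    if "has_form_derivative \<phi> \<phi>' t S" for \<phi> \<phi>'
    using that
  proof (induction vs arbitrary: \<phi> \<phi>')
    case (Cons u vs)
    have "has_form_derivative (\<lambda>r us. \<phi> r (u # us)) (\<lambda>us. \<phi>' (u # us)) t S"
      using Cons.prems by (simp add: has_form_derivative_def)
    from has_vector_derivative_diff[OF has_vector_derivative_mult[OF inner[of u] Cons.prems[unfolded has_form_derivative_def, rule_format, of vs]] Cons.IH[OF this]]
    show ?case by (simp add: wedge_one_form_Cons algebra_simps)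
  qed (simp add: wedge_one_form_Nil)
  have "((\<lambda>r. \<psi> r (v r # vs) - (1/2) * wedge (one_form (\<lambda>u. of_real (v r \<bullet> u))) (\<psi> r) vs) has_vector_derivative
      (\<psi>' (v t # vs) + \<psi> t (v' # vs)) - (1/2) * (wedge (one_form (\<lambda>u. of_real (v' \<bullet> u))) (\<psi> t) vs + wedge (one_form (\<lambda>u. of_real (v t \<bullet> u))) \<psi>' vs)) (at t within S)"
    by (rule has_vector_derivative_diff[OF c has_vector_derivative_mult_right[OF w[OF \<psi>]]])
  then show "((\<lambda>r. cl (v r) (\<psi> r) vs) has_vector_derivative cl v' (\<psi> t) vs + cl (v t) \<psi>' vs) (at t within S)"
    by (simp add: cl_def algebra_simps add_divide_distrib)
qed

context oriented_frame
begin

lemma ip_derivative: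
  assumes "has_form_derivative \<psi> \<psi>' t S" "has_form_derivative \<phi> \<phi>' t S" "t \<in> S"
    and alt: "\<And>r. r \<in> S \<Longrightarrow> \<phi> r \<in> alternating_forms" and alt': "\<phi>' \<in> alternating_forms"
  shows "((\<lambda>r. ip (\<psi> r) (\<phi> r)) has_vector_derivative ip (\<psi> t) \<phi>' + ip \<psi>' (\<phi> t)) (at t within S)"
proof -
  have d: "((\<lambda>r. \<psi> r vs) has_vector_derivative \<psi>' vs) (at t within S)"
    "((\<lambda>r. \<phi> r vs) has_vector_derivative \<phi>' vs) (at t within S)" for vs
    using assms(1,2) by (simp_all add: has_form_derivative_def)
  have "((\<lambda>r. \<Sum>I\<in>Pow {..<DIM('a)}. 2 ^ card I / 2 ^ n * (cnj (\<psi> r (frame_list e I)) * \<phi> r (frame_list e I)))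
      has_vector_derivative (\<Sum>I\<in>Pow {..<DIM('a)}. 2 ^ card I / 2 ^ n *
        (cnj (\<psi> t (frame_list e I)) * \<phi>' (frame_list e I) + cnj (\<psi>' (frame_list e I)) * \<phi> t (frame_list e I)))) (at t within S)"
    by (intro has_vector_derivative_sum has_vector_derivative_mult_right has_vector_derivative_mult has_vector_derivative_cnj d)
  moreover have "(\<Sum>I\<in>Pow {..<DIM('a)}. 2 ^ card I / 2 ^ n *
        (cnj (\<psi> t (frame_list e I)) * \<phi>' (frame_list e I) + cnj (\<psi>' (frame_list e I)) * \<phi> t (frame_list e I)))
      = ip (\<psi> t) \<phi>' + ip \<psi>' (\<phi> t)"
    by (simp add: ip_eq alt[OF \<open>t \<in> S\<close>] alt' algebra_simps sum.distrib add_divide_distrib)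
  ultimately have d: "((\<lambda>r. \<Sum>I\<in>Pow {..<DIM('a)}. 2 ^ card I / 2 ^ n * (cnj (\<psi> r (frame_list e I)) * \<phi> r (frame_list e I)))
      has_vector_derivative ip (\<psi> t) \<phi>' + ip \<psi>' (\<phi> t)) (at t within S)" by (simp only:)
  show ?thesis
    by (rule has_vector_derivative_transform[OF \<open>t \<in> S\<close> _ d]) (simp only: ip_eq[OF alt] mult.assoc)
qed

lemma fibre_H_eqI:
  assumes "\<phi> \<in> fibre_H J" "\<psi> \<in> fibre_H J" "\<And>\<theta>. \<theta> \<in> fibre_H J \<Longrightarrow> ip \<theta> \<phi> = ip \<theta> \<psi>"
  shows "\<phi> = \<psi>"
proof -
  have alt: "\<theta> \<in> alternating_forms" if "\<theta> \<in> fibre_H J" for \<theta>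
    using that by (simp add: fibre_H_def)
  have "proj_H e J \<phi> = \<psi>" "proj_H e J \<phi> = \<phi>"
    using assms alt by (auto intro!: proj_H_eqI)
  then show ?thesis by simp
qed

end

text \<open>The identities behind the splitting of \<open>B (f j)\<close> in
  \<open>ip_K\<close>.\<close>

lemma tan_double:
  fixes \<tau> :: real
  assumes "cos \<tau> \<noteq> 0"
  shows "1 + cos (2 * \<tau>) + tan \<tau> * sin (2 * \<tau>) = 2" "tan \<tau> * (1 + cos (2 * \<tau>)) = sin (2 * \<tau>)"
proof -
  have "tan \<tau> * (2 * sin \<tau> * cos \<tau>) = 2 * (sin \<tau>)\<^sup>2"
    using assms by (simp add: tan_def power2_eq_square)
  then show "1 + cos (2 * \<tau>) + tan \<tau> * sin (2 * \<tau>) = 2"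
    unfolding cos_double_sin sin_double by simp
  show "tan \<tau> * (1 + cos (2 * \<tau>)) = sin (2 * \<tau>)"
    unfolding cos_double_cos sin_double using assms by (simp add: tan_def power2_eq_square)
qed

section \<open>The projections along the rotated complex structures\<close>

locale complex_rotation = oriented_frame e n + skew_frame "complex_frame J b" "\<lambda>j. \<theta> (j div 2)" B
  for e :: "nat \<Rightarrow> 'a::euclidean_space" and n and J :: "'a \<Rightarrow>\<^sub>L 'a" and b \<theta> B +
  assumes J: "J \<in> complex_structures e" and JB: "B (J x) = - J (B x)"
    and nonneg: "i < n \<Longrightarrow> 0 \<le> \<theta> i" and less_pi: "i < n \<Longrightarrow> \<theta> i < pi"
begin

abbreviation "Jt t \<equiv> E t o\<^sub>L J"
abbreviation "f \<equiv> complex_frame J b"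

lemma Jt: "Jt t \<in> complex_structures e"
  by (rule rot_complex_structure[OF e J JB])

lemmas JtD = complex_structureD[OF Jt]

lemma J_E: "J (E t x) = E (- t) (J x)"
  by (rule E_anticommute[OF JB])

text \<open>The complex structure at time \<open>t\<close> is the conjugate of \<open>J\<close> by
  the half rotation, so the frame that is unitary for it is \<open>E (t / 2) (b i)\<close> and not
  \<open>E t (b i)\<close>.\<close>

lemma Jt_half: "E t (J (E (t / 2) x)) = E (t / 2) (J x)"
  using E_add_apply[of t "- (t / 2)" "J x"] by (simp add: J_E)

lemma complex_frame_Jt: "complex_frame (Jt t) (\<lambda>i. E (t / 2) (b i)) = (\<lambda>j. E (t / 2) (f j))"
  by (rule ext) (simp add: complex_frame_def Jt_half)

sublocale Jt: complex_frame_setting e n "Jt t" "\<lambda>i. E (t / 2) (b i)" for t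
proof
  show "orthonormal_frame (complex_frame (Jt t) (\<lambda>i. E (t / 2) (b i)))"
    unfolding complex_frame_Jt using frame by (simp add: orthonormal_frame_def E_orth)
qed (rule JtD)+

abbreviation "P t \<equiv> vacuum_proj (Jt t) (\<lambda>i. E (t / 2) (b i))"

lemma P_eq: "P t \<psi> = foldr (\<lambda>i. proj_step (E (t / 2) (b i)) (E (t / 2) (J (b i)))) [0..<n] \<psi>"
  by (simp add: vacuum_proj_def Jt_half)

text \<open>
  The image of \<open>B / 2\<close> in the Clifford algebra; its commutator with \<open>cl x\<close> is \<open>cl (B x / 2)\<close>.
\<close>

definition K :: "('a list \<Rightarrow> complex) \<Rightarrow> 'a list \<Rightarrow> complex" where
  "K \<psi> vs = (\<Sum>j<DIM('a). 1/4 * cl (f j) (cl (B (f j)) \<psi>) vs)"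

lemma K_alternating [simp, intro]: "\<psi> \<in> alternating_forms \<Longrightarrow> K \<psi> \<in> alternating_forms"
  unfolding K_def[abs_def] by (intro alternating_forms_sum alternating_forms_scale cl_alternating)

lemma K_add: "K (\<lambda>vs. \<psi> vs + \<phi> vs) vs = K \<psi> vs + K \<phi> vs"
  by (simp add: K_def cl_add[abs_def] algebra_simps sum.distrib)

lemma K_scale: "K (\<lambda>vs. c * \<psi> vs) vs = c * K \<psi> vs"
  by (simp add: K_def cl_scale[abs_def] sum_distrib_left mult_ac)

text \<open>Moving \<open>cl x\<close> past both factors of a summand leaves two sums. Each is a
  frame expansion of a quarter of \<open>B x\<close>, the second one by skewness of
  \<open>B\<close>.\<close>

lemma K_cl:
  assumes \<psi>: "\<psi> \<in> alternating_forms"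
  shows "cl ((1/2) *\<^sub>R B x) \<psi> vs = K (cl x \<psi>) vs - cl x (K \<psi>) vs"
proof -
  have summand: "cl u (cl v (cl x \<psi>)) vs - cl x (cl u (cl v \<psi>)) vs = of_real (u \<bullet> x) * cl v \<psi> vs - of_real (v \<bullet> x) * cl u \<psi> vs" for u v
  proof -
    have "cl v (cl x \<psi>) = (\<lambda>vs. - of_real (v \<bullet> x) * \<psi> vs - cl x (cl v \<psi>) vs)"
      by (rule ext) (rule cl_anticommute[OF \<psi>])
    then have "cl u (cl v (cl x \<psi>)) vs = - of_real (v \<bullet> x) * cl u \<psi> vs - cl u (cl x (cl v \<psi>)) vs"
      by (simp only: cl_diff cl_scale)
    moreover have "cl u (cl x (cl v \<psi>)) vs = - of_real (u \<bullet> x) * cl v \<psi> vs - cl x (cl u (cl v \<psi>)) vs"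
      by (rule cl_anticommute) (use \<psi> in simp)
    ultimately show ?thesis by simp
  qed
  have "K (cl x \<psi>) vs - cl x (K \<psi>) vs
      = (\<Sum>j<DIM('a). 1/4 * (cl (f j) (cl (B (f j)) (cl x \<psi>)) vs - cl x (cl (f j) (cl (B (f j)) \<psi>)) vs))"
    unfolding K_def[abs_def] cl_sum cl_scale by (simp only: sum_subtractf right_diff_distrib)
  also have "\<dots> = (\<Sum>j<DIM('a). of_real (1/4 * (x \<bullet> f j)) * cl (B (f j)) \<psi> vs) + (\<Sum>j<DIM('a). of_real (1/4 * (B x \<bullet> f j)) * cl (f j) \<psi> vs)"
    unfolding summand sum.distrib[symmetric]
    by (intro sum.cong refl) (simp add: skew[of x] inner_commute algebra_simps)
  also have "\<dots> = cl (\<Sum>j<DIM('a). (1/4 * (x \<bullet> f j)) *\<^sub>R B (f j)) \<psi> vs + cl (\<Sum>j<DIM('a). (1/4 * (B x \<bullet> f j)) *\<^sub>R f j) \<psi> vs"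
    by (simp only: cl_sum_vec[OF \<psi>])
  also have "(\<Sum>j<DIM('a). (1/4 * (x \<bullet> f j)) *\<^sub>R B (f j)) = (1/4) *\<^sub>R B x"
    by (subst (2) orthonormal_frame_expand[OF frame, of x])
       (simp add: blinfun.sum_right blinfun.scaleR_right scaleR_sum_right)
  also have "(\<Sum>j<DIM('a). (1/4 * (B x \<bullet> f j)) *\<^sub>R f j) = (1/4) *\<^sub>R B x"
    by (subst (2) orthonormal_frame_expand[OF frame, of "B x"]) (simp add: scaleR_sum_right)
  finally show ?thesis by (simp add: cl_scale_vec[OF \<psi>])
qed

lemma E_half_deriv: "((\<lambda>t. E (t / 2) x) has_vector_derivative (1/2) *\<^sub>R B (E (t / 2) x)) (at t within S)"
  using bounded_linear.has_vector_derivative[OF blinfun.bounded_linear_left E_deriv_affine[of 0 "1/2" t S], of x]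
  by (simp add: blinfun.scaleR_left)

text \<open>The shape \<open>K (\<phi> t) - \<xi>\<close> of a derivative survives the application
  of another factor, since differentiating the rotated vectors contributes commutators with
  \<open>K\<close>. Starting from a constant \<open>\<psi>\<close> with
  \<open>\<xi> = K \<psi>\<close>, the whole product acquires the commutator with \<open>K\<close>
  as its derivative.\<close>

lemma proj_step_derivative:
  assumes t: "t \<in> S" "at t within S \<noteq> bot" and \<phi>: "has_form_derivative \<phi> (\<lambda>vs. K (\<phi> t) vs - \<xi> vs) t S"
    and alt: "\<And>r. \<phi> r \<in> alternating_forms" and \<xi>: "\<xi> \<in> alternating_forms"
  shows "has_form_derivative (\<lambda>r. proj_step (E (r / 2) x) (E (r / 2) y) (\<phi> r))
    (\<lambda>vs. K (proj_step (E (t / 2) x) (E (t / 2) y) (\<phi> t)) vs - proj_step (E (t / 2) x) (E (t / 2) y) \<xi> vs) t S"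
proof -
  let ?v = "E (t / 2) x" and ?w = "E (t / 2) y" and ?p = "\<phi> t"
  let ?D = "\<lambda>vs. K ?p vs - \<xi> vs"
  have D: "?D \<in> alternating_forms" using alt \<xi> by simp
  let ?D1 = "\<lambda>vs. cl ((1/2) *\<^sub>R B ?w) ?p vs + cl ?w ?D vs"
  have d1: "has_form_derivative (\<lambda>r. cl (E (r / 2) y) (\<phi> r)) ?D1 t S"
    by (rule cl_derivative[OF E_half_deriv \<phi> alt D t(1)])
  have D1: "?D1 = (\<lambda>vs. K (cl ?w ?p) vs - cl ?w \<xi> vs)"
    by (rule ext) (simp only: K_cl[OF alt] cl_diff, simp)
  have D1_alt: "?D1 \<in> alternating_forms" unfolding D1 using alt \<xi> by simp
  have d2: "has_form_derivative (\<lambda>r. cl (E (r / 2) x) (cl (E (r / 2) y) (\<phi> r)))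
      (\<lambda>vs. cl ((1/2) *\<^sub>R B ?v) (cl ?w ?p) vs + cl ?v ?D1 vs) t S"
    by (rule cl_derivative[OF E_half_deriv d1 _ D1_alt t(1)]) (use alt in simp)
  have D2: "cl ((1/2) *\<^sub>R B ?v) (cl ?w ?p) vs + cl ?v ?D1 vs = K (cl ?v (cl ?w ?p)) vs - cl ?v (cl ?w \<xi>) vs" for vs
    unfolding D1 by (simp only: K_cl[OF cl_alternating[OF alt]] cl_diff) simp
  show ?thesis
    unfolding has_form_derivative_def
  proof
    fix vs
    have "((\<lambda>r. 1/2 * \<phi> r vs + \<i> * cl (E (r / 2) x) (cl (E (r / 2) y) (\<phi> r)) vs) has_vector_derivative
      1/2 * ?D vs + \<i> * (cl ((1/2) *\<^sub>R B ?v) (cl ?w ?p) vs + cl ?v ?D1 vs)) (at t within S)"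
      by (intro has_vector_derivative_add has_vector_derivative_mult_right
          \<phi>[unfolded has_form_derivative_def, rule_format] d2[unfolded has_form_derivative_def, rule_format])
    moreover have "1/2 * ?D vs + \<i> * (cl ((1/2) *\<^sub>R B ?v) (cl ?w ?p) vs + cl ?v ?D1 vs)
      = K (proj_step ?v ?w ?p) vs - proj_step ?v ?w \<xi> vs"
      unfolding D2 proj_step_def[abs_def] K_add K_scale by (simp add: algebra_simps)
    ultimately show "((\<lambda>r. proj_step (E (r / 2) x) (E (r / 2) y) (\<phi> r) vs) has_vector_derivative
      K (proj_step ?v ?w ?p) vs - proj_step ?v ?w \<xi> vs) (at t within S)"
      by (simp add: proj_step_def)
  qed
qed

lemma P_derivative:
  assumes t: "t \<in> S" "at t within S \<noteq> bot" and \<psi>: "\<psi> \<in> alternating_forms"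
  shows "has_form_derivative (\<lambda>r. P r \<psi>) (\<lambda>vs. K (P t \<psi>) vs - P t (K \<psi>) vs) t S"
proof -
  let ?F = "\<lambda>is r \<psi>. foldr (\<lambda>i. proj_step (E (r / 2) (b i)) (E (r / 2) (J (b i)))) is \<psi>"
  have "has_form_derivative (\<lambda>r. ?F is r \<psi>) (\<lambda>vs. K (?F is t \<psi>) vs - ?F is t (K \<psi>) vs) t S" for "is"
  proof (induction "is")
    case Nil
    show ?case by (simp add: has_form_derivative_def)
  next
    case (Cons i "is")
    have "has_form_derivative (\<lambda>r. proj_step (E (r / 2) (b i)) (E (r / 2) (J (b i))) (?F is r \<psi>))
      (\<lambda>vs. K (proj_step (E (t / 2) (b i)) (E (t / 2) (J (b i))) (?F is t \<psi>)) vs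
        - proj_step (E (t / 2) (b i)) (E (t / 2) (J (b i))) (?F is t (K \<psi>)) vs) t S"
      by (rule proj_step_derivative[OF t Cons.IH foldr_proj_step_alternating[OF \<psi>]
            foldr_proj_step_alternating[OF K_alternating[OF \<psi>]]])
    then show ?case by simp
  qed
  then show ?thesis unfolding P_eq .
qed

text \<open>The logarithmic derivative of \<open>\<kappa>\<close>, introduced early because it is
  the scalar that \<open>K\<close> becomes in \<open>ip_K\<close>.\<close>

definition log_derivative :: "real \<Rightarrow> real" where
  "log_derivative u = - (\<Sum>i<n. \<theta> i * tan (u * \<theta> i / 2)) / 4"

text \<open>Here \<open>less_pi\<close> enters. Two times in the unit interval differ by at most 1,
  so half angles stay below pi / 2.\<close>

lemma cos_half_pos: "i < n \<Longrightarrow> \<bar>u\<bar> \<le> 1 \<Longrightarrow> 0 < cos (u * \<theta> i / 2)"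
proof -
  assume "i < n" "\<bar>u\<bar> \<le> 1"
  then have "\<bar>u\<bar> * \<theta> i \<le> \<theta> i" using nonneg[of i] by (simp add: mult_left_le_one_le)
  then have "\<bar>u * \<theta> i / 2\<bar> < pi / 2" using less_pi[OF \<open>i < n\<close>] nonneg[OF \<open>i < n\<close>] by (simp add: abs_mult)
  then show ?thesis by (intro cos_gt_zero_pi) linarith+
qed

text \<open>
  Since \<open>V\<^sup>\<complex>\<close> is the sum of \<open>V\<^sup>1\<^sup>,\<^sup>0\<close> at \<open>t0\<close> and \<open>V\<^sup>0\<^sup>,\<^sup>1\<close> at \<open>t\<close>, the pairing of the two fibres turns
  \<open>K\<close> into a scalar.
\<close>

lemma ip_K:
  assumes \<phi>: "\<phi> \<in> fibre_H (Jt t0)" and s: "s \<in> fibre_H (Jt t)" and t: "\<bar>t - t0\<bar> \<le> 1"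
  shows "ip \<phi> (K s) = of_real (log_derivative (t - t0)) * ip \<phi> s"
proof -
  let ?k = "ip \<phi> s" and ?J0 = "Jt t0" and ?J1 = "Jt t"
  define q where "q = (\<lambda>x y. ip \<phi> (cl x (cl y s)))"
  note \<phi>_alt = Jt.fibre_HD(1)[OF \<phi>] and s_alt = Jt.fibre_HD(1)[OF s]
  have q_add: "q x (y + z) = q x y + q x z" for x y z
  proof -
    have "cl (y + z) s = (\<lambda>vs. cl y s vs + cl z s vs)" by (rule ext) (rule cl_add_vec[OF s_alt])
    then have "cl x (cl (y + z) s) = (\<lambda>vs. cl x (cl y s) vs + cl x (cl z s) vs)" by (intro ext) (simp only: cl_add)
    then show ?thesis using s_alt by (simp add: q_def ip_add_right)
  qed
  have q_J1: "q x (?J1 y) = \<i> * q x y" for x y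
  proof -
    have "cl x (cl (?J1 y) s) = (\<lambda>vs. \<i> * cl x (cl y s) vs)"
      unfolding Jt.fibre_HD(2)[OF s] by (intro ext) (simp only: cl_scale)
    then show ?thesis using s_alt by (simp add: q_def ip_scale_right)
  qed
  have q_J0: "q (?J0 x) y = - \<i> * q x y" for x y
  proof -
    have "q (?J0 x) y = - ip (\<lambda>vs. \<i> * cl x \<phi> vs) (cl y s)"
      unfolding q_def using \<phi>_alt s_alt by (simp only: ip_cl cl_alternating Jt.fibre_HD(2)[OF \<phi>])
    also have "\<dots> = - \<i> * q x y"
      unfolding q_def using \<phi>_alt s_alt by (simp add: ip_scale_left ip_cl)
    finally show ?thesis .
  qed
  have q_swap: "q x y = - of_real (x \<bullet> y) * ?k - q y x" for x y
  proof -
    have "cl x (cl y s) = (\<lambda>vs. - of_real (x \<bullet> y) * s vs - cl y (cl x s) vs)"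
      by (rule ext) (rule cl_anticommute[OF s_alt])
    then show ?thesis using s_alt
      by (simp only: q_def ip_diff_right ip_scale_right alternating_forms_scale cl_alternating)
  qed
  \<comment> \<open>Two swaps express \<open>q x (?J0 y)\<close> by \<open>- \<i> * q x y\<close>
    and multiples of \<open>?k\<close>. This cancels \<open>q x (?J1 y)\<close>, so on vectors of
    the form \<open>?J0 y + ?J1 y\<close> only multiples of \<open>?k\<close> remain.\<close>
  have q_sum: "q x (?J0 y + ?J1 y) = - (of_real (x \<bullet> ?J0 y) + \<i> * of_real (x \<bullet> y)) * ?k" for x y
  proof -
    have "q x (?J0 y) = - of_real (x \<bullet> ?J0 y) * ?k + \<i> * q y x"
      using q_swap[of x "?J0 y"] q_J0[of y x] by simp
    also have "q y x = - of_real (x \<bullet> y) * ?k - q x y"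
      using q_swap[of y x] by (simp add: inner_commute)
    finally show ?thesis unfolding q_add q_J1 by (simp add: algebra_simps)
  qed
  have summand: "q (f j) (B (f j)) = - (of_real (\<theta> (j div 2) * tan ((t - t0) * \<theta> (j div 2) / 2) / 2) - \<i> / 2 * of_real (f j \<bullet> ?J0 (B (f j)))) * ?k"
    if j: "j < DIM('a)" for j
  proof -
    let ?th = "\<theta> (j div 2)" and ?x = "f j"
    define \<tau> where "\<tau> = (t - t0) * ?th / 2"
    have dbl: "(t - t0) * ?th = 2 * \<tau>" by (simp add: \<tau>_def)
    have "j div 2 < n" using j dim by auto
    then have c: "cos \<tau> \<noteq> 0" using cos_half_pos[OF _ t] unfolding \<tau>_def by force
    note tri = tan_double[OF c]
    \<comment> \<open>\<open>y\<close> solves \<open>?J0 y + ?J1 y = B ?x\<close>. Since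
      \<open>?J1 y\<close> is \<open>E (t - t0) (?J0 y)\<close>, one has to invert 1 plus the
      rotation by \<open>2 * \<tau>\<close> in the plane of \<open>?x\<close> and
      \<open>B ?x\<close>, which is \<open>2 * cos \<tau>\<close> times the rotation by
      \<open>\<tau>\<close>.\<close>
    define y where "y = (- 1/2) *\<^sub>R ?J0 (B ?x + (?th * tan \<tau>) *\<^sub>R ?x)"
    have J0y: "?J0 y = (1/2) *\<^sub>R (B ?x + (?th * tan \<tau>) *\<^sub>R ?x)"
      unfolding y_def blinfun.scaleR_right[of "Jt t0"] JtD(1) by (simp add: scaleR_add_right scaleR_diff_right)
    have J1y: "?J1 y = (1/2) *\<^sub>R (B (E (t - t0) ?x) + (?th * tan \<tau>) *\<^sub>R E (t - t0) ?x)"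
    proof -
      have "?J1 y = E (t - t0) (?J0 y)" using E_add_apply[of "t - t0" t0 "J y"] by simp
      then show ?thesis unfolding J0y by (simp add: blinfun.add_right blinfun.scaleR_right B_E_apply)
    qed
    have sum_y: "?J0 y + ?J1 y = B ?x"
    proof (cases "?th = 0")
      case True
      then have "E (t - t0) ?x = ?x" unfolding E_frame[OF j] by simp
      with True B_zero[OF j] show ?thesis unfolding J0y J1y by simp
    next
      case False
      have E: "E (t - t0) ?x = cos (2 * \<tau>) *\<^sub>R ?x + (sin (2 * \<tau>) / ?th) *\<^sub>R B ?x"
        unfolding E_frame[OF j] dbl ..
      then have BE: "B (E (t - t0) ?x) = cos (2 * \<tau>) *\<^sub>R B ?x - (sin (2 * \<tau>) * ?th) *\<^sub>R ?x"
        using False by (simp add: blinfun.add_right blinfun.scaleR_right eig[OF j] power2_eq_square)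
      have lin: "(1/2) *\<^sub>R (u + (k * T) *\<^sub>R v) + (1/2) *\<^sub>R ((C *\<^sub>R u - (S * k) *\<^sub>R v) + (k * T) *\<^sub>R (C *\<^sub>R v + (S / k) *\<^sub>R u))
          = ((1 + C + T * S) / 2) *\<^sub>R u + (k * (T * (1 + C) - S) / 2) *\<^sub>R v"
        if "k \<noteq> 0" for u v :: 'a and k T C S :: real
        by (rule euclidean_eqI) (use that in \<open>simp add: inner_add_left inner_diff_left field_simps\<close>)
      show ?thesis unfolding J0y J1y BE unfolding E lin[OF False] tri by simp
    qed
    have "?x \<bullet> B ?x = 0" using skew[of ?x ?x] inner_commute[of ?x "B ?x"] by linarith
    then have xJ0y: "?x \<bullet> ?J0 y = ?th * tan \<tau> / 2"
      unfolding J0y using orthonormal_frame_inner[OF frame j j] by (simp add: inner_add_right)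
    have "?x \<bullet> ?J0 ?x = 0" using JtD(3)[of t0 ?x ?x] inner_commute[of ?x "?J0 ?x"] by linarith
    then have xy: "?x \<bullet> y = - (?x \<bullet> ?J0 (B ?x)) / 2"
      unfolding y_def by (simp only: blinfun.add_right blinfun.scaleR_right inner_add_right inner_scaleR_right) simp
    show ?thesis using q_sum[of ?x y] unfolding sum_y xJ0y xy \<tau>_def[symmetric]
      by (simp add: algebra_simps)
  qed
  \<comment> \<open>The imaginary contributions add up to a trace, which vanishes because
    \<open>?J0\<close> and \<open>B\<close> anticommute.\<close>
  have trace0: "(\<Sum>j<DIM('a). f j \<bullet> ?J0 (B (f j))) = 0"
  proof -
    have "trace_op (?J0 o\<^sub>L B) = trace_op (- (?J0 o\<^sub>L B))"
    proof -
      have "- (?J0 o\<^sub>L B) = B o\<^sub>L ?J0"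
        by (rule blinfun_eqI) (simp only: blinfun.minus_left blinfun_apply_blinfun_compose[of B] blinfun_apply_blinfun_compose[of "Jt t0" B] rot_anticommute[OF JB])
      then show ?thesis using trace_commute by metis
    qed
    then have "trace_op (?J0 o\<^sub>L B) = 0" by (simp add: trace_minus)
    then show ?thesis by (simp add: trace_frame[OF frame] inner_commute)
  qed
  have "ip \<phi> (K s) = (\<Sum>j<DIM('a). 1/4 * q (f j) (B (f j)))"
    unfolding K_def[abs_def] q_def using s_alt
    by (simp only: ip_sum_right ip_scale_right alternating_forms_scale cl_alternating)
  also have "\<dots> = (\<Sum>j<DIM('a). 1/4 * (- (of_real (\<theta> (j div 2) * tan ((t - t0) * \<theta> (j div 2) / 2) / 2) - \<i> / 2 * of_real (f j \<bullet> ?J0 (B (f j)))) * ?k))"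
    by (intro sum.cong refl) (simp only: summand lessThan_iff)
  also have "\<dots> = - (1/8) * of_real (\<Sum>j<DIM('a). \<theta> (j div 2) * tan ((t - t0) * \<theta> (j div 2) / 2)) * ?k
      + \<i> / 8 * of_real (\<Sum>j<DIM('a). f j \<bullet> ?J0 (B (f j))) * ?k"
    unfolding of_real_sum sum_distrib_left sum_distrib_right sum.distrib[symmetric]
    by (intro sum.cong refl) (simp add: algebra_simps)
  also have "(\<Sum>j<DIM('a). \<theta> (j div 2) * tan ((t - t0) * \<theta> (j div 2) / 2)) = 2 * (\<Sum>i<n. \<theta> i * tan ((t - t0) * \<theta> i / 2))"
    unfolding dim sum_lessThan_double by (simp add: sum_distrib_left)
  finally show ?thesis unfolding trace0 by (simp add: log_derivative_def)
qed

text \<open>Where the cosines are positive this is the square root of their product; in this form it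
  is differentiated term by term.\<close>

definition \<kappa> :: "real \<Rightarrow> real" where
  "\<kappa> u = exp ((\<Sum>i<n. ln (cos (u * \<theta> i / 2))) / 2)"

lemma \<kappa>_pos: "0 < \<kappa> u" by (simp add: \<kappa>_def)

lemma \<kappa>_0: "\<kappa> 0 = 1" by (simp add: \<kappa>_def)

lemma log_derivative_minus: "log_derivative (- u) = - log_derivative u"
  by (simp add: log_derivative_def sum_negf)

lemma \<kappa>_deriv:
  assumes "\<bar>u\<bar> \<le> 1"
  shows "(\<kappa> has_real_derivative log_derivative u * \<kappa> u) (at u within S)"
proof -
  have "((\<lambda>u. ln (cos (u * \<theta> i / 2))) has_real_derivative - (\<theta> i * tan (u * \<theta> i / 2)) / 2) (at u within S)" if "i < n" for i
    using cos_half_pos[OF that assms] by (auto intro!: derivative_eq_intros simp: tan_def field_simps)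
  then have "((\<lambda>u. (\<Sum>i<n. ln (cos (u * \<theta> i / 2))) / 2) has_real_derivative (\<Sum>i<n. - (\<theta> i * tan (u * \<theta> i / 2)) / 2) / 2) (at u within S)"
    by (intro DERIV_cdivide DERIV_sum) auto
  also have "(\<Sum>i<n. - (\<theta> i * tan (u * \<theta> i / 2)) / 2) / 2 = log_derivative u"
    by (simp add: log_derivative_def sum_negf flip: sum_divide_distrib)
  finally have "((\<lambda>u. exp ((\<Sum>i<n. ln (cos (u * \<theta> i / 2))) / 2)) has_real_derivative
      exp ((\<Sum>i<n. ln (cos (u * \<theta> i / 2))) / 2) * log_derivative u) (at u within S)"
    by (rule DERIV_chain2[OF DERIV_exp])
  then show ?thesis by (simp add: \<kappa>_def[abs_def] mult.commute)
qed

text \<open>The section \<open>P t \<psi> / \<kappa> (t - t0)\<close> satisfies \<open>s' = K s\<close>, and \<open>K s\<close> is orthogonal to the fibre.\<close>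

definition transport_H :: "real \<Rightarrow> ('a list \<Rightarrow> complex) \<Rightarrow> real \<Rightarrow> 'a list \<Rightarrow> complex" where
  "transport_H t0 \<psi> t vs = of_real (inverse (\<kappa> (t - t0))) * P t \<psi> vs"

lemma transport_H_fibre:
  assumes "\<psi> \<in> alternating_forms"
  shows "transport_H t0 \<psi> t \<in> fibre_H (Jt t)"
  using fibre_H_lincomb[OF Jt.vacuum_proj_fibre[OF assms] Jt.vacuum_proj_fibre[OF assms], of "of_real (inverse (\<kappa> (t - t0)))" t 0]
  by (simp add: transport_H_def[abs_def])

lemma transport_H_init: "\<psi> \<in> fibre_H (Jt t0) \<Longrightarrow> transport_H t0 \<psi> t0 = \<psi>"
  by (rule ext) (simp add: transport_H_def \<kappa>_0 Jt.vacuum_proj_fix)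

text \<open>Tested against the fibre at \<open>t\<close>, this is \<open>ip_K\<close> with the two
  times exchanged; the tangents are odd, hence the sign.\<close>

lemma P_K:
  assumes \<psi>: "\<psi> \<in> fibre_H (Jt t0)" and t: "\<bar>t - t0\<bar> \<le> 1"
  shows "P t (K \<psi>) = (\<lambda>vs. - of_real (log_derivative (t - t0)) * P t \<psi> vs)"
proof (rule fibre_H_eqI)
  note \<psi>_alt = Jt.fibre_HD(1)[OF \<psi>]
  show "P t (K \<psi>) \<in> fibre_H (Jt t)" by (rule Jt.vacuum_proj_fibre) (use \<psi>_alt in simp)
  show "(\<lambda>vs. - of_real (log_derivative (t - t0)) * P t \<psi> vs) \<in> fibre_H (Jt t)"
    using fibre_H_lincomb[OF Jt.vacuum_proj_fibre[OF \<psi>_alt] Jt.vacuum_proj_fibre[OF \<psi>_alt], of "- of_real (log_derivative (t - t0))" t 0]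
    by simp
  fix \<theta> assume \<theta>: "\<theta> \<in> fibre_H (Jt t)"
  have "ip \<theta> (P t (K \<psi>)) = ip \<theta> (K \<psi>)" by (rule Jt.ip_vacuum_proj[OF \<theta>]) (use \<psi>_alt in simp)
  also have "\<dots> = of_real (log_derivative (t0 - t)) * ip \<theta> \<psi>"
    by (rule ip_K[OF \<theta> \<psi>]) (use t in linarith)
  also have "log_derivative (t0 - t) = - log_derivative (t - t0)"
    using log_derivative_minus[of "t - t0"] by simp
  also have "ip \<theta> \<psi> = ip \<theta> (P t \<psi>)" by (rule Jt.ip_vacuum_proj[OF \<theta> \<psi>_alt, symmetric])
  finally show "ip \<theta> (P t (K \<psi>)) = ip \<theta> (\<lambda>vs. - of_real (log_derivative (t - t0)) * P t \<psi> vs)"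
    using Jt.fibre_HD(1)[OF Jt.vacuum_proj_fibre[OF \<psi>_alt]] by (simp only: ip_scale_right of_real_minus)
qed

lemma transport_H_deriv:
  assumes \<psi>: "\<psi> \<in> fibre_H (Jt t0)" and t0: "t0 \<in> {0..1}" and t: "t \<in> {0..1}"
  shows "has_form_derivative (transport_H t0 \<psi>) (K (transport_H t0 \<psi> t)) t {0..1}"
  unfolding has_form_derivative_def
proof
  fix vs
  let ?k = "\<kappa> (t - t0)" and ?l = "log_derivative (t - t0)"
  have abs: "\<bar>t - t0\<bar> \<le> 1" using t t0 by auto
  have nb: "at t within {0..1} \<noteq> bot" using t by (simp add: trivial_limit_within islimpt_Icc)
  have "((\<lambda>r. r - t0) has_real_derivative 1) (at t within {0..1})" by (auto intro!: derivative_eq_intros)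
  from DERIV_image_chain[OF \<kappa>_deriv[OF abs] this]
  have "((\<lambda>r. \<kappa> (r - t0)) has_real_derivative ?l * ?k) (at t within {0..1})" by (simp add: o_def)
  then have "((\<lambda>r. inverse (\<kappa> (r - t0))) has_real_derivative - (inverse ?k * ?l)) (at t within {0..1})"
    using \<kappa>_pos[of "t - t0"] by (auto intro!: derivative_eq_intros simp: field_simps power2_eq_square)
  then have d1: "((\<lambda>r. complex_of_real (inverse (\<kappa> (r - t0)))) has_vector_derivative of_real (- (inverse ?k * ?l))) (at t within {0..1})"
    by (intro has_vector_derivative_of_real) (simp add: has_real_derivative_iff_has_vector_derivative)
  have d2: "((\<lambda>r. P r \<psi> vs) has_vector_derivative K (P t \<psi>) vs - P t (K \<psi>) vs) (at t within {0..1})"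
    using P_derivative[OF t nb Jt.fibre_HD(1)[OF \<psi>]] by (simp add: has_form_derivative_def)
  have "((\<lambda>r. of_real (inverse (\<kappa> (r - t0))) * P r \<psi> vs) has_vector_derivative
     of_real (inverse ?k) * (K (P t \<psi>) vs - P t (K \<psi>) vs) + of_real (- (inverse ?k * ?l)) * P t \<psi> vs) (at t within {0..1})"
    by (rule has_vector_derivative_mult[OF d1 d2])
  also have "of_real (inverse ?k) * (K (P t \<psi>) vs - P t (K \<psi>) vs) + of_real (- (inverse ?k * ?l)) * P t \<psi> vs = K (transport_H t0 \<psi> t) vs"
    unfolding transport_H_def[abs_def] K_scale P_K[OF \<psi> abs] by (simp add: algebra_simps)
  finally show "((\<lambda>r. transport_H t0 \<psi> r vs) has_vector_derivative K (transport_H t0 \<psi> t) vs) (at t within {0..1})"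
    by (simp only: transport_H_def)
qed

text \<open>This is \<open>ip_K\<close> at equal times, where all tangents vanish.\<close>

lemma proj_K_zero:
  assumes "s \<in> fibre_H (Jt t)"
  shows "proj_H e (Jt t) (K s) = (\<lambda>vs. 0)"
proof (rule proj_H_eqI)
  show "K s \<in> alternating_forms" using Jt.fibre_HD(1)[OF assms] by simp
  show "(\<lambda>vs. 0) \<in> fibre_H (Jt t)" using fibre_H_lincomb[OF assms assms, of 0 0] by simp
  show "ip \<phi> (K s) = ip \<phi> (\<lambda>vs. 0)" if "\<phi> \<in> fibre_H (Jt t)" for \<phi>
    using ip_K[OF that assms] by (simp add: log_derivative_def ip_zero_right)
qed

end

section \<open>Parallel sections along the curve: existence, uniqueness, isometry\<close>

locale rotation_curve = complex_rotation +
  fixes \<gamma> :: "real \<Rightarrow> 'a \<Rightarrow>\<^sub>L 'a"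
  assumes \<gamma>: "t \<in> {0..1} \<Longrightarrow> \<gamma> t = Jt t"
begin

lemma transport_H_parallel:
  assumes \<psi>: "\<psi> \<in> fibre_H (Jt t0)" and t0: "t0 \<in> {0..1}"
  shows "has_cov_H e \<gamma> (transport_H t0 \<psi>) (\<lambda>t vs. 0)"
  unfolding has_cov_H_def
proof (intro ballI conjI)
  fix t :: real assume t: "t \<in> {0..1}"
  show F: "transport_H t0 \<psi> t \<in> fibre_H (\<gamma> t)"
    using transport_H_fibre[OF Jt.fibre_HD(1)[OF \<psi>]] by (simp add: \<gamma>[OF t])
  show "\<exists>s'. (\<forall>vs. ((\<lambda>r. transport_H t0 \<psi> r vs) has_vector_derivative s' vs) (at t within {0..1})) \<and>
           (\<lambda>vs. 0) = proj_H e (\<gamma> t) s'"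
    using transport_H_deriv[OF \<psi> t0 t] proj_K_zero[of "transport_H t0 \<psi> t" t] F
    by (intro exI[of _ "K (transport_H t0 \<psi> t)"]) (simp add: has_form_derivative_def \<gamma>[OF t])
qed

lemma has_cov_H_fibre: "has_cov_H e \<gamma> s Ds \<Longrightarrow> t \<in> {0..1} \<Longrightarrow> s t \<in> fibre_H (Jt t)"
  using \<gamma>[of t] by (metis has_cov_H_def)

lemma has_cov_HD:
  assumes "has_cov_H e \<gamma> s Ds" "t \<in> {0..1}"
  obtains s' where "has_form_derivative s s' t {0..1}" "s' \<in> alternating_forms" "Ds t = P t s'"
    "\<And>\<phi>. \<phi> \<in> fibre_H (Jt t) \<Longrightarrow> ip \<phi> s' = ip \<phi> (Ds t)"
proof -
  have fib: "s r \<in> alternating_forms" if "r \<in> {0..1}" for r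
    using assms(1) that by (auto simp: has_cov_H_def fibre_H_def)
  from assms obtain s' where s': "has_form_derivative s s' t {0..1}" "Ds t = proj_H e (\<gamma> t) s'"
    unfolding has_cov_H_def has_form_derivative_def by blast
  have alt: "s' \<in> alternating_forms"
    by (rule alternating_form_derivative[OF s'(1) assms(2) _ fib])
      (use assms(2) in \<open>auto simp: trivial_limit_within islimpt_Icc\<close>)
  have "Ds t = P t s'" using s'(2) Jt.proj_H_eq[OF alt] by (simp add: \<gamma>[OF assms(2)])
  then show thesis using that[OF s'(1) alt] Jt.ip_vacuum_proj[OF _ alt] by simp
qed

text \<open>The derivative of a parallel section is orthogonal to the fibre, so both terms of the
  product rule vanish. Uniqueness and the isometry property both rest on this.\<close>

lemma parallel_ip_constant:
  assumes s1: "has_cov_H e \<gamma> s1 (\<lambda>t vs. 0)" and s2: "has_cov_H e \<gamma> s2 (\<lambda>t vs. 0)" and t: "t \<in> {0..1}"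
  shows "ip (s1 t) (s2 t) = ip (s1 0) (s2 0)"
proof -
  have fib: "s1 r \<in> fibre_H (Jt r)" "s2 r \<in> fibre_H (Jt r)" if "r \<in> {0..1}" for r
    using has_cov_H_fibre[OF s1 that] has_cov_H_fibre[OF s2 that] by blast+
  note alt = Jt.fibre_HD(1)[OF fib(1)] Jt.fibre_HD(1)[OF fib(2)]
  have "((\<lambda>r. ip (s1 r) (s2 r)) has_vector_derivative 0) (at r within {0..1})" if r: "r \<in> {0..1}" for r
  proof -
    obtain s1' where s1': "has_form_derivative s1 s1' r {0..1}" "s1' \<in> alternating_forms"
      "\<And>\<phi>. \<phi> \<in> fibre_H (Jt r) \<Longrightarrow> ip \<phi> s1' = ip \<phi> (\<lambda>vs. 0)"
      using has_cov_HD[OF s1 r] by metis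
    obtain s2' where s2': "has_form_derivative s2 s2' r {0..1}" "s2' \<in> alternating_forms"
      "\<And>\<phi>. \<phi> \<in> fibre_H (Jt r) \<Longrightarrow> ip \<phi> s2' = ip \<phi> (\<lambda>vs. 0)"
      using has_cov_HD[OF s2 r] by metis
    have "ip (s1 r) s2' = 0" using s2'(3)[OF fib(1)[OF r]] by (simp add: ip_zero_right)
    moreover have "ip s1' (s2 r) = 0"
      using s1'(3)[OF fib(2)[OF r]] ip_cnj[OF alt(2)[OF r] s1'(2)] by (simp add: ip_zero_right)
    ultimately show ?thesis
      using ip_derivative[OF s1'(1) s2'(1) r alt(2) s2'(2)] by simp
  qed
  then obtain c where "\<And>r. r \<in> {0..1} \<Longrightarrow> ip (s1 r) (s2 r) = c"
    using has_vector_derivative_zero_constant[of "{0..1}" "\<lambda>r. ip (s1 r) (s2 r)"] by auto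
  from this[OF t] this[of 0] show ?thesis by simp
qed

text \<open>The Leibniz rule for coefficients that depend on time. It is needed for the tensor
  product, where the half-form factors are written as multiples of one section and the multiples
  move to the forms.\<close>

lemma has_cov_H_combine:
  assumes s: "\<And>i. i < N \<Longrightarrow> has_cov_H e \<gamma> (s i) (Ds i)"
    and g: "\<And>i t. i < N \<Longrightarrow> t \<in> {0..1} \<Longrightarrow> (g i has_vector_derivative g' i t) (at t within {0..1})"
  shows "has_cov_H e \<gamma> (\<lambda>t vs. \<Sum>i<N. g i t * s i t vs) (\<lambda>t vs. \<Sum>i<(N::nat). g i t * Ds i t vs + g' i t * s i t vs)"
  unfolding has_cov_H_def
proof (intro ballI conjI)
  fix t :: real assume t: "t \<in> {0..1}"
  have fib: "s i t \<in> fibre_H (Jt t)" if "i < N" for i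
    using has_cov_H_fibre[OF s[OF that] t] .
  have fibre_sum: "(\<lambda>vs. \<Sum>i<M. c i * w i vs) \<in> fibre_H (Jt t)" if "\<And>i. i < M \<Longrightarrow> w i \<in> fibre_H (Jt t)" for M :: nat and c w
    using that
  proof (induction M)
    case 0
    have "(\<lambda>vs. 0) \<in> fibre_H (Jt t)"
      using transport_H_fibre[of "\<lambda>vs. 0" 0 t] fibre_H_lincomb[of _ "Jt t" _ 0 0] by fastforce
    then show ?case by simp
  next
    case (Suc M)
    then show ?case using fibre_H_lincomb[of "\<lambda>vs. \<Sum>i<M. c i * w i vs" "Jt t" "w M" 1 "c M"] by simp
  qed
  show "(\<lambda>vs. \<Sum>i<N. g i t * s i t vs) \<in> fibre_H (\<gamma> t)"
    unfolding \<gamma>[OF t] by (rule fibre_sum[OF fib])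
  have "\<exists>s'. has_form_derivative (s i) s' t {0..1} \<and> s' \<in> alternating_forms \<and> Ds i t = P t s' \<and>
     (\<forall>\<phi>\<in>fibre_H (Jt t). ip \<phi> s' = ip \<phi> (Ds i t))" if "i < N" for i
    using has_cov_HD[OF s[OF that] t] by metis
  then obtain s' where s': "\<And>i. i < N \<Longrightarrow> has_form_derivative (s i) (s' i) t {0..1}"
    "\<And>i. i < N \<Longrightarrow> s' i \<in> alternating_forms" "\<And>i. i < N \<Longrightarrow> Ds i t = P t (s' i)"
    "\<And>i \<phi>. i < N \<Longrightarrow> \<phi> \<in> fibre_H (Jt t) \<Longrightarrow> ip \<phi> (s' i) = ip \<phi> (Ds i t)"
    by metis
  have Ds_fib: "Ds i t \<in> fibre_H (Jt t)" if "i < N" for i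
    unfolding s'(3)[OF that] by (rule Jt.vacuum_proj_fibre[OF s'(2)[OF that]])
  let ?S' = "\<lambda>vs. \<Sum>i<N. g i t * s' i vs + g' i t * s i t vs"
  let ?D = "\<lambda>vs. \<Sum>i<N. g i t * Ds i t vs + g' i t * s i t vs"
  have alt: "s i t \<in> alternating_forms" "Ds i t \<in> alternating_forms" if "i < N" for i
    using Jt.fibre_HD(1) fib[OF that] Ds_fib[OF that] by blast+
  have "proj_H e (\<gamma> t) ?S' = ?D"
    unfolding \<gamma>[OF t]
  proof (rule proj_H_eqI)
    show "?S' \<in> alternating_forms" using s'(2) alt by (intro alternating_forms_sum alternating_forms_add alternating_forms_scale) auto
    have "?D = (\<lambda>vs. 1 * (\<Sum>i<N. g i t * Ds i t vs) + 1 * (\<Sum>i<N. g' i t * s i t vs))" by (simp add: sum.distrib)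
    also have "\<dots> \<in> fibre_H (Jt t)" by (intro fibre_H_lincomb fibre_sum fib Ds_fib)
    finally show "?D \<in> fibre_H (Jt t)" .
    show "ip \<phi> ?S' = ip \<phi> ?D" if "\<phi> \<in> fibre_H (Jt t)" for \<phi>
    proof -
      have lin: "ip \<phi> (\<lambda>vs. \<Sum>i<N. g i t * u i vs + g' i t * s i t vs) = (\<Sum>i<N. g i t * ip \<phi> (u i) + g' i t * ip \<phi> (s i t))"
        if u: "\<And>i. i < N \<Longrightarrow> u i \<in> alternating_forms" for u
      proof -
        have "ip \<phi> (\<lambda>vs. \<Sum>i<N. g i t * u i vs + g' i t * s i t vs) = (\<Sum>i<N. ip \<phi> (\<lambda>vs. g i t * u i vs + g' i t * s i t vs))"
          by (rule ip_sum_right) (use u alt in auto)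
        also have "\<dots> = (\<Sum>i<N. g i t * ip \<phi> (u i) + g' i t * ip \<phi> (s i t))"
          by (intro sum.cong refl) (simp add: ip_add_right ip_scale_right u alt)
        finally show ?thesis .
      qed
      note lin[of s', OF s'(2)] lin[of "\<lambda>i. Ds i t", OF alt(2)]
      then show ?thesis using s'(4)[OF _ that] by simp
    qed
  qed
  moreover have "((\<lambda>r. \<Sum>i<N. g i r * s i r vs) has_vector_derivative ?S' vs) (at t within {0..1})" for vs
    using s'(1) g[OF _ t] unfolding has_form_derivative_def
    by (intro has_vector_derivative_sum has_vector_derivative_mult) auto
  ultimately show "\<exists>s'. (\<forall>vs. ((\<lambda>r. \<Sum>i<N. g i r * s i r vs) has_vector_derivative s' vs) (at t within {0..1})) \<and>
     (\<lambda>vs. \<Sum>i<N. g i t * Ds i t vs + g' i t * s i t vs) = proj_H e (\<gamma> t) s'"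
    by (intro exI[of _ ?S']) simp
qed

lemma parallel_unique:
  assumes s1: "has_cov_H e \<gamma> s1 (\<lambda>t vs. 0)" and s2: "has_cov_H e \<gamma> s2 (\<lambda>t vs. 0)"
    and init: "s1 0 = s2 0" and t: "t \<in> {0..1}"
  shows "s1 t = s2 t"
proof -
  have alt: "s1 r \<in> alternating_forms" "s2 r \<in> alternating_forms" if "r \<in> {0..1}" for r
    using s1 s2 that by (auto simp: has_cov_H_def fibre_H_def)
  have z: "(0::real) \<in> {0..1}" by simp
  have expand: "ip (\<lambda>vs. s1 r vs - s2 r vs) (\<lambda>vs. s1 r vs - s2 r vs) = ip (s1 r) (s1 r) - ip (s1 r) (s2 r) - (ip (s2 r) (s1 r) - ip (s2 r) (s2 r))"
    if "r \<in> {0..1}" for r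
    using alt[OF that] by (simp add: ip_diff_right ip_diff_left)
  have "ip (\<lambda>vs. s1 t vs - s2 t vs) (\<lambda>vs. s1 t vs - s2 t vs) = ip (\<lambda>vs. s1 0 vs - s2 0 vs) (\<lambda>vs. s1 0 vs - s2 0 vs)"
    unfolding expand[OF t] expand[OF z]
    using parallel_ip_constant[OF s1 s1 t] parallel_ip_constant[OF s1 s2 t]
      parallel_ip_constant[OF s2 s1 t] parallel_ip_constant[OF s2 s2 t] by simp
  also have "\<dots> = 0" unfolding init by (simp add: ip_zero_right)
  finally have "(\<lambda>vs. s1 t vs - s2 t vs) = (\<lambda>vs. 0)"
    using alt[OF t] by (intro ip_definite) simp_all
  then show ?thesis by (simp add: fun_eq_iff)
qed

abbreviation "UH \<psi> \<equiv> transport_H 0 \<psi> 1"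

lemma UH_fibre: "\<psi> \<in> fibre_H (Jt 0) \<Longrightarrow> UH \<psi> \<in> fibre_H (Jt 1)"
  using transport_H_fibre[OF Jt.fibre_HD(1)] by blast

lemma UH_isometry:
  assumes "\<psi> \<in> fibre_H (Jt 0)" "\<phi> \<in> fibre_H (Jt 0)"
  shows "ip (UH \<psi>) (UH \<phi>) = ip \<psi> \<phi>"
  using parallel_ip_constant[OF transport_H_parallel[OF assms(1)] transport_H_parallel[OF assms(2)], of 1]
  by (simp add: transport_H_init assms)

lemma UH_transport: "is_transport (\<lambda>s. has_cov_H e \<gamma> s (\<lambda>t vs. 0)) (fibre_H (Jt 0)) UH"
  unfolding is_transport_def
proof (intro ballI allI iffI)
  fix \<psi> y assume \<psi>: "\<psi> \<in> fibre_H (Jt 0)"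
  have par: "has_cov_H e \<gamma> (transport_H 0 \<psi>) (\<lambda>t vs. 0)" by (rule transport_H_parallel[OF \<psi>]) simp
  {
    assume "\<exists>s. has_cov_H e \<gamma> s (\<lambda>t vs. 0) \<and> s 0 = \<psi> \<and> s 1 = y"
    then obtain s where s: "has_cov_H e \<gamma> s (\<lambda>t vs. 0)" "s 0 = \<psi>" "s 1 = y" by blast
    then show "y = UH \<psi>"
      using parallel_unique[OF s(1) par, of 1] transport_H_init[OF \<psi>] by simp
  next
    assume "y = UH \<psi>"
    then show "\<exists>s. has_cov_H e \<gamma> s (\<lambda>t vs. 0) \<and> s 0 = \<psi> \<and> s 1 = y"
      using par transport_H_init[OF \<psi>] by (intro exI[of _ "transport_H 0 \<psi>"]) simp
  }
qed

text \<open>A preimage is found by transporting back from time 1, for which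
  \<open>transport_H\<close> allows any base time \<open>t0\<close>.\<close>

lemma UH_surj:
  assumes \<phi>: "\<phi> \<in> fibre_H (Jt 1)"
  obtains \<psi> where "\<psi> \<in> fibre_H (Jt 0)" "UH \<psi> = \<phi>"
proof -
  let ?s = "transport_H 1 \<phi>"
  have par: "has_cov_H e \<gamma> ?s (\<lambda>t vs. 0)" by (rule transport_H_parallel[OF \<phi>]) simp
  have fib: "?s 0 \<in> fibre_H (Jt 0)" by (rule transport_H_fibre[OF Jt.fibre_HD(1)[OF \<phi>]])
  have "UH (?s 0) = ?s 1"
    by (rule parallel_unique[OF transport_H_parallel[OF fib] par]) (simp_all add: transport_H_init[OF fib])
  then show thesis using that[OF fib] transport_H_init[OF \<phi>] by simp
qed

end

subsection \<open>Polyvectors\<close>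

definition cevec :: "'a::euclidean_space cvec \<Rightarrow> ('a \<Rightarrow>\<^sub>L real) \<Rightarrow> complex" where
  "cevec z = (\<lambda>\<alpha>. Complex (blinfun_apply \<alpha> (fst z)) (blinfun_apply \<alpha> (snd z)))"

definition cconj :: "'a::euclidean_space cvec \<Rightarrow> 'a cvec" where
  "cconj z = (fst z, - snd z)"

lemma wedge_vecs_simps [simp]:
  "wedge_vecs [] = (\<lambda>\<alpha>s. if \<alpha>s = [] then 1 else 0)"
  "wedge_vecs (z # zs) = wedge (one_form (cevec z)) (wedge_vecs zs)"
  by (simp_all add: wedge_vecs_def cevec_def)

lemma cevec_add: "cevec (x + y) = (\<lambda>\<alpha>. cevec x \<alpha> + cevec y \<alpha>)"
  by (auto simp: cevec_def blinfun.add_right complex_eq_iff)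

lemma cevec_scale: "cevec (cvec_scale c x) = (\<lambda>\<alpha>. c * cevec x \<alpha>)"
  by (auto simp: cevec_def cvec_scale_def blinfun.add_right blinfun.diff_right blinfun.scaleR_right complex_eq_iff)

lemma cevec_cconj: "cevec (cconj z) = (\<lambda>\<alpha>. cnj (cevec z \<alpha>))"
  by (auto simp: cevec_def cconj_def blinfun.minus_right complex_eq_iff)

lemma wedge_vecs_move: "wedge_vecs (vs @ x # ws) = (\<lambda>\<alpha>s. (-1) ^ length vs * wedge_vecs (x # vs @ ws) \<alpha>s)"
proof (induction vs)
  case (Cons v vs)
  show ?case
  proof
    fix \<alpha>s
    have "wedge_vecs ((v # vs) @ x # ws) \<alpha>s = (-1) ^ length vs * wedge (one_form (cevec v)) (wedge (one_form (cevec x)) (wedge_vecs (vs @ ws))) \<alpha>s"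
      by (simp add: Cons wedge_scale_right)
    then show "wedge_vecs ((v # vs) @ x # ws) \<alpha>s = (-1) ^ length (v # vs) * wedge_vecs (x # (v # vs) @ ws) \<alpha>s"
      by (simp add: wedge_one_form_anticommute[of "cevec v"])
  qed
qed simp

lemma alternating_wedge_vecs: "alternating cvec_scale (\<lambda>c. c) (\<lambda>zs. wedge_vecs zs \<alpha>s)"
proof -
  have add: "wedge_vecs (us @ (x + y) # vs) = (\<lambda>\<alpha>s. wedge_vecs (us @ x # vs) \<alpha>s + wedge_vecs (us @ y # vs) \<alpha>s)"
    for us vs and x y :: "'a cvec"
    by (induction us) (auto simp: cevec_add wedge_one_form_add wedge_add_right)
  have scale: "wedge_vecs (us @ cvec_scale c x # vs) = (\<lambda>\<alpha>s. c * wedge_vecs (us @ x # vs) \<alpha>s)"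
    for us vs c and x :: "'a cvec"
    by (induction us) (auto simp: cevec_scale wedge_one_form_scale wedge_scale_right)
  have rep: "wedge_vecs (us @ x # vs @ x # ws) = (\<lambda>\<alpha>s. 0)" for us vs ws and x :: "'a cvec"
  proof (induction us)
    case Nil
    have "wedge_vecs (x # vs @ x # ws) = wedge (one_form (cevec x)) (wedge_vecs (vs @ x # ws))" by simp
    also have "\<dots> = (\<lambda>\<alpha>s. (-1) ^ length vs * wedge (one_form (cevec x)) (wedge (one_form (cevec x)) (wedge_vecs (vs @ ws))) \<alpha>s)"
      unfolding wedge_vecs_move by (rule ext) (simp add: wedge_scale_right)
    finally show ?case by (simp add: wedge_one_form_self)
  next
    case (Cons u us)
    then show ?case by (auto simp: wedge_zero_right)
  qed
  show ?thesis unfolding alternating_def add scale rep by simp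
qed

lemma wedge_unit_left: "wedge (\<lambda>us. if us = [] then 1 else 0) \<phi> vs = \<phi> vs"
proof (induction vs arbitrary: \<phi>)
  case (Cons v vs)
  have "(\<lambda>us. (- 1) ^ length us * (if us = [] then 1 else 0)) = (\<lambda>us::'a list. if us = [] then 1 else (0::complex))"
    by auto
  with Cons show ?case by (simp add: wedge_Cons wedge_zero_left)
qed (simp add: wedge_Nil)

lemma wedge_vecs_append: "wedge_vecs (xs @ ys) = wedge (wedge_vecs xs) (wedge_vecs ys)"
  by (induction xs) (auto simp: wedge_unit_left wedge_assoc)

lemma conj_form_wedge_vecs: "conj_form (wedge_vecs zs) = wedge_vecs (map cconj zs)"
proof (induction zs)
  case Nil
  show ?case by (auto simp: conj_form_def)
next
  case (Cons z zs)
  have "conj_form (one_form (cevec z)) = one_form (cevec (cconj z))"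
    by (auto simp: conj_form_def one_form_def cevec_cconj)
  with Cons show ?case by (simp add: conj_form_wedge)
qed

text \<open>In contrast to \<open>alternating_map\<close> the scalars may change along
  \<open>g\<close>, which leads from real to complexified vectors.\<close>

lemma alternating_pullback:
  assumes F: "alternating sc h F" and "\<And>x y. A (x + y) = A x + A y" "\<And>r x. A (sc' r x) = sc (g r) (A x)"
  shows "alternating sc' (\<lambda>r. h (g r)) (\<lambda>vs. F (map A vs))"
  unfolding alternating_def
proof (intro conjI allI)
  show "F (map A (us @ x # vs @ x # ws)) = 0" for us vs ws x
    using alternating_repeat[OF F, of "map A us" "A x" "map A vs" "map A ws"] by simp
qed (simp_all add: assms(2,3) alternating_add[OF F] alternating_scale[OF F])

lemma alternating_append: "alternating sc h F \<Longrightarrow> alternating sc h (\<lambda>vs. F (us @ vs))"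
  unfolding alternating_def by (metis append.assoc)

definition dual_frame :: "(nat \<Rightarrow> 'a::euclidean_space) \<Rightarrow> ('a \<Rightarrow>\<^sub>L real) list" where
  "dual_frame e = map (\<lambda>i. blinfun_inner_right (e i)) [0..<DIM('a)]"

lemma wedge_vecs_dual_frame:
  fixes e :: "nat \<Rightarrow> 'a::euclidean_space"
  assumes e: "orthonormal_frame e"
  shows "wedge_vecs (map (\<lambda>i. (e i, 0)) [0..<DIM('a)]) (dual_frame e) = 1"
proof -
  have "wedge_vecs (map (\<lambda>i. (e i, 0)) ks) (map (\<lambda>i. blinfun_inner_right (e i)) ks) = 1"
    if "distinct ks" "set ks \<subseteq> {..<DIM('a)}" for ks
    using that
  proof (induction ks)
    case (Cons k ks)
    have "cevec (e k, 0) (blinfun_inner_right (e j)) = (if j = k then 1 else 0)" if "j < DIM('a)" for j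
      using that Cons.prems by (auto simp: cevec_def orthonormal_frame_inner[OF e] complex_eq_iff)
    then have "wedge (one_form (cevec (e k, 0))) \<phi> (map (\<lambda>i. blinfun_inner_right (e i)) ks) = 0" for \<phi>
      using Cons.prems by (intro wedge_one_form_eq_0) auto
    with Cons \<open>\<And>j. j < DIM('a) \<Longrightarrow> _\<close> show ?case by (simp add: wedge_one_form_Cons)
  qed simp
  then show ?thesis unfolding dual_frame_def by (simp add: lessThan_atLeast0)
qed

text \<open>For \<open>DIM('a)\<close> vectors this is the coefficient of their wedge product
  relative to the oriented unit volume element, a complex determinant.\<close>

definition top_eval :: "(nat \<Rightarrow> 'a::euclidean_space) \<Rightarrow> 'a cvec list \<Rightarrow> complex" where
  "top_eval e zs = wedge_vecs zs (dual_frame e)"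

lemma alternating_top_eval: "alternating cvec_scale (\<lambda>c. c) (top_eval e)"
  unfolding top_eval_def[abs_def] by (rule alternating_wedge_vecs)

lemma top_eval_real:
  fixes e :: "nat \<Rightarrow> 'a::euclidean_space"
  assumes e: "orthonormal_frame e" and len: "length vs = DIM('a)"
  shows "top_eval e (map (\<lambda>v. (v, 0)) vs) = of_real (vol_form inner e vs)"
proof -
  have "alternating scaleR (\<lambda>r. complex_of_real r) (\<lambda>vs. top_eval e (map (\<lambda>v. (v, 0)) vs))"
    by (rule alternating_pullback[OF alternating_top_eval, where g = of_real]) (simp_all add: cvec_scale_def)
  from alternating_frame_top[OF e this len] show ?thesis
    using wedge_vecs_dual_frame[OF e] by (simp add: top_eval_def o_def)
qed

lemma pair_K_wedge_vecs:
  fixes e :: "nat \<Rightarrow> 'a::euclidean_space"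
  shows "pair_K e (wedge_vecs xs) (wedge_vecs ys) = (-1) ^ ((DIM('a) div 2) * (DIM('a) div 2 - 1) div 2) * \<i> ^ (DIM('a) div 2)
    * top_eval e (map cconj xs @ ys)"
  by (simp add: pair_K_def Let_def conj_form_wedge_vecs top_eval_def dual_frame_def flip: wedge_vecs_append)

lemma pair_K_scale: "pair_K e (\<lambda>\<alpha>s. a * \<mu>' \<alpha>s) (\<lambda>\<alpha>s. b * \<mu> \<alpha>s) = cnj a * b * pair_K e \<mu>' \<mu>"
proof -
  have "conj_form (\<lambda>\<alpha>s. a * \<mu>' \<alpha>s) = (\<lambda>\<alpha>s. cnj a * conj_form \<mu>' \<alpha>s)" by (auto simp: conj_form_def)
  then show ?thesis by (simp add: pair_K_def Let_def wedge_scale_left wedge_scale_right)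
qed

text \<open>The \<open>y\<close> belonging to each index passes the \<open>x\<close> of all later
  indices. The total is the exponent of -1 in \<open>pair_K\<close>.\<close>

lemma alternating_interleave:
  assumes F: "alternating sc h F"
  shows "F (us @ map x ks @ map y ks) = (-1) ^ (length ks * (length ks - 1) div 2) * F (us @ concat (map (\<lambda>i. [x i, y i]) ks))"
proof (induction ks arbitrary: us)
  case (Cons i ks)
  let ?k = "length ks"
  have "F (us @ map x (i # ks) @ map y (i # ks)) = (-1) ^ ?k * F ((us @ [x i, y i]) @ map x ks @ map y ks)"
    using alternating_move[OF F, of "us @ [x i]" "map x ks" "y i" "map y ks"] by simp
  also have "\<dots> = (-1) ^ (?k + ?k * (?k - 1) div 2) * F (us @ concat (map (\<lambda>i. [x i, y i]) (i # ks)))"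
    unfolding Cons by (simp add: power_add)
  also have "?k + ?k * (?k - 1) div 2 = Suc ?k * (Suc ?k - 1) div 2"
  proof (cases ?k)
    case (Suc k)
    then have "Suc ?k * (Suc ?k - 1) = ?k * (?k - 1) + 2 * ?k" by (simp add: algebra_simps)
    then show ?thesis by simp
  qed simp
  finally show ?case by simp
qed simp

lemma wedge_one_form_derivative:
  assumes \<alpha>: "\<And>u. ((\<lambda>r. \<alpha> r u) has_vector_derivative \<alpha>' u) (at t within S)" and "has_form_derivative \<phi> \<phi>' t S"
  shows "has_form_derivative (\<lambda>r. wedge (one_form (\<alpha> r)) (\<phi> r)) (\<lambda>vs. wedge (one_form \<alpha>') (\<phi> t) vs + wedge (one_form (\<alpha> t)) \<phi>' vs) t S"
  unfolding has_form_derivative_def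
proof
  fix vs
  show "((\<lambda>r. wedge (one_form (\<alpha> r)) (\<phi> r) vs) has_vector_derivative
      wedge (one_form \<alpha>') (\<phi> t) vs + wedge (one_form (\<alpha> t)) \<phi>' vs) (at t within S)"
    using assms(2)
  proof (induction vs arbitrary: \<phi> \<phi>')
    case (Cons u vs)
    have "has_form_derivative (\<lambda>r us. \<phi> r (u # us)) (\<lambda>us. \<phi>' (u # us)) t S"
      using Cons.prems by (simp add: has_form_derivative_def)
    from has_vector_derivative_diff[OF has_vector_derivative_mult[OF \<alpha>[of u] Cons.prems[unfolded has_form_derivative_def, rule_format, of vs]] Cons.IH[OF this]]
    show ?case by (simp add: wedge_one_form_Cons algebra_simps)
  qed (simp add: wedge_one_form_Nil)
qed

lemma cevec_derivative:
  assumes "(z has_vector_derivative z') (at t within S)"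
  shows "((\<lambda>r. cevec (z r) \<alpha>) has_vector_derivative cevec z' \<alpha>) (at t within S)"
proof -
  have "((\<lambda>r. of_real (blinfun_apply \<alpha> (fst (z r))) + \<i> * of_real (blinfun_apply \<alpha> (snd (z r)))) has_vector_derivative
      of_real (blinfun_apply \<alpha> (fst z')) + \<i> * of_real (blinfun_apply \<alpha> (snd z'))) (at t within S)"
    by (intro has_vector_derivative_add has_vector_derivative_mult_right has_vector_derivative_of_real)
      (simp_all add: has_real_derivative_iff_has_vector_derivative
        bounded_linear.has_vector_derivative[OF bounded_linear_compose[OF blinfun.bounded_linear_right bounded_linear_fst] assms]
        bounded_linear.has_vector_derivative[OF bounded_linear_compose[OF blinfun.bounded_linear_right bounded_linear_snd] assms])
  moreover have "of_real a + \<i> * of_real b = Complex a b" for a b by (simp add: complex_eq_iff)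
  ultimately show ?thesis by (simp add: cevec_def)
qed

lemma wedge_vecs_derivative:
  assumes "\<And>i. i < length zs \<Longrightarrow> ((zs ! i) has_vector_derivative d i) (at t within S)"
  shows "has_form_derivative (\<lambda>r. wedge_vecs (map (\<lambda>z. z r) zs))
    (\<lambda>\<alpha>s. \<Sum>i<length zs. wedge_vecs ((map (\<lambda>z. z t) zs)[i := d i]) \<alpha>s) t S"
  using assms
proof (induction zs arbitrary: d)
  case Nil
  show ?case by (simp add: has_form_derivative_def)
next
  case (Cons z zs)
  have "has_form_derivative (\<lambda>r. wedge_vecs (map (\<lambda>z. z r) zs))
    (\<lambda>\<alpha>s. \<Sum>i<length zs. wedge_vecs ((map (\<lambda>z. z t) zs)[i := d (Suc i)]) \<alpha>s) t S"
  proof (rule Cons.IH)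
    show "((zs ! i) has_vector_derivative d (Suc i)) (at t within S)" if "i < length zs" for i
      using Cons.prems[of "Suc i"] that by simp
  qed
  from wedge_one_form_derivative[OF cevec_derivative this] Cons.prems[of 0]
  have "has_form_derivative (\<lambda>r. wedge (one_form (cevec (z r))) (wedge_vecs (map (\<lambda>z. z r) zs)))
     (\<lambda>\<alpha>s. wedge (one_form (cevec (d 0))) (wedge_vecs (map (\<lambda>z. z t) zs)) \<alpha>s +
       wedge (one_form (cevec (z t))) (\<lambda>\<alpha>s. \<Sum>i<length zs. wedge_vecs ((map (\<lambda>z. z t) zs)[i := d (Suc i)]) \<alpha>s) \<alpha>s) t S"
    by simp
  then show ?case by (simp add: wedge_sum_right sum.lessThan_Suc_shift del: sum.lessThan_Suc)
qed

lemma cvec_map_add: "cvec_map A (x + y) = cvec_map A x + cvec_map A y"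
  by (simp add: cvec_map_def blinfun.add_right)

lemma cvec_map_scale: "cvec_map A (cvec_scale c x) = cvec_scale c (cvec_map A x)"
  by (simp add: cvec_map_def cvec_scale_def blinfun.add_right blinfun.diff_right blinfun.scaleR_right)

lemma cvec_scale_real: "cvec_scale (of_real r) z = r *\<^sub>R z"
  by (simp add: cvec_scale_def prod_eq_iff)

section \<open>Bases of the eigenspaces and coordinates on their top exterior powers\<close>

context complex_frame_setting
begin

lemma V10_iff: "z \<in> V10 J \<longleftrightarrow> snd z = - J (fst z)"
  by (auto simp: V10_def cvec_map_def cvec_scale_def prod_eq_iff JJ blinfun.minus_right)

lemma V01_iff: "z \<in> V01 J \<longleftrightarrow> snd z = J (fst z)"
  by (auto simp: V01_def cvec_map_def cvec_scale_def prod_eq_iff JJ blinfun.minus_right)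

lemma cconj_V10: "cconj z \<in> V01 J \<longleftrightarrow> z \<in> V10 J"
  by (simp add: V10_iff V01_iff cconj_def) (metis minus_minus)

definition zvec :: "nat \<Rightarrow> 'a cvec" where
  "zvec i = (b i, - J (b i))"

lemma zvec_V10: "zvec i \<in> V10 J"
  by (simp add: zvec_def V10_iff)

lemma V10_expand:
  assumes "z \<in> V10 J"
  shows "z = (\<Sum>i<n. cvec_scale (Complex (fst z \<bullet> b i) (fst z \<bullet> J (b i))) (zvec i))"
proof -
  let ?x = "fst z"
  have "cvec_scale (Complex (?x \<bullet> b i) (?x \<bullet> J (b i))) (zvec i)
      = ((?x \<bullet> b i) *\<^sub>R b i + (?x \<bullet> J (b i)) *\<^sub>R J (b i), - J ((?x \<bullet> b i) *\<^sub>R b i + (?x \<bullet> J (b i)) *\<^sub>R J (b i)))" for i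
    by (simp add: cvec_scale_def zvec_def blinfun.add_right blinfun.scaleR_right JJ)
  then have "(\<Sum>i<n. cvec_scale (Complex (?x \<bullet> b i) (?x \<bullet> J (b i))) (zvec i))
      = (\<Sum>i<n. (?x \<bullet> b i) *\<^sub>R b i + (?x \<bullet> J (b i)) *\<^sub>R J (b i), - J (\<Sum>i<n. (?x \<bullet> b i) *\<^sub>R b i + (?x \<bullet> J (b i)) *\<^sub>R J (b i)))"
    by (simp add: sum_prod blinfun.sum_right sum_negf)
  also have "\<dots> = (?x, - J ?x)" by (simp only: frame_sum[symmetric])
  also have "\<dots> = z" using assms by (simp add: V10_iff prod_eq_iff)
  finally show ?thesis by simp
qed

lemma V10_expand_ex: "z \<in> V10 J \<Longrightarrow> \<exists>a. z = (\<Sum>i<n. cvec_scale (a i) (zvec i))"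
  by (rule exI[of _ "\<lambda>i. Complex (fst z \<bullet> b i) (fst z \<bullet> J (b i))"]) (rule V10_expand)

lemma V01_expand:
  assumes "z \<in> V01 J"
  shows "\<exists>a. z = (\<Sum>i<n. cvec_scale (a i) (cconj (zvec i)))"
proof -
  have "cconj (cconj z) = z" by (simp add: cconj_def)
  then have "cconj z \<in> V10 J" using assms cconj_V10[of "cconj z"] by simp
  then obtain a where a: "cconj z = (\<Sum>i<n. cvec_scale (a i) (zvec i))" using V10_expand_ex by blast
  have add: "cconj (x + y) = cconj x + cconj y" "cconj 0 = 0" for x y :: "'a cvec" by (simp_all add: cconj_def zero_prod_def)
  have "z = cconj (\<Sum>i<n. cvec_scale (a i) (zvec i))" using a \<open>cconj (cconj z) = z\<close> by simp
  also have "\<dots> = (\<Sum>i<n. cconj (cvec_scale (a i) (zvec i)))"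
    by (induction n) (simp_all add: add)
  also have "\<dots> = (\<Sum>i<n. cvec_scale (cnj (a i)) (cconj (zvec i)))"
    by (simp add: cconj_def cvec_scale_def)
  finally show ?thesis by (rule exI[of _ "\<lambda>i. cnj (a i)"])
qed

abbreviation "zs \<equiv> map zvec [0..<n]"
abbreviation "czs \<equiv> map (\<lambda>i. cconj (zvec i)) [0..<n]"

text \<open>An argument spanned by vectors that already stand among the others contributes nothing.
  It is applied to the bases of \<open>V10 J\<close> and of \<open>V01 J\<close>.\<close>

lemma kill:
  assumes F: "alternating sc h F" and z: "z = (\<Sum>i<n. sc (a i) (x i))"
    and sub: "x ` {..<n} \<subseteq> set us \<union> set vs"
  shows "F (us @ z # vs) = 0"
proof -
  have "F (us @ x i # vs) = 0" if "i < n" for i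
  proof (rule alternating_not_distinct[OF F])
    have "x i \<in> set us \<union> set vs" using that sub by auto
    then show "\<not> distinct (us @ x i # vs)" by auto
  qed
  then show ?thesis by (simp add: z alternating_sum[OF F] alternating_scale[OF F])
qed

lemma kill_V10:
  assumes "alternating cvec_scale h F" "z \<in> V10 J" "set zs \<subseteq> set us \<union> set vs"
  shows "F (us @ z # vs) = 0"
  by (rule kill[OF assms(1) V10_expand[OF assms(2)]]) (use assms(3) in \<open>simp add: lessThan_atLeast0\<close>)

lemma kill_V01:
  assumes "alternating cvec_scale h F" "z \<in> V01 J" "set czs \<subseteq> set us \<union> set vs"
  shows "F (us @ z # vs) = 0"
proof -
  obtain a where "z = (\<Sum>i<n. cvec_scale (a i) (cconj (zvec i)))" using V01_expand[OF assms(2)] by blast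
  then show ?thesis
    by (rule kill[OF assms(1)]) (use assms(3) in \<open>simp add: lessThan_atLeast0\<close>)
qed

lemma V10_proportional:
  assumes F: "alternating cvec_scale h F" and G: "alternating cvec_scale h G"
    and ys: "set ys \<subseteq> V10 J" "length ys = n"
  shows "F zs * G ys = G zs * F ys"
proof (rule alternating_proportional[OF F G ys(2)])
  fix v assume "v \<in> set ys"
  then have "v \<in> V10 J" using ys(1) by blast
  then show "\<exists>a. v = (\<Sum>i<n. cvec_scale (a i) (zvec i))" by (rule V10_expand_ex)
qed

text \<open>Wedging with the conjugate basis turns an n-vector into a number. On the line
  \<open>fibre_K J\<close> this is a coordinate up to the factor
  \<open>top_eval e (czs @ zs)\<close>.\<close>

definition coeff_K :: "(('a \<Rightarrow>\<^sub>L real) list \<Rightarrow> complex) \<Rightarrow> complex" where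
  "coeff_K \<mu> = wedge (wedge_vecs czs) \<mu> (dual_frame e)"

lemma coeff_K_wedge_vecs: "coeff_K (wedge_vecs ys) = top_eval e (czs @ ys)"
  by (simp add: coeff_K_def top_eval_def wedge_vecs_append)

lemma coeff_K_scale: "coeff_K (\<lambda>\<alpha>s. c * \<mu> \<alpha>s) = c * coeff_K \<mu>"
  by (simp add: coeff_K_def wedge_scale_right)

lemma coeff_K_sum: "coeff_K (\<lambda>\<alpha>s. \<Sum>i\<in>A. \<mu> i \<alpha>s) = (\<Sum>i\<in>A. coeff_K (\<mu> i))"
  by (simp add: coeff_K_def wedge_sum_right)

text \<open>With \<open>x = b k\<close> and \<open>y = J (b k)\<close> one has
  \<open>(x + \<i> y) \<and> (x - \<i> y) = - 2 \<i> (x \<and> y)\<close>.\<close>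

lemma top_eval_pairs:
  "top_eval e (us @ concat (map (\<lambda>i. [cconj (zvec i), zvec i]) ks))
    = (- 2 * \<i>) ^ length ks * top_eval e (us @ map (\<lambda>v. (v, 0)) (concat (map (\<lambda>v. [v, J v]) (map b ks))))"
proof (induction ks arbitrary: us)
  case (Cons k ks)
  note A = alternating_top_eval[of e]
  let ?x = "(b k, 0) :: 'a cvec" and ?y = "(J (b k), 0) :: 'a cvec"
  have z: "cconj (zvec k) = ?x + cvec_scale \<i> ?y" "zvec k = ?x + cvec_scale (- \<i>) ?y"
    by (simp_all add: zvec_def cconj_def cvec_scale_def)
  have "top_eval e (us @ cconj (zvec k) # zvec k # vs) = (- 2 * \<i>) * top_eval e (us @ ?x # ?y # vs)" for vs
  proof -
    have r: "top_eval e (us @ w # w # vs) = 0" for w using alternating_repeat[OF A, of us w "[]"] by simp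
    have a: "top_eval e (us @ w # (?x + cvec_scale (- \<i>) ?y) # vs) = top_eval e (us @ w # ?x # vs) - \<i> * top_eval e (us @ w # ?y # vs)" for w
      using alternating_add[OF A, of "us @ [w]" ?x "cvec_scale (- \<i>) ?y" vs] alternating_scale[OF A, of "us @ [w]" "- \<i>" ?y vs]
      by simp
    have "top_eval e (us @ cconj (zvec k) # zvec k # vs)
        = top_eval e (us @ ?x # zvec k # vs) + \<i> * top_eval e (us @ ?y # zvec k # vs)"
      unfolding z(1) by (simp only: alternating_add[OF A] alternating_scale[OF A])
    also have "\<dots> = - \<i> * top_eval e (us @ ?x # ?y # vs) + \<i> * top_eval e (us @ ?y # ?x # vs)"
      unfolding z(2) a r by simp
    also have "top_eval e (us @ ?y # ?x # vs) = - top_eval e (us @ ?x # ?y # vs)"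
      by (rule alternating_swap[OF A])
    finally show ?thesis by simp
  qed
  then show ?case using Cons[of "us @ [?x, ?y]"] by simp
qed simp

text \<open>This is where the constant in the pairing of \<open>fibre_K\<close> comes from.\<close>

lemma pair_K_zs:
  "pair_K e (wedge_vecs zs) (wedge_vecs zs) = of_real (2 ^ n * vol_form inner e (map (complex_frame J b) [0..<DIM('a)]))"
proof -
  let ?s = "(-1) ^ (n * (n - 1) div 2) :: complex"
  have "top_eval e (czs @ zs) = ?s * top_eval e (concat (map (\<lambda>i. [cconj (zvec i), zvec i]) [0..<n]))"
    using alternating_interleave[OF alternating_top_eval[of e], of "[]" "\<lambda>i. cconj (zvec i)" "[0..<n]" zvec] by simp
  also have "top_eval e (concat (map (\<lambda>i. [cconj (zvec i), zvec i]) [0..<n]))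
     = (- 2 * \<i>) ^ n * top_eval e (map (\<lambda>v. (v, 0)) (map (complex_frame J b) [0..<DIM('a)]))"
    using top_eval_pairs[of "[]" "[0..<n]"] by (simp add: dim map_complex_frame)
  also have "top_eval e (map (\<lambda>v. (v, 0)) (map (complex_frame J b) [0..<DIM('a)])) = of_real (vol_form inner e (map (complex_frame J b) [0..<DIM('a)]))"
    by (rule top_eval_real[OF e]) simp
  finally have t: "top_eval e (czs @ zs) = ?s * ((- 2 * \<i>) ^ n * of_real (vol_form inner e (map (complex_frame J b) [0..<DIM('a)])))" .
  have const: "?s * \<i> ^ n * (?s * ((- 2 * \<i>) ^ n * x)) = 2 ^ n * x" for x
  proof -
    have "?s * ?s = 1" by (simp flip: power_mult_distrib)
    moreover have "\<i> * (- 2 * \<i>) = 2" by (simp add: complex_eq_iff)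
    then have "\<i> ^ n * (- 2 * \<i>) ^ n = 2 ^ n" by (metis power_mult_distrib)
    moreover have "?s * \<i> ^ n * (?s * ((- 2 * \<i>) ^ n * x)) = (?s * ?s) * (\<i> ^ n * (- 2 * \<i>) ^ n) * x" by (simp only: mult_ac)
    ultimately show ?thesis by simp
  qed
  have "DIM('a) div 2 = n" "map cconj zs = czs" by (simp_all add: dim o_def)
  then show ?thesis
    unfolding pair_K_wedge_vecs by (simp only: t const of_real_mult of_real_power of_real_numeral)
qed

end

subsection \<open>The half-form bundle along a rotation curve\<close>

context complex_frame_setting
begin

lemma top_eval_zs_nonzero:
  assumes "J \<in> complex_structures e"
  shows "top_eval e (czs @ zs) \<noteq> 0"
proof
  assume "top_eval e (czs @ zs) = 0"
  then have "pair_K e (wedge_vecs zs) (wedge_vecs zs) = 0"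
    by (simp add: pair_K_wedge_vecs o_def)
  then have "2 ^ n * vol_form inner e (map (complex_frame J b) [0..<DIM('a)]) = 0"
    unfolding pair_K_zs by (simp only: of_real_eq_0_iff)
  then show False using complex_frame_positive[OF dim assms frame] by simp
qed

lemma fibre_K_coeff:
  assumes "\<mu> \<in> fibre_K J"
  shows "top_eval e (czs @ zs) * \<mu> \<alpha>s = coeff_K \<mu> * wedge_vecs zs \<alpha>s"
proof -
  from assms obtain N ys where \<mu>: "\<mu> = (\<lambda>\<alpha>s. \<Sum>i<(N::nat). wedge_vecs (ys i) \<alpha>s)"
    and ys: "\<forall>i<N. length (ys i) = DIM('a) div 2 \<and> set (ys i) \<subseteq> V10 J"
    unfolding fibre_K_def by blast
  have "top_eval e (czs @ zs) * wedge_vecs (ys i) \<alpha>s = top_eval e (czs @ ys i) * wedge_vecs zs \<alpha>s" if "i < N" for i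
    using V10_proportional[OF alternating_append[OF alternating_top_eval] alternating_wedge_vecs, of "ys i" e czs \<alpha>s] ys that dim
    by (simp add: mult.commute)
  then show ?thesis
    by (simp add: \<mu> coeff_K_sum coeff_K_wedge_vecs sum_distrib_left sum_distrib_right)
qed

text \<open>More than \<open>n\<close> vectors of \<open>V10 J\<close> are dependent.\<close>

lemma top_eval_dependent:
  assumes J: "J \<in> complex_structures e" and "w \<in> V10 J" "length ys = n" "set ys \<subseteq> V10 J"
  shows "top_eval e (us @ w # vs @ ys) = 0"
proof -
  have F: "alternating cvec_scale (\<lambda>c. c) (\<lambda>ys. top_eval e (us @ w # vs @ ys))"
    using alternating_append[OF alternating_top_eval, of e "us @ w # vs"] by simp
  have "top_eval e (us @ w # vs @ zs) = 0"
    by (rule kill_V10[OF alternating_top_eval assms(2)]) auto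
  then show ?thesis
    using V10_proportional[OF alternating_append[OF alternating_top_eval] F assms(4,3), of e czs]
      top_eval_zs_nonzero[OF J] by simp
qed

end

lemma mult_cross_cancel: "x * (a * c) = c * y \<Longrightarrow> c \<noteq> 0 \<Longrightarrow> y = a * x" for x :: complex
  by (simp add: mult.left_commute[of x] mult.left_commute[of a] mult.commute[of x] mult.assoc)

lemma continuous_wedge_vecs:
  assumes "\<And>i t. i < n \<Longrightarrow> t \<in> S \<Longrightarrow> (z i has_vector_derivative d i t) (at t within S)"
  shows "continuous_on S (\<lambda>t. wedge_vecs (map (\<lambda>i. z i t) [0..<n]) \<alpha>s)"
proof (rule continuous_on_vector_derivative)
  fix t assume t: "t \<in> S"
  have "has_form_derivative (\<lambda>r. wedge_vecs (map (\<lambda>z. z r) (map z [0..<n])))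
    (\<lambda>\<alpha>s. \<Sum>i<length (map z [0..<n]). wedge_vecs ((map (\<lambda>z. z t) (map z [0..<n]))[i := d i t]) \<alpha>s) t S"
    by (rule wedge_vecs_derivative) (simp add: assms t)
  then show "((\<lambda>t. wedge_vecs (map (\<lambda>i. z i t) [0..<n]) \<alpha>s) has_vector_derivative
      (\<Sum>i<n. wedge_vecs ((map (\<lambda>i. z i t) [0..<n])[i := d i t]) \<alpha>s)) (at t within S)"
    by (simp add: has_form_derivative_def o_def)
qed

context complex_rotation
begin

abbreviation "zt t \<equiv> complex_frame_setting.zvec (Jt t) (\<lambda>i. E (t / 2) (b i))"
abbreviation "zst t \<equiv> map (zt t) [0..<n]"
abbreviation "czst t \<equiv> map (\<lambda>i. cconj (zt t i)) [0..<n]"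
abbreviation "CK t \<equiv> complex_frame_setting.coeff_K e n (Jt t) (\<lambda>i. E (t / 2) (b i))"

lemma zt_eq: "zt t i = cvec_map (E (t / 2)) (b i, - J (b i))"
  unfolding Jt.zvec_def by (simp add: cvec_map_def Jt_half blinfun.minus_right)

lemma zt_flow: "zt t i = cvec_map (E (t / 2)) (zt 0 i)"
  unfolding zt_eq[of t] zt_eq[of 0] by (simp add: cvec_map_def E_0)

lemma E_maps_V10: "z \<in> V10 (Jt 0) \<Longrightarrow> cvec_map (E (t / 2)) z \<in> V10 (Jt t)"
  unfolding Jt.V10_iff by (simp add: cvec_map_def Jt_half E_0 blinfun.minus_right)

lemma zt_deriv: "((\<lambda>t. zt t i) has_vector_derivative (1/2) *\<^sub>R cvec_map B (zt t i)) (at t within S)"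
proof -
  have "((\<lambda>t. (E (t / 2) (b i), E (t / 2) (- J (b i)))) has_vector_derivative
      ((1/2) *\<^sub>R B (E (t / 2) (b i)), (1/2) *\<^sub>R B (E (t / 2) (- J (b i))))) (at t within S)"
    by (intro has_vector_derivative_Pair E_half_deriv)
  then show ?thesis by (simp add: zt_eq cvec_map_def)
qed

lemma cconj_zt_deriv: "((\<lambda>t. cconj (zt t i)) has_vector_derivative (1/2) *\<^sub>R cvec_map B (cconj (zt t i))) (at t within S)"
proof -
  have "((\<lambda>t. (E (t / 2) (b i), E (t / 2) (J (b i)))) has_vector_derivative
      ((1/2) *\<^sub>R B (E (t / 2) (b i)), (1/2) *\<^sub>R B (E (t / 2) (J (b i))))) (at t within S)"
    by (intro has_vector_derivative_Pair E_half_deriv)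
  then show ?thesis by (simp add: zt_eq cvec_map_def cconj_def blinfun.minus_right)
qed

lemma B_V10: "z \<in> V10 (Jt t) \<Longrightarrow> r *\<^sub>R cvec_map B z \<in> V01 (Jt t)"
  using rot_anticommute[OF JB, of t] by (simp add: Jt.V10_iff Jt.V01_iff cvec_map_def blinfun.minus_right blinfun.scaleR_right)

lemma B_V01: "z \<in> V01 (Jt t) \<Longrightarrow> r *\<^sub>R cvec_map B z \<in> V10 (Jt t)"
  using rot_anticommute[OF JB, of t] by (simp add: Jt.V10_iff Jt.V01_iff cvec_map_def blinfun.minus_right blinfun.scaleR_right)

text \<open>The derivatives of the conjugate basis lie in \<open>V10\<close>, where they meet
  \<open>n\<close> further vectors of that space and vanish. The derivative of \<open>y i\<close>
  may be replaced by its \<open>V10\<close> part, because the conjugate basis kills the rest. So the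
  coordinate of a wedge product is differentiated by covariant derivatives alone.\<close>

lemma section_derivative:
  assumes y: "\<And>i. i < n \<Longrightarrow> (y i has_vector_derivative d i) (at t within S)"
    and y10: "\<And>i. i < n \<Longrightarrow> y i t \<in> V10 (Jt t)" and d: "\<And>i. i < n \<Longrightarrow> d i - D i \<in> V01 (Jt t)"
  shows "((\<lambda>r. top_eval e (czst r @ map (\<lambda>i. y i r) [0..<n])) has_vector_derivative
    (\<Sum>i<n. top_eval e (czst t @ (map (\<lambda>i. y i t) [0..<n])[i := D i]))) (at t within S)"
proof -
  let ?fs = "map (\<lambda>i r. cconj (zt r i)) [0..<n] @ map y [0..<n]"
  let ?ys = "map (\<lambda>i. y i t) [0..<n]"
  let ?d = "\<lambda>i. if i < n then (1/2) *\<^sub>R cvec_map B (cconj (zt t i)) else d (i - n)"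
  have "has_form_derivative (\<lambda>r. wedge_vecs (map (\<lambda>z. z r) ?fs))
    (\<lambda>\<alpha>s. \<Sum>i<length ?fs. wedge_vecs ((map (\<lambda>z. z t) ?fs)[i := ?d i]) \<alpha>s) t S"
    by (rule wedge_vecs_derivative) (auto simp: nth_append cconj_zt_deriv y)
  moreover have map_fs: "map (\<lambda>z. z r) ?fs = czst r @ map (\<lambda>i. y i r) [0..<n]" for r by (simp add: o_def)
  ultimately have "((\<lambda>r. top_eval e (czst r @ map (\<lambda>i. y i r) [0..<n])) has_vector_derivative
      (\<Sum>i<2 * n. top_eval e ((czst t @ ?ys)[i := ?d i]))) (at t within S)"
    unfolding has_form_derivative_def map_fs top_eval_def by (simp add: mult_2)
  moreover have "(\<Sum>i<2 * n. top_eval e ((czst t @ ?ys)[i := ?d i])) = (\<Sum>i<n. top_eval e (czst t @ ?ys[i := D i]))"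
  proof -
    have "top_eval e ((czst t @ ?ys)[i := ?d i]) = 0" if "i < n" for i
    proof -
      have "(czst t @ ?ys)[i := ?d i] = take i (czst t) @ ?d i # drop (Suc i) (czst t) @ ?ys"
        using that by (simp add: list_update_append1 upd_conv_take_nth_drop)
      moreover have "?d i \<in> V10 (Jt t)"
        using that B_V01[of "cconj (zt t i)" t "1/2"] Jt.cconj_V10[of "zt t i" t] Jt.zvec_V10[of t i] by simp
      moreover have "set ?ys \<subseteq> V10 (Jt t)" using y10 by auto
      ultimately show ?thesis by (simp only: Jt.top_eval_dependent[OF Jt] length_map length_upt diff_zero)
    qed
    moreover have "top_eval e ((czst t @ ?ys)[n + i := ?d (n + i)]) = top_eval e (czst t @ ?ys[i := D i])" if "i < n" for i
    proof -
      have upd: "(czst t @ ?ys)[n + i := w] = (czst t @ take i ?ys) @ w # drop (Suc i) ?ys"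
        "czst t @ ?ys[i := w] = (czst t @ take i ?ys) @ w # drop (Suc i) ?ys" for w
        using that by (simp_all add: list_update_append upd_conv_take_nth_drop)
      have "top_eval e ((czst t @ take i ?ys) @ (d i - D i) # drop (Suc i) ?ys) = 0"
        by (rule Jt.kill_V01[OF alternating_top_eval d[OF that]]) auto
      then have "top_eval e ((czst t @ take i ?ys) @ (D i + (d i - D i)) # drop (Suc i) ?ys)
          = top_eval e ((czst t @ take i ?ys) @ D i # drop (Suc i) ?ys)"
        by (simp only: alternating_add[OF alternating_top_eval] add_0_right)
      then show ?thesis unfolding upd using that by simp
    qed
    moreover have "(\<Sum>i<2 * n. g i) = (\<Sum>i<n. g i) + (\<Sum>i<n. g (n + i))" for g :: "nat \<Rightarrow> complex"
    proof -
      have "(\<Sum>i<n + k. g i) = (\<Sum>i<n. g i) + (\<Sum>i<k. g (n + i))" for k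
        by (induction k) simp_all
      from this[of n] show ?thesis by (simp only: mult_2)
    qed
    ultimately show ?thesis by simp
  qed
  ultimately show ?thesis by simp
qed

text \<open>The basis \<open>zst t\<close> is covariantly constant, so
  \<open>section_derivative\<close> applies with \<open>D i = 0\<close>. One normalising constant
  \<open>tc\<close> therefore serves all times.\<close>

lemma top_eval_constant: "top_eval e (czst t @ zst t) = top_eval e (czst 0 @ zst 0)"
proof -
  have "((\<lambda>r. top_eval e (czst r @ zst r)) has_vector_derivative 0) (at t within UNIV)" for t
  proof -
    have "((\<lambda>r. top_eval e (czst r @ map (\<lambda>i. zt r i) [0..<n])) has_vector_derivative
      (\<Sum>i<n. top_eval e (czst t @ (map (\<lambda>i. zt t i) [0..<n])[i := 0]))) (at t within UNIV)"
      by (rule section_derivative[OF zt_deriv Jt.zvec_V10]) (use B_V10[OF Jt.zvec_V10] in simp)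
    moreover have "top_eval e (czst t @ (zst t)[i := 0]) = 0" if "i < n" for i
      using alternating_zero[OF alternating_top_eval, of e "czst t @ take i (zst t)" "drop (Suc i) (zst t)"] that
      by (simp add: upd_conv_take_nth_drop)
    ultimately show ?thesis by simp
  qed
  then obtain c where "\<And>t. top_eval e (czst t @ zst t) = c"
    using has_vector_derivative_zero_constant[of UNIV "\<lambda>r. top_eval e (czst r @ zst r)"] by auto
  then show ?thesis by metis
qed

text \<open>The rotated conjugate vectors are replaced one at a time: each is a cosine times the
  initial one plus a vector of the initial \<open>V10\<close>, which \<open>zst 0\<close>
  kills.\<close>

lemma top_eval_cos:
  "top_eval e (czst t @ zst 0) = (\<Prod>i<n. of_real (cos (t * \<theta> i / 2))) * top_eval e (czst 0 @ zst 0)"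
proof -
  have step: "cconj (zt t i) = cvec_scale (of_real (cos (t * \<theta> i / 2))) (cconj (zt 0 i))
      + (sin (t * \<theta> i / 2) / \<theta> i) *\<^sub>R cvec_map B (cconj (zt 0 i))" if "i < n" for i
  proof -
    have "E (t / 2) (b i) = cos (t * \<theta> i / 2) *\<^sub>R b i + (sin (t * \<theta> i / 2) / \<theta> i) *\<^sub>R B (b i)"
      using E_frame[of "2 * i" "t / 2"] that dim by simp
    moreover have "E (t / 2) (J (b i)) = cos (t * \<theta> i / 2) *\<^sub>R J (b i) + (sin (t * \<theta> i / 2) / \<theta> i) *\<^sub>R B (J (b i))"
      using E_frame[of "Suc (2 * i)" "t / 2"] that dim by simp
    ultimately show ?thesis
      unfolding zt_eq[of t] zt_eq[of 0]
      by (simp add: cvec_map_def cconj_def E_0 cvec_scale_real blinfun.minus_right)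
  qed
  have all: "top_eval e (us @ map (\<lambda>i. cconj (zt t i)) ks @ zst 0)
     = (\<Prod>i\<leftarrow>ks. of_real (cos (t * \<theta> i / 2))) * top_eval e (us @ map (\<lambda>i. cconj (zt 0 i)) ks @ zst 0)"
    if "set ks \<subseteq> {..<n}" for us ks
    using that
  proof (induction ks arbitrary: us)
    case (Cons i ks)
    let ?vs = "map (\<lambda>i. cconj (zt t i)) ks @ zst 0"
    have i: "i < n" using Cons.prems by simp
    have "(sin (t * \<theta> i / 2) / \<theta> i) *\<^sub>R cvec_map B (cconj (zt 0 i)) \<in> V10 (Jt 0)"
      using B_V01 Jt.cconj_V10 Jt.zvec_V10 by blast
    then have "top_eval e (us @ ((sin (t * \<theta> i / 2) / \<theta> i) *\<^sub>R cvec_map B (cconj (zt 0 i))) # ?vs) = 0"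
      by (rule Jt.kill_V10[OF alternating_top_eval]) auto
    then have "top_eval e (us @ cconj (zt t i) # ?vs) = of_real (cos (t * \<theta> i / 2)) * top_eval e (us @ cconj (zt 0 i) # ?vs)"
      unfolding step[OF i] by (simp only: alternating_add[OF alternating_top_eval] alternating_scale[OF alternating_top_eval] add_0_right)
    then show ?case using Cons.IH[of "us @ [cconj (zt 0 i)]"] Cons.prems by simp
  qed simp
  have "set [0..<n] \<subseteq> {..<n}" by auto
  from all[OF this, of "[]"] have "top_eval e (czst t @ zst 0)
      = (\<Prod>i\<leftarrow>[0..<n]. of_real (cos (t * \<theta> i / 2))) * top_eval e (czst 0 @ zst 0)"
    unfolding append_Nil .
  moreover have "(\<Prod>i\<leftarrow>[0..<n]. g i) = (\<Prod>i<n. g i)" for g :: "nat \<Rightarrow> complex"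
    by (induction n) (simp_all add: mult.commute)
  ultimately show ?thesis by (simp only:)
qed

abbreviation "tc \<equiv> top_eval e (czst 0 @ zst 0)"

lemma tc_nonzero: "tc \<noteq> 0"
  by (rule Jt.top_eval_zs_nonzero[OF Jt])

lemma fibre_K_eq: "\<mu> \<in> fibre_K (Jt t) \<Longrightarrow> \<mu> = (\<lambda>\<alpha>s. CK t \<mu> / tc * wedge_vecs (zst t) \<alpha>s)"
  using Jt.fibre_K_coeff[of \<mu> t] tc_nonzero by (auto simp: top_eval_constant[of t] field_simps)

lemma CK_zst: "CK t (\<lambda>\<alpha>s. a * wedge_vecs (zst t) \<alpha>s) = a * tc"
  by (simp add: Jt.coeff_K_scale Jt.coeff_K_wedge_vecs top_eval_constant[of t])

text \<open>The squared norm of \<open>wedge_vecs (zst t)\<close>, the same at every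
  \<open>t\<close>, written in the form that \<open>pair_K_zs\<close> yields at time 0.\<close>

definition pc :: real where
  "pc = 2 ^ n * vol_form inner e (map (complex_frame (Jt 0) (\<lambda>i. E (0 / 2) (b i))) [0..<DIM('a)])"

lemma pc_pos: "0 < pc"
  unfolding pc_def using complex_frame_positive[OF dim Jt Jt.frame[of 0]] by simp

lemma pair_K_zst:
  "pair_K e (wedge_vecs (zst t)) (wedge_vecs (zst t)) = of_real pc"
  "pair_K e (wedge_vecs (zst t)) (wedge_vecs (zst 0)) = of_real ((\<Prod>i<n. cos (t * \<theta> i / 2)) * pc)"
proof -
  obtain c where c: "\<And>xs ys. pair_K e (wedge_vecs xs) (wedge_vecs ys) = c * top_eval e (map cconj xs @ ys)"
    using pair_K_wedge_vecs by blast
  have p0: "c * tc = of_real pc"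
    using Jt.pair_K_zs[of 0] unfolding c pc_def map_map o_def .
  show "pair_K e (wedge_vecs (zst t)) (wedge_vecs (zst t)) = of_real pc"
    using p0 unfolding c map_map o_def top_eval_constant[of t] .
  show "pair_K e (wedge_vecs (zst t)) (wedge_vecs (zst 0)) = of_real ((\<Prod>i<n. cos (t * \<theta> i / 2)) * pc)"
    unfolding c map_map o_def top_eval_cos[of t] by (simp only: mult.left_commute[of c] p0 of_real_mult of_real_prod)
qed

text \<open>The induced map on the top exterior power does not depend on the factorisation
  \<open>ys\<close>: by \<open>V10_proportional\<close> it is fixed by its value on
  \<open>zst 0\<close>.\<close>

lemma wedge_vecs_flow:
  assumes ys: "length ys = n" "set ys \<subseteq> V10 (Jt 0)" and a: "wedge_vecs ys = (\<lambda>\<alpha>s. a * wedge_vecs (zst 0) \<alpha>s)"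
  shows "wedge_vecs (map (cvec_map (E (t / 2))) ys) = (\<lambda>\<alpha>s. a * wedge_vecs (zst t) \<alpha>s)"
proof
  fix \<alpha>s
  have F: "alternating cvec_scale (\<lambda>c. c) (\<lambda>ys. wedge_vecs (map (cvec_map (E (t / 2))) ys) \<alpha>s)"
    by (rule alternating_pullback[OF alternating_wedge_vecs, where g = "\<lambda>c. c"])
       (simp_all add: cvec_map_add cvec_map_scale)
  have ys_eq: "top_eval e (czst 0 @ ys) = a * tc"
    by (rule trans[OF Jt.coeff_K_wedge_vecs[symmetric] CK_zst[of 0 a, folded a]])
  have zst_eq: "map (cvec_map (E (t / 2))) (zst 0) = zst t"
    unfolding map_map by (rule map_cong) (simp_all only: o_apply zt_flow[of t])
  have "wedge_vecs (map (cvec_map (E (t / 2))) (zst 0)) \<alpha>s * top_eval e (czst 0 @ ys)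
      = tc * wedge_vecs (map (cvec_map (E (t / 2))) ys) \<alpha>s"
    by (rule Jt.V10_proportional[OF F alternating_append[OF alternating_top_eval] ys(2,1)])
  then have "wedge_vecs (zst t) \<alpha>s * (a * tc) = tc * wedge_vecs (map (cvec_map (E (t / 2))) ys) \<alpha>s"
    unfolding zst_eq ys_eq .
  then show "wedge_vecs (map (cvec_map (E (t / 2))) ys) \<alpha>s = a * wedge_vecs (zst t) \<alpha>s"
    by (rule mult_cross_cancel[OF _ tc_nonzero])
qed

lemma continuous_wedge_vecs_czst: "continuous_on S (\<lambda>t. wedge_vecs (czst t) \<alpha>s)"
  by (rule continuous_wedge_vecs[where z = "\<lambda>i t. cconj (zt t i)" and d = "\<lambda>i t. (1/2) *\<^sub>R cvec_map B (cconj (zt t i))"])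
     (rule cconj_zt_deriv)

lemma continuous_CK:
  assumes "\<And>\<alpha>s. continuous_on S (\<lambda>t. M t \<alpha>s)"
  shows "continuous_on S (\<lambda>t. CK t (M t))"
  unfolding Jt.coeff_K_def wedge_def
  by (intro continuous_intros continuous_wedge_vecs_czst assms)

lemma continuous_Jt: "continuous_on S Jt"
  using continuous_on_vector_derivative[OF rot_curve_deriv[of 1 J], of S] by simp

end

text \<open>Near \<open>t\<close> the quotient \<open>f r / f t\<close> stays in the right
  half-plane, where the principal root is continuous and inverts squaring.\<close>

lemma csqrt_local:
  fixes f :: "real \<Rightarrow> complex"
  assumes "continuous_on S f" "t \<in> S" "f t \<noteq> 0"
  obtains d where "d > 0" "\<And>r. r \<in> S \<Longrightarrow> \<bar>r - t\<bar> < d \<Longrightarrow> 0 < Re (f r / f t)"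
proof -
  have "continuous_on S (\<lambda>r. Re (f r / f t))" by (intro continuous_intros assms) (use assms(3) in auto)
  then obtain d where "d > 0" and d: "\<And>r. r \<in> S \<Longrightarrow> dist r t < d \<Longrightarrow> dist (Re (f r / f t)) (Re (f t / f t)) < 1"
    using assms(2) unfolding continuous_on_iff by (metis zero_less_one)
  show thesis
  proof (rule that[OF \<open>d > 0\<close>])
    fix r assume "r \<in> S" "\<bar>r - t\<bar> < d"
    then have "\<bar>Re (f r / f t) - 1\<bar> < 1" using d[of r] assms(3) by (simp add: dist_real_def)
    then show "0 < Re (f r / f t)" by linarith
  qed
qed

lemma Re_pos_not_nonpos: "0 < Re z \<Longrightarrow> z \<notin> \<real>\<^sub>\<le>\<^sub>0"
  by (auto simp: complex_nonpos_Reals_iff)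

text \<open>Locally \<open>g r\<close> is \<open>g t\<close> times the principal root of
  \<open>(g r)\<^sup>2 / (g t)\<^sup>2\<close>. This matters because in \<open>has_cov_L\<close> the
  section \<open>\<sigma>\<close> is only continuous, with a differentiable square.\<close>

lemma square_root_derivative:
  fixes g :: "real \<Rightarrow> complex"
  assumes cont: "continuous_on S g" and t: "t \<in> S" and g: "g t \<noteq> 0"
    and d: "((\<lambda>r. (g r)\<^sup>2) has_vector_derivative 2 * g t * h) (at t within S)"
  shows "(g has_vector_derivative h) (at t within S)"
proof -
  obtain \<epsilon> where \<epsilon>: "\<epsilon> > 0" "\<And>r. r \<in> S \<Longrightarrow> \<bar>r - t\<bar> < \<epsilon> \<Longrightarrow> 0 < Re (g r / g t)"
    using csqrt_local[OF cont t g] by blast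
  have "((\<lambda>r. (g r)\<^sup>2 / (g t)\<^sup>2) has_vector_derivative (2 * g t * h) / (g t)\<^sup>2) (at t within S)"
    by (rule has_vector_derivative_divide[OF d])
  then have "(csqrt \<circ> (\<lambda>r. (g r)\<^sup>2 / (g t)\<^sup>2) has_vector_derivative ((2 * g t * h) / (g t)\<^sup>2) * (1 / 2)) (at t within S)"
  proof (rule field_vector_diff_chain_within)
    have "(csqrt has_field_derivative inverse (2 * csqrt 1)) (at 1 within (\<lambda>r. (g r)\<^sup>2 / (g t)\<^sup>2) ` S)"
      by (rule has_field_derivative_at_within) (rule has_field_derivative_csqrt, simp)
    then show "(csqrt has_field_derivative 1 / 2) (at ((g t)\<^sup>2 / (g t)\<^sup>2) within (\<lambda>r. (g r)\<^sup>2 / (g t)\<^sup>2) ` S)"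
      using g by simp
  qed
  then have "((\<lambda>r. g t * csqrt ((g r)\<^sup>2 / (g t)\<^sup>2)) has_vector_derivative g t * (((2 * g t * h) / (g t)\<^sup>2) * (1 / 2))) (at t within S)"
    by (intro has_vector_derivative_mult_right) (simp add: o_def)
  then have "((\<lambda>r. g t * csqrt ((g r)\<^sup>2 / (g t)\<^sup>2)) has_vector_derivative h) (at t within S)"
    using g by (simp add: power2_eq_square)
  then show ?thesis
  proof (rule has_vector_derivative_transform_within[OF _ \<epsilon>(1) t])
    fix r assume r: "r \<in> S" "dist r t < \<epsilon>"
    then have "0 < Re (g r / g t)" using \<epsilon>(2) by (simp add: dist_real_def)
    then have "csqrt ((g r / g t)\<^sup>2) = g r / g t" by (intro csqrt_square) simp
    then show "g t * csqrt ((g r)\<^sup>2 / (g t)\<^sup>2) = g r" using g by (simp add: power_divide)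
  qed
qed

text \<open>The quotient is continuous with values 1 and -1, hence constant on the interval.\<close>

lemma continuous_sign_constant:
  fixes \<phi> \<rho> :: "real \<Rightarrow> complex"
  assumes "continuous_on {0..1} \<phi>" "continuous_on {0..1} \<rho>"
    and "\<And>t. t \<in> {0..1} \<Longrightarrow> (\<phi> t)\<^sup>2 = (\<rho> t)\<^sup>2" and nz: "\<And>t. t \<in> {0..1} \<Longrightarrow> \<rho> t \<noteq> 0"
    and init: "\<phi> 0 = \<rho> 0" and t: "t \<in> {0..1}"
  shows "\<phi> t = \<rho> t"
proof -
  let ?q = "\<lambda>t. \<phi> t / \<rho> t"
  have q: "?q t = 1 \<or> ?q t = - 1" if "t \<in> {0..1}" for t
    using assms(3)[OF that] nz[OF that] by (auto simp: power2_eq_iff)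
  have "continuous_on {0..1} ?q" using assms(1,2) nz by (intro continuous_intros) auto
  moreover have "finite (?q ` {0..1})" by (rule finite_subset[of _ "{1, -1}"]) (use q in blast, simp)
  ultimately have "?q constant_on {0..1}" by (rule continuous_finite_range_constant[rotated]) simp
  then have "?q t = ?q 0" using t by (fastforce simp: constant_on_def)
  then show ?thesis using init nz[OF t] nz[of 0] by simp
qed

text \<open>The coordinate of \<open>v\<close> on the line of \<open>w\<close>. Expressing it by the
  Hermitian product makes it continuous in both vectors.\<close>

definition comp_along :: "complex ^ 'k \<Rightarrow> complex ^ 'k \<Rightarrow> complex" where
  "comp_along w v = (\<Sum>k\<in>UNIV. cnj (w $ k) * v $ k) / (\<Sum>k\<in>UNIV. cnj (w $ k) * w $ k)"

lemma norm_sum_nonzero: "w \<noteq> 0 \<Longrightarrow> (\<Sum>k\<in>UNIV. cnj (w $ k) * w $ k) \<noteq> 0" for w :: "complex ^ 'k"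
proof -
  assume "w \<noteq> 0"
  then obtain j where "w $ j \<noteq> 0" by (auto simp: vec_eq_iff)
  have "(\<Sum>k\<in>UNIV. cnj (w $ k) * w $ k) = of_real (\<Sum>k\<in>UNIV. (cmod (w $ k))\<^sup>2)"
    unfolding of_real_sum complex_norm_square by (simp add: mult.commute)
  moreover have "(\<Sum>k\<in>UNIV. (cmod (w $ k))\<^sup>2) > 0"
    using \<open>w $ j \<noteq> 0\<close> by (intro sum_pos2[of _ j]) auto
  ultimately show ?thesis by (metis less_numeral_extra(3) of_real_eq_0_iff)
qed

lemma comp_along_scale: "w \<noteq> 0 \<Longrightarrow> comp_along w (c *s w) = c"
  using norm_sum_nonzero[of w] by (simp add: comp_along_def sum_distrib_left[symmetric] mult.left_commute)

lemma comp_along_hom: "comp_along w (c *s v) = c * comp_along w v"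
  by (simp add: comp_along_def sum_distrib_left mult.left_commute)

lemma continuous_comp_along:
  assumes "continuous_on S r" "continuous_on S v" "\<And>t. t \<in> S \<Longrightarrow> r t \<noteq> 0"
  shows "continuous_on S (\<lambda>t. comp_along (r t) (v t))"
  unfolding comp_along_def using assms norm_sum_nonzero by (intro continuous_intros) auto

lemma continuous_vscale:
  assumes "continuous_on S f" "continuous_on S v"
  shows "continuous_on S (\<lambda>t. f t *s (v t :: complex ^ 'k))"
  unfolding vector_scalar_mult_def using assms by (intro continuous_intros) auto

text \<open>On a line the norm function in \<open>inner_L\<close> is the squared modulus of the
  coordinate times a constant, so polarisation recovers a Hermitian form.\<close>

lemma inner_L_line:
  assumes m: "\<And>a. m J (a *s w) (a *s w) = (\<lambda>\<alpha>s. a\<^sup>2 * \<mu> \<alpha>s)" and \<mu>: "pair_K e \<mu> \<mu> = of_real p" and p: "0 \<le> p"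
  shows "inner_L e m J (a *s w) (b *s w) = cnj a * b * of_real (sqrt p)"
proof -
  have q: "sqrt (Re (pair_K e (m J (c *s w) (c *s w)) (m J (c *s w) (c *s w)))) = (cmod c)\<^sup>2 * sqrt p" for c
  proof -
    have "cnj (c\<^sup>2) * c\<^sup>2 = of_real (((cmod c)\<^sup>2)\<^sup>2)"
      by (simp only: of_real_power[of "(cmod c)\<^sup>2"] complex_norm_square) (simp add: power_mult_distrib mult.commute)
    then have "pair_K e (m J (c *s w) (c *s w)) (m J (c *s w) (c *s w)) = of_real (((cmod c)\<^sup>2)\<^sup>2 * p)"
      by (simp only: m pair_K_scale \<mu> of_real_mult)
    then show ?thesis by (simp only: Re_complex_of_real real_sqrt_mult real_sqrt_abs abs_power2)
  qed
  have "of_real ((cmod (a + \<i> ^ k * b))\<^sup>2) = (a + \<i> ^ k * b) * (cnj a + (- \<i>) ^ k * cnj b)" for k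
    by (simp only: complex_norm_square) simp
  then have pol: "(\<Sum>k<4. (- \<i>) ^ k * of_real ((cmod (a + \<i> ^ k * b))\<^sup>2)) = 4 * (cnj a * b)"
    by (simp add: numeral_eq_Suc algebra_simps)
  have "a *s w + \<i> ^ k *s (b *s w) = (a + \<i> ^ k * b) *s w" for k
    by (simp add: vec_eq_iff algebra_simps)
  then have "inner_L e m J (a *s w) (b *s w) = (\<Sum>k<4. (- \<i>) ^ k * of_real ((cmod (a + \<i> ^ k * b))\<^sup>2 * sqrt p)) / 4"
    by (simp only: inner_L_def Let_def q)
  also have "\<dots> = (\<Sum>k<4. (- \<i>) ^ k * of_real ((cmod (a + \<i> ^ k * b))\<^sup>2)) * of_real (sqrt p) / 4"
    by (simp only: of_real_mult sum_distrib_right mult.assoc)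
  finally show ?thesis unfolding pol by simp
qed

section \<open>Parallel sections of the square root bundle\<close>

locale half_forms = rotation_curve e n J b \<theta> B \<gamma>
  for e :: "nat \<Rightarrow> 'a::euclidean_space" and n J b \<theta> B \<gamma> +
  fixes L :: "('a \<Rightarrow>\<^sub>L 'a) \<Rightarrow> (complex ^ 'k) set"
    and m :: "('a \<Rightarrow>\<^sub>L 'a) \<Rightarrow> complex ^ 'k \<Rightarrow> complex ^ 'k \<Rightarrow> ('a \<Rightarrow>\<^sub>L real) list \<Rightarrow> complex"
    and w0 :: "complex ^ 'k" and a0 :: complex
  assumes root_bundle: "sqrt_bundle e L m" and w0: "w0 \<in> L (Jt 0)" "w0 \<noteq> 0" and a0: "a0 \<noteq> 0"
    and m0: "m (Jt 0) w0 w0 = (\<lambda>\<alpha>s. a0 * wedge_vecs (zst 0) \<alpha>s)"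
begin

lemma L_generated: "w \<in> L (Jt t) \<Longrightarrow> w \<noteq> 0 \<Longrightarrow> v \<in> L (Jt t) \<longleftrightarrow> (\<exists>c. v = c *s w)"
proof -
  assume w: "w \<in> L (Jt t)" "w \<noteq> 0"
  obtain u where u: "L (Jt t) = range (\<lambda>c. c *s u)"
    using root_bundle Jt unfolding sqrt_bundle_def by blast
  obtain c where c: "w = c *s u" using w(1) u by blast
  then have "c \<noteq> 0" using w(2) by auto
  then have inv: "a *s u = (a / c) *s w" for a by (simp add: c vec_eq_iff)
  show ?thesis
  proof
    assume "v \<in> L (Jt t)"
    then obtain a where "v = a *s u" using u by blast
    then show "\<exists>c. v = c *s w" using inv by blast
  next
    assume "\<exists>c. v = c *s w"
    then obtain d where "v = d *s w" by blast
    then have "v = (d * c) *s u" by (simp add: c vec_eq_iff mult.assoc)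
    then show "v \<in> L (Jt t)" unfolding u by blast
  qed
qed

lemma L_scale: "w \<in> L (Jt t) \<Longrightarrow> c *s w \<in> L (Jt t)"
proof -
  obtain u where u: "L (Jt t) = range (\<lambda>c. c *s u)"
    using root_bundle Jt unfolding sqrt_bundle_def by blast
  assume "w \<in> L (Jt t)"
  then obtain d where "w = d *s u" using u by blast
  then have "c *s w = (c * d) *s u" by (simp add: vec_eq_iff mult.assoc)
  then show ?thesis unfolding u by blast
qed

lemma m_scale:
  assumes "w \<in> L (Jt t)" "w' \<in> L (Jt t)"
  shows "m (Jt t) (a *s w) (c *s w') = (\<lambda>\<alpha>s. a * c * m (Jt t) w w' \<alpha>s)"
proof
  fix \<alpha>s
  have s: "m (Jt t) (a *s w) w' \<alpha>s = a * m (Jt t) w w' \<alpha>s \<and> m (Jt t) w (a *s w') \<alpha>s = a * m (Jt t) w w' \<alpha>s"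
    if "w \<in> L (Jt t)" "w' \<in> L (Jt t)" for a w w'
    using root_bundle Jt that unfolding sqrt_bundle_def by blast
  show "m (Jt t) (a *s w) (c *s w') \<alpha>s = a * c * m (Jt t) w w' \<alpha>s"
    using s[of w "c *s w'" a] s[of w w' c] L_scale assms by simp
qed

lemma m_fibre: "w \<in> L (Jt t) \<Longrightarrow> w' \<in> L (Jt t) \<Longrightarrow> m (Jt t) w w' \<in> fibre_K (Jt t)"
  using root_bundle Jt unfolding sqrt_bundle_def by blast

lemma m_nonzero: "w \<in> L (Jt t) \<Longrightarrow> w \<noteq> 0 \<Longrightarrow> m (Jt t) w w \<noteq> (\<lambda>\<alpha>s. 0)"
  using root_bundle Jt unfolding sqrt_bundle_def by meson

text \<open>The parallel section of the top exterior powers through the square of \<open>w0\<close>;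
  its continuous roots will be the parallel half forms.\<close>

definition \<mu> :: "real \<Rightarrow> ('a \<Rightarrow>\<^sub>L real) list \<Rightarrow> complex" where
  "\<mu> t = (\<lambda>\<alpha>s. a0 * wedge_vecs (zst t) \<alpha>s)"

lemma CK_\<mu>: "CK t (\<mu> t) = a0 * tc"
  unfolding \<mu>_def by (rule CK_zst)

lemma \<mu>_scale_inj: "(\<lambda>\<alpha>s. c * \<mu> t \<alpha>s) = (\<lambda>\<alpha>s. d * \<mu> t \<alpha>s) \<Longrightarrow> c = d"
proof -
  assume "(\<lambda>\<alpha>s. c * \<mu> t \<alpha>s) = (\<lambda>\<alpha>s. d * \<mu> t \<alpha>s)"
  then have "CK t (\<lambda>\<alpha>s. c * \<mu> t \<alpha>s) = CK t (\<lambda>\<alpha>s. d * \<mu> t \<alpha>s)" by simp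
  then show "c = d" using a0 tc_nonzero by (simp add: Jt.coeff_K_scale CK_\<mu>)
qed

lemma fibre_K_\<mu>: "M \<in> fibre_K (Jt t) \<Longrightarrow> M = (\<lambda>\<alpha>s. CK t M / (a0 * tc) * \<mu> t \<alpha>s)"
  using fibre_K_eq[of M t] a0 by (simp add: \<mu>_def)

definition root_section :: "real set \<Rightarrow> (real \<Rightarrow> complex ^ 'k) \<Rightarrow> bool" where
  "root_section S r \<longleftrightarrow> continuous_on S r \<and> (\<forall>t\<in>S. r t \<in> L (Jt t) \<and> m (Jt t) (r t) (r t) = \<mu> t)"

lemma root_section_nonzero: "root_section S r \<Longrightarrow> t \<in> S \<Longrightarrow> r t \<noteq> 0"
proof
  assume r: "root_section S r" "t \<in> S" and "r t = 0"
  then have "m (Jt t) (0 *s r t) (0 *s r t) = \<mu> t" by (auto simp: root_section_def)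
  then have "\<mu> t = (\<lambda>\<alpha>s. 0 * \<mu> t \<alpha>s)"
    using r m_scale[of "r t" t "r t" 0 0] by (auto simp: root_section_def)
  then have "(1::complex) = 0" using \<mu>_scale_inj[of 1 t 0] by simp
  then show False by simp
qed

text \<open>A local nowhere vanishing section of \<open>L\<close> has square \<open>f\<close> times
  \<open>\<mu>\<close> with \<open>f\<close> continuous and nonzero; dividing it by a continuous
  root of \<open>f\<close> gives a root of \<open>\<mu>\<close>. The form of the statement is that
  required for bisection of the interval.\<close>

lemma root_section_local: "\<exists>d>0. \<forall>a b. a \<le> x \<and> x \<le> b \<and> b - a < d \<longrightarrow> (\<exists>r. root_section {a..b} r)"
proof -
  obtain U s where Us: "open U \<and> Jt x \<in> U \<and> continuous_on (complex_structures e \<inter> U) s \<and>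
    (\<forall>K \<in> complex_structures e \<inter> U. s K \<in> L K \<and> s K \<noteq> 0) \<and>
    (\<forall>\<alpha>s. continuous_on (complex_structures e \<inter> U) (\<lambda>K. m K (s K) (s K) \<alpha>s))"
    using bspec[OF root_bundle[unfolded sqrt_bundle_def] Jt[of x], THEN conjunct2, THEN conjunct2] by (elim exE)
  then have U: "open U" "Jt x \<in> U" and s: "continuous_on (complex_structures e \<inter> U) s"
    "\<And>K. K \<in> complex_structures e \<inter> U \<Longrightarrow> s K \<in> L K \<and> s K \<noteq> 0"
    "\<And>\<alpha>s. continuous_on (complex_structures e \<inter> U) (\<lambda>K. m K (s K) (s K) \<alpha>s)"
    by (elim conjE; simp)+
  define T where "T = {t. Jt t \<in> U}"
  have "open T"
    using open_vimage[OF U(1) continuous_Jt] by (simp add: T_def vimage_def)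
  have TU: "Jt ` T \<subseteq> complex_structures e \<inter> U" using Jt by (auto simp: T_def)
  define f where "f = (\<lambda>t. CK t (m (Jt t) (s (Jt t)) (s (Jt t))) / (a0 * tc))"
  have sT: "s (Jt t) \<in> L (Jt t)" "s (Jt t) \<noteq> 0" if "t \<in> T" for t
    using s(2)[of "Jt t"] TU that by auto
  have mf: "m (Jt t) (s (Jt t)) (s (Jt t)) = (\<lambda>\<alpha>s. f t * \<mu> t \<alpha>s)" if "t \<in> T" for t
    unfolding f_def by (rule fibre_K_\<mu>[OF m_fibre[OF sT(1) sT(1)]]) (use that in auto)
  have f_nz: "f t \<noteq> 0" if "t \<in> T" for t
    using mf[OF that] m_nonzero[OF sT[OF that]] by auto
  have s_cont: "continuous_on T (\<lambda>t. s (Jt t))"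
    by (rule continuous_on_compose2[OF s(1) continuous_Jt TU])
  have f_cont: "continuous_on T f"
    unfolding f_def
  proof (intro continuous_intros continuous_CK)
    show "continuous_on T (\<lambda>t. m (Jt t) (s (Jt t)) (s (Jt t)) \<alpha>s)" for \<alpha>s
      by (rule continuous_on_compose2[OF s(3) continuous_Jt TU])
  qed (use a0 tc_nonzero in simp)
  have "x \<in> T" using U(2) by (simp add: T_def)
  obtain d1 where d1: "d1 > 0" "\<And>t. \<bar>t - x\<bar> < d1 \<Longrightarrow> t \<in> T"
    using \<open>open T\<close> \<open>x \<in> T\<close> unfolding open_dist dist_real_def by blast
  obtain d2 where d2: "d2 > 0" "\<And>r. r \<in> T \<Longrightarrow> \<bar>r - x\<bar> < d2 \<Longrightarrow> 0 < Re (f r / f x)"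
    using csqrt_local[OF f_cont \<open>x \<in> T\<close> f_nz[OF \<open>x \<in> T\<close>]] by blast
  \<comment> \<open>\<open>csqrt (f t)\<close> could jump at the branch cut; near \<open>x\<close>
    the quotient \<open>f t / f x\<close> stays away from it.\<close>
  define g where "g = (\<lambda>t. csqrt (f x) * csqrt (f t / f x))"
  define r where "r = (\<lambda>t. inverse (g t) *s s (Jt t))"
  have "\<exists>r. root_section {a..b} r" if ab: "a \<le> x \<and> x \<le> b \<and> b - a < min d1 d2" for a b
  proof -
    have near: "\<bar>t - x\<bar> < d1" "\<bar>t - x\<bar> < d2" if "t \<in> {a..b}" for t using ab that by auto
    have sub: "{a..b} \<subseteq> T" using near d1 by blast
    have g2: "(g t)\<^sup>2 = f t" if "t \<in> {a..b}" for t
      using f_nz[OF \<open>x \<in> T\<close>] by (simp add: g_def power_mult_distrib)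
    have "continuous_on {a..b} g"
      unfolding g_def
    proof (intro continuous_intros continuous_on_compose2[OF continuous_on_csqrt])
      show "continuous_on {a..b} f" by (rule continuous_on_subset[OF f_cont sub])
      show "(\<lambda>t. f t / f x) ` {a..b} \<subseteq> - \<real>\<^sub>\<le>\<^sub>0"
        using d2(2) near sub Re_pos_not_nonpos by blast
    qed (use f_nz[OF \<open>x \<in> T\<close>] in simp)
    moreover have g_nz: "g t \<noteq> 0" if "t \<in> {a..b}" for t using g2[OF that] f_nz[of t] sub that by auto
    ultimately have "continuous_on {a..b} r"
      unfolding r_def by (intro continuous_vscale continuous_on_inverse continuous_on_subset[OF s_cont sub]) auto
    moreover have "r t \<in> L (Jt t) \<and> m (Jt t) (r t) (r t) = \<mu> t" if t: "t \<in> {a..b}" for t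
    proof
      have tT: "t \<in> T" using sub t by blast
      show "r t \<in> L (Jt t)" unfolding r_def by (rule L_scale[OF sT(1)[OF tT]])
      have "inverse (g t) * inverse (g t) * f t = 1"
        using g_nz[OF t] by (simp add: g2[OF t, symmetric] power2_eq_square field_simps)
      then show "m (Jt t) (r t) (r t) = \<mu> t"
        unfolding r_def m_scale[OF sT(1)[OF tT] sT(1)[OF tT]] mf[OF tT] by (simp flip: mult.assoc)
    qed
    ultimately show ?thesis unfolding root_section_def by blast
  qed
  then show ?thesis using d1(1) d2(1) by (intro exI[of _ "min d1 d2"]) auto
qed

lemma root_section_sign:
  assumes "r1 t \<in> L (Jt t)" "r2 t \<in> L (Jt t)" "m (Jt t) (r1 t) (r1 t) = \<mu> t" "m (Jt t) (r2 t) (r2 t) = \<mu> t"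
  shows "\<exists>s. s\<^sup>2 = 1 \<and> r1 t = s *s r2 t"
proof -
  have nz: "r2 t \<noteq> 0" using root_section_nonzero[of "{t}" r2 t] assms by (simp add: root_section_def)
  then obtain s where s: "r1 t = s *s r2 t" using L_generated[OF assms(2)] assms(1) by blast
  have "(\<lambda>\<alpha>s. 1 * \<mu> t \<alpha>s) = (\<lambda>\<alpha>s. s * s * \<mu> t \<alpha>s)"
    using assms(3) m_scale[OF assms(2,2), of s s] by (simp add: s assms(4))
  from \<mu>_scale_inj[OF this] show ?thesis using s by (auto simp: power2_eq_square)
qed

lemma root_section_flip: "root_section S r \<Longrightarrow> s\<^sup>2 = 1 \<Longrightarrow> root_section S (\<lambda>t. s *s r t)"
  unfolding root_section_def
  by (auto intro!: continuous_vscale L_scale simp: m_scale power2_eq_square)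

lemma root_section_exists: "\<exists>r. root_section {0..1} r \<and> r 0 = w0"
proof -
  have "\<exists>r. root_section {0..1::real} r"
  \<comment> \<open>Bisection: roots on adjacent intervals agree at the common point up to a sign,
    which is absorbed into the second one.\<close>
  proof (rule Bolzano[of 0 1 "\<lambda>a b. \<exists>r. root_section {a..b} r"])
    fix a b c :: real
    assume "\<exists>r. root_section {a..b} r" "\<exists>r. root_section {b..c} r" and ab: "a \<le> b" "b \<le> c"
    then obtain r1 r2 where r: "root_section {a..b} r1" "root_section {b..c} r2" by blast
    then obtain s where s: "s\<^sup>2 = 1" "r1 b = s *s r2 b"
      using root_section_sign[of r1 b r2] ab by (auto simp: root_section_def)
    note r2 = root_section_flip[OF r(2) s(1)]
    let ?r = "\<lambda>t. if t \<le> b then r1 t else s *s r2 t"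
    have "continuous_on ({a..b} \<union> {b..c}) ?r"
      using r(1) r2 s(2) by (intro continuous_on_If) (auto simp: root_section_def)
    moreover have "{a..b} \<union> {b..c} = {a..c}" using ab by auto
    ultimately have "continuous_on {a..c} ?r" by simp
    moreover have "?r t \<in> L (Jt t) \<and> m (Jt t) (?r t) (?r t) = \<mu> t" if "t \<in> {a..c}" for t
      using r(1) r2 that by (auto simp: root_section_def)
    ultimately show "\<exists>r. root_section {a..c} r" unfolding root_section_def by blast
  qed (use root_section_local in auto)
  then obtain r where r: "root_section {0..1} r" by blast
  obtain s where s: "s\<^sup>2 = 1" "w0 = s *s r 0"
    using root_section_sign[of "\<lambda>t. w0" 0 r] r w0 m0 by (auto simp: root_section_def \<mu>_def)
  show ?thesis using root_section_flip[OF r s(1)] s(2) by (intro exI[of _ "\<lambda>t. s *s r t"]) simp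
qed

lemma n_pos: "0 < n"
  using dim DIM_positive[where 'a = 'a] by simp

text \<open>The factor \<open>a0\<close> is absorbed into the first vector, since
  \<open>has_cov_K\<close> and \<open>halfform_root\<close> speak of single wedge products.\<close>

lemma scaled_zst: "\<mu> t = wedge_vecs (map (\<lambda>i. if i = 0 then cvec_scale a0 (zt t 0) else zt t i) [0..<n])"
proof -
  have u: "[0..<n] = 0 # [1..<n]" using n_pos by (simp add: upt_rec)
  have "map (\<lambda>i. if i = 0 then cvec_scale a0 (zt t 0) else zt t i) [0..<n] = cvec_scale a0 (zt t 0) # map (zt t) [1..<n]"
    "zst t = zt t 0 # map (zt t) [1..<n]"
    unfolding u by auto
  then show ?thesis unfolding \<mu>_def
    using alternating_scale[OF alternating_wedge_vecs, of "[]" a0 "zt t 0" "map (zt t) [1..<n]"]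
    by (intro ext) (simp only: append_Nil)
qed

lemma V10_scale: "z \<in> V10 (Jt t) \<Longrightarrow> cvec_scale c z \<in> V10 (Jt t)"
  unfolding V10_def mem_Collect_eq cvec_map_scale by (simp add: cvec_scale_def algebra_simps)

text \<open>A root section is parallel, so relative to it the covariant derivative is the derivative
  of the coefficient.\<close>

lemma has_cov_L_iff:
  assumes r: "root_section {0..1} r"
  shows "has_cov_L L m \<gamma> s Ds \<longleftrightarrow> (\<exists>f f'. \<forall>t\<in>{0..1}. (f has_vector_derivative f' t) (at t within {0..1}) \<and>
    s t = f t *s r t \<and> Ds t = f' t *s r t)"
proof
  have rD: "r t \<in> L (Jt t)" "m (Jt t) (r t) (r t) = \<mu> t" "r t \<noteq> 0" if "t \<in> {0..1}" for t
    using r that root_section_nonzero[OF r that] by (auto simp: root_section_def)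
  {
    assume "\<exists>f f'. \<forall>t\<in>{0..1}. (f has_vector_derivative f' t) (at t within {0..1}) \<and>
      s t = f t *s r t \<and> Ds t = f' t *s r t"
    then obtain f f' where f: "\<forall>t\<in>{0..1}. (f has_vector_derivative f' t) (at t within {0..1}) \<and>
      s t = f t *s r t \<and> Ds t = f' t *s r t" by blast
    let ?z = "\<lambda>i t. if i = 0 then cvec_scale a0 (zt t 0) else zt t i"
    \<comment> \<open>Here \<open>r\<close> itself is the nowhere vanishing section in the
      definition. Its square is a wedge product of half-rotated vectors, whose derivatives lie in
      \<open>V01\<close>, so all covariant derivatives are 0.\<close>
    have K: "has_cov_K \<gamma> (\<lambda>t. m (\<gamma> t) (r t) (r t)) (\<lambda>t \<alpha>s. 2 * m (\<gamma> t) (r t) 0 \<alpha>s)"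
      unfolding has_cov_K_def
    proof (rule exI[of _ ?z], rule exI[of _ "\<lambda>i t. 0"], intro conjI allI impI ballI)
      fix i
      show "has_cov_V \<gamma> (?z i) (\<lambda>t. 0)"
        unfolding has_cov_V_def
      proof (intro ballI conjI)
        fix t :: real assume t: "t \<in> {0..1}"
        show "?z i t \<in> V10 (\<gamma> t)" unfolding \<gamma>[OF t] using V10_scale Jt.zvec_V10 by simp
        have lin: "bounded_linear (\<lambda>z::'a cvec. cvec_scale a0 z)"
          unfolding cvec_scale_def by (intro bounded_linear_intros)
        let ?d = "if i = 0 then cvec_scale a0 ((1/2) *\<^sub>R cvec_map B (zt t 0)) else (1/2) *\<^sub>R cvec_map B (zt t i)"
        have "(?z i has_vector_derivative ?d) (at t within {0..1})"
          using zt_deriv bounded_linear.has_vector_derivative[OF lin zt_deriv] by auto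
        moreover have "?d - 0 \<in> V01 (\<gamma> t)"
        proof -
          have "cvec_scale a0 ((1/2) *\<^sub>R cvec_map B (zt t 0)) = (1/2) *\<^sub>R cvec_map B (cvec_scale a0 (zt t 0))"
            unfolding cvec_map_scale by (simp add: cvec_scale_def algebra_simps)
          then show ?thesis unfolding \<gamma>[OF t] using B_V10 V10_scale Jt.zvec_V10 by simp
        qed
        moreover have "0 \<in> V10 (\<gamma> t)" by (simp add: \<gamma>[OF t] Jt.V10_iff)
        ultimately show "\<exists>s'. (?z i has_vector_derivative s') (at t within {0..1}) \<and> 0 \<in> V10 (\<gamma> t) \<and> s' - 0 \<in> V01 (\<gamma> t)"
          by blast
      qed
    next
      fix t :: real assume t: "t \<in> {0..1}"
      let ?zs = "map (\<lambda>i. ?z i t) [0..<DIM('a) div 2]"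
      have "m (\<gamma> t) (r t) (r t) = wedge_vecs ?zs"
        unfolding \<gamma>[OF t] rD(2)[OF t] scaled_zst by (simp add: dim)
      moreover have "(\<lambda>\<alpha>s. 2 * m (\<gamma> t) (r t) 0 \<alpha>s) = (\<lambda>\<alpha>s. \<Sum>i<DIM('a) div 2. wedge_vecs (?zs[i := 0]) \<alpha>s)"
      proof -
        have "wedge_vecs (?zs[i := 0]) \<alpha>s = 0" if "i < DIM('a) div 2" for i \<alpha>s
          using alternating_zero[OF alternating_wedge_vecs, of "take i ?zs" "drop (Suc i) ?zs" \<alpha>s] that
          by (simp add: upd_conv_take_nth_drop)
        moreover have "m (Jt t) (1 *s r t) (0 *s r t) = (\<lambda>\<alpha>s. 0)"
          unfolding m_scale[OF rD(1)[OF t] rD(1)[OF t]] by simp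
        ultimately show ?thesis unfolding \<gamma>[OF t] by simp
      qed
      ultimately show "let zs = ?zs in m (\<gamma> t) (r t) (r t) = wedge_vecs zs \<and>
        (\<lambda>\<alpha>s. 2 * m (\<gamma> t) (r t) 0 \<alpha>s) = (\<lambda>\<alpha>s. \<Sum>i<DIM('a) div 2. wedge_vecs (zs[i := 0]) \<alpha>s)"
        unfolding Let_def by blast
    qed
    have zero: "0 \<in> L (\<gamma> t)" if "t \<in> {0..1}" for t
      using L_scale[OF rD(1)[OF that], of 0] by (simp add: \<gamma>[OF that])
    have "continuous_on {0..1} r" using r by (simp add: root_section_def)
    then show "has_cov_L L m \<gamma> s Ds"
      unfolding has_cov_L_def
      using K f rD zero \<gamma> by (intro exI[of _ r] exI[of _ "\<lambda>t. 0"] exI[of _ f] exI[of _ f']) simp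
  next
    assume "has_cov_L L m \<gamma> s Ds"
    then obtain \<sigma> D\<sigma> f f' where S: "continuous_on {0..1} \<sigma> \<and>
      (\<forall>t\<in>{0..1}. \<sigma> t \<in> L (\<gamma> t) \<and> \<sigma> t \<noteq> 0 \<and> D\<sigma> t \<in> L (\<gamma> t)) \<and>
      has_cov_K \<gamma> (\<lambda>t. m (\<gamma> t) (\<sigma> t) (\<sigma> t)) (\<lambda>t \<alpha>s. 2 * m (\<gamma> t) (\<sigma> t) (D\<sigma> t) \<alpha>s) \<and>
      (\<forall>t\<in>{0..1}. (f has_vector_derivative f' t) (at t within {0..1}) \<and>
        s t = f t *s \<sigma> t \<and> Ds t = f' t *s \<sigma> t + f t *s D\<sigma> t)"
      unfolding has_cov_L_def by (elim exE)
    note \<sigma>_cont = conjunct1[OF S] and K = conjunct1[OF conjunct2[OF conjunct2[OF S]]]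
    have \<sigma>: "\<sigma> t \<in> L (Jt t) \<and> \<sigma> t \<noteq> 0 \<and> D\<sigma> t \<in> L (Jt t)" if "t \<in> {0..1}" for t
      using bspec[OF conjunct1[OF conjunct2[OF S]] that] unfolding \<gamma>[OF that] .
    have f: "(f has_vector_derivative f' t) (at t within {0..1})"
      "s t = f t *s \<sigma> t \<and> Ds t = f' t *s \<sigma> t + f t *s D\<sigma> t" if "t \<in> {0..1}" for t
      using bspec[OF conjunct2[OF conjunct2[OF conjunct2[OF S]]] that] by blast+
    define g where "g = (\<lambda>t. comp_along (r t) (\<sigma> t))"
    define h where "h = (\<lambda>t. comp_along (r t) (D\<sigma> t))"
    have g: "\<sigma> t = g t *s r t" and h: "D\<sigma> t = h t *s r t" if "t \<in> {0..1}" for t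
      using \<sigma>[OF that] L_generated[OF rD(1)[OF that] rD(3)[OF that]] comp_along_scale[OF rD(3)[OF that]]
      by (auto simp: g_def h_def)
    have g_nz: "g t \<noteq> 0" if "t \<in> {0..1}" for t
      using \<sigma>[OF that] g[OF that] by auto
    have g_cont: "continuous_on {0..1} g"
      unfolding g_def by (rule continuous_comp_along) (use r \<sigma>_cont rD(3) in \<open>auto simp: root_section_def\<close>)
    have dim2: "DIM('a) div 2 = n" using dim by simp
    obtain z Dz where zD: "(\<forall>i<n. has_cov_V \<gamma> (z i) (Dz i)) \<and>
      (\<forall>t\<in>{0..1}. m (\<gamma> t) (\<sigma> t) (\<sigma> t) = wedge_vecs (map (\<lambda>i. z i t) [0..<n]) \<and>
        (\<lambda>\<alpha>s. 2 * m (\<gamma> t) (\<sigma> t) (D\<sigma> t) \<alpha>s)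
          = (\<lambda>\<alpha>s. \<Sum>i<n. wedge_vecs ((map (\<lambda>i. z i t) [0..<n])[i := Dz i t]) \<alpha>s))"
      using K unfolding has_cov_K_def Let_def dim2 by (elim exE)
    have V: "has_cov_V \<gamma> (z i) (Dz i)" if "i < n" for i using conjunct1[OF zD] that by blast
    have W: "m (\<gamma> t) (\<sigma> t) (\<sigma> t) = wedge_vecs (map (\<lambda>i. z i t) [0..<n])"
      "(\<lambda>\<alpha>s. 2 * m (\<gamma> t) (\<sigma> t) (D\<sigma> t) \<alpha>s)
          = (\<lambda>\<alpha>s. \<Sum>i<n. wedge_vecs ((map (\<lambda>i. z i t) [0..<n])[i := Dz i t]) \<alpha>s)" if "t \<in> {0..1}" for t
      using bspec[OF conjunct2[OF zD] that] by blast+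
    \<comment> \<open>Only the square of \<open>\<sigma>\<close> is known to be differentiable.
      Comparing coordinates relative to \<open>\<mu>\<close> shows that \<open>g\<^sup>2\<close> has
      derivative \<open>2 g h\<close>, and continuity of \<open>g\<close> gives the rest.\<close>
    have g_deriv: "(g has_vector_derivative h t) (at t within {0..1})" if t: "t \<in> {0..1}" for t
    proof (rule square_root_derivative[OF g_cont t g_nz[OF t]])
      have "\<exists>d. (z i has_vector_derivative d) (at t within {0..1}) \<and> z i t \<in> V10 (Jt t) \<and> d - Dz i t \<in> V01 (Jt t)" if "i < n" for i
        using bspec[OF V[OF that, unfolded has_cov_V_def] t] unfolding \<gamma>[OF t] by blast
      then obtain d where d: "\<And>i. i < n \<Longrightarrow> (z i has_vector_derivative d i) (at t within {0..1})"
        "\<And>i. i < n \<Longrightarrow> z i t \<in> V10 (Jt t)" "\<And>i. i < n \<Longrightarrow> d i - Dz i t \<in> V01 (Jt t)" by metis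
      have 1: "top_eval e (czst r @ map (\<lambda>i. z i r) [0..<n]) = (g r)\<^sup>2 * (a0 * tc)" if r: "r \<in> {0..1}" for r
      proof -
        have "wedge_vecs (map (\<lambda>i. z i r) [0..<n]) = (\<lambda>\<alpha>s. (g r)\<^sup>2 * \<mu> r \<alpha>s)"
          unfolding W(1)[OF r, symmetric] \<gamma>[OF r] g[OF r] m_scale[OF rD(1)[OF r] rD(1)[OF r]] rD(2)[OF r] power2_eq_square ..
        then have "CK r (wedge_vecs (map (\<lambda>i. z i r) [0..<n])) = (g r)\<^sup>2 * (a0 * tc)"
          by (simp only: Jt.coeff_K_scale CK_\<mu>)
        then show ?thesis by (simp only: Jt.coeff_K_wedge_vecs)
      qed
      have 2: "(\<Sum>i<n. top_eval e (czst t @ (map (\<lambda>i. z i t) [0..<n])[i := Dz i t])) = 2 * g t * h t * (a0 * tc)"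
      proof -
        have "(\<lambda>\<alpha>s. \<Sum>i<n. wedge_vecs ((map (\<lambda>i. z i t) [0..<n])[i := Dz i t]) \<alpha>s) = (\<lambda>\<alpha>s. 2 * g t * h t * \<mu> t \<alpha>s)"
          unfolding W(2)[OF t, symmetric] \<gamma>[OF t] g[OF t] h[OF t] m_scale[OF rD(1)[OF t] rD(1)[OF t]] rD(2)[OF t] by (simp add: mult.assoc)
        then have "CK t (\<lambda>\<alpha>s. \<Sum>i<n. wedge_vecs ((map (\<lambda>i. z i t) [0..<n])[i := Dz i t]) \<alpha>s) = 2 * g t * h t * (a0 * tc)"
          by (simp only: Jt.coeff_K_scale CK_\<mu>)
        then show ?thesis by (simp only: Jt.coeff_K_sum Jt.coeff_K_wedge_vecs)
      qed
      from section_derivative[where D = "\<lambda>i. Dz i t", OF d]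
      have "((\<lambda>r. top_eval e (czst r @ map (\<lambda>i. z i r) [0..<n])) has_vector_derivative 2 * g t * h t * (a0 * tc)) (at t within {0..1})"
        unfolding 2 .
      then have "((\<lambda>r. (g r)\<^sup>2 * (a0 * tc)) has_vector_derivative 2 * g t * h t * (a0 * tc)) (at t within {0..1})"
        by (rule has_vector_derivative_transform[OF t, rotated]) (simp only: 1)
      from has_vector_derivative_divide[OF this, of "a0 * tc"]
      show "((\<lambda>r. (g r)\<^sup>2) has_vector_derivative 2 * g t * h t) (at t within {0..1})"
        using a0 tc_nonzero by (simp add: mult.assoc)
    qed
    have "((\<lambda>t. f t * g t) has_vector_derivative f t * h t + f' t * g t) (at t within {0..1})" if t: "t \<in> {0..1}" for t
      by (rule has_vector_derivative_mult[OF f(1)[OF t] g_deriv[OF t]])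
    moreover have "s t = (f t * g t) *s r t" if t: "t \<in> {0..1}" for t
      unfolding conjunct1[OF f(2)[OF t]] g[OF t] by (rule vector_smult_assoc)
    moreover have "Ds t = (f t * h t + f' t * g t) *s r t" if t: "t \<in> {0..1}" for t
      unfolding conjunct2[OF f(2)[OF t]] g[OF t] h[OF t] vector_smult_assoc vector_sadd_rdistrib by (rule add.commute)
    ultimately show "\<exists>f f'. \<forall>t\<in>{0..1}. (f has_vector_derivative f' t) (at t within {0..1}) \<and>
      s t = f t *s r t \<and> Ds t = f' t *s r t"
      by (intro exI[of _ "\<lambda>t. f t * g t"] exI[of _ "\<lambda>t. f t * h t + f' t * g t"] ballI conjI)
  }
qed

lemma has_cov_L_parallel: "root_section {0..1} r \<Longrightarrow> has_cov_L L m \<gamma> (\<lambda>t. c *s r t) (\<lambda>t. 0)"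
  unfolding has_cov_L_iff by (intro exI[of _ "\<lambda>t. c"] exI[of _ "\<lambda>t. 0"]) simp

lemma L_transport:
  assumes r: "root_section {0..1} r" "r 0 = w0" and R: "\<And>c. R (c *s w0) = c *s r 1"
  shows "is_transport (\<lambda>s. has_cov_L L m \<gamma> s (\<lambda>t. 0)) (L (Jt 0)) R"
  unfolding is_transport_def
proof (intro ballI allI iffI)
  fix w y assume "w \<in> L (Jt 0)"
  then obtain c where c: "w = c *s w0" using L_generated[OF w0] by blast
  {
    assume "\<exists>s. has_cov_L L m \<gamma> s (\<lambda>t. 0) \<and> s 0 = w \<and> s 1 = y"
    then obtain s where s: "has_cov_L L m \<gamma> s (\<lambda>t. 0)" "s 0 = w" "s 1 = y" by blast
    then obtain f f' where f: "\<And>t. t \<in> {0..1} \<Longrightarrow> (f has_vector_derivative f' t) (at t within {0..1}) \<and>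
      s t = f t *s r t \<and> 0 = f' t *s r t" unfolding has_cov_L_iff[OF r(1)] by blast
    have "f' t = 0" if "t \<in> {0..1}" for t
      using f[OF that] root_section_nonzero[OF r(1) that] by (metis vector_mul_eq_0)
    then have "(f has_vector_derivative 0) (at t within {0..1})" if "t \<in> {0..1}" for t
      using f[OF that] that by metis
    then obtain a where a: "\<And>t. t \<in> {0..1} \<Longrightarrow> f t = a"
      using has_vector_derivative_zero_constant[of "{0..1}" f] by auto
    have "a *s w0 = c *s w0" using f[of 0] a[of 0] s(2) r(2) c by auto
    then show "y = R w" using f[of 1] a[of 1] s(3) R[of c] c w0(2) by simp
  next
    assume "y = R w"
    then show "\<exists>s. has_cov_L L m \<gamma> s (\<lambda>t. 0) \<and> s 0 = w \<and> s 1 = y"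
      using has_cov_L_parallel[OF r(1), of c] by (intro exI[of _ "\<lambda>t. c *s r t"]) (simp add: R c r(2))
  }
qed

lemma inner_L_along:
  assumes r: "root_section {0..1} r" and t: "t \<in> {0..1}"
  shows "inner_L e m (Jt t) (a *s r t) (c *s r t) = cnj a * c * of_real (cmod a0 * sqrt pc)"
proof -
  have rD: "r t \<in> L (Jt t)" "m (Jt t) (r t) (r t) = \<mu> t" using r t by (auto simp: root_section_def)
  have "inner_L e m (Jt t) (a *s r t) (c *s r t) = cnj a * c * of_real (sqrt ((cmod a0)\<^sup>2 * pc))"
  proof (rule inner_L_line)
    show "m (Jt t) (a *s r t) (a *s r t) = (\<lambda>\<alpha>s. a\<^sup>2 * \<mu> t \<alpha>s)" for a
      unfolding m_scale[OF rD(1) rD(1)] rD(2) power2_eq_square ..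
    show "pair_K e (\<mu> t) (\<mu> t) = of_real ((cmod a0)\<^sup>2 * pc)"
      unfolding \<mu>_def pair_K_scale pair_K_zst of_real_mult complex_norm_square by (simp add: mult.commute)
  qed (use pc_pos in simp)
  then show ?thesis by (simp add: real_sqrt_mult)
qed

section \<open>The square root of the half rotation and the half-form pairing\<close>

lemma half_rotation_V10:
  assumes z: "z \<in> V10 (Jt 0)" and t: "t \<in> {0..1}"
  shows "cvec_scale (1 / \<i>) (cvec_map (\<gamma> (t / 2)) z) = cvec_map (E (t / 2)) z"
proof -
  have "t / 2 \<in> {0..1}" using t by auto
  note [simp] = \<gamma>[OF this]
  have "snd z = - J (fst z)" using z unfolding Jt.V10_iff by (simp add: E_0)
  then show ?thesis
    by (simp add: cvec_map_def cvec_scale_def complex_structureD(1)[OF J] blinfun.minus_right prod_eq_iff)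
qed

text \<open>This pins down every \<open>halfform_root\<close>: on \<open>w0\<close> it is a root
  section, and \<open>w0\<close> spans the initial fibre.\<close>

lemma halfform_root_section:
  assumes R: "halfform_root L m \<gamma> R"
  shows "root_section {0..1} (\<lambda>t. R t w0)" "R 0 w0 = w0" "t \<in> {0..1} \<Longrightarrow> R t (c *s w0) = c *s R t w0"
proof -
  have \<gamma>0: "\<gamma> 0 = Jt 0" by (simp add: \<gamma>)
  have R': "R 0 w = w \<and> continuous_on {0..1} (\<lambda>t. R t w) \<and>
        (\<forall>t\<in>{0..1}. R t w \<in> L (\<gamma> t) \<and> (\<forall>c. R t (c *s w) = c *s R t w) \<and>
           (\<forall>zs. length zs = DIM('a) div 2 \<and> set zs \<subseteq> V10 (\<gamma> 0) \<and> m (\<gamma> 0) w w = wedge_vecs zs \<longrightarrow>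
              m (\<gamma> t) (R t w) (R t w) =
              wedge_vecs (map (\<lambda>z. cvec_scale (1 / \<i>) (cvec_map (\<gamma> (t / 2)) z)) zs)))" if "w \<in> L (Jt 0)" for w
    using R that unfolding halfform_root_def \<gamma>0 by blast
  show "R 0 w0 = w0" using R'[OF w0(1)] by blast
  show "R t (c *s w0) = c *s R t w0" if "t \<in> {0..1}" using R'[OF w0(1)] that by blast
  have "m (Jt t) (R t w0) (R t w0) = \<mu> t" if t: "t \<in> {0..1}" for t
  proof -
    let ?zs = "map (\<lambda>i. if i = 0 then cvec_scale a0 (zt 0 0) else zt 0 i) [0..<n]"
    have "(if i = 0 then cvec_scale a0 (zt 0 0) else zt 0 i) \<in> V10 (Jt 0)" for i :: nat
      by (cases "i = 0") (simp_all only: if_True if_False V10_scale Jt.zvec_V10 simp_thms)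
    then have zs: "length ?zs = DIM('a) div 2" "set ?zs \<subseteq> V10 (Jt 0)"
      using dim unfolding set_map by (simp, intro image_subsetI)
    have m0': "m (Jt 0) w0 w0 = wedge_vecs ?zs" using m0 scaled_zst[of 0] by (simp add: \<mu>_def)
    have map_eq: "map (\<lambda>z. cvec_scale (1 / \<i>) (cvec_map (\<gamma> (t / 2)) z)) ?zs = map (cvec_map (E (t / 2))) ?zs"
      by (rule map_cong[OF refl]) (rule half_rotation_V10[OF subsetD[OF zs(2)] t])
    have "m (\<gamma> t) (R t w0) (R t w0) = wedge_vecs (map (\<lambda>z. cvec_scale (1 / \<i>) (cvec_map (\<gamma> (t / 2)) z)) ?zs)"
      by (rule bspec[OF conjunct2[OF conjunct2[OF R'[OF w0(1)]]] t, THEN conjunct2, THEN conjunct2, THEN spec, THEN mp])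
         (intro conjI; (rule zs(1))?; unfold \<gamma>0; (rule zs(2) m0'))
    then have "m (Jt t) (R t w0) (R t w0) = wedge_vecs (map (cvec_map (E (t / 2))) ?zs)"
      unfolding map_eq \<gamma>[OF t] .
    also have "\<dots> = \<mu> t"
      unfolding \<mu>_def by (rule wedge_vecs_flow) (use zs dim m0 m0' in auto)
    finally show ?thesis .
  qed
  then show "root_section {0..1} (\<lambda>t. R t w0)"
    using R'[OF w0(1)] \<gamma> unfolding root_section_def by metis
qed

text \<open>The condition on squares ranges over all factorisations of the square of
  \<open>w\<close>; \<open>wedge_vecs_flow\<close> treats them alike.\<close>

lemma halfform_root_exists: "\<exists>R. halfform_root L m \<gamma> R"
proof -
  obtain r where r: "root_section {0..1} r" "r 0 = w0" using root_section_exists by blast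
  have rD: "r t \<in> L (Jt t)" "m (Jt t) (r t) (r t) = \<mu> t" if "t \<in> {0..1}" for t
    using r that by (auto simp: root_section_def)
  have \<gamma>0: "\<gamma> 0 = Jt 0" by (simp add: \<gamma>)
  have "halfform_root L m \<gamma> (\<lambda>t w. comp_along w0 w *s r t)"
    unfolding halfform_root_def \<gamma>0
  proof (intro ballI conjI allI impI)
    fix w assume "w \<in> L (Jt 0)"
    then obtain c where c: "w = c *s w0" using L_generated[OF w0] by blast
    show "comp_along w0 w *s r 0 = w" using w0(2) by (simp add: c comp_along_scale r(2))
    show "continuous_on {0..1} (\<lambda>t. comp_along w0 w *s r t)"
      using r(1) by (intro continuous_vscale continuous_on_const) (simp add: root_section_def)
    fix t :: real assume t: "t \<in> {0..1}"
    show "comp_along w0 w *s r t \<in> L (\<gamma> t)" unfolding \<gamma>[OF t] by (rule L_scale[OF rD(1)[OF t]])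
    show "comp_along w0 (a *s w) *s r t = a *s (comp_along w0 w *s r t)" for a
      by (simp add: comp_along_hom vec_eq_iff)
    fix ys assume ys: "length ys = DIM('a) div 2 \<and> set ys \<subseteq> V10 (Jt 0) \<and> m (Jt 0) w w = wedge_vecs ys"
    have map_eq: "map (\<lambda>z. cvec_scale (1 / \<i>) (cvec_map (\<gamma> (t / 2)) z)) ys = map (cvec_map (E (t / 2))) ys"
      by (rule map_cong[OF refl]) (rule half_rotation_V10[OF _ t], use ys in blast)
    have "wedge_vecs ys = (\<lambda>\<alpha>s. (c\<^sup>2 * a0) * wedge_vecs (zst 0) \<alpha>s)"
      using ys m_scale[OF w0(1) w0(1), of c c] by (simp add: c m0 power2_eq_square mult.assoc)
    then have "wedge_vecs (map (cvec_map (E (t / 2))) ys) = (\<lambda>\<alpha>s. (c\<^sup>2 * a0) * wedge_vecs (zst t) \<alpha>s)"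
      using ys dim by (intro wedge_vecs_flow) auto
    moreover have "m (\<gamma> t) (c *s r t) (c *s r t) = (\<lambda>\<alpha>s. (c\<^sup>2 * a0) * wedge_vecs (zst t) \<alpha>s)"
      unfolding \<gamma>[OF t] m_scale[OF rD(1)[OF t] rD(1)[OF t]] rD(2)[OF t] \<mu>_def by (simp add: power2_eq_square mult.assoc)
    ultimately show "m (\<gamma> t) (comp_along w0 w *s r t) (comp_along w0 w *s r t) =
              wedge_vecs (map (\<lambda>z. cvec_scale (1 / \<i>) (cvec_map (\<gamma> (t / 2)) z)) ys)"
      unfolding map_eq c comp_along_scale[OF w0(2)] by (simp only:)
  qed
  then show ?thesis by blast
qed

abbreviation "cosprod t \<equiv> (\<Prod>i<n. cos (t * \<theta> i / 2))"

lemma cosprod_pos: "t \<in> {0..1} \<Longrightarrow> 0 < cosprod t"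
  by (intro prod_pos) (use cos_half_pos in auto)

text \<open>The right side is displayed as a square because the half-form pairing has to be a root
  of it.\<close>

lemma pair_K_section:
  assumes r: "root_section {0..1} r" "r 0 = w0" and t: "t \<in> {0..1}"
  shows "pair_K e (m (\<gamma> t) (a *s r t) (a *s r t)) (m (\<gamma> 0) (c *s w0) (c *s w0))
    = (cnj a * c * of_real (cmod a0 * sqrt pc * sqrt (cosprod t)))\<^sup>2"
proof -
  have rD: "r t \<in> L (Jt t)" "m (Jt t) (r t) (r t) = \<mu> t" using r t by (auto simp: root_section_def)
  have \<gamma>0: "\<gamma> 0 = Jt 0" by (simp add: \<gamma>)
  have sq: "(sqrt pc)\<^sup>2 = pc" "(sqrt (cosprod t))\<^sup>2 = cosprod t" using pc_pos cosprod_pos[OF t] by simp_all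
  have "pair_K e (m (\<gamma> t) (a *s r t) (a *s r t)) (m (\<gamma> 0) (c *s w0) (c *s w0))
    = cnj (a * a * a0) * (c * c * a0) * of_real (cosprod t * pc)"
    unfolding \<gamma>[OF t] \<gamma>0 m_scale[OF rD(1) rD(1)] m_scale[OF w0(1) w0(1)] rD(2) m0 \<mu>_def
    by (simp only: mult.assoc[symmetric] pair_K_scale pair_K_zst)
  also have "cnj (a * a * a0) * (c * c * a0) = (cnj a * c)\<^sup>2 * (a0 * cnj a0)"
    by (simp add: power2_eq_square mult_ac)
  also have "a0 * cnj a0 = of_real ((cmod a0)\<^sup>2)" by (simp only: complex_norm_square)
  also have "(cnj a * c)\<^sup>2 * of_real ((cmod a0)\<^sup>2) * of_real (cosprod t * pc)
     = (cnj a * c * of_real (cmod a0 * sqrt pc * sqrt (cosprod t)))\<^sup>2"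
    unfolding power_mult_distrib of_real_power[symmetric] sq by simp
  finally show ?thesis .
qed

lemma halfform_pairing_exists: "\<exists>p. halfform_pairing e L m \<gamma> p"
proof -
  obtain r where r: "root_section {0..1} r" "r 0 = w0" using root_section_exists by blast
  have rD: "r t \<in> L (Jt t)" "r t \<noteq> 0" if "t \<in> {0..1}" for t
    using r that root_section_nonzero[OF r(1) that] by (auto simp: root_section_def)
  have \<gamma>0: "\<gamma> 0 = Jt 0" by (simp add: \<gamma>)
  define p where "p = (\<lambda>t w' w. cnj (comp_along (r t) w') * comp_along w0 w * of_real (cmod a0 * sqrt pc * sqrt (cosprod t)))"
  have "halfform_pairing e L m \<gamma> p"
    unfolding halfform_pairing_def
  proof (intro conjI ballI allI impI)
    fix t w' w assume t: "t \<in> {0..1}" and w: "w' \<in> L (\<gamma> t)" "w \<in> L (\<gamma> 0)"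
    show "p t (c *s w') w = cnj c * p t w' w" "p t w' (c *s w) = c * p t w' w" for c
      by (simp_all add: p_def comp_along_hom)
    obtain a c where ac: "w' = a *s r t" "w = c *s w0"
      using w L_generated[OF rD(1)[OF t] rD(2)[OF t]] L_generated[OF w0] \<gamma>[OF t] \<gamma>0 by auto
    show "(p t w' w)\<^sup>2 = pair_K e (m (\<gamma> t) w' w') (m (\<gamma> 0) w w)"
      unfolding ac pair_K_section[OF r t] using rD(2)[OF t] w0(2) by (simp add: p_def comp_along_scale)
  next
    fix w' w assume w: "w' \<in> L (\<gamma> 0)" "w \<in> L (\<gamma> 0)"
    obtain a c where ac: "w' = a *s w0" "w = c *s w0" using w L_generated[OF w0] \<gamma>0 by auto
    show "p 0 w' w = inner_L e m (\<gamma> 0) w' w"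
      using inner_L_along[OF r(1), of 0 a c] w0(2) by (simp add: \<gamma>0 ac r(2) p_def comp_along_scale)
  next
    fix s w assume "w \<in> L (\<gamma> 0)" and s: "continuous_on {0..1} s \<and> (\<forall>t\<in>{0..1}. s t \<in> L (\<gamma> t))"
    have "continuous_on {0..1} (\<lambda>t. comp_along (r t) (s t))"
      by (rule continuous_comp_along) (use r(1) s rD(2) in \<open>auto simp: root_section_def\<close>)
    then show "continuous_on {0..1} (\<lambda>t. p t (s t) w)"
      unfolding p_def by (intro continuous_intros) auto
  qed
  then show ?thesis by blast
qed

text \<open>Both sides have the same square and agree at time 0 for \<open>a = c = 1\<close>. The
  explicit side never vanishes, so by continuity no change of sign can occur.\<close>

lemma halfform_pairing_section:
  assumes p: "halfform_pairing e L m \<gamma> p" and r: "root_section {0..1} r" "r 0 = w0" and t: "t \<in> {0..1}"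
  shows "p t (a *s r t) (c *s w0) = cnj a * c * of_real (cmod a0 * sqrt pc * sqrt (cosprod t))"
proof -
  have \<gamma>0: "\<gamma> 0 = Jt 0" by (simp add: \<gamma>)
  have rD: "r t \<in> L (\<gamma> t)" if "t \<in> {0..1}" for t
    using r that \<gamma>[OF that] by (auto simp: root_section_def)
  have w0': "w0 \<in> L (\<gamma> 0)" using w0 \<gamma>0 by simp
  have "p t (r t) w0 = of_real (cmod a0 * sqrt pc * sqrt (cosprod t))"
  proof (rule continuous_sign_constant[OF _ _ _ _ _ t])
    show "continuous_on {0..1} (\<lambda>t. p t (r t) w0)"
      using p r(1) rD w0' unfolding halfform_pairing_def root_section_def by blast
    show "continuous_on {0..1} (\<lambda>t. complex_of_real (cmod a0 * sqrt pc * sqrt (cosprod t)))"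
      by (intro continuous_intros) auto
    show "(p t (r t) w0)\<^sup>2 = (of_real (cmod a0 * sqrt pc * sqrt (cosprod t)))\<^sup>2" if t: "t \<in> {0..1}" for t
    proof -
      have "(p t (r t) w0)\<^sup>2 = pair_K e (m (\<gamma> t) (r t) (r t)) (m (\<gamma> 0) w0 w0)"
        using p rD[OF t] w0' t unfolding halfform_pairing_def by blast
      then show ?thesis using pair_K_section[OF r t, of 1 1] by simp
    qed
    show "complex_of_real (cmod a0 * sqrt pc * sqrt (cosprod t)) \<noteq> 0" if "t \<in> {0..1}" for t
    proof -
      have "0 < cmod a0 * sqrt pc * sqrt (cosprod t)"
        by (intro mult_pos_pos real_sqrt_gt_zero cosprod_pos[OF that] pc_pos) (use a0 in simp)
      then show ?thesis unfolding of_real_eq_0_iff by (rule less_imp_neq[THEN not_sym])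
    qed
    have "p 0 w0 w0 = inner_L e m (\<gamma> 0) w0 w0" using p w0' unfolding halfform_pairing_def by blast
    then show "p 0 (r 0) w0 = of_real (cmod a0 * sqrt pc * sqrt (cosprod 0))"
      using inner_L_along[OF r(1), of 0 1 1] unfolding r(2) \<gamma>0 by simp
  qed
  moreover have "p t (a *s r t) (c *s w0) = cnj a * (c * p t (r t) w0)"
  proof -
    have cw0: "c *s w0 \<in> L (\<gamma> 0)" unfolding \<gamma>0 by (rule L_scale[OF w0(1)])
    have hom: "p t (c *s w') w = cnj c * p t w' w \<and> p t w' (c *s w) = c * p t w' w"
      if "w' \<in> L (\<gamma> t)" "w \<in> L (\<gamma> 0)" for c w' w
      by (rule bspec[OF bspec[OF bspec[OF conjunct1[OF p[unfolded halfform_pairing_def]] t] that(1)] that(2), THEN conjunct1, THEN spec])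
    show ?thesis unfolding conjunct1[OF hom[OF rD[OF t] cw0]] conjunct2[OF hom[OF rD[OF t] w0']] ..
  qed
  ultimately show ?thesis by simp
qed

end

subsection \<open>The tensor product\<close>

lemma comp_along_tensor: "w \<noteq> 0 \<Longrightarrow> (\<lambda>vs. comp_along w (tensor \<phi> w vs)) = \<phi>"
  by (simp add: tensor_def comp_along_scale)

text \<open>When all second factors lie on one line, every tensor is decomposable. This reduces the
  tensor product with \<open>L\<close> to forms.\<close>

lemma tensor_sum_line:
  assumes "\<And>i. i < N \<Longrightarrow> v i = c i *s w"
  shows "tensor_sum N \<psi> v = tensor (\<lambda>vs. \<Sum>i<N. c i * \<psi> i vs) w"
proof
  fix vs
  have "tensor_sum N \<psi> v vs = (\<Sum>i<N. (c i * \<psi> i vs) *s w)"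
    unfolding tensor_sum_def using assms by (intro sum.cong) (auto simp: vec_eq_iff)
  then show "tensor_sum N \<psi> v vs = tensor (\<lambda>vs. \<Sum>i<N. c i * \<psi> i vs) w vs"
    by (simp add: tensor_def vec_eq_iff sum_distrib_right)
qed

lemma tensor_in_space: "\<psi> \<in> E \<Longrightarrow> w \<in> F \<Longrightarrow> tensor \<psi> w \<in> tensor_space E F"
  unfolding tensor_space_def
  by (intro CollectI exI[of _ "1::nat"] exI[of _ "\<lambda>i. \<psi>"] exI[of _ "\<lambda>i. w"])
     (auto simp: tensor_sum_def tensor_def)

lemma (in oriented_frame) ip_lincomb_right:
  assumes "\<And>i. i < (N::nat) \<Longrightarrow> \<phi> i \<in> alternating_forms"
  shows "ip \<xi> (\<lambda>vs. \<Sum>i<N. c i * \<phi> i vs) = (\<Sum>i<N. c i * ip \<xi> (\<phi> i))"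
proof -
  have "(\<lambda>vs. c i * \<phi> i vs) \<in> alternating_forms" if "i \<in> {..<N}" for i using assms that by auto
  from ip_sum_right[where A = "{..<N}" and \<phi> = "\<lambda>i vs. c i * \<phi> i vs", OF this]
  have "ip \<xi> (\<lambda>vs. \<Sum>i<N. c i * \<phi> i vs) = (\<Sum>i<N. ip \<xi> (\<lambda>vs. c i * \<phi> i vs))" by blast
  also have "\<dots> = (\<Sum>i<N. c i * ip \<xi> (\<phi> i))"
    by (rule sum.cong[OF refl]) (simp add: ip_scale_right assms)
  finally show ?thesis .
qed

lemma (in oriented_frame) ip_lincomb_left:
  assumes "\<xi> \<in> alternating_forms"
  shows "ip (\<lambda>vs. \<Sum>i\<in>A. c i * \<phi> i vs) \<xi> = (\<Sum>i\<in>A. cnj (c i) * ip (\<phi> i) \<xi>)"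
  using ip_sum_left[OF assms, where A = A and \<psi> = "\<lambda>i vs. c i * \<phi> i vs"] by (simp add: ip_scale_left assms)

context half_forms
begin

lemma fibre_H_sum:
  assumes "\<And>i. i < (N::nat) \<Longrightarrow> w i \<in> fibre_H (Jt t)"
  shows "(\<lambda>vs. \<Sum>i<N. c i * w i vs) \<in> fibre_H (Jt t)"
  using assms
proof (induction N)
  case 0
  have "transport_H 0 (\<lambda>vs. 0) t \<in> fibre_H (Jt t)" by (rule transport_H_fibre) simp
  from fibre_H_lincomb[OF this this, of 0 0] show ?case by simp
next
  case (Suc N)
  then show ?case using fibre_H_lincomb[of "\<lambda>vs. \<Sum>i<N. c i * w i vs" "Jt t" "w N" 1 "c N"] by simp
qed

lemma P_sum:
  assumes \<psi>: "\<And>i. i < (N::nat) \<Longrightarrow> \<psi> i \<in> alternating_forms"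
  shows "P t (\<lambda>vs. \<Sum>i<N. c i * \<psi> i vs) = (\<lambda>vs. \<Sum>i<N. c i * P t (\<psi> i) vs)"
proof (rule fibre_H_eqI)
  have alt: "(\<lambda>vs. \<Sum>i<N. c i * \<psi> i vs) \<in> alternating_forms" using \<psi> by auto
  show "P t (\<lambda>vs. \<Sum>i<N. c i * \<psi> i vs) \<in> fibre_H (Jt t)" by (rule Jt.vacuum_proj_fibre[OF alt])
  show "(\<lambda>vs. \<Sum>i<N. c i * P t (\<psi> i) vs) \<in> fibre_H (Jt t)"
    by (rule fibre_H_sum) (rule Jt.vacuum_proj_fibre[OF \<psi>])
  fix \<phi> assume \<phi>: "\<phi> \<in> fibre_H (Jt t)"
  have "P t (\<psi> i) \<in> alternating_forms" if "i < N" for i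
    using Jt.fibre_HD(1)[OF Jt.vacuum_proj_fibre[OF \<psi>[OF that]]] .
  then show "ip \<phi> (P t (\<lambda>vs. \<Sum>i<N. c i * \<psi> i vs)) = ip \<phi> (\<lambda>vs. \<Sum>i<N. c i * P t (\<psi> i) vs)"
    unfolding Jt.ip_vacuum_proj[OF \<phi> alt] by (simp add: ip_lincomb_right \<psi> Jt.ip_vacuum_proj[OF \<phi>])
qed

lemma UH_sum:
  assumes "\<And>i. i < (N::nat) \<Longrightarrow> \<psi> i \<in> fibre_H (Jt 0)"
  shows "UH (\<lambda>vs. \<Sum>i<N. c i * \<psi> i vs) = (\<lambda>vs. \<Sum>i<N. c i * UH (\<psi> i) vs)"
  using P_sum[of N \<psi> 1 c] Jt.fibre_HD(1)[OF assms]
  by (simp add: transport_H_def[abs_def] sum_distrib_left mult.left_commute)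

lemma \<kappa>_1: "\<kappa> 1 = sqrt (cosprod 1)"
proof -
  have pos: "0 < cos (1 * \<theta> i / 2)" if "i < n" for i using cos_half_pos[OF that, of 1] by simp
  have "(\<kappa> 1)\<^sup>2 = exp (\<Sum>i<n. ln (cos (1 * \<theta> i / 2)))"
    by (simp add: \<kappa>_def power2_eq_square flip: exp_add)
  also have "\<dots> = (\<Prod>i<n. exp (ln (cos (1 * \<theta> i / 2))))" by (rule exp_sum) simp
  also have "\<dots> = cosprod 1" using pos by (intro prod.cong) auto
  finally show ?thesis using \<kappa>_pos[of 1] by (simp add: real_sqrt_unique)
qed

text \<open>The witness for all three pairings of the tensor product: read off the form components
  along fixed spanning vectors, pair them, and multiply by the pairing of these vectors.\<close>

lemma tensor_form:
  assumes w: "w' \<in> L (Jt t')" "w' \<noteq> 0" "w \<in> L (Jt t)" "w \<noteq> 0"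
    and q: "\<And>a c. bl (a *s w') (c *s w) = cnj a * c * q"
  shows "is_tensor_form (fibre_H (Jt t')) (L (Jt t')) (fibre_H (Jt t)) (L (Jt t)) ip bl
    (\<lambda>\<Psi> \<Phi>. ip (\<lambda>vs. comp_along w' (\<Psi> vs)) (\<lambda>vs. comp_along w (\<Phi> vs)) * q)"
  unfolding is_tensor_form_def
proof (intro allI impI)
  fix N :: nat and \<psi> u and M :: nat and \<phi> v
  assume A: "(\<forall>i<N. \<psi> i \<in> fibre_H (Jt t') \<and> u i \<in> L (Jt t')) \<and> (\<forall>j<M. \<phi> j \<in> fibre_H (Jt t) \<and> v j \<in> L (Jt t))"
  have "\<forall>i<N. \<exists>c. u i = c *s w'" "\<forall>j<M. \<exists>c. v j = c *s w"
    using A L_generated[OF w(1,2)] L_generated[OF w(3,4)] by blast+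
  then obtain a c where a: "\<And>i. i < N \<Longrightarrow> u i = a i *s w'" and c: "\<And>j. j < M \<Longrightarrow> v j = c j *s w" by metis
  have alt: "\<psi> i \<in> alternating_forms" if "i < N" for i using A that Jt.fibre_HD(1) by blast
  have alt': "\<phi> j \<in> alternating_forms" if "j < M" for j using A that Jt.fibre_HD(1) by blast
  have "(\<lambda>vs. \<Sum>j<M. c j * \<phi> j vs) \<in> alternating_forms" using alt' by auto
  then have "ip (\<lambda>vs. \<Sum>i<N. a i * \<psi> i vs) (\<lambda>vs. \<Sum>j<M. c j * \<phi> j vs) * q
      = (\<Sum>i<N. \<Sum>j<M. (cnj (a i) * (c j * ip (\<psi> i) (\<phi> j))) * q)"
    by (simp add: ip_lincomb_left ip_lincomb_right alt' sum_distrib_left sum_distrib_right)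
  also have "\<dots> = (\<Sum>i<N. \<Sum>j<M. ip (\<psi> i) (\<phi> j) * bl (u i) (v j))"
    by (intro sum.cong refl) (simp add: a c q)
  finally have eq: "ip (\<lambda>vs. \<Sum>i<N. a i * \<psi> i vs) (\<lambda>vs. \<Sum>j<M. c j * \<phi> j vs) * q
      = (\<Sum>i<N. \<Sum>j<M. ip (\<psi> i) (\<phi> j) * bl (u i) (v j))" .
  have "tensor_sum N \<psi> u = tensor (\<lambda>vs. \<Sum>i<N. a i * \<psi> i vs) w'"
    "tensor_sum M \<phi> v = tensor (\<lambda>vs. \<Sum>j<M. c j * \<phi> j vs) w"
    by (rule tensor_sum_line, erule a) (rule tensor_sum_line, erule c)
  with eq show "ip (\<lambda>vs. comp_along w' (tensor_sum N \<psi> u vs)) (\<lambda>vs. comp_along w (tensor_sum M \<phi> v vs)) * q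
      = (\<Sum>i<N. \<Sum>j<M. ip (\<psi> i) (\<phi> j) * bl (u i) (v j))"
    by (simp only: comp_along_tensor[OF w(2)] comp_along_tensor[OF w(4)])
qed

lemma tensor_space_line:
  assumes w: "w \<in> L (Jt t)" "w \<noteq> 0" and \<Psi>: "\<Psi> \<in> tensor_space (fibre_H (Jt t)) (L (Jt t))"
  obtains \<psi> where "\<psi> \<in> fibre_H (Jt t)" "\<Psi> = tensor \<psi> w"
proof -
  from \<Psi> obtain N \<psi> u where \<Psi>': "\<Psi> = tensor_sum N \<psi> u" and A: "\<forall>i<N. \<psi> i \<in> fibre_H (Jt t) \<and> u i \<in> L (Jt t)"
    unfolding tensor_space_def by blast
  have "\<forall>i<N. \<exists>c. u i = c *s w" using A L_generated[OF w] by blast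
  then obtain c where c: "\<And>i. i < N \<Longrightarrow> u i = c i *s w" by metis
  show thesis
  proof (rule that)
    show "(\<lambda>vs. \<Sum>i<N. c i * \<psi> i vs) \<in> fibre_H (Jt t)" by (rule fibre_H_sum) (use A in blast)
    show "\<Psi> = tensor (\<lambda>vs. \<Sum>i<N. c i * \<psi> i vs) w" unfolding \<Psi>' by (rule tensor_sum_line) (rule c)
  qed
qed

definition U_hat :: "complex ^ 'k \<Rightarrow> ('a list \<Rightarrow> complex ^ 'k) \<Rightarrow> 'a list \<Rightarrow> complex ^ 'k" where
  "U_hat w1 \<Psi> = tensor (UH (\<lambda>vs. comp_along w0 (\<Psi> vs))) w1"

lemma U_hat_tensor: "U_hat w1 (tensor \<psi> w0) = tensor (UH \<psi>) w1"
  by (simp add: U_hat_def comp_along_tensor[OF w0(2)])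

lemma U_hat_tensor_map:
  assumes R: "\<And>c. R (c *s w0) = c *s w1" and U: "\<And>\<psi>. \<psi> \<in> fibre_H (Jt 0) \<Longrightarrow> U \<psi> = UH \<psi>"
  shows "is_tensor_map (fibre_H (Jt 0)) (L (Jt 0)) U R (U_hat w1)"
  unfolding is_tensor_map_def
proof (intro allI impI)
  fix N :: nat and \<psi> u assume A: "\<forall>i<N. \<psi> i \<in> fibre_H (Jt 0) \<and> u i \<in> L (Jt 0)"
  then have "\<forall>i<N. \<exists>c. u i = c *s w0" using L_generated[OF w0] by blast
  then obtain c where c: "\<And>i. i < N \<Longrightarrow> u i = c i *s w0" by metis
  have "tensor_sum N (\<lambda>i. U (\<psi> i)) (\<lambda>i. R (u i)) = tensor (\<lambda>vs. \<Sum>i<N. c i * U (\<psi> i) vs) w1"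
    by (rule tensor_sum_line) (simp add: c R)
  also have "(\<lambda>vs. \<Sum>i<N. c i * U (\<psi> i) vs) = (\<lambda>vs. \<Sum>i<N. c i * UH (\<psi> i) vs)"
    using A U by auto
  finally show "U_hat w1 (tensor_sum N \<psi> u) = tensor_sum N (\<lambda>i. U (\<psi> i)) (\<lambda>i. R (u i))"
    using UH_sum[of N \<psi> c] A tensor_sum_line[of N u c w0 \<psi>, OF c] by (simp add: U_hat_tensor)
qed

text \<open>A parallel section may be presented as a sum of terms none of which is parallel. Writing
  every half-form factor as a multiple of \<open>r\<close> collapses the sum to
  \<open>\<Phi> \<otimes> r\<close>, and then \<open>\<Phi>\<close> is parallel because
  \<open>r\<close> has no zeros.\<close>

lemma U_hat_transport:
  assumes r: "root_section {0..1} r" "r 0 = w0"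
  shows "is_transport (\<lambda>S. has_cov_Hhat e L m \<gamma> S (\<lambda>t vs. 0)) (tensor_space (fibre_H (Jt 0)) (L (Jt 0))) (U_hat (r 1))"
  unfolding is_transport_def
proof (intro ballI allI iffI)
  fix \<Psi> y assume "\<Psi> \<in> tensor_space (fibre_H (Jt 0)) (L (Jt 0))"
  then obtain \<psi> where \<psi>: "\<psi> \<in> fibre_H (Jt 0)" "\<Psi> = tensor \<psi> w0" using tensor_space_line[OF w0] by blast
  have par: "has_cov_H e \<gamma> (transport_H 0 \<psi>) (\<lambda>t vs. 0)" by (rule transport_H_parallel[OF \<psi>(1)]) simp
  {
    assume "y = U_hat (r 1) \<Psi>"
    then have y: "y = tensor (UH \<psi>) (r 1)" by (simp add: \<psi>(2) U_hat_tensor)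
    have "has_cov_Hhat e L m \<gamma> (\<lambda>t. tensor (transport_H 0 \<psi> t) (r t)) (\<lambda>t vs. 0)"
      unfolding has_cov_Hhat_def
      using par has_cov_L_parallel[OF r(1), of 1]
      by (intro exI[of _ "1::nat"] exI[of _ "\<lambda>i. transport_H 0 \<psi>"] exI[of _ "\<lambda>i t vs. 0"] exI[of _ "\<lambda>i. r"] exI[of _ "\<lambda>i t. 0"])
         (auto simp: tensor_sum_def tensor_def)
    then show "\<exists>S. has_cov_Hhat e L m \<gamma> S (\<lambda>t vs. 0) \<and> S 0 = \<Psi> \<and> S 1 = y"
      using transport_H_init[OF \<psi>(1)] by (intro exI[of _ "\<lambda>t. tensor (transport_H 0 \<psi> t) (r t)"]) (simp add: y \<psi>(2) r(2))
  next
    assume "\<exists>S. has_cov_Hhat e L m \<gamma> S (\<lambda>t vs. 0) \<and> S 0 = \<Psi> \<and> S 1 = y"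
    then obtain S N \<psi>' D\<psi> s Ds where S0: "S 0 = \<Psi>" "S 1 = y"
      and H: "\<And>i. i < N \<Longrightarrow> has_cov_H e \<gamma> (\<psi>' i) (D\<psi> i)" and Ls: "\<And>i. i < N \<Longrightarrow> has_cov_L L m \<gamma> (s i) (Ds i)"
      and S: "\<And>t. t \<in> {0..1} \<Longrightarrow> S t = tensor_sum N (\<lambda>i. \<psi>' i t) (\<lambda>i. s i t)"
      and DS: "\<And>t. t \<in> {0..1} \<Longrightarrow> (\<lambda>vs. 0) = (\<lambda>vs. tensor_sum N (\<lambda>i. D\<psi> i t) (\<lambda>i. s i t) vs + tensor_sum N (\<lambda>i. \<psi>' i t) (\<lambda>i. Ds i t) vs)"
      unfolding has_cov_Hhat_def by blast
    have "\<forall>i<N. \<exists>f f'. \<forall>t\<in>{0..1}. (f has_vector_derivative f' t) (at t within {0..1}) \<and>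
      s i t = f t *s r t \<and> Ds i t = f' t *s r t"
      using Ls unfolding has_cov_L_iff[OF r(1)] by blast
    then obtain f f' where f: "\<And>i t. i < N \<Longrightarrow> t \<in> {0..1} \<Longrightarrow> (f i has_vector_derivative f' i t) (at t within {0..1})"
      "\<And>i t. i < N \<Longrightarrow> t \<in> {0..1} \<Longrightarrow> s i t = f i t *s r t" "\<And>i t. i < N \<Longrightarrow> t \<in> {0..1} \<Longrightarrow> Ds i t = f' i t *s r t"
      by metis
    define \<Phi> where "\<Phi> = (\<lambda>t vs. \<Sum>i<N. f i t * \<psi>' i t vs)"
    define D\<Phi> where "D\<Phi> = (\<lambda>t vs. \<Sum>i<N. f i t * D\<psi> i t vs + f' i t * \<psi>' i t vs)"
    have cov: "has_cov_H e \<gamma> \<Phi> D\<Phi>"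
      unfolding \<Phi>_def D\<Phi>_def by (rule has_cov_H_combine[OF H f(1)])
    have S': "S t = tensor (\<Phi> t) (r t)" if t: "t \<in> {0..1}" for t
      unfolding S[OF t] \<Phi>_def by (rule tensor_sum_line) (rule f(2)[OF _ t])
    have "D\<Phi> t = (\<lambda>vs. 0)" if t: "t \<in> {0..1}" for t
    proof
      fix vs
      have "tensor_sum N (\<lambda>i. D\<psi> i t) (\<lambda>i. s i t) = tensor (\<lambda>vs. \<Sum>i<N. f i t * D\<psi> i t vs) (r t)"
        "tensor_sum N (\<lambda>i. \<psi>' i t) (\<lambda>i. Ds i t) = tensor (\<lambda>vs. \<Sum>i<N. f' i t * \<psi>' i t vs) (r t)"
        using f(2,3)[OF _ t] by (auto intro!: tensor_sum_line)
      with fun_cong[OF DS[OF t], of vs] have "D\<Phi> t vs *s r t = 0"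
        by (simp add: tensor_def D\<Phi>_def sum.distrib vec_eq_iff algebra_simps)
      then show "D\<Phi> t vs = 0" using root_section_nonzero[OF r(1) t] by (simp add: vector_mul_eq_0)
    qed
    with cov have "has_cov_H e \<gamma> \<Phi> (\<lambda>t vs. 0)" unfolding has_cov_H_def by simp
    moreover have "\<Phi> 0 = \<psi>"
      using S'[of 0] S0(1) comp_along_tensor[OF w0(2)] by (metis \<psi>(2) r(2) atLeastAtMost_iff order_refl zero_le_one)
    ultimately have "\<Phi> 1 = UH \<psi>"
      using parallel_unique[OF _ par, of \<Phi> 1] transport_H_init[OF \<psi>(1)] by simp
    then show "y = U_hat (r 1) \<Psi>"
      using S'[of 1] S0(2) by (simp add: \<psi>(2) U_hat_tensor)
  }
qed

end

section \<open>Transport in the tensor product and the final assembly\<close>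

lemma tensor_eq_tensor_sum: "tensor \<psi> w = tensor_sum 1 (\<lambda>i. \<psi>) (\<lambda>i. w)"
  by (rule ext) (simp add: tensor_def tensor_sum_def)

lemma is_tensor_map_tensor:
  "is_tensor_map E F A B T \<Longrightarrow> \<psi> \<in> E \<Longrightarrow> w \<in> F \<Longrightarrow> T (tensor \<psi> w) = tensor (A \<psi>) (B w)"
  unfolding is_tensor_map_def tensor_eq_tensor_sum by simp

lemma is_tensor_form_tensor:
  assumes "is_tensor_form E1 F1 E0 F0 a b B" "\<psi> \<in> E1" "w \<in> F1" "\<phi> \<in> E0" "v \<in> F0"
  shows "B (tensor \<psi> w) (tensor \<phi> v) = a \<psi> \<phi> * b w v"
  using assms(1)[unfolded is_tensor_form_def, rule_format, of 1 "\<lambda>i. \<psi>" "\<lambda>i. w" 1 "\<lambda>i. \<phi>" "\<lambda>i. v"] assms(2-)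
  by (simp add: tensor_eq_tensor_sum)

lemma is_transport_cong:
  "is_transport par A U \<Longrightarrow> (\<And>x. x \<in> A \<Longrightarrow> U' x = U x) \<Longrightarrow> is_transport par A U'"
  unfolding is_transport_def by simp

context half_forms
begin

lemma UH_eq_proj_H: "\<psi> \<in> alternating_forms \<Longrightarrow> UH \<psi> = (\<lambda>vs. of_real (inverse (\<kappa> 1)) * proj_H e (Jt 1) \<psi> vs)"
  by (rule ext) (simp add: transport_H_def Jt.proj_H_eq)

lemma proj_H_alternating: "\<psi> \<in> alternating_forms \<Longrightarrow> proj_H e (Jt 1) \<psi> \<in> alternating_forms"
  using Jt.fibre_HD(1)[OF Jt.vacuum_proj_fibre] by (simp add: Jt.proj_H_eq)

lemma ip_UH:
  assumes "\<phi> \<in> fibre_H (Jt 1)" "\<psi> \<in> fibre_H (Jt 0)"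
  shows "ip \<phi> \<psi> = of_real (\<kappa> 1) * ip \<phi> (UH \<psi>)"
proof -
  have alt: "\<psi> \<in> alternating_forms" using Jt.fibre_HD(1)[OF assms(2)] .
  have "ip \<phi> (UH \<psi>) = of_real (inverse (\<kappa> 1)) * ip \<phi> \<psi>"
    unfolding UH_eq_proj_H[OF alt] ip_scale_right[OF proj_H_alternating[OF alt]]
    by (simp add: Jt.proj_H_eq[OF alt] Jt.ip_vacuum_proj[OF assms(1) alt])
  then show ?thesis using \<kappa>_pos[of 1] by simp
qed

lemma halfform_pairing_root:
  assumes R: "halfform_root L m \<gamma> R" and p: "halfform_pairing e L m \<gamma> p"
    and w: "w' \<in> L (Jt 0)" "w \<in> L (Jt 0)"
  shows "p 1 (R 1 w') w = of_real (sqrt (cosprod 1)) * inner_L e m (Jt 0) w' w"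
proof -
  have one: "(1::real) \<in> {0..1}" "(0::real) \<in> {0..1}" by simp_all
  obtain a c where w': "w' = a *s w0" and w: "w = c *s w0" using w L_generated[OF w0] by blast
  note r = halfform_root_section[OF R]
  have "p 1 (R 1 w') w = cnj a * c * of_real (cmod a0 * sqrt pc * sqrt (cosprod 1))"
    unfolding w' w r(3)[OF one(1)] by (rule halfform_pairing_section[OF p r(1,2) one(1)])
  moreover have "inner_L e m (Jt 0) w' w = cnj a * c * of_real (cmod a0 * sqrt pc)"
    using inner_L_along[OF r(1) one(2), of a c] unfolding w' w r(2) .
  ultimately show ?thesis by (simp only: of_real_mult mult_ac)
qed

text \<open>Fixing \<open>w0\<close> and \<open>w1\<close> identifies the tensor spaces with the
  fibres of forms, and every claim becomes one about \<open>UH\<close>. Against the inner product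
  after transport the pairing gains one factor \<open>\<kappa> 1\<close> from the half forms and
  another from \<open>ip_UH\<close>.\<close>

lemma quantized_transport:
  assumes R: "halfform_root L m \<gamma> R" and p: "halfform_pairing e L m \<gamma> p"
    and A: "\<And>\<psi>. \<psi> \<in> fibre_H (Jt 0) \<Longrightarrow> A \<psi> = UH \<psi>"
  shows "\<exists>U B G0 G1.
    is_tensor_map (fibre_H (Jt 0)) (L (Jt 0)) A (R 1) U \<and>
    is_transport (\<lambda>s. has_cov_Hhat e L m \<gamma> s (\<lambda>t vs. 0)) (tensor_space (fibre_H (Jt 0)) (L (Jt 0))) U \<and>
    is_tensor_form (fibre_H (Jt 1)) (L (Jt 1)) (fibre_H (Jt 0)) (L (Jt 0)) ip (p 1) B \<and>
    is_tensor_form (fibre_H (Jt 0)) (L (Jt 0)) (fibre_H (Jt 0)) (L (Jt 0)) ip (inner_L e m (Jt 0)) G0 \<and>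
    is_tensor_form (fibre_H (Jt 1)) (L (Jt 1)) (fibre_H (Jt 1)) (L (Jt 1)) ip (inner_L e m (Jt 1)) G1 \<and>
    U ` tensor_space (fibre_H (Jt 0)) (L (Jt 0)) = tensor_space (fibre_H (Jt 1)) (L (Jt 1)) \<and>
    (\<forall>\<Psi>' \<in> tensor_space (fibre_H (Jt 0)) (L (Jt 0)). \<forall>\<Psi> \<in> tensor_space (fibre_H (Jt 0)) (L (Jt 0)).
      G1 (U \<Psi>') (U \<Psi>) = G0 \<Psi>' \<Psi>) \<and>
    (\<forall>\<Psi>1 \<in> tensor_space (fibre_H (Jt 1)) (L (Jt 1)). \<forall>\<Psi>0 \<in> tensor_space (fibre_H (Jt 0)) (L (Jt 0)).
      B \<Psi>1 \<Psi>0 = of_real (cosprod 1) * G1 \<Psi>1 (U \<Psi>0)) \<and>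
    (\<forall>\<psi>'\<in>fibre_H (Jt 0). \<forall>w'\<in>L (Jt 0). \<forall>\<psi>\<in>fibre_H (Jt 0). \<forall>w\<in>L (Jt 0).
      B (U (tensor \<psi>' w')) (tensor \<psi> w) = ip (proj_H e (Jt 1) \<psi>') \<psi> * inner_L e m (Jt 0) w' w)"
proof -
  have one: "(1::real) \<in> {0..1}" "(0::real) \<in> {0..1}" by simp_all
  note r = halfform_root_section[OF R]
  define w1 where "w1 = R 1 w0"
  have w1: "w1 \<in> L (Jt 1)" "w1 \<noteq> 0"
    using r(1) root_section_nonzero[OF r(1) one(1)] by (simp_all add: root_section_def w1_def)
  have R1: "R 1 (c *s w0) = c *s w1" for c unfolding w1_def by (rule r(3)[OF one(1)])
  \<comment> \<open>\<open>q\<close> is the squared norm of both \<open>w0\<close> and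
    \<open>w1\<close> under \<open>inner_L\<close>, and \<open>q * s\<close> is the pairing of
    \<open>w1\<close> with \<open>w0\<close>.\<close>
  define q :: complex where "q = of_real (cmod a0 * sqrt pc)"
  define s :: complex where "s = of_real (sqrt (cosprod 1))"
  have s2: "s * s = of_real (cosprod 1)"
    unfolding s_def of_real_mult[symmetric] by (simp only: real_sqrt_mult_self abs_of_pos[OF cosprod_pos[OF one(1)]])
  have s: "s = of_real (\<kappa> 1)" unfolding s_def \<kappa>_1 ..
  define U where "U = U_hat w1"
  have U: "U (tensor \<psi> w0) = tensor (UH \<psi>) w1" for \<psi> unfolding U_def by (rule U_hat_tensor)
  define G where "G = (\<lambda>(v :: complex ^ 'k) (w :: complex ^ 'k) q \<Psi> \<Phi>. ip (\<lambda>vs. comp_along v (\<Psi> vs)) (\<lambda>vs. comp_along w (\<Phi> vs)) * (q :: complex))"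
  have G: "G v w q (tensor \<psi> v) (tensor \<phi> w) = ip \<psi> \<phi> * q" if "v \<noteq> 0" "w \<noteq> 0" for v w :: "complex ^ 'k" and q \<psi> \<phi>
    unfolding G_def comp_along_tensor[OF that(1)] comp_along_tensor[OF that(2)] ..
  have form0: "is_tensor_form (fibre_H (Jt 0)) (L (Jt 0)) (fibre_H (Jt 0)) (L (Jt 0)) ip (inner_L e m (Jt 0)) (G w0 w0 q)"
    unfolding G_def
    by (rule tensor_form[OF w0 w0]) (use inner_L_along[OF r(1) one(2)] in \<open>simp only: r(2) q_def\<close>)
  have form1: "is_tensor_form (fibre_H (Jt 1)) (L (Jt 1)) (fibre_H (Jt 1)) (L (Jt 1)) ip (inner_L e m (Jt 1)) (G w1 w1 q)"
    unfolding G_def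
    by (rule tensor_form[OF w1 w1]) (use inner_L_along[OF r(1) one(1)] in \<open>simp only: w1_def q_def\<close>)
  have formB: "is_tensor_form (fibre_H (Jt 1)) (L (Jt 1)) (fibre_H (Jt 0)) (L (Jt 0)) ip (p 1) (G w1 w0 (q * s))"
    unfolding G_def
    by (rule tensor_form[OF w1 w0])
       (use halfform_pairing_section[OF p r(1,2) one(1)] in \<open>simp only: w1_def q_def s_def of_real_mult mult.assoc\<close>)
  have map: "is_tensor_map (fibre_H (Jt 0)) (L (Jt 0)) A (R 1) U"
    unfolding U_def by (rule U_hat_tensor_map[OF R1 A])
  have line0: "\<exists>\<psi>\<in>fibre_H (Jt 0). \<Psi> = tensor \<psi> w0" if "\<Psi> \<in> tensor_space (fibre_H (Jt 0)) (L (Jt 0))" for \<Psi>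
    using tensor_space_line[OF w0 that] by metis
  have line1: "\<exists>\<psi>\<in>fibre_H (Jt 1). \<Psi> = tensor \<psi> w1" if "\<Psi> \<in> tensor_space (fibre_H (Jt 1)) (L (Jt 1))" for \<Psi>
    using tensor_space_line[OF w1 that] by metis
  show ?thesis
  proof (rule exI[of _ U], rule exI[of _ "G w1 w0 (q * s)"], rule exI[of _ "G w0 w0 q"], rule exI[of _ "G w1 w1 q"],
      intro conjI ballI map form0 form1 formB)
    show "is_transport (\<lambda>s. has_cov_Hhat e L m \<gamma> s (\<lambda>t vs. 0)) (tensor_space (fibre_H (Jt 0)) (L (Jt 0))) U"
      unfolding U_def w1_def by (rule U_hat_transport[OF r(1,2)])
    show "U ` tensor_space (fibre_H (Jt 0)) (L (Jt 0)) = tensor_space (fibre_H (Jt 1)) (L (Jt 1))"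
    proof (intro set_eqI iffI)
      fix \<Phi> assume "\<Phi> \<in> U ` tensor_space (fibre_H (Jt 0)) (L (Jt 0))"
      then obtain \<psi> where \<psi>: "\<psi> \<in> fibre_H (Jt 0)" "\<Phi> = U (tensor \<psi> w0)" using line0 by blast
      show "\<Phi> \<in> tensor_space (fibre_H (Jt 1)) (L (Jt 1))"
        unfolding \<psi>(2) U by (rule tensor_in_space[OF UH_fibre[OF \<psi>(1)] w1(1)])
    next
      fix \<Phi> assume "\<Phi> \<in> tensor_space (fibre_H (Jt 1)) (L (Jt 1))"
      then obtain \<phi> where \<phi>: "\<phi> \<in> fibre_H (Jt 1)" "\<Phi> = tensor \<phi> w1" using line1 by blast
      obtain \<psi> where \<psi>: "\<psi> \<in> fibre_H (Jt 0)" "UH \<psi> = \<phi>" by (rule UH_surj[OF \<phi>(1)])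
      have "U (tensor \<psi> w0) = \<Phi>" unfolding U \<psi>(2) \<phi>(2) ..
      then show "\<Phi> \<in> U ` tensor_space (fibre_H (Jt 0)) (L (Jt 0))"
        using imageI[OF tensor_in_space[OF \<psi>(1) w0(1)], of U] by (simp only:)
    qed
  next
    fix \<Psi>' \<Psi> assume "\<Psi>' \<in> tensor_space (fibre_H (Jt 0)) (L (Jt 0))" "\<Psi> \<in> tensor_space (fibre_H (Jt 0)) (L (Jt 0))"
    then obtain \<psi>' \<psi> where \<psi>: "\<psi>' \<in> fibre_H (Jt 0)" "\<psi> \<in> fibre_H (Jt 0)" "\<Psi>' = tensor \<psi>' w0" "\<Psi> = tensor \<psi> w0"
      using line0 by blast
    show "G w1 w1 q (U \<Psi>') (U \<Psi>) = G w0 w0 q \<Psi>' \<Psi>"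
      unfolding \<psi>(3,4) U G[OF w1(2) w1(2)] G[OF w0(2) w0(2)] UH_isometry[OF \<psi>(1,2)] ..
  next
    fix \<Psi>1 \<Psi>0 assume "\<Psi>1 \<in> tensor_space (fibre_H (Jt 1)) (L (Jt 1))" "\<Psi>0 \<in> tensor_space (fibre_H (Jt 0)) (L (Jt 0))"
    then obtain \<phi> \<psi> where \<psi>: "\<phi> \<in> fibre_H (Jt 1)" "\<psi> \<in> fibre_H (Jt 0)" "\<Psi>1 = tensor \<phi> w1" "\<Psi>0 = tensor \<psi> w0"
      using line0 line1 by blast
    show "G w1 w0 (q * s) \<Psi>1 \<Psi>0 = of_real (cosprod 1) * G w1 w1 q \<Psi>1 (U \<Psi>0)"
      unfolding \<psi>(3,4) U G[OF w1(2) w0(2)] G[OF w1(2) w1(2)] ip_UH[OF \<psi>(1,2)] s2[symmetric] s[symmetric]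
      by (simp only: mult_ac)
  next
    fix \<psi>' w' \<psi> w
    assume \<psi>: "\<psi>' \<in> fibre_H (Jt 0)" "\<psi> \<in> fibre_H (Jt 0)" and w: "w' \<in> L (Jt 0)" "w \<in> L (Jt 0)"
    have alt: "\<psi>' \<in> alternating_forms" "\<psi> \<in> alternating_forms" using Jt.fibre_HD(1)[OF \<psi>(1)] Jt.fibre_HD(1)[OF \<psi>(2)] .
    obtain a where a: "w' = a *s w0" using w(1) L_generated[OF w0] by blast
    have R1w: "R 1 w' \<in> L (Jt 1)" unfolding a R1 by (rule L_scale[OF w1(1)])
    have "G w1 w0 (q * s) (U (tensor \<psi>' w')) (tensor \<psi> w) = ip (UH \<psi>') \<psi> * (s * inner_L e m (Jt 0) w' w)"
      unfolding is_tensor_map_tensor[OF map \<psi>(1) w(1)] A[OF \<psi>(1)]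
        is_tensor_form_tensor[OF formB UH_fibre[OF \<psi>(1)] R1w \<psi>(2) w(2)] halfform_pairing_root[OF R p w, folded s_def] ..
    also have "ip (UH \<psi>') \<psi> = inverse s * ip (proj_H e (Jt 1) \<psi>') \<psi>"
      unfolding UH_eq_proj_H[OF alt(1)] ip_scale_left[OF alt(2)] s by (simp only: complex_cnj_complex_of_real complex_cnj_inverse of_real_inverse)
    finally show "G w1 w0 (q * s) (U (tensor \<psi>' w')) (tensor \<psi> w) = ip (proj_H e (Jt 1) \<psi>') \<psi> * inner_L e m (Jt 0) w' w"
      using \<kappa>_pos[of 1] s by simp
  qed
qed

lemma transport_theorem:
  defines "d \<equiv> det_op e ((1/2) *\<^sub>R (\<gamma> 0 + \<gamma> 1))"
  defines "A \<equiv> \<lambda>\<psi> vs. of_real (d powr (-1/4)) * proj_H e (\<gamma> 1) \<psi> vs"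
  shows "0 < d \<and>
    is_transport (\<lambda>s. has_cov_H e \<gamma> s (\<lambda>t vs. 0)) (fibre_H (\<gamma> 0)) A \<and>
    (\<lambda>z. cvec_scale (1 / \<i>) (cvec_map (\<gamma> (1/2)) z)) ` V10 (\<gamma> 0) \<subseteq> V10 (\<gamma> 1) \<and>
    (\<exists>R. halfform_root L m \<gamma> R) \<and>
    (\<exists>p. halfform_pairing e L m \<gamma> p) \<and>
    (\<forall>R p. halfform_root L m \<gamma> R \<and> halfform_pairing e L m \<gamma> p \<longrightarrow>
      is_transport (\<lambda>s. has_cov_L L m \<gamma> s (\<lambda>t. 0)) (L (\<gamma> 0)) (R 1) \<and>
      (\<forall>w'\<in>L (\<gamma> 0). \<forall>w\<in>L (\<gamma> 0). p 1 (R 1 w') w = of_real (d powr (1/4)) * inner_L e m (\<gamma> 0) w' w) \<and>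
      (\<exists>U B G0 G1.
        is_tensor_map (fibre_H (\<gamma> 0)) (L (\<gamma> 0)) A (R 1) U \<and>
        is_transport (\<lambda>s. has_cov_Hhat e L m \<gamma> s (\<lambda>t vs. 0)) (tensor_space (fibre_H (\<gamma> 0)) (L (\<gamma> 0))) U \<and>
        is_tensor_form (fibre_H (\<gamma> 1)) (L (\<gamma> 1)) (fibre_H (\<gamma> 0)) (L (\<gamma> 0)) (inner_H e) (p 1) B \<and>
        is_tensor_form (fibre_H (\<gamma> 0)) (L (\<gamma> 0)) (fibre_H (\<gamma> 0)) (L (\<gamma> 0)) (inner_H e) (inner_L e m (\<gamma> 0)) G0 \<and>
        is_tensor_form (fibre_H (\<gamma> 1)) (L (\<gamma> 1)) (fibre_H (\<gamma> 1)) (L (\<gamma> 1)) (inner_H e) (inner_L e m (\<gamma> 1)) G1 \<and>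
        U ` tensor_space (fibre_H (\<gamma> 0)) (L (\<gamma> 0)) = tensor_space (fibre_H (\<gamma> 1)) (L (\<gamma> 1)) \<and>
        (\<forall>\<Psi>' \<in> tensor_space (fibre_H (\<gamma> 0)) (L (\<gamma> 0)). \<forall>\<Psi> \<in> tensor_space (fibre_H (\<gamma> 0)) (L (\<gamma> 0)).
          G1 (U \<Psi>') (U \<Psi>) = G0 \<Psi>' \<Psi>) \<and>
        (\<forall>\<Psi>1 \<in> tensor_space (fibre_H (\<gamma> 1)) (L (\<gamma> 1)). \<forall>\<Psi>0 \<in> tensor_space (fibre_H (\<gamma> 0)) (L (\<gamma> 0)).
          B \<Psi>1 \<Psi>0 = of_real (d powr (1/2)) * G1 \<Psi>1 (U \<Psi>0)) \<and>
        (\<forall>\<psi>'\<in>fibre_H (\<gamma> 0). \<forall>w'\<in>L (\<gamma> 0). \<forall>\<psi>\<in>fibre_H (\<gamma> 0). \<forall>w\<in>L (\<gamma> 0).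
          B (U (tensor \<psi>' w')) (tensor \<psi> w) = inner_H e (proj_H e (\<gamma> 1) \<psi>') \<psi> * inner_L e m (\<gamma> 0) w' w)))"
proof -
  have one: "(1::real) \<in> {0..1}" "(0::real) \<in> {0..1}" by simp_all
  have \<gamma>0: "\<gamma> 0 = Jt 0" and \<gamma>1: "\<gamma> 1 = Jt 1" using one \<gamma> by blast+
  have "Jt 0 = J" by (rule blinfun_eqI) (simp add: E_0)
  then have "d = (\<Prod>i<n. cos (\<theta> i / 2))\<^sup>2"
    unfolding d_def \<gamma>0 \<gamma>1 by (simp only: det_half_sum[OF e dim J skew_frame_axioms JB])
  then have d: "d = (cosprod 1)\<^sup>2" by simp
  have c: "0 < cosprod 1" by (rule cosprod_pos[OF one(1)])
  \<comment> \<open>As \<open>d\<close> is the square of \<open>cosprod 1\<close>, its powers 1/2,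
    1/4 and -1/4 become \<open>cosprod 1\<close>, its square root \<open>\<kappa> 1\<close> and the
    inverse of that.\<close>
  have d_powr: "d powr x = cosprod 1 powr (2 * x)" for x
    unfolding d using c by (simp only: powr_numeral[OF less_imp_le, symmetric] powr_powr)
  have d_half: "d powr (1/2) = cosprod 1" and d_quarter: "d powr (1/4) = sqrt (cosprod 1)"
    and d_neg: "d powr (-1/4) = inverse (\<kappa> 1)"
    unfolding d_powr \<kappa>_1 using c by (simp_all add: powr_half_sqrt powr_minus flip: powr_half_sqrt)
  have A: "A \<psi> = UH \<psi>" if "\<psi> \<in> fibre_H (Jt 0)" for \<psi>
    unfolding A_def \<gamma>1 d_neg UH_eq_proj_H[OF Jt.fibre_HD(1)[OF that]] ..
  have tL: "is_transport (\<lambda>s. has_cov_L L m \<gamma> s (\<lambda>t. 0)) (L (Jt 0)) (R 1)" if R: "halfform_root L m \<gamma> R" for R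
    by (rule L_transport[OF halfform_root_section(1,2)[OF R] halfform_root_section(3)[OF R one(1)]])
  have V: "(\<lambda>z. cvec_scale (1 / \<i>) (cvec_map (\<gamma> (1/2)) z)) ` V10 (Jt 0) \<subseteq> V10 (Jt 1)"
  proof (rule image_subsetI)
    fix z assume z: "z \<in> V10 (Jt 0)"
    show "cvec_scale (1 / \<i>) (cvec_map (\<gamma> (1/2)) z) \<in> V10 (Jt 1)"
      unfolding half_rotation_V10[OF z one(1)] by (rule E_maps_V10[OF z])
  qed
  have d_pos: "0 < d" unfolding d by (rule zero_less_power[OF c])
  show ?thesis
    unfolding \<gamma>0 \<gamma>1 d_half d_quarter
    by (intro conjI allI impI, rule d_pos, rule is_transport_cong[OF UH_transport], erule A, rule V,
        rule halfform_root_exists, rule halfform_pairing_exists, erule conjE, erule tL,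
        elim conjE, intro ballI, erule (3) halfform_pairing_root, elim conjE, erule (1) quantized_transport, erule A)
qed

end

lemma half_forms_exist:
  fixes e :: "nat \<Rightarrow> 'a::euclidean_space" and \<gamma> :: "real \<Rightarrow> 'a \<Rightarrow>\<^sub>L 'a"
    and L :: "('a \<Rightarrow>\<^sub>L 'a) \<Rightarrow> (complex ^ 'k) set"
  assumes dim: "DIM('a) = 2 * n" and e: "orthonormal_frame e"
    and geo: "geodesic_on e {0..1} \<gamma>" and cut: "\<forall>t\<in>{0..1}. \<gamma> t \<notin> cut_locus e (\<gamma> 0)" and sq: "sqrt_bundle e L m"
  shows "\<exists>J b \<theta> B w0 a0. half_forms e n J b \<theta> B \<gamma> L m w0 a0"
proof -
  have J: "\<gamma> 0 \<in> complex_structures e" using geo by (simp add: geodesic_on_def)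
  obtain B :: "'a \<Rightarrow>\<^sub>L 'a" where skew: "\<And>x y. B x \<bullet> y = - (x \<bullet> B y)" and JB: "\<And>x. B (\<gamma> 0 x) = - \<gamma> 0 (B x)"
    and flow: "\<And>t. t \<in> {0..1} \<Longrightarrow> (\<gamma> has_vector_derivative B o\<^sub>L \<gamma> t) (at t within {0..1})"
    using geodesic_velocity[OF e dim geo] by blast
  obtain b \<theta> where nonneg: "\<And>i. i < n \<Longrightarrow> 0 \<le> \<theta> i"
    and sf: "skew_frame (complex_frame (\<gamma> 0) b) (\<lambda>j. \<theta> (j div 2)) B"
    using skew_eigenframe[OF J dim skew JB] by metis
  have \<gamma>: "\<gamma> t = rot (complex_frame (\<gamma> 0) b) (\<lambda>j. \<theta> (j div 2)) B t o\<^sub>L \<gamma> 0" if "t \<in> {0..1}" for t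
    by (rule rot_along_flow[OF sf flow that])
  have cut': "\<forall>t\<in>{0..1}. rot (complex_frame (\<gamma> 0) b) (\<lambda>j. \<theta> (j div 2)) B t o\<^sub>L \<gamma> 0 \<notin> cut_locus e (\<gamma> 0)"
    using cut \<gamma> by metis
  interpret skew_frame "complex_frame (\<gamma> 0) b" "\<lambda>j. \<theta> (j div 2)" B by (rule sf)
  interpret rotation_curve e n "\<gamma> 0" b \<theta> B \<gamma>
    by unfold_locales (use e dim J JB nonneg angles_less_pi[OF e dim J sf JB nonneg cut'] \<gamma> in blast)+
  obtain w0 where w0: "w0 \<noteq> 0" "L (Jt 0) = range (\<lambda>c. c *s w0)"
    using sq Jt[of 0] unfolding sqrt_bundle_def by meson
  have "w0 = 1 *s w0" by simp
  then have w0L: "w0 \<in> L (Jt 0)" unfolding w0(2) by (rule range_eqI)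
  note m = bspec[OF bspec[OF bspec[OF sq[unfolded sqrt_bundle_def] Jt[of 0], THEN conjunct2, THEN conjunct1] w0L] w0L]
  define a0 where "a0 = CK 0 (m (Jt 0) w0 w0) / tc"
  have m0: "m (Jt 0) w0 w0 = (\<lambda>\<alpha>s. a0 * wedge_vecs (zst 0) \<alpha>s)"
    unfolding a0_def by (rule fibre_K_eq[OF conjunct1[OF m]])
  obtain \<alpha>s where "m (Jt 0) w0 w0 \<alpha>s \<noteq> 0" using conjunct2[OF conjunct2[OF m]] w0(1) by blast
  then have "a0 \<noteq> 0" unfolding m0 by auto
  then have "half_forms e n (\<gamma> 0) b \<theta> B \<gamma> L m w0 a0"
    by unfold_locales (rule sq w0L w0(1) m0 | assumption)+
  then show ?thesis by blast
qed

theorem theorem3p3: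
  fixes e :: "nat \<Rightarrow> 'a::euclidean_space" and n :: nat
    and J0 J1 :: "'a \<Rightarrow>\<^sub>L 'a" and \<gamma> :: "real \<Rightarrow> 'a \<Rightarrow>\<^sub>L 'a"
    and L :: "('a \<Rightarrow>\<^sub>L 'a) \<Rightarrow> (complex ^ 'k) set"
    and m :: "('a \<Rightarrow>\<^sub>L 'a) \<Rightarrow> complex ^ 'k \<Rightarrow> complex ^ 'k \<Rightarrow> ('a \<Rightarrow>\<^sub>L real) list \<Rightarrow> complex"
  assumes "DIM('a) = 2 * n"
    and "orthonormal_frame e"
    and "J0 \<in> complex_structures e" and "J1 \<in> complex_structures e"
    and "geodesic_on e {0..1} \<gamma>" and "\<gamma> 0 = J0" and "\<gamma> 1 = J1"
    and "\<forall>t\<in>{0..1}. \<gamma> t \<notin> cut_locus e J0"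
    and "sqrt_bundle e L m"
  shows
    "let d = det_op e ((1/2) *\<^sub>R (J0 + J1));
         UH = (\<lambda>\<psi> vs. of_real (d powr (-1/4)) * proj_H e J1 \<psi> vs)
     in
     0 < d \<and>
     is_transport (\<lambda>s. has_cov_H e \<gamma> s (\<lambda>t vs. 0)) (fibre_H J0) UH \<and>
     (\<lambda>z. cvec_scale (1 / \<i>) (cvec_map (\<gamma> (1/2)) z)) ` V10 J0 \<subseteq> V10 J1 \<and>
     (\<exists>R. halfform_root L m \<gamma> R) \<and>
     (\<exists>p. halfform_pairing e L m \<gamma> p) \<and>
     (\<forall>R p. halfform_root L m \<gamma> R \<and> halfform_pairing e L m \<gamma> p \<longrightarrow>
        is_transport (\<lambda>s. has_cov_L L m \<gamma> s (\<lambda>t. 0)) (L J0) (R 1) \<and>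
        (\<forall>w'\<in>L J0. \<forall>w\<in>L J0. p 1 (R 1 w') w = of_real (d powr (1/4)) * inner_L e m J0 w' w) \<and>
        (\<exists>U B G0 G1.
           is_tensor_map (fibre_H J0) (L J0) UH (R 1) U \<and>
           is_transport (\<lambda>s. has_cov_Hhat e L m \<gamma> s (\<lambda>t vs. 0)) (tensor_space (fibre_H J0) (L J0)) U \<and>
           is_tensor_form (fibre_H J1) (L J1) (fibre_H J0) (L J0) (inner_H e) (p 1) B \<and>
           is_tensor_form (fibre_H J0) (L J0) (fibre_H J0) (L J0) (inner_H e) (inner_L e m J0) G0 \<and>
           is_tensor_form (fibre_H J1) (L J1) (fibre_H J1) (L J1) (inner_H e) (inner_L e m J1) G1 \<and>
           U ` tensor_space (fibre_H J0) (L J0) = tensor_space (fibre_H J1) (L J1) \<and>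
           (\<forall>\<Psi>' \<in> tensor_space (fibre_H J0) (L J0). \<forall>\<Psi> \<in> tensor_space (fibre_H J0) (L J0).
              G1 (U \<Psi>') (U \<Psi>) = G0 \<Psi>' \<Psi>) \<and>
           (\<forall>\<Psi>1 \<in> tensor_space (fibre_H J1) (L J1). \<forall>\<Psi>0 \<in> tensor_space (fibre_H J0) (L J0).
              B \<Psi>1 \<Psi>0 = of_real (d powr (1/2)) * G1 \<Psi>1 (U \<Psi>0)) \<and>
           (\<forall>\<psi>'\<in>fibre_H J0. \<forall>w'\<in>L J0. \<forall>\<psi>\<in>fibre_H J0. \<forall>w\<in>L J0.
              B (U (tensor \<psi>' w')) (tensor \<psi> w) = inner_H e (proj_H e J1 \<psi>') \<psi> * inner_L e m J0 w' w)))"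
proof -
  have cut: "\<forall>t\<in>{0..1}. \<gamma> t \<notin> cut_locus e (\<gamma> 0)" unfolding assms(6) by (rule assms(8))
  obtain J b \<theta> B w0 a0 where "half_forms e n J b \<theta> B \<gamma> L m w0 a0"
    using half_forms_exist[OF assms(1,2,5) cut assms(9)] by (elim exE)
  from half_forms.transport_theorem[OF this] show ?thesis
    unfolding Let_def assms(6,7) .
qed

end
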